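(* Let $\mathcal V$ be a regular descent category, $k$ a positive integer, and $X$ a regular $k$-category in $\mathcal V$. For $n\ge0$ let $\mathcal G(X)_n$ be the image (the codomain of the coimage) of the regular morphism $\mathrm{Map}(\boldsymbol\Delta^n,X)\to\mathrm{Map}(\Delta^n,X)=X_n$ induced by $\Delta^n\subset\boldsymbol\Delta^n$. Then the objects $\mathcal G(X)_n$ form a simplicial space (with structure maps induced from $X$), this simplicial space is a $k$-groupoid, and the induced morphism $\mathbb G(X)\to\mathcal G(X)$ is a hypercover, where $\mathbb G(X)_n=\mathrm{Map}(\boldsymbol\Delta^n,X)$.
   Context: A descent category is a small category $\mathcal V$ with a subcategory of morphisms called covers such that: $\mathcal V$ has finite limits; pullbacks of covers are covers; if $f$ and $g\circ f$ are covers then $g$ is a cover. The coimage of $f:X\to Y$ is the coequalizer $p:X\to Z$ (if it exists) of the two projections $X\times_YX\rightrightarrows X$; the image is the induced $i:Z\to Y$. It is subcanonical if every cover is an effective epimorphism (i.e. its image is an isomorphism). A regular descent category is a subcanonical descent category with a subcategory of regular morphisms such that every cover is regular, pullbacks of regular morphisms are regular, and every regular morphism has a coimage which is a cover. A simplicial space is a simplicial object in $\mathcal V$; $\mathrm{Map}(T,X)$ is the limit representing simplicial maps $T\to X$ (for $k$-categories it equals the finite limit $\mathrm{Map}(\mathrm{sk}_{k+1}T,X)$); for $f:X\to Y$ and $S\subset T$, $\mathrm{Map}(S\hookrightarrow T,f)=\mathrm{Map}(S,X)\times_{\mathrm{Map}(S,Y)}\mathrm{Map}(T,Y)$. $\Lambda^n_i=\bigcup_{j\ne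 i}\partial_j\Delta^n$. The thick simplex $\boldsymbol\Delta^n$ is the nerve of the groupoid on $\{0,\dots,n\}$ with exactly one morphism between any two objects ($m$-simplices: all functions $\{0,..,m\}\to\{0,..,n\}$; $\Delta^n$ = the monotone ones). A $k$-category is a simplicial space $X$ with $X_n\to\mathrm{Map}(\Lambda^n_i,X)$ a cover for $0<i<n$ and an isomorphism for $n>k$, and $\mathrm{Map}(\boldsymbol\Delta^1,X)\to X_0$ (restriction to a vertex) a cover; it is regular if $\mathrm{Map}(\boldsymbol\Delta^1,X)\to X_1$ is regular. A $k$-groupoid is a simplicial space with $X_n\to\mathrm{Map}(\Lambda^n_i,X)$ a cover for all $n>0$, $0\le i\le n$, and an isomorphism for $n>k$. A morphism $f:X\to Y$ is a hypercover if $X_n\to\mathrm{Map}(\partial\Delta^n\hookrightarrow\Delta^n,f)$ is a cover for all $n\ge0$. (That $\mathrm{Map}(\boldsymbol\Delta^n,X)\to X_n$ is regular is part of the setting.) *)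

theory Defs
  imports Main
begin

record ('o,'m) cat =
  Ob  :: "'o set"
  Ar  :: "'m set"
  Dom :: "'m \<Rightarrow> 'o"
  Cod :: "'m \<Rightarrow> 'o"
  Cmp :: "'m \<Rightarrow> 'm \<Rightarrow> 'm"   (* Cmp C g f = g o f *)
  Idm :: "'o \<Rightarrow> 'm"

definition homs :: "('o,'m) cat \<Rightarrow> 'o \<Rightarrow> 'o \<Rightarrow> 'm set" where
  "homs C a b = {f \<in> Ar C. Dom C f = a \<and> Cod C f = b}"

definition category :: "('o,'m) cat \<Rightarrow> bool" where
  "category C \<longleftrightarrow>
     (\<forall>f\<in>Ar C. Dom C f \<in> Ob C \<and> Cod C f \<in> Ob C) \<and>
     (\<forall>a\<in>Ob C. Idm C a \<in> homs C a a) \<and>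
     (\<forall>f g. f \<in> Ar C \<and> g \<in> Ar C \<and> Cod C f = Dom C g \<longrightarrow>
        Cmp C g f \<in> homs C (Dom C f) (Cod C g)) \<and>
     (\<forall>f\<in>Ar C. Cmp C f (Idm C (Dom C f)) = f \<and> Cmp C (Idm C (Cod C f)) f = f) \<and>
     (\<forall>f g h. f \<in> Ar C \<and> g \<in> Ar C \<and> h \<in> Ar C \<and> Cod C f = Dom C g \<and> Cod C g = Dom C h
        \<longrightarrow> Cmp C h (Cmp C g f) = Cmp C (Cmp C h g) f)"

definition iso :: "('o,'m) cat \<Rightarrow> 'm \<Rightarrow> bool" where
  "iso C f \<longleftrightarrow> f \<in> Ar C \<and> (\<exists>g\<in>homs C (Cod C f) (Dom C f).
      Cmp C g f = Idm C (Dom C f) \<and> Cmp C f g = Idm C (Cod C f))"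

record ('i,'e,'o,'m) diag =
  DV   :: "'i set"
  DE   :: "'e set"
  Dsrc :: "'e \<Rightarrow> 'i"
  Dtgt :: "'e \<Rightarrow> 'i"
  Dobj :: "'i \<Rightarrow> 'o"
  Darr :: "'e \<Rightarrow> 'm"

definition wf_diag :: "('o,'m) cat \<Rightarrow> ('i,'e,'o,'m) diag \<Rightarrow> bool" where
  "wf_diag C D \<longleftrightarrow> (\<forall>v\<in>DV D. Dobj D v \<in> Ob C) \<and>
     (\<forall>e\<in>DE D. Dsrc D e \<in> DV D \<and> Dtgt D e \<in> DV D \<and>
        Darr D e \<in> homs C (Dobj D (Dsrc D e)) (Dobj D (Dtgt D e)))"

definition is_cone :: "('o,'m) cat \<Rightarrow> ('i,'e,'o,'m) diag \<Rightarrow> 'o \<Rightarrow> ('i \<Rightarrow> 'm) \<Rightarrow> bool" where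
  "is_cone C D L p \<longleftrightarrow> L \<in> Ob C \<and> (\<forall>v\<in>DV D. p v \<in> homs C L (Dobj D v)) \<and>
     (\<forall>e\<in>DE D. Cmp C (Darr D e) (p (Dsrc D e)) = p (Dtgt D e))"

definition is_limit :: "('o,'m) cat \<Rightarrow> ('i,'e,'o,'m) diag \<Rightarrow> 'o \<Rightarrow> ('i \<Rightarrow> 'm) \<Rightarrow> bool" where
  "is_limit C D L p \<longleftrightarrow> is_cone C D L p \<and>
     (\<forall>L' p'. is_cone C D L' p' \<longrightarrow>
        (\<exists>!u. u \<in> homs C L' L \<and> (\<forall>v\<in>DV D. Cmp C (p v) u = p' v)))"

text \<open>Finite limits: every diagram on a finite graph (w.l.o.g. with vertices and edges
  labelled by natural numbers) has a limit.\<close>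
definition has_finite_limits :: "('o,'m) cat \<Rightarrow> bool" where
  "has_finite_limits C \<longleftrightarrow>
     (\<forall>D :: (nat,nat,'o,'m) diag. wf_diag C D \<and> finite (DV D) \<and> finite (DE D) \<longrightarrow>
        (\<exists>L p. is_limit C D L p))"

definition is_pullback :: "('o,'m) cat \<Rightarrow> 'm \<Rightarrow> 'm \<Rightarrow> 'o \<Rightarrow> 'm \<Rightarrow> 'm \<Rightarrow> bool" where
  "is_pullback C f g P p1 p2 \<longleftrightarrow>
     f \<in> Ar C \<and> g \<in> Ar C \<and> Cod C f = Cod C g \<and> P \<in> Ob C \<and>
     p1 \<in> homs C P (Dom C f) \<and> p2 \<in> homs C P (Dom C g) \<and>
     Cmp C f p1 = Cmp C g p2 \<and>
     (\<forall>Q a b. a \<in> homs C Q (Dom C f) \<and> b \<in> homs C Q (Dom C g) \<and> Cmp C f a = Cmp C g b \<longrightarrow>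
        (\<exists>!u. u \<in> homs C Q P \<and> Cmp C p1 u = a \<and> Cmp C p2 u = b))"

definition is_coequalizer :: "('o,'m) cat \<Rightarrow> 'm \<Rightarrow> 'm \<Rightarrow> 'm \<Rightarrow> bool" where
  "is_coequalizer C a b p \<longleftrightarrow>
     a \<in> Ar C \<and> b \<in> homs C (Dom C a) (Cod C a) \<and> p \<in> Ar C \<and> Dom C p = Cod C a \<and>
     Cmp C p a = Cmp C p b \<and>
     (\<forall>h. h \<in> Ar C \<and> Dom C h = Cod C a \<and> Cmp C h a = Cmp C h b \<longrightarrow>
        (\<exists>!u. u \<in> homs C (Cod C p) (Cod C h) \<and> Cmp C u p = h))"

definition is_coimage :: "('o,'m) cat \<Rightarrow> 'm \<Rightarrow> 'm \<Rightarrow> 'm \<Rightarrow> bool" where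
  "is_coimage C f p i \<longleftrightarrow>
     (\<exists>K a b. is_pullback C f f K a b \<and> is_coequalizer C a b p) \<and>
     i \<in> homs C (Cod C p) (Cod C f) \<and> Cmp C i p = f"

definition effective_epi :: "('o,'m) cat \<Rightarrow> 'm \<Rightarrow> bool" where
  "effective_epi C f \<longleftrightarrow> (\<exists>p i. is_coimage C f p i \<and> iso C i)"

definition wide_subcat :: "('o,'m) cat \<Rightarrow> 'm set \<Rightarrow> bool" where
  "wide_subcat C M \<longleftrightarrow> M \<subseteq> Ar C \<and> (\<forall>a\<in>Ob C. Idm C a \<in> M) \<and>
     (\<forall>f g. f \<in> M \<and> g \<in> M \<and> Cod C f = Dom C g \<longrightarrow> Cmp C g f \<in> M)"

definition pullback_stable :: "('o,'m) cat \<Rightarrow> 'm set \<Rightarrow> bool" where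
  "pullback_stable C M \<longleftrightarrow>
     (\<forall>f g P p1 p2. f \<in> M \<and> is_pullback C f g P p1 p2 \<longrightarrow> p2 \<in> M)"

definition descent_cat :: "('o,'m) cat \<Rightarrow> 'm set \<Rightarrow> bool" where
  "descent_cat C Cov \<longleftrightarrow> category C \<and> has_finite_limits C \<and> wide_subcat C Cov \<and>
     pullback_stable C Cov \<and>
     (\<forall>f g. f \<in> Cov \<and> g \<in> Ar C \<and> Cod C f = Dom C g \<and> Cmp C g f \<in> Cov \<longrightarrow> g \<in> Cov)"

definition subcanonical :: "('o,'m) cat \<Rightarrow> 'm set \<Rightarrow> bool" where
  "subcanonical C Cov \<longleftrightarrow> descent_cat C Cov \<and> (\<forall>f\<in>Cov. effective_epi C f)"

definition regular_descent_cat :: "('o,'m) cat \<Rightarrow> 'm set \<Rightarrow> 'm set \<Rightarrow> bool" where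
  "regular_descent_cat C Cov Reg \<longleftrightarrow> subcanonical C Cov \<and> wide_subcat C Reg \<and>
     Cov \<subseteq> Reg \<and> pullback_stable C Reg \<and>
     (\<forall>f\<in>Reg. \<exists>p i. is_coimage C f p i \<and> p \<in> Cov)"

text \<open>A monotone map theta : [m] -> [n] is encoded as the list [theta 0, ..., theta m]
  (nonempty, sorted, entries at most n); m = length theta - 1.\<close>
definition mono_list :: "nat \<Rightarrow> nat list \<Rightarrow> bool" where
  "mono_list n \<theta> \<longleftrightarrow> \<theta> \<noteq> [] \<and> sorted \<theta> \<and> (\<forall>j\<in>set \<theta>. j \<le> n)"

definition simplicial_object :: "('o,'m) cat \<Rightarrow> (nat \<Rightarrow> 'o) \<Rightarrow> (nat \<Rightarrow> nat list \<Rightarrow> 'm) \<Rightarrow> bool" where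
  "simplicial_object C X Xm \<longleftrightarrow>
     (\<forall>n. X n \<in> Ob C) \<and>
     (\<forall>n \<theta>. mono_list n \<theta> \<longrightarrow> Xm n \<theta> \<in> homs C (X n) (X (length \<theta> - 1))) \<and>
     (\<forall>n. Xm n [0..<Suc n] = Idm C (X n)) \<and>
     (\<forall>n \<theta> \<psi>. mono_list n \<theta> \<and> mono_list (length \<theta> - 1) \<psi> \<longrightarrow>
        Cmp C (Xm (length \<theta> - 1) \<psi>) (Xm n \<theta>) = Xm n (map (\<lambda>j. \<theta> ! j) \<psi>))"

text \<open>Sub-simplicial sets of the thick simplex: an m-simplex of the thick n-simplex is any
  function [m] -> [n], encoded as a nonempty list with entries at most n.\<close>
definition thick :: "nat \<Rightarrow> nat list set" where
  "thick n = {\<sigma>. \<sigma> \<noteq> [] \<and> (\<forall>j\<in>set \<sigma>. j \<le> n)}"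

definition simplex :: "nat \<Rightarrow> nat list set" where
  "simplex n = {\<sigma>\<in>thick n. sorted \<sigma>}"

definition bdry :: "nat \<Rightarrow> nat list set" where
  "bdry n = {\<sigma>\<in>simplex n. \<not> ({..n} \<subseteq> set \<sigma>)}"

definition horn :: "nat \<Rightarrow> nat \<Rightarrow> nat list set" where
  "horn n i = {\<sigma>\<in>simplex n. \<not> ({..n} \<subseteq> insert i (set \<sigma>))}"

text \<open>The diagram (category of elements of T) whose limit is Map(T,X), for T given by its
  set of simplices S (a sub-simplicial set of a thick simplex).\<close>
definition map_diag :: "(nat \<Rightarrow> 'o) \<Rightarrow> (nat \<Rightarrow> nat list \<Rightarrow> 'm) \<Rightarrow> nat list set
     \<Rightarrow> (nat list, nat list \<times> nat list, 'o, 'm) diag" where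
  "map_diag X Xm S =
     \<lparr> DV = S,
       DE = {(\<sigma>,\<theta>). \<sigma> \<in> S \<and> mono_list (length \<sigma> - 1) \<theta>},
       Dsrc = fst,
       Dtgt = (\<lambda>(\<sigma>,\<theta>). map (\<lambda>j. \<sigma> ! j) \<theta>),
       Dobj = (\<lambda>\<sigma>. X (length \<sigma> - 1)),
       Darr = (\<lambda>(\<sigma>,\<theta>). Xm (length \<sigma> - 1) \<theta>) \<rparr>"

text \<open>P holds for the canonical map X n -> Map(S,X) (S a subcomplex of the n-simplex),
  for any choice of the limit Map(S,X).\<close>
definition restr_prop :: "('o,'m) cat \<Rightarrow> ('m \<Rightarrow> bool) \<Rightarrow> (nat \<Rightarrow> 'o) \<Rightarrow> (nat \<Rightarrow> nat list \<Rightarrow> 'm)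
     \<Rightarrow> nat \<Rightarrow> nat list set \<Rightarrow> bool" where
  "restr_prop C P X Xm n S \<longleftrightarrow>
     (\<forall>L p u. is_limit C (map_diag X Xm S) L p \<and> u \<in> homs C (X n) L \<and>
        (\<forall>\<sigma>\<in>S. Cmp C (p \<sigma>) u = Xm n \<sigma>) \<longrightarrow> P u)"

definition k_category :: "('o,'m) cat \<Rightarrow> 'm set \<Rightarrow> (nat \<Rightarrow> 'o) \<Rightarrow> (nat \<Rightarrow> nat list \<Rightarrow> 'm) \<Rightarrow> nat \<Rightarrow> bool" where
  "k_category C Cov X Xm k \<longleftrightarrow> simplicial_object C X Xm \<and>
     (\<forall>n i. 0 < i \<and> i < n \<longrightarrow> restr_prop C (\<lambda>u. u \<in> Cov) X Xm n (horn n i)) \<and>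
     (\<forall>n i. k < n \<and> 0 < i \<and> i < n \<longrightarrow> restr_prop C (iso C) X Xm n (horn n i)) \<and>
     (\<exists>L p. is_limit C (map_diag X Xm (thick 1)) L p \<and> p [0] \<in> Cov)"

definition regular_k_category :: "('o,'m) cat \<Rightarrow> 'm set \<Rightarrow> 'm set \<Rightarrow> (nat \<Rightarrow> 'o)
     \<Rightarrow> (nat \<Rightarrow> nat list \<Rightarrow> 'm) \<Rightarrow> nat \<Rightarrow> bool" where
  "regular_k_category C Cov Reg X Xm k \<longleftrightarrow> k_category C Cov X Xm k \<and>
     (\<forall>L p. is_limit C (map_diag X Xm (thick 1)) L p \<longrightarrow> p [0,1] \<in> Reg)"

definition k_groupoid :: "('o,'m) cat \<Rightarrow> 'm set \<Rightarrow> (nat \<Rightarrow> 'o) \<Rightarrow> (nat \<Rightarrow> nat list \<Rightarrow> 'm) \<Rightarrow> nat \<Rightarrow> bool" where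
  "k_groupoid C Cov X Xm k \<longleftrightarrow> simplicial_object C X Xm \<and>
     (\<forall>n i. 0 < n \<and> i \<le> n \<longrightarrow> restr_prop C (\<lambda>u. u \<in> Cov) X Xm n (horn n i)) \<and>
     (\<forall>n i. k < n \<and> i \<le> n \<longrightarrow> restr_prop C (iso C) X Xm n (horn n i))"

text \<open>f = (f n) : Y -> Z is a hypercover: for each n the map
  Y n -> Map(bdry n, Y) x_{Map(bdry n, Z)} Z n is a cover (for any choices of the limits).\<close>
definition hypercover :: "('o,'m) cat \<Rightarrow> 'm set \<Rightarrow> (nat \<Rightarrow> 'o) \<Rightarrow> (nat \<Rightarrow> nat list \<Rightarrow> 'm)
     \<Rightarrow> (nat \<Rightarrow> 'o) \<Rightarrow> (nat \<Rightarrow> nat list \<Rightarrow> 'm) \<Rightarrow> (nat \<Rightarrow> 'm) \<Rightarrow> bool" where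
  "hypercover C Cov Y Ym Z Zm f \<longleftrightarrow>
     (\<forall>n LY pY LZ pZ g h r P p1 p2 u.
        is_limit C (map_diag Y Ym (bdry n)) LY pY \<and>
        is_limit C (map_diag Z Zm (bdry n)) LZ pZ \<and>
        g \<in> homs C LY LZ \<and> (\<forall>\<sigma>\<in>bdry n. Cmp C (pZ \<sigma>) g = Cmp C (f (length \<sigma> - 1)) (pY \<sigma>)) \<and>
        h \<in> homs C (Z n) LZ \<and> (\<forall>\<sigma>\<in>bdry n. Cmp C (pZ \<sigma>) h = Zm n \<sigma>) \<and>
        r \<in> homs C (Y n) LY \<and> (\<forall>\<sigma>\<in>bdry n. Cmp C (pY \<sigma>) r = Ym n \<sigma>) \<and>
        is_pullback C g h P p1 p2 \<and>
        u \<in> homs C (Y n) P \<and> Cmp C p1 u = r \<and> Cmp C p2 u = f n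
        \<longrightarrow> u \<in> Cov)"

text \<open>Structure maps of G(X)_n = Map(thick n, X), given limit cones (Gb n, p n):
  for theta : [m] -> [n], the map Gb n -> Gb m induced by thick m -> thick n.\<close>
definition thick_map :: "('o,'m) cat \<Rightarrow> (nat \<Rightarrow> 'o) \<Rightarrow> (nat \<Rightarrow> nat list \<Rightarrow> 'm)
     \<Rightarrow> nat \<Rightarrow> nat list \<Rightarrow> 'm" where
  "thick_map C Gb p n \<theta> = (THE u. u \<in> homs C (Gb n) (Gb (length \<theta> - 1)) \<and>
      (\<forall>\<sigma>\<in>thick (length \<theta> - 1). Cmp C (p (length \<theta> - 1) \<sigma>) u = p n (map (\<lambda>j. \<theta> ! j) \<sigma>)))"

end

(* All maps of limits Map(T, X) -> Map(S, X) are treated as morphisms of presheaves of cones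
   that are representable by covers; this class is closed under composition and base change, so
   S <= T may be enlarged one simplex at a time. Attaching simplices along inner horns gives covers,
   and isomorphisms above dimension k.

   A nondegenerate simplex of a thick simplex is a word without equal neighbours, and inserting or
   deleting an inner letter pairs such words. One pairing exhibits the thick n-simplex as an inner
   expansion of each of its thick horns (n >= 2), with all new simplices above dimension k if n > k;
   hence GG(X) = Map(thick n, X) is a k-groupoid (for n = 1 one uses the last axiom of a
   k-category). A second pairing exhibits it as an inner expansion of the union of its thick boundary
   with the ordinary n-simplex (n >= 2). As the image of GG(X)_n in X_n is a subobject, a base
   change of the latter is the condition on GG(X) -> G(X) to be a hypercover; for n <= 1 that
   condition only says that the coimage is a cover.

   Finally, a hypercover Y -> Z of simplicial spaces with Y a k-groupoid makes Z a k-groupoid: the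
   horn maps of Z are covers by the cancellation axiom, and they are monic above dimension k
   because two fillers of the same horn lift, locally, to fillers in Y of the same horn. *)

theory Submission
  imports Defs "HOL-Library.FuncSet"
begin

text \<open>The diagram of Map(T,X) is infinite even for a standard simplex T, since degenerate
  simplices belong to it; finite limits do not apply to it directly. Its cones always form a
  presheaf, so for subcomplexes of standard simplices the existence of Map(T,X) becomes a conclusion
  and not a presupposition. The horns of dimension at most k are finite in number; after them every
  stage is a bijection of cones, and this passes to the union. Since only inner horns may be filled,
  a pairing must insert its letter strictly inside the word. The star pairing used for thick horns
  does not respect the ordinary simplex: centred at 0 it pairs 012 with 0102. For the thick boundary
  the letters 0, ..., l are therefore made equivalent for growing l, and l is inserted just before
  the tail l+1, ..., n. For l = n this tail is empty and the insertion would be outer, so the last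
  step has a pairing of its own.\<close>

locale cat_ctx =
  fixes C :: "('o,'m) cat"
  assumes cat: "category C"
begin

abbreviation cmp (infixl "\<cdot>" 70) where "g \<cdot> f \<equiv> Cmp C g f"

abbreviation hom where "hom \<equiv> homs C"

lemma hom_obs: "f \<in> hom a b \<Longrightarrow> a \<in> Ob C \<and> b \<in> Ob C"
  using cat unfolding category_def homs_def by auto

lemma hom_ar: "f \<in> Ar C \<Longrightarrow> f \<in> hom (Dom C f) (Cod C f)"
  unfolding homs_def by auto

lemma ar_hom: "f \<in> hom a b \<Longrightarrow> f \<in> Ar C \<and> Dom C f = a \<and> Cod C f = b"
  unfolding homs_def by auto

lemma cmp_hom: "g \<in> hom b c \<Longrightarrow> f \<in> hom a b \<Longrightarrow> g \<cdot> f \<in> hom a c"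
  using cat unfolding category_def homs_def by auto

lemma assoc: "h \<in> hom c d \<Longrightarrow> g \<in> hom b c \<Longrightarrow> f \<in> hom a b \<Longrightarrow> h \<cdot> g \<cdot> f = h \<cdot> (g \<cdot> f)"
  using cat unfolding category_def homs_def by auto

lemma id_hom [intro]: "a \<in> Ob C \<Longrightarrow> Idm C a \<in> hom a a"
  using cat unfolding category_def homs_def by auto

lemma id_right [simp]: "f \<in> hom a b \<Longrightarrow> f \<cdot> Idm C a = f"
  using cat unfolding category_def homs_def by auto

lemma id_left [simp]: "f \<in> hom a b \<Longrightarrow> Idm C b \<cdot> f = f"
  using cat unfolding category_def homs_def by auto

lemma isoI: "f \<in> hom a b \<Longrightarrow> g \<in> hom b a \<Longrightarrow> g \<cdot> f = Idm C a \<Longrightarrow> f \<cdot> g = Idm C b \<Longrightarrow> iso C f"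
  unfolding iso_def homs_def by auto

lemma isoE:
  assumes "iso C f" "f \<in> hom a b"
  obtains g where "g \<in> hom b a" "g \<cdot> f = Idm C a" "f \<cdot> g = Idm C b"
  using assms unfolding iso_def homs_def by auto

lemma is_pullback_hom:
  assumes "f \<in> hom a c" "g \<in> hom b c"
  shows "is_pullback C f g P p1 p2 \<longleftrightarrow> p1 \<in> hom P a \<and> p2 \<in> hom P b \<and> f \<cdot> p1 = g \<cdot> p2 \<and>
     (\<forall>Q x y. x \<in> hom Q a \<and> y \<in> hom Q b \<and> f \<cdot> x = g \<cdot> y \<longrightarrow>
        (\<exists>!u. u \<in> hom Q P \<and> p1 \<cdot> u = x \<and> p2 \<cdot> u = y))"
  using assms hom_obs unfolding is_pullback_def by (auto simp: homs_def)

section \<open>Classes of arrows stable under composition and base change\<close>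

text \<open>Used for three classes: covers, isomorphisms and all arrows. One argument thus yields
  the cover statements, the isomorphism statements above dimension \<open>k\<close> and the
  existence of limits.\<close>

definition mor_class :: "'m set \<Rightarrow> bool" where
  "mor_class M \<longleftrightarrow> M \<subseteq> Ar C \<and> (\<forall>f. iso C f \<longrightarrow> f \<in> M) \<and>
     (\<forall>f g a b c. f \<in> M \<and> g \<in> M \<and> f \<in> hom a b \<and> g \<in> hom b c \<longrightarrow> g \<cdot> f \<in> M) \<and> pullback_stable C M"

lemma id_iso: "a \<in> Ob C \<Longrightarrow> iso C (Idm C a)"
  using id_hom[of a] id_left[OF id_hom[of a]] isoI[of "Idm C a" a a "Idm C a"] by simp

lemma mor_class_comp: "mor_class M \<Longrightarrow> f \<in> M \<Longrightarrow> g \<in> M \<Longrightarrow> f \<in> hom a b \<Longrightarrow> g \<in> hom b c \<Longrightarrow> g \<cdot> f \<in> M"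
  and mor_class_iso: "mor_class M \<Longrightarrow> iso C f \<Longrightarrow> f \<in> M"
  unfolding mor_class_def by blast+

lemma mor_class_id: "mor_class M \<Longrightarrow> a \<in> Ob C \<Longrightarrow> Idm C a \<in> M"
  unfolding mor_class_def using id_iso by blast

text \<open>Since \<open>pullback_stable\<close> speaks of every pullback square, an isomorphism
  lies in \<open>M\<close> as a base change of an identity.\<close>

lemma wide_subcat_mor_class:
  assumes w: "wide_subcat C M" and p: "pullback_stable C M"
  shows "mor_class M"
proof -
  have "f \<in> M" if i: "iso C f" for f
  proof -
    from i have fh: "f \<in> hom (Dom C f) (Cod C f)" (is "_ \<in> hom ?a ?b")
      using hom_ar unfolding iso_def by simp
    obtain g where g: "g \<in> hom ?b ?a" "g \<cdot> f = Idm C ?a" "f \<cdot> g = Idm C ?b"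
      using isoE[OF i fh] .
    have b: "?b \<in> Ob C" using fh hom_obs by blast
    have "is_pullback C (Idm C ?b) (Idm C ?b) ?a f f"
      unfolding is_pullback_hom[OF id_hom[OF b] id_hom[OF b]]
    proof (intro conjI allI impI)
      fix Q x y assume *: "x \<in> hom Q ?b \<and> y \<in> hom Q ?b \<and> Idm C ?b \<cdot> x = Idm C ?b \<cdot> y"
      then have xy: "x = y" and x: "x \<in> hom Q ?b" by auto
      show "\<exists>!u. u \<in> hom Q ?a \<and> f \<cdot> u = x \<and> f \<cdot> u = y"
      proof (rule ex1I[of _ "g \<cdot> x"])
        show "g \<cdot> x \<in> hom Q ?a \<and> f \<cdot> (g \<cdot> x) = x \<and> f \<cdot> (g \<cdot> x) = y"
          using assoc[OF fh g(1) x] g x xy cmp_hom[OF g(1) x] by auto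
        show "u = g \<cdot> x" if "u \<in> hom Q ?a \<and> f \<cdot> u = x \<and> f \<cdot> u = y" for u
          using assoc[OF g(1) fh, of u Q] that g by auto
      qed
    qed (use fh in auto)
    moreover have "Idm C ?b \<in> M" using w b unfolding wide_subcat_def by blast
    ultimately show ?thesis using p unfolding pullback_stable_def by blast
  qed
  then show ?thesis
    using w p unfolding mor_class_def wide_subcat_def homs_def by auto
qed

lemma iso_mor_class: "mor_class {f. iso C f}"
  unfolding mor_class_def
proof (intro conjI allI impI)
  show "{f. iso C f} \<subseteq> Ar C" unfolding iso_def by auto
next
  fix f g a b c
  assume "f \<in> {f. iso C f} \<and> g \<in> {f. iso C f} \<and> f \<in> hom a b \<and> g \<in> hom b c"
  then have f: "iso C f" "f \<in> hom a b" and g: "iso C g" "g \<in> hom b c" by auto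
  obtain f' where f': "f' \<in> hom b a" "f' \<cdot> f = Idm C a" "f \<cdot> f' = Idm C b" using isoE[OF f] .
  obtain g' where g': "g' \<in> hom c b" "g' \<cdot> g = Idm C b" "g \<cdot> g' = Idm C c" using isoE[OF g] .
  have "iso C (g \<cdot> f)"
  proof (rule isoI)
    show gf: "g \<cdot> f \<in> hom a c" and fg': "f' \<cdot> g' \<in> hom c a"
      using cmp_hom[OF g(2) f(2)] cmp_hom[OF f'(1) g'(1)] by auto
    have "f' \<cdot> g' \<cdot> (g \<cdot> f) = f' \<cdot> (g' \<cdot> g \<cdot> f)"
      using assoc[OF f'(1) g'(1) gf] assoc[OF g'(1) g(2) f(2)] by simp
    then show "f' \<cdot> g' \<cdot> (g \<cdot> f) = Idm C a" using f' g' f by simp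
    have "g \<cdot> f \<cdot> (f' \<cdot> g') = g \<cdot> (f \<cdot> f' \<cdot> g')"
      using assoc[OF g(2) f(2) fg'] assoc[OF f(2) f'(1) g'(1)] by simp
    then show "g \<cdot> f \<cdot> (f' \<cdot> g') = Idm C c" using f' g' g by simp
  qed
  then show "g \<cdot> f \<in> {f. iso C f}" by simp
next
  show "pullback_stable C {f. iso C f}"
    unfolding pullback_stable_def
  proof (intro allI impI)
    fix f g P p1 p2
    assume "f \<in> {f. iso C f} \<and> is_pullback C f g P p1 p2"
    then have i: "iso C f" and pb: "is_pullback C f g P p1 p2" by auto
    define a where "a = Dom C f"
    define b where "b = Dom C g"
    define c where "c = Cod C g"
    have f: "f \<in> hom a c" and g: "g \<in> hom b c"
      using pb unfolding is_pullback_def a_def b_def c_def homs_def by auto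
    have b: "b \<in> Ob C" using g hom_obs by blast
    note pb' = pb[unfolded is_pullback_hom[OF f g]]
    then have p1: "p1 \<in> hom P a" and p2: "p2 \<in> hom P b" and e: "f \<cdot> p1 = g \<cdot> p2"
      and univ: "\<And>Q x y. x \<in> hom Q a \<Longrightarrow> y \<in> hom Q b \<Longrightarrow> f \<cdot> x = g \<cdot> y \<Longrightarrow>
        (\<exists>!u. u \<in> hom Q P \<and> p1 \<cdot> u = x \<and> p2 \<cdot> u = y)" by auto
    obtain f' where f': "f' \<in> hom c a" "f' \<cdot> f = Idm C a" "f \<cdot> f' = Idm C c" using isoE[OF i f] .
    \<comment> \<open>The pair of \<open>f' \<cdot> g\<close> and the identity induces a section
      \<open>u\<close> of \<open>p2\<close>; by uniqueness of arrows into \<open>P\<close> it is the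
      inverse.\<close>
    have "f' \<cdot> g \<in> hom b a" "f \<cdot> (f' \<cdot> g) = g \<cdot> Idm C b"
      using f' g assoc[OF f f'(1) g] cmp_hom[OF f'(1) g] by auto
    from univ[OF this(1) id_hom[OF b] this(2)] obtain u where
      u: "u \<in> hom b P" "p1 \<cdot> u = f' \<cdot> g" "p2 \<cdot> u = Idm C b" by auto
    have P: "P \<in> Ob C" using p1 hom_obs by blast
    have "p1 \<cdot> (u \<cdot> p2) = p1"
    proof -
      have "p1 \<cdot> (u \<cdot> p2) = f' \<cdot> g \<cdot> p2" using assoc[OF p1 u(1) p2] u by simp
      also have "\<dots> = f' \<cdot> (f \<cdot> p1)" using assoc[OF f'(1) g p2] e by simp
      also have "\<dots> = p1" using assoc[OF f'(1) f p1] f' p1 by simp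
      finally show ?thesis .
    qed
    moreover have "p2 \<cdot> (u \<cdot> p2) = p2" using assoc[OF p2 u(1) p2] u p2 by simp
    ultimately have "u \<cdot> p2 = Idm C P"
      using univ[OF p1 p2 e] u p2 p1 P id_right cmp_hom[OF u(1) p2] by blast
    then show "p2 \<in> {f. iso C f}" using isoI[OF p2 u(1)] u by simp
  qed
qed auto

subsection \<open>Presheaves and representable morphisms\<close>

text \<open>A presheaf is a pair of its sets of sections and the action of arrows on sections.\<close>

abbreviation El :: "('o \<Rightarrow> 'e set) \<times> ('e \<Rightarrow> 'm \<Rightarrow> 'e) \<Rightarrow> 'o \<Rightarrow> 'e set" where "El \<equiv> fst"
abbreviation ac :: "('o \<Rightarrow> 'e set) \<times> ('e \<Rightarrow> 'm \<Rightarrow> 'e) \<Rightarrow> 'e \<Rightarrow> 'm \<Rightarrow> 'e" where "ac \<equiv> snd"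

definition psh :: "('o \<Rightarrow> 'e set) \<times> ('e \<Rightarrow> 'm \<Rightarrow> 'e) \<Rightarrow> bool" where
  "psh P \<longleftrightarrow> (\<forall>U x. x \<in> El P U \<longrightarrow> U \<in> Ob C \<and> ac P x (Idm C U) = x) \<and>
     (\<forall>U V x g. x \<in> El P U \<and> g \<in> hom V U \<longrightarrow> ac P x g \<in> El P V) \<and>
     (\<forall>U V W x g h. x \<in> El P U \<and> g \<in> hom V U \<and> h \<in> hom W V \<longrightarrow> ac P (ac P x g) h = ac P x (g \<cdot> h))"

lemma psh_ob: "psh P \<Longrightarrow> x \<in> El P U \<Longrightarrow> U \<in> Ob C"
  and psh_id: "psh P \<Longrightarrow> x \<in> El P U \<Longrightarrow> ac P x (Idm C U) = x"
  and psh_ac: "psh P \<Longrightarrow> x \<in> El P U \<Longrightarrow> g \<in> hom V U \<Longrightarrow> ac P x g \<in> El P V"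
  and psh_cmp: "psh P \<Longrightarrow> x \<in> El P U \<Longrightarrow> g \<in> hom V U \<Longrightarrow> h \<in> hom W V \<Longrightarrow>
    ac P (ac P x g) h = ac P x (g \<cdot> h)"
  unfolding psh_def by blast+

text \<open>One function serves all objects \<open>U\<close>: the transformations in use are given
  by formulas that do not depend on \<open>U\<close>.\<close>

definition ntr :: "('o \<Rightarrow> 'e set) \<times> ('e \<Rightarrow> 'm \<Rightarrow> 'e) \<Rightarrow> ('o \<Rightarrow> 'f set) \<times> ('f \<Rightarrow> 'm \<Rightarrow> 'f) \<Rightarrow> ('e \<Rightarrow> 'f) \<Rightarrow> bool" where
  "ntr P Q \<phi> \<longleftrightarrow> (\<forall>U x. x \<in> El P U \<longrightarrow> \<phi> x \<in> El Q U \<and>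
     (\<forall>V g. g \<in> hom V U \<longrightarrow> \<phi> (ac P x g) = ac Q (\<phi> x) g))"

lemma ntrI:
  assumes "\<And>U x. x \<in> El P U \<Longrightarrow> \<phi> x \<in> El Q U"
    and "\<And>U V x g. x \<in> El P U \<Longrightarrow> g \<in> hom V U \<Longrightarrow> \<phi> (ac P x g) = ac Q (\<phi> x) g"
  shows "ntr P Q \<phi>"
  using assms unfolding ntr_def by blast

lemma ntr_el: "ntr P Q \<phi> \<Longrightarrow> x \<in> El P U \<Longrightarrow> \<phi> x \<in> El Q U"
  and ntr_ac: "ntr P Q \<phi> \<Longrightarrow> x \<in> El P U \<Longrightarrow> g \<in> hom V U \<Longrightarrow> \<phi> (ac P x g) = ac Q (\<phi> x) g"
  unfolding ntr_def by blast+

lemma ntr_comp: "ntr P Q \<phi> \<Longrightarrow> ntr Q R \<psi> \<Longrightarrow> ntr P R (\<lambda>x. \<psi> (\<phi> x))"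
  by (rule ntrI, rule ntr_el, assumption, rule ntr_el, assumption+)
    (subst ntr_ac[of P Q], assumption+, rule ntr_ac, assumption, rule ntr_el, assumption+)

text \<open>\<open>cov M P Q \<phi>\<close>: the fibre of \<open>\<phi>\<close> over every section \<open>b\<close> of \<open>Q\<close> over \<open>U\<close> is represented
  by an arrow to \<open>U\<close> that belongs to \<open>M\<close>.\<close>

definition cov :: "'m set \<Rightarrow> ('o \<Rightarrow> 'e set) \<times> ('e \<Rightarrow> 'm \<Rightarrow> 'e) \<Rightarrow> ('o \<Rightarrow> 'f set) \<times> ('f \<Rightarrow> 'm \<Rightarrow> 'f) \<Rightarrow> ('e \<Rightarrow> 'f) \<Rightarrow> bool" where
  "cov M P Q \<phi> \<longleftrightarrow> (\<forall>U b. b \<in> El Q U \<longrightarrow>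
     (\<exists>V g a. g \<in> M \<and> g \<in> hom V U \<and> a \<in> El P V \<and> \<phi> a = ac Q b g \<and>
       (\<forall>W h e. h \<in> hom W U \<and> e \<in> El P W \<and> \<phi> e = ac Q b h \<longrightarrow>
         (\<exists>!u. u \<in> hom W V \<and> g \<cdot> u = h \<and> ac P a u = e))))"

lemma covE:
  assumes "cov M P Q \<phi>" "b \<in> El Q U"
  obtains V g a where "g \<in> M" "g \<in> hom V U" "a \<in> El P V" "\<phi> a = ac Q b g"
    "\<And>W h e. h \<in> hom W U \<Longrightarrow> e \<in> El P W \<Longrightarrow> \<phi> e = ac Q b h \<Longrightarrow>
         (\<exists>!u. u \<in> hom W V \<and> g \<cdot> u = h \<and> ac P a u = e)"
proof -
  from assms(1)[unfolded cov_def, rule_format, OF assms(2)] show ?thesis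
    by (elim exE conjE, intro that) (assumption | simp)+
qed

text \<open>The fibre of the composite over \<open>b\<close> is represented in two steps: by
  \<open>g\<close> for \<psi>, then by \<open>g'\<close> for \<phi> over the section that represents
  the first fibre. The resulting arrow is \<open>g \<cdot> g'\<close>.\<close>

lemma cov_comp:
  assumes M: "mor_class M" and P: "psh P" and Q: "psh Q" and R: "psh R"
    and n1: "ntr P Q \<phi>" and n2: "ntr Q R \<psi>" and c1: "cov M P Q \<phi>" and c2: "cov M Q R \<psi>"
  shows "cov M P R (\<lambda>x. \<psi> (\<phi> x))"
  unfolding cov_def
proof (intro allI impI)
  fix U b assume b: "b \<in> El R U"
  obtain V g a where 1: "g \<in> M" "g \<in> hom V U" "a \<in> El Q V" "\<psi> a = ac R b g"
    "\<And>W h e. h \<in> hom W U \<Longrightarrow> e \<in> El Q W \<Longrightarrow> \<psi> e = ac R b h \<Longrightarrow>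
         (\<exists>!u. u \<in> hom W V \<and> g \<cdot> u = h \<and> ac Q a u = e)"
    by (rule covE[OF c2 b], rule that) (assumption | simp)+
  obtain V' g' a' where 2: "g' \<in> M" "g' \<in> hom V' V" "a' \<in> El P V'" "\<phi> a' = ac Q a g'"
    "\<And>W h e. h \<in> hom W V \<Longrightarrow> e \<in> El P W \<Longrightarrow> \<phi> e = ac Q a h \<Longrightarrow>
         (\<exists>!u. u \<in> hom W V' \<and> g' \<cdot> u = h \<and> ac P a' u = e)"
    by (rule covE[OF c1 1(3)], rule that) (assumption | simp)+
  show "\<exists>V g a. g \<in> M \<and> g \<in> hom V U \<and> a \<in> El P V \<and> \<psi> (\<phi> a) = ac R b g \<and>
       (\<forall>W h e. h \<in> hom W U \<and> e \<in> El P W \<and> \<psi> (\<phi> e) = ac R b h \<longrightarrow>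
         (\<exists>!u. u \<in> hom W V \<and> g \<cdot> u = h \<and> ac P a u = e))"
  proof (intro exI conjI allI impI)
    show "g \<cdot> g' \<in> M" using mor_class_comp[OF M 2(1) 1(1) 2(2) 1(2)] .
    show "g \<cdot> g' \<in> hom V' U" using cmp_hom[OF 1(2) 2(2)] .
    show "a' \<in> El P V'" by fact
    show "\<psi> (\<phi> a') = ac R b (g \<cdot> g')"
      using 2(4) ntr_ac[OF n2 1(3) 2(2)] 1(4) psh_cmp[OF R b 1(2) 2(2)] by simp
    fix W h e assume "h \<in> hom W U \<and> e \<in> El P W \<and> \<psi> (\<phi> e) = ac R b h"
    then have h: "h \<in> hom W U" and e: "e \<in> El P W" and he: "\<psi> (\<phi> e) = ac R b h" by auto
    obtain u where u: "u \<in> hom W V" "g \<cdot> u = h" "ac Q a u = \<phi> e"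
      and uu: "\<And>u'. u' \<in> hom W V \<Longrightarrow> g \<cdot> u' = h \<Longrightarrow> ac Q a u' = \<phi> e \<Longrightarrow> u' = u"
      using 1(5)[OF h ntr_el[OF n1 e] he] by metis
    obtain v where v: "v \<in> hom W V'" "g' \<cdot> v = u" "ac P a' v = e"
      and vv: "\<And>u'. u' \<in> hom W V' \<Longrightarrow> g' \<cdot> u' = u \<Longrightarrow> ac P a' u' = e \<Longrightarrow> u' = v"
      using 2(5)[OF u(1) e u(3)[symmetric]] by metis
    show "\<exists>!u. u \<in> hom W V' \<and> g \<cdot> g' \<cdot> u = h \<and> ac P a' u = e"
    proof (rule ex1I[of _ v])
      show "v \<in> hom W V' \<and> g \<cdot> g' \<cdot> v = h \<and> ac P a' v = e"
        using v u assoc[OF 1(2) 2(2) v(1)] by simp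
      fix w assume w: "w \<in> hom W V' \<and> g \<cdot> g' \<cdot> w = h \<and> ac P a' w = e"
      have "ac Q a (g' \<cdot> w) = \<phi> e"
        using psh_cmp[OF Q 1(3) 2(2), of w W] w 2(4) ntr_ac[OF n1 2(3), of w W] by simp
      moreover have "g \<cdot> (g' \<cdot> w) = h" using w assoc[OF 1(2) 2(2), of w W] by simp
      ultimately have "g' \<cdot> w = u" using uu cmp_hom[OF 2(2)] w by blast
      then show "w = v" using vv w by blast
    qed
  qed
qed

text \<open>\<open>sq\<close> and \<open>pb\<close> say that \<open>P'\<close> is objectwise the
  pullback of \<open>P\<close> and \<open>Q'\<close> over \<open>Q\<close>. The arrow that
  represents the fibre over \<open>\<beta> b\<close> then also represents the fibre over
  \<open>b\<close>, so membership in \<open>M\<close> carries over unchanged.\<close>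

lemma cov_base:
  assumes c: "cov M P Q \<phi>" and Q: "psh Q" and P': "psh P'" and Q': "psh Q'"
    and n\<phi>': "ntr P' Q' \<phi>'" and n\<alpha>: "ntr P' P \<alpha>" and n\<beta>: "ntr Q' Q \<beta>"
    and sq: "\<And>U x. x \<in> El P' U \<Longrightarrow> \<phi> (\<alpha> x) = \<beta> (\<phi>' x)"
    and pb: "\<And>U a b. a \<in> El P U \<Longrightarrow> b \<in> El Q' U \<Longrightarrow> \<phi> a = \<beta> b \<Longrightarrow>
      \<exists>!x. x \<in> El P' U \<and> \<alpha> x = a \<and> \<phi>' x = b"
  shows "cov M P' Q' \<phi>'"
  unfolding cov_def
proof (intro allI impI)
  fix U b assume b: "b \<in> El Q' U"
  have bb: "\<beta> b \<in> El Q U" using ntr_el[OF n\<beta> b] .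
  obtain V g a where 1: "g \<in> M" "g \<in> hom V U" "a \<in> El P V" "\<phi> a = ac Q (\<beta> b) g"
    "\<And>W h e. h \<in> hom W U \<Longrightarrow> e \<in> El P W \<Longrightarrow> \<phi> e = ac Q (\<beta> b) h \<Longrightarrow>
         (\<exists>!u. u \<in> hom W V \<and> g \<cdot> u = h \<and> ac P a u = e)"
    by (rule covE[OF c bb], rule that) (assumption | simp)+
  have bg: "ac Q' b g \<in> El Q' V" using psh_ac[OF Q' b 1(2)] .
  have "\<phi> a = \<beta> (ac Q' b g)" using 1 ntr_ac[OF n\<beta> b] by metis
  then obtain x where x: "x \<in> El P' V" "\<alpha> x = a" "\<phi>' x = ac Q' b g" using pb[OF 1(3) bg] by blast
  show "\<exists>V g a. g \<in> M \<and> g \<in> hom V U \<and> a \<in> El P' V \<and> \<phi>' a = ac Q' b g \<and>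
       (\<forall>W h e. h \<in> hom W U \<and> e \<in> El P' W \<and> \<phi>' e = ac Q' b h \<longrightarrow>
         (\<exists>!u. u \<in> hom W V \<and> g \<cdot> u = h \<and> ac P' a u = e))"
  proof (intro exI conjI allI impI)
    show "g \<in> M" "g \<in> hom V U" "x \<in> El P' V" "\<phi>' x = ac Q' b g" by fact+
    fix W h e assume "h \<in> hom W U \<and> e \<in> El P' W \<and> \<phi>' e = ac Q' b h"
    then have h: "h \<in> hom W U" and e: "e \<in> El P' W" and he: "\<phi>' e = ac Q' b h" by auto
    have ae: "\<alpha> e \<in> El P W" using ntr_el[OF n\<alpha> e] .
    have he': "\<phi> (\<alpha> e) = ac Q (\<beta> b) h" using sq[OF e] he ntr_ac[OF n\<beta> b h] by simp
    obtain u where u: "u \<in> hom W V" "g \<cdot> u = h" "ac P a u = \<alpha> e"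
      and uu: "\<And>u'. u' \<in> hom W V \<Longrightarrow> g \<cdot> u' = h \<Longrightarrow> ac P a u' = \<alpha> e \<Longrightarrow> u' = u"
      using 1(5)[OF h ae he'] by metis
    have "ac P' x u \<in> El P' W" "\<alpha> (ac P' x u) = \<alpha> e" "\<phi>' (ac P' x u) = \<phi>' e"
      using psh_ac[OF P' x(1) u(1)] ntr_ac[OF n\<alpha> x(1) u(1)] ntr_ac[OF n\<phi>' x(1) u(1)] u x he
        psh_cmp[OF Q' b 1(2) u(1)] by auto
    moreover have "\<phi> (\<alpha> e) = \<beta> (\<phi>' e)" using sq[OF e] .
    ultimately have xe: "ac P' x u = e" using pb[OF ae ntr_el[OF n\<phi>' e]] e by metis
    show "\<exists>!u. u \<in> hom W V \<and> g \<cdot> u = h \<and> ac P' x u = e"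
    proof (rule ex1I[of _ u])
      show "u \<in> hom W V \<and> g \<cdot> u = h \<and> ac P' x u = e" using u xe by simp
      fix w assume w: "w \<in> hom W V \<and> g \<cdot> w = h \<and> ac P' x w = e"
      then have "ac P a w = \<alpha> e" using ntr_ac[OF n\<alpha> x(1)] x(2) by metis
      then show "w = u" using uu w by blast
    qed
  qed
qed

definition bijn :: "('o \<Rightarrow> 'e set) \<times> ('e \<Rightarrow> 'm \<Rightarrow> 'e) \<Rightarrow> ('o \<Rightarrow> 'f set) \<times> ('f \<Rightarrow> 'm \<Rightarrow> 'f) \<Rightarrow> ('e \<Rightarrow> 'f) \<Rightarrow> bool" where
  "bijn P Q \<phi> \<longleftrightarrow> (\<forall>U. bij_betw \<phi> (El P U) (El Q U))"

lemma bijnI: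
  assumes "ntr P Q \<phi>" "\<And>U b. b \<in> El Q U \<Longrightarrow> \<exists>x. x \<in> El P U \<and> \<phi> x = b"
    "\<And>U x y. x \<in> El P U \<Longrightarrow> y \<in> El P U \<Longrightarrow> \<phi> x = \<phi> y \<Longrightarrow> x = y"
  shows "bijn P Q \<phi>"
  unfolding bijn_def bij_betw_def
proof (intro allI conjI inj_onI equalityI subsetI)
  show "x = y" if "x \<in> El P U" "y \<in> El P U" "\<phi> x = \<phi> y" for U x y
    by (rule assms(3)[OF that])
  show "y \<in> El Q U" if "y \<in> \<phi> ` El P U" for U y
    using that ntr_el[OF assms(1)] by (elim imageE) simp
  show "y \<in> \<phi> ` El P U" if "y \<in> El Q U" for U y
    using assms(2)[OF that] by (elim exE conjE) (simp add: image_iff, blast)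
qed

lemma bijn_ex: "bijn P Q \<phi> \<Longrightarrow> b \<in> El Q U \<Longrightarrow> \<exists>x. x \<in> El P U \<and> \<phi> x = b"
  unfolding bijn_def bij_betw_def by (metis imageE)

lemma bijn_inj: "bijn P Q \<phi> \<Longrightarrow> x \<in> El P U \<Longrightarrow> y \<in> El P U \<Longrightarrow> \<phi> x = \<phi> y \<Longrightarrow> x = y"
  unfolding bijn_def bij_betw_def inj_on_def by blast

text \<open>A commutative square with two opposite bijective sides is a pullback.\<close>

lemma cov_bijn_transfer:
  assumes "cov M P Q \<phi>" "psh P" "psh Q" "psh P'" "psh Q'" "ntr P' Q' \<phi>'" "ntr P' P \<alpha>" "ntr Q' Q \<beta>"
    "bijn P' P \<alpha>" "bijn Q' Q \<beta>" "\<And>U x. x \<in> El P' U \<Longrightarrow> \<phi> (\<alpha> x) = \<beta> (\<phi>' x)"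
  shows "cov M P' Q' \<phi>'"
proof (rule cov_base[OF assms(1) assms(3,4,5,6,7,8,11)])
  fix U a b assume a: "a \<in> El P U" and b: "b \<in> El Q' U" and e: "\<phi> a = \<beta> b"
  obtain x where x: "x \<in> El P' U" "\<alpha> x = a" using bijn_ex[OF assms(9) a] by blast
  have "\<phi>' x = b" using bijn_inj[OF assms(10) ntr_el[OF assms(6) x(1)] b] assms(11)[OF x(1)] x e by simp
  then show "\<exists>!x. x \<in> El P' U \<and> \<alpha> x = a \<and> \<phi>' x = b"
    using x bijn_inj[OF assms(9)] by blast
qed auto

lemma bijn_transfer:
  assumes "bijn P Q \<phi>" "ntr P' Q' \<phi>'" "ntr P' P \<alpha>" "ntr Q' Q \<beta>"
    "bijn P' P \<alpha>" "bijn Q' Q \<beta>" "\<And>U x. x \<in> El P' U \<Longrightarrow> \<phi> (\<alpha> x) = \<beta> (\<phi>' x)"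
  shows "bijn P' Q' \<phi>'"
proof (rule bijnI[OF assms(2)])
  fix U b assume b: "b \<in> El Q' U"
  obtain a where a: "a \<in> El P U" "\<phi> a = \<beta> b" using bijn_ex[OF assms(1) ntr_el[OF assms(4) b]] by blast
  obtain x where x: "x \<in> El P' U" "\<alpha> x = a" using bijn_ex[OF assms(5) a(1)] by blast
  have "\<phi>' x = b" using bijn_inj[OF assms(6) ntr_el[OF assms(2) x(1)] b] assms(7)[OF x(1)] x a by simp
  then show "\<exists>x. x \<in> El P' U \<and> \<phi>' x = b" using x by blast
next
  fix U x y assume x: "x \<in> El P' U" and y: "y \<in> El P' U" and e: "\<phi>' x = \<phi>' y"
  have "\<phi> (\<alpha> x) = \<phi> (\<alpha> y)" using assms(7)[OF x] assms(7)[OF y] e by simp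
  then have "\<alpha> x = \<alpha> y" using bijn_inj[OF assms(1)] ntr_el[OF assms(3)] x y by blast
  then show "x = y" using bijn_inj[OF assms(5)] x y by blast
qed

text \<open>Every section of \<open>Q\<close> has exactly one preimage, so its fibre is represented
  by an identity.\<close>

lemma bijn_cov:
  assumes M: "mor_class M" and P: "psh P" and Q: "psh Q" and n: "ntr P Q \<phi>" and b: "bijn P Q \<phi>"
  shows "cov M P Q \<phi>"
  unfolding cov_def
proof (intro allI impI)
  fix U y assume y: "y \<in> El Q U"
  obtain x where x: "x \<in> El P U" "\<phi> x = y" using bijn_ex[OF b y] by blast
  have U: "U \<in> Ob C" using psh_ob[OF Q y] .
  show "\<exists>V g a. g \<in> M \<and> g \<in> hom V U \<and> a \<in> El P V \<and> \<phi> a = ac Q y g \<and>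
       (\<forall>W h e. h \<in> hom W U \<and> e \<in> El P W \<and> \<phi> e = ac Q y h \<longrightarrow>
         (\<exists>!u. u \<in> hom W V \<and> g \<cdot> u = h \<and> ac P a u = e))"
  proof (intro exI conjI allI impI)
    show "Idm C U \<in> M" "Idm C U \<in> hom U U" "x \<in> El P U" "\<phi> x = ac Q y (Idm C U)"
      using mor_class_id[OF M U] U x psh_id[OF Q y] by auto
    fix W h e assume h: "h \<in> hom W U \<and> e \<in> El P W \<and> \<phi> e = ac Q y h"
    then have "\<phi> (ac P x h) = \<phi> e" using ntr_ac[OF n x(1)] x by metis
    then have "ac P x h = e" using bijn_inj[OF b] psh_ac[OF P x(1)] h by blast
    moreover have "Idm C U \<cdot> h = h" using h id_left[of h W U] by simp
    ultimately show "\<exists>!u. u \<in> hom W U \<and> Idm C U \<cdot> u = h \<and> ac P x u = e"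
    proof (intro ex1I[of _ h])
      show "u = h" if "u \<in> hom W U \<and> Idm C U \<cdot> u = h \<and> ac P x u = e" for u
        using that id_left[of u W U] by simp
    qed (use h in simp)
  qed
qed

definition HomP :: "'o \<Rightarrow> ('o \<Rightarrow> 'm set) \<times> ('m \<Rightarrow> 'm \<Rightarrow> 'm)" where
  "HomP A = (\<lambda>U. hom U A, Cmp C)"

lemma psh_HomP: "psh (HomP A)"
proof -
  have "U \<in> Ob C \<and> x \<cdot> Idm C U = x" if "x \<in> hom U A" for U x
    using hom_obs[OF that] id_right[OF that] by simp
  then have "U \<in> Ob C" "ac (HomP A) x (Idm C U) = x" if "x \<in> El (HomP A) U" for U x
    using that unfolding HomP_def by auto
  then show ?thesis
    unfolding psh_def
  proof (intro conjI allI impI; (elim conjE)?)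
    show "ac (HomP A) x g \<in> El (HomP A) V" if "x \<in> El (HomP A) U" "g \<in> hom V U" for U V x g
      using cmp_hom[of x U A g V] that by (simp add: HomP_def)
    show "ac (HomP A) (ac (HomP A) x g) h = ac (HomP A) x (g \<cdot> h)"
      if "x \<in> El (HomP A) U" "g \<in> hom V U" "h \<in> hom W V" for U V W x g h
      using assoc[of x U A g V h W] that by (simp add: HomP_def)
  qed
qed

text \<open>A representation in the sense of Yoneda, with universal element \<xi>.\<close>

definition reps :: "('o \<Rightarrow> 'e set) \<times> ('e \<Rightarrow> 'm \<Rightarrow> 'e) \<Rightarrow> 'o \<Rightarrow> 'e \<Rightarrow> bool" where
  "reps Q L \<xi> \<longleftrightarrow> \<xi> \<in> El Q L \<and> (\<forall>W e. e \<in> El Q W \<longrightarrow> (\<exists>!v. v \<in> hom W L \<and> ac Q \<xi> v = e))"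

lemma reps_bijn: "psh Q \<Longrightarrow> reps Q L \<xi> \<Longrightarrow> ntr (HomP L) Q (ac Q \<xi>) \<and> bijn (HomP L) Q (ac Q \<xi>)"
proof (intro conjI)
  assume Q: "psh Q" and r: "reps Q L \<xi>"
  then have x: "\<xi> \<in> El Q L" unfolding reps_def by blast
  show n: "ntr (HomP L) Q (ac Q \<xi>)"
    by (rule ntrI) (simp_all add: HomP_def psh_ac[OF Q x] psh_cmp[OF Q x])
  show "bijn (HomP L) Q (ac Q \<xi>)"
  proof (rule bijnI[OF n])
    show "\<exists>v. v \<in> El (HomP L) U \<and> ac Q \<xi> v = b" if "b \<in> El Q U" for U b
      using r that unfolding HomP_def reps_def fst_conv by blast
    show "v = w" if "v \<in> El (HomP L) U" "w \<in> El (HomP L) U" "ac Q \<xi> v = ac Q \<xi> w" for U v w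
      using r that psh_ac[OF Q x, of v U] unfolding HomP_def reps_def by auto
  qed
qed

text \<open>This passes from presheaves back to arrows. The fibre over the universal element \<xi>
  is represented by \<open>u\<close> as well as by an arrow \<open>g\<close> in \<open>M\<close>;
  the comparison \<open>s\<close> is an isomorphism, and \<open>u\<close> equals
  \<open>g \<cdot> s\<close>.\<close>

lemma cov_reps_arrow:
  assumes M: "mor_class M" and Q: "psh Q" and c: "cov M (HomP A) Q \<phi>" and n: "ntr (HomP A) Q \<phi>"
    and r: "reps Q L \<xi>" and u: "u \<in> hom A L" and e: "\<phi> (Idm C A) = ac Q \<xi> u"
  shows "u \<in> M"
proof -
  have x: "\<xi> \<in> El Q L" using r unfolding reps_def by blast
  have A: "A \<in> Ob C" using u hom_obs by blast
  have \<phi>: "\<phi> y = ac Q \<xi> (u \<cdot> y)" if "y \<in> hom W A" for W y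
    using ntr_ac[OF n, of "Idm C A" A y W] that A e psh_cmp[OF Q x u that] by (auto simp: HomP_def)
  have inj: "v = w" if "v \<in> hom W L" "w \<in> hom W L" "ac Q \<xi> v = ac Q \<xi> w" for v w W
    using r psh_ac[OF Q x that(1)] that unfolding reps_def by auto
  obtain V g a where 1: "g \<in> M" "g \<in> hom V L" "a \<in> El (HomP A) V" "\<phi> a = ac Q \<xi> g"
    "\<And>W h e. h \<in> hom W L \<Longrightarrow> e \<in> El (HomP A) W \<Longrightarrow> \<phi> e = ac Q \<xi> h \<Longrightarrow>
         (\<exists>!u. u \<in> hom W V \<and> g \<cdot> u = h \<and> ac (HomP A) a u = e)"
    by (rule covE[OF c x], rule that) (assumption | simp)+
  have a: "a \<in> hom V A" using 1(3) by (simp add: HomP_def)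
  have ua: "u \<cdot> a = g" using inj[OF cmp_hom[OF u a] 1(2)] 1(4) \<phi>[OF a] by simp
  have "Idm C A \<in> El (HomP A) A" using A by (auto simp: HomP_def)
  from 1(5)[OF u this e] obtain s where s: "s \<in> hom A V" "g \<cdot> s = u" "a \<cdot> s = Idm C A"
    by (auto simp: HomP_def)
  have V: "V \<in> Ob C" using a hom_obs by blast
  have sa: "s \<cdot> a \<in> hom V V" "g \<cdot> (s \<cdot> a) = g" "a \<cdot> (s \<cdot> a) = a"
    using s a ua assoc[OF 1(2) s(1) a] assoc[OF a s(1) a] cmp_hom[OF s(1) a] by auto
  have "s \<cdot> a = Idm C V"
    using 1(5)[OF 1(2) 1(3) 1(4)] sa id_hom[OF V] id_right[OF 1(2)] id_right[OF a]
    unfolding HomP_def snd_conv by blast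
  then have "iso C s" using isoI[OF s(1) a] s by blast
  then have "s \<in> M" using mor_class_iso[OF M] by blast
  then show ?thesis using mor_class_comp[OF M _ 1(1) s(1) 1(2)] s(2) by simp
qed

text \<open>If a fibre is represented by an isomorphism \<open>g\<close>, the inverse of
  \<open>g\<close> gives a preimage, and two preimages are two sections of \<open>g\<close>, hence
  equal.\<close>

lemma bijn_iso_cov:
  assumes P: "psh P" and Q: "psh Q" and n: "ntr P Q \<phi>" and c: "cov {f. iso C f} P Q \<phi>"
  shows "bijn P Q \<phi>"
proof (rule bijnI[OF n])
  fix U b assume b: "b \<in> El Q U"
  obtain V g a where 1: "g \<in> {f. iso C f}" "g \<in> hom V U" "a \<in> El P V" "\<phi> a = ac Q b g"
    by (rule covE[OF c b]) (rule that)
  have "iso C g" using 1(1) by simp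
  then obtain g' where g': "g' \<in> hom U V" "g' \<cdot> g = Idm C V" "g \<cdot> g' = Idm C U"
    by (rule isoE[OF _ 1(2)])
  have "\<phi> (ac P a g') = b" using ntr_ac[OF n 1(3) g'(1)] 1 psh_cmp[OF Q b 1(2) g'(1)] g' psh_id[OF Q b] by simp
  then show "\<exists>x. x \<in> El P U \<and> \<phi> x = b" using psh_ac[OF P 1(3) g'(1)] by blast
next
  fix U x y assume x: "x \<in> El P U" and y: "y \<in> El P U" and e: "\<phi> x = \<phi> y"
  have b: "\<phi> x \<in> El Q U" using ntr_el[OF n x] .
  have U: "U \<in> Ob C" using psh_ob[OF Q b] .
  obtain V g a where 1: "g \<in> {f. iso C f}" "g \<in> hom V U" "a \<in> El P V" "\<phi> a = ac Q (\<phi> x) g"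
    "\<And>W h e. h \<in> hom W U \<Longrightarrow> e \<in> El P W \<Longrightarrow> \<phi> e = ac Q (\<phi> x) h \<Longrightarrow>
         (\<exists>!u. u \<in> hom W V \<and> g \<cdot> u = h \<and> ac P a u = e)"
    by (rule covE[OF c b], rule that) (assumption | simp)+
  have i: "\<phi> z = ac Q (\<phi> x) (Idm C U)" if "z \<in> {x,y}" for z using that e psh_id[OF Q b] by auto
  obtain s t where s: "s \<in> hom U V" "g \<cdot> s = Idm C U" "ac P a s = x"
    and t: "t \<in> hom U V" "g \<cdot> t = Idm C U" "ac P a t = y"
    using 1(5)[OF id_hom[OF U] x i] 1(5)[OF id_hom[OF U] y i] by auto
  have "iso C g" using 1(1) by simp
  then obtain g' where g': "g' \<in> hom U V" "g' \<cdot> g = Idm C V"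
    by (rule isoE[OF _ 1(2)])
  have "s = t" using assoc[OF g'(1) 1(2) s(1)] assoc[OF g'(1) 1(2) t(1)] g' s t by simp
  then show "x = y" using s t by simp
qed

end

section \<open>Pullbacks and the terminal object\<close>

locale fl_ctx = cat_ctx C for C :: "('o,'m) cat" +
  assumes fl: "has_finite_limits C"
begin

lemma pullback_ex:
  assumes f: "f \<in> hom a c" and g: "g \<in> hom b c"
  obtains P p1 p2 where "is_pullback C f g P p1 p2"
proof -
  \<comment> \<open>The cospan as a graph: edge 0 runs from vertex 0 to vertex 2 and edge 1 from
    vertex 1 to vertex 2, so \<open>Dsrc\<close> is the identity.\<close>
  define D :: "(nat,nat,'o,'m) diag" where
    "D = \<lparr>DV = {0,1,2}, DE = {0,1}, Dsrc = (\<lambda>e. e), Dtgt = (\<lambda>_. 2),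
          Dobj = (\<lambda>v. if v = 0 then a else if v = 1 then b else c),
          Darr = (\<lambda>e. if e = 0 then f else g)\<rparr>"
  have "wf_diag C D" using f g hom_obs unfolding wf_diag_def D_def by auto
  then obtain L p where l: "is_limit C D L p"
    using fl unfolding has_finite_limits_def D_def by (metis (no_types, lifting) diag.select_convs(1,2) finite.simps)
  have cone: "is_cone C D Q q \<longleftrightarrow> q 0 \<in> hom Q a \<and> q 1 \<in> hom Q b \<and> q 2 \<in> hom Q c \<and>
     f \<cdot> q 0 = q 2 \<and> g \<cdot> q 1 = q 2" for Q q
    unfolding is_cone_def D_def using hom_obs by auto
  have lc: "p 0 \<in> hom L a" "p 1 \<in> hom L b" "f \<cdot> p 0 = p 2" "g \<cdot> p 1 = p 2"
    using l unfolding is_limit_def cone by auto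
  have "is_pullback C f g L (p 0) (p 1)"
    unfolding is_pullback_hom[OF f g]
  proof (intro conjI allI impI)
    fix Q x y assume xy: "x \<in> hom Q a \<and> y \<in> hom Q b \<and> f \<cdot> x = g \<cdot> y"
    define q where "q v = (if v = 0 then x else if v = (1::nat) then y else f \<cdot> x)" for v
    have "is_cone C D Q q" unfolding cone using xy cmp_hom[OF f, of x Q] unfolding q_def by auto
    then have "\<exists>!u. u \<in> hom Q L \<and> (\<forall>v\<in>DV D. p v \<cdot> u = q v)" using l unfolding is_limit_def by blast
    moreover have "(\<forall>v\<in>DV D. p v \<cdot> u = q v) \<longleftrightarrow> p 0 \<cdot> u = x \<and> p 1 \<cdot> u = y" if "u \<in> hom Q L" for u
      using assoc[OF f lc(1) that] lc xy unfolding q_def D_def by auto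
    ultimately show "\<exists>!u. u \<in> hom Q L \<and> p 0 \<cdot> u = x \<and> p 1 \<cdot> u = y" by metis
  qed (use lc in auto)
  then show ?thesis using that by blast
qed

lemma terminal_ex:
  obtains L where "L \<in> Ob C" "\<And>U. U \<in> Ob C \<Longrightarrow> \<exists>!u. u \<in> hom U L"
proof -
  define D :: "(nat,nat,'o,'m) diag" where
    "D = \<lparr>DV = {}, DE = {}, Dsrc = (\<lambda>e. e), Dtgt = (\<lambda>_. 2), Dobj = undefined, Darr = undefined\<rparr>"
  have "wf_diag C D" unfolding wf_diag_def D_def by auto
  then obtain L p where l: "is_limit C D L p"
    using fl unfolding has_finite_limits_def D_def by (metis (no_types, lifting) diag.select_convs(1,2) finite.simps)
  have cone: "is_cone C D Q q \<longleftrightarrow> Q \<in> Ob C" for Q q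
    unfolding is_cone_def D_def by auto
  show ?thesis using that[of L] l unfolding is_limit_def cone by (auto simp: D_def)
qed

text \<open>Converse of \<open>cov_reps_arrow\<close>, by means of pullbacks: a section
  \<open>b\<close> over \<open>U\<close> is an arrow \<open>v\<close> from \<open>U\<close> to
  \<open>L\<close>, and the pullback of \<open>u\<close> along \<open>v\<close> represents the fibre
  over \<open>b\<close>.\<close>

lemma arrow_reps_cov:
  assumes M: "mor_class M" and Q: "psh Q" and n: "ntr (HomP A) Q \<phi>"
    and r: "reps Q L \<xi>" and u: "u \<in> hom A L" and e: "\<phi> (Idm C A) = ac Q \<xi> u" and uM: "u \<in> M"
  shows "cov M (HomP A) Q \<phi>"
  unfolding cov_def
proof (intro allI impI)
  have x: "\<xi> \<in> El Q L" using r unfolding reps_def by blast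
  have A: "A \<in> Ob C" using u hom_obs by blast
  have \<phi>: "\<phi> y = ac Q \<xi> (u \<cdot> y)" if "y \<in> hom W A" for W y
    using ntr_ac[OF n, of "Idm C A" A y W] that A e psh_cmp[OF Q x u that] by (auto simp: HomP_def)
  have inj: "v = w" if "v \<in> hom W L" "w \<in> hom W L" "ac Q \<xi> v = ac Q \<xi> w" for v w W
    using r psh_ac[OF Q x that(1)] that unfolding reps_def by auto
  fix U b assume b: "b \<in> El Q U"
  obtain v where v: "v \<in> hom U L" "ac Q \<xi> v = b" using r b unfolding reps_def by blast
  obtain V p1 p2 where pb: "is_pullback C u v V p1 p2" using pullback_ex[OF u v(1)] .
  note pb' = pb[unfolded is_pullback_hom[OF u v(1)]]
  show "\<exists>V g a. g \<in> M \<and> g \<in> hom V U \<and> a \<in> El (HomP A) V \<and> \<phi> a = ac Q b g \<and>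
       (\<forall>W h e. h \<in> hom W U \<and> e \<in> El (HomP A) W \<and> \<phi> e = ac Q b h \<longrightarrow>
         (\<exists>!u. u \<in> hom W V \<and> g \<cdot> u = h \<and> ac (HomP A) a u = e))"
  proof (intro exI conjI allI impI)
    show "p2 \<in> M" using M uM pb unfolding mor_class_def pullback_stable_def by blast
    show "p2 \<in> hom V U" "p1 \<in> El (HomP A) V" using pb' by (auto simp: HomP_def)
    show "\<phi> p1 = ac Q b p2" using \<phi>[of p1 V] pb' v psh_cmp[OF Q x v(1), of p2 V] by auto
    fix W h e assume "h \<in> hom W U \<and> e \<in> El (HomP A) W \<and> \<phi> e = ac Q b h"
    then have h: "h \<in> hom W U" and ee: "e \<in> hom W A" and he: "\<phi> e = ac Q b h" by (auto simp: HomP_def)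
    have "ac Q \<xi> (u \<cdot> e) = ac Q \<xi> (v \<cdot> h)"
      using \<phi>[OF ee] he v psh_cmp[OF Q x v(1) h] by simp
    then have "u \<cdot> e = v \<cdot> h" using inj[OF cmp_hom[OF u ee] cmp_hom[OF v(1) h]] by blast
    then have "\<exists>!w. w \<in> hom W V \<and> p1 \<cdot> w = e \<and> p2 \<cdot> w = h" using pb' ee h by blast
    then show "\<exists>!w. w \<in> hom W V \<and> p2 \<cdot> w = h \<and> ac (HomP A) p1 w = e"
      by (simp add: HomP_def) metis
  qed
qed

end

subsection \<open>Words and cones\<close>

text \<open>A simplex of a thick simplex is a function stored as a list, so this is composition of
  functions: the action of the simplicial operator \<theta> on the simplex \<sigma>.\<close>

abbreviation sub :: "'a list \<Rightarrow> nat list \<Rightarrow> 'a list" (infixl "\<odot>" 75) where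
  "\<sigma> \<odot> \<theta> \<equiv> map (\<lambda>j. \<sigma> ! j) \<theta>"

abbreviation dm :: "'a list \<Rightarrow> nat" where "dm \<sigma> \<equiv> length \<sigma> - 1"

lemma simplex_iff: "\<theta> \<in> simplex n \<longleftrightarrow> \<theta> \<noteq> [] \<and> (\<forall>j\<in>set \<theta>. j \<le> n) \<and> sorted \<theta>"
  unfolding simplex_def thick_def by auto

lemma mono_list_simplex: "mono_list n \<theta> \<longleftrightarrow> \<theta> \<in> simplex n"
  unfolding simplex_iff mono_list_def by auto

lemma simplex_lt: "\<theta> \<in> simplex (dm \<sigma>) \<Longrightarrow> \<sigma> \<noteq> [] \<Longrightarrow> j \<in> set \<theta> \<Longrightarrow> j < length \<sigma>"
  unfolding simplex_iff by (cases \<sigma>) auto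

lemma sub_sub: "\<psi> \<in> simplex (dm \<theta>) \<Longrightarrow> \<theta> \<noteq> [] \<Longrightarrow> \<sigma> \<odot> \<theta> \<odot> \<psi> = \<sigma> \<odot> (\<theta> \<odot> \<psi>)"
  using simplex_lt[of \<psi> \<theta>] by simp

lemma sub_id: "\<sigma> \<noteq> [] \<Longrightarrow> \<sigma> \<odot> [0..<Suc (dm \<sigma>)] = \<sigma>"
  using map_nth[of \<sigma>] by (cases \<sigma>) (auto simp del: upt_Suc)

lemma id_simplex: "[0..<Suc n] \<in> simplex n"
  unfolding simplex_iff using sorted_upt[of 0 "Suc n"] by auto

lemma sub_set: "\<theta> \<in> simplex (dm \<sigma>) \<Longrightarrow> \<sigma> \<noteq> [] \<Longrightarrow> set (\<sigma> \<odot> \<theta>) \<subseteq> set \<sigma>"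
  using simplex_lt[of \<theta> \<sigma>] by auto

lemma sub_simplex:
  assumes t: "\<theta> \<in> simplex n" and p: "\<psi> \<in> simplex (dm \<theta>)"
  shows "\<theta> \<odot> \<psi> \<in> simplex n"
proof -
  have ne: "\<theta> \<noteq> []" using t unfolding simplex_iff by blast
  have "sorted_wrt (\<lambda>x y. \<theta> ! x \<le> \<theta> ! y) \<psi>"
  proof (rule sorted_wrt_mono_rel[of \<psi> "(\<le>)"])
    show "\<theta> ! x \<le> \<theta> ! y" if "x \<in> set \<psi>" "y \<in> set \<psi>" "x \<le> y" for x y
      using that t simplex_lt[OF p ne] sorted_nth_mono[of \<theta> x y] unfolding simplex_iff by blast
  qed (use p in \<open>simp add: simplex_iff\<close>)
  then have "sorted (\<theta> \<odot> \<psi>)" by (simp add: sorted_wrt_map)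
  then show ?thesis using t p sub_set[OF p ne] unfolding simplex_iff by auto
qed

text \<open>Subcomplexes: closed under all monotone operators, faces and degeneracies alike, so that
  membership can later be tested on nondegenerate words.\<close>

definition sset :: "'a list set \<Rightarrow> bool" where
  "sset S \<longleftrightarrow> (\<forall>\<sigma>\<in>S. \<sigma> \<noteq> [] \<and> (\<forall>\<theta>\<in>simplex (dm \<sigma>). \<sigma> \<odot> \<theta> \<in> S))"

lemma ssetD: "sset S \<Longrightarrow> \<sigma> \<in> S \<Longrightarrow> \<theta> \<in> simplex (dm \<sigma>) \<Longrightarrow> \<sigma> \<odot> \<theta> \<in> S"
  and sset_ne: "sset S \<Longrightarrow> \<sigma> \<in> S \<Longrightarrow> \<sigma> \<noteq> []"
  unfolding sset_def by auto

lemma sset_simplex: "sset (simplex n)"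
  unfolding sset_def using sub_simplex by (auto simp: simplex_iff)

lemma sset_Un: "sset S \<Longrightarrow> sset T \<Longrightarrow> sset (S \<union> T)"
  unfolding sset_def by blast

lemma sset_empty: "sset {}"
  unfolding sset_def by blast

text \<open>Boundaries and horns, ordinary or thick, are cut out by conditions on the support of a
  word, and an operator can only shrink the support.\<close>

lemma sset_support:
  assumes "sset S" "\<And>A B. P A \<Longrightarrow> B \<subseteq> A \<Longrightarrow> P B"
  shows "sset {\<sigma>\<in>S. P (set \<sigma>)}"
  unfolding sset_def
proof (intro ballI conjI)
  fix \<sigma> assume s: "\<sigma> \<in> {\<sigma>\<in>S. P (set \<sigma>)}"
  then show ne: "\<sigma> \<noteq> []" using sset_ne[OF assms(1)] by blast
  fix \<theta> assume "\<theta> \<in> simplex (dm \<sigma>)"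
  then show "\<sigma> \<odot> \<theta> \<in> {\<sigma>\<in>S. P (set \<sigma>)}"
    using s ssetD[OF assms(1)] assms(2) sub_set[OF _ ne] by blast
qed

lemma sset_thick: "sset (thick n)"
  unfolding sset_def
proof (intro ballI conjI)
  fix \<sigma> assume s: "\<sigma> \<in> thick n"
  then show ne: "\<sigma> \<noteq> []" unfolding thick_def by blast
  fix \<theta> assume t: "\<theta> \<in> simplex (dm \<sigma>)"
  then have "\<theta> \<noteq> []" unfolding simplex_iff by blast
  then show "\<sigma> \<odot> \<theta> \<in> thick n"
    using s sub_set[OF t ne] unfolding thick_def by auto
qed

lemma sset_bdry: "sset (bdry n)"
  unfolding bdry_def by (rule sset_support[OF sset_simplex]) blast

lemma sset_horn: "sset (horn n i)"
  unfolding horn_def by (rule sset_support[OF sset_simplex]) blast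

text \<open>The simplex \<open>\<tau>\<close> of dimension \<open>m\<close> is attached to \<open>S\<close> along the subcomplex \<open>R\<close> of its
  standard simplex.\<close>

definition attach :: "nat list \<Rightarrow> nat \<Rightarrow> nat list set \<Rightarrow> nat list set \<Rightarrow> nat list set \<Rightarrow> bool" where
  "attach \<tau> m R S T \<longleftrightarrow> sset S \<and> R \<subseteq> simplex m \<and> length \<tau> = Suc m \<and>
     T = S \<union> (\<lambda>\<theta>. \<tau> \<odot> \<theta>) ` simplex m \<and> (\<forall>\<theta>\<in>simplex m. \<tau> \<odot> \<theta> \<in> S \<longleftrightarrow> \<theta> \<in> R) \<and>
     inj_on (\<lambda>\<theta>. \<tau> \<odot> \<theta>) (simplex m - R)"

lemma attach_sset_image: "length \<tau> = Suc m \<Longrightarrow> sset ((\<lambda>\<theta>. \<tau> \<odot> \<theta>) ` simplex m)"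
  unfolding sset_def
proof (intro ballI conjI)
  fix \<sigma> assume "\<sigma> \<in> (\<lambda>\<theta>. \<tau> \<odot> \<theta>) ` simplex m"
  then obtain \<theta> where t: "\<theta> \<in> simplex m" "\<sigma> = \<tau> \<odot> \<theta>" by blast
  then have ne: "\<theta> \<noteq> []" unfolding simplex_iff by blast
  then show "\<sigma> \<noteq> []" using t by simp
  fix \<psi> assume p: "\<psi> \<in> simplex (dm \<sigma>)"
  then have p: "\<psi> \<in> simplex (dm \<theta>)" using t by simp
  show "\<sigma> \<odot> \<psi> \<in> (\<lambda>\<theta>. \<tau> \<odot> \<theta>) ` simplex m"
    using sub_sub[OF p ne, of \<tau>] sub_simplex[OF t(1) p] t(2) by blast
qed

lemma attach_facts:
  assumes "attach \<tau> m R S T"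
  shows "sset S" "sset T" "S \<subseteq> T" "\<tau> \<in> T" "dm \<tau> = m" "\<tau> \<noteq> []" "R \<subseteq> simplex m" "sset R"
proof -
  show 1: "sset S" "R \<subseteq> simplex m" using assms unfolding attach_def by auto
  have l: "length \<tau> = Suc m" using assms unfolding attach_def by auto
  then show 2: "dm \<tau> = m" "\<tau> \<noteq> []" by auto
  show "sset T" "S \<subseteq> T"
    using assms sset_Un[OF 1(1) attach_sset_image[OF l]] unfolding attach_def by auto
  have "\<tau> \<odot> [0..<Suc m] = \<tau>" using sub_id[OF 2(2)] 2(1) by simp
  then show "\<tau> \<in> T" using assms id_simplex[of m] unfolding attach_def by (metis UnI2 image_eqI)
  show "sset R" unfolding sset_def
  proof (intro ballI conjI)
    fix \<theta> assume t: "\<theta> \<in> R"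
    then have t': "\<theta> \<in> simplex m" using 1 by blast
    then show ne: "\<theta> \<noteq> []" unfolding simplex_iff by blast
    fix \<psi> assume p: "\<psi> \<in> simplex (dm \<theta>)"
    have "\<tau> \<odot> \<theta> \<in> S" using assms t t' unfolding attach_def by blast
    then have "\<tau> \<odot> \<theta> \<odot> \<psi> \<in> S" using ssetD[OF 1(1)] p by simp
    then show "\<theta> \<odot> \<psi> \<in> R"
      using assms sub_sub[OF p ne, of \<tau>] sub_simplex[OF t' p] unfolding attach_def by auto
  qed
qed

section \<open>Presheaves of cones\<close>

context cat_ctx
begin

lemma so_ob: "simplicial_object C X Xm \<Longrightarrow> X n \<in> Ob C"
  and so_hom: "simplicial_object C X Xm \<Longrightarrow> \<theta> \<in> simplex n \<Longrightarrow> Xm n \<theta> \<in> hom (X n) (X (dm \<theta>))"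
  and so_id: "simplicial_object C X Xm \<Longrightarrow> Xm n [0..<Suc n] = Idm C (X n)"
  and so_cmp: "simplicial_object C X Xm \<Longrightarrow> \<theta> \<in> simplex n \<Longrightarrow> \<psi> \<in> simplex (dm \<theta>) \<Longrightarrow>
    Xm (dm \<theta>) \<psi> \<cdot> Xm n \<theta> = Xm n (\<theta> \<odot> \<psi>)"
  unfolding simplicial_object_def mono_list_simplex by blast+

text \<open>Sections over \<open>U\<close> are the arrows from \<open>U\<close> to Map(S,X), written
  as cones so that no limit has to exist. Extensionality makes a cone determined by its legs on
  \<open>S\<close>, so that equality of sections is equality of functions.\<close>

definition ConP :: "(nat \<Rightarrow> 'o) \<Rightarrow> (nat \<Rightarrow> nat list \<Rightarrow> 'm) \<Rightarrow> nat list set \<Rightarrow>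
    ('o \<Rightarrow> (nat list \<Rightarrow> 'm) set) \<times> ((nat list \<Rightarrow> 'm) \<Rightarrow> 'm \<Rightarrow> (nat list \<Rightarrow> 'm))" where
  "ConP X Xm S = (\<lambda>U. {c. is_cone C (map_diag X Xm S) U c \<and> c \<in> extensional S},
     \<lambda>c g. (\<lambda>\<sigma>\<in>S. c \<sigma> \<cdot> g))"

lemma is_cone_map_diag: "is_cone C (map_diag X Xm S) U c \<longleftrightarrow> U \<in> Ob C \<and>
    (\<forall>\<sigma>\<in>S. c \<sigma> \<in> hom U (X (dm \<sigma>))) \<and>
    (\<forall>\<sigma>\<in>S. \<forall>\<theta>\<in>simplex (dm \<sigma>). Xm (dm \<sigma>) \<theta> \<cdot> c \<sigma> = c (\<sigma> \<odot> \<theta>))"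
  unfolding is_cone_def map_diag_def mono_list_simplex by auto

lemma ConPI:
  assumes "U \<in> Ob C" "c \<in> extensional S" "\<And>\<sigma>. \<sigma> \<in> S \<Longrightarrow> c \<sigma> \<in> hom U (X (dm \<sigma>))"
    "\<And>\<sigma> \<theta>. \<sigma> \<in> S \<Longrightarrow> \<theta> \<in> simplex (dm \<sigma>) \<Longrightarrow> Xm (dm \<sigma>) \<theta> \<cdot> c \<sigma> = c (\<sigma> \<odot> \<theta>)"
  shows "c \<in> El (ConP X Xm S) U"
  using assms unfolding ConP_def is_cone_map_diag by auto

lemma ConP_ext: "c \<in> El (ConP X Xm S) U \<Longrightarrow> c \<in> extensional S"
  and ConP_ob: "c \<in> El (ConP X Xm S) U \<Longrightarrow> U \<in> Ob C"
  and ConP_hom: "c \<in> El (ConP X Xm S) U \<Longrightarrow> \<sigma> \<in> S \<Longrightarrow> c \<sigma> \<in> hom U (X (dm \<sigma>))"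
  and ConP_face: "c \<in> El (ConP X Xm S) U \<Longrightarrow> \<sigma> \<in> S \<Longrightarrow> \<theta> \<in> simplex (dm \<sigma>) \<Longrightarrow>
    Xm (dm \<sigma>) \<theta> \<cdot> c \<sigma> = c (\<sigma> \<odot> \<theta>)"
  unfolding ConP_def is_cone_map_diag by auto

lemma ConP_ac: "ac (ConP X Xm S) c g = (\<lambda>\<sigma>\<in>S. c \<sigma> \<cdot> g)"
  unfolding ConP_def by simp

lemma ConP_eqI:
  assumes "c \<in> El (ConP X Xm S) U" "d \<in> El (ConP X Xm S) U'" "\<And>\<sigma>. \<sigma> \<in> S \<Longrightarrow> c \<sigma> = d \<sigma>"
  shows "c = d"
  using extensionalityI[OF ConP_ext[OF assms(1)] ConP_ext[OF assms(2)]] assms(3) by blast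

lemma psh_ConP:
  assumes so: "simplicial_object C X Xm" and S: "sset S"
  shows "psh (ConP X Xm S)"
  unfolding psh_def
proof (intro conjI allI impI; (elim conjE)?)
  fix U x assume x: "x \<in> El (ConP X Xm S) U"
  then show "U \<in> Ob C" by (rule ConP_ob)
  show "ac (ConP X Xm S) x (Idm C U) = x"
    unfolding ConP_ac
    by (rule extensionalityI[OF restrict_extensional ConP_ext[OF x]]) (use id_right[OF ConP_hom[OF x]] in simp)
next
  fix U V x g assume x: "x \<in> El (ConP X Xm S) U" and g: "g \<in> hom V U"
  show "ac (ConP X Xm S) x g \<in> El (ConP X Xm S) V"
    unfolding ConP_ac
  proof (rule ConPI)
    show "V \<in> Ob C" using hom_obs[OF g] by blast
    show "restrict (\<lambda>\<sigma>. x \<sigma> \<cdot> g) S \<sigma> \<in> hom V (X (dm \<sigma>))" if "\<sigma> \<in> S" for \<sigma>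
      using cmp_hom[OF ConP_hom[OF x that] g] that by simp
    show "Xm (dm \<sigma>) \<theta> \<cdot> restrict (\<lambda>\<sigma>. x \<sigma> \<cdot> g) S \<sigma> = restrict (\<lambda>\<sigma>. x \<sigma> \<cdot> g) S (\<sigma> \<odot> \<theta>)"
      if "\<sigma> \<in> S" "\<theta> \<in> simplex (dm \<sigma>)" for \<sigma> \<theta>
      using assoc[OF so_hom[OF so that(2)] ConP_hom[OF x that(1)] g] ConP_face[OF x that]
        ssetD[OF S that] that by simp
  qed simp
next
  fix U V W x g h assume x: "x \<in> El (ConP X Xm S) U" and g: "g \<in> hom V U" and h: "h \<in> hom W V"
  show "ac (ConP X Xm S) (ac (ConP X Xm S) x g) h = ac (ConP X Xm S) x (g \<cdot> h)"
    unfolding ConP_ac by (rule restrict_ext) (simp add: assoc[OF ConP_hom[OF x] g h])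
qed

lemma restrict_ConP:
  assumes "c \<in> El (ConP X Xm T) U" "S \<subseteq> T" "sset S"
  shows "restrict c S \<in> El (ConP X Xm S) U"
proof (rule ConPI)
  show "Xm (dm \<sigma>) \<theta> \<cdot> restrict c S \<sigma> = restrict c S (\<sigma> \<odot> \<theta>)"
    if "\<sigma> \<in> S" "\<theta> \<in> simplex (dm \<sigma>)" for \<sigma> \<theta>
    using ConP_face[OF assms(1), of \<sigma> \<theta>] that assms(2) ssetD[OF assms(3) that] by auto
qed (use ConP_ob[OF assms(1)] ConP_hom[OF assms(1)] assms(2) in auto)

lemma ntr_restrict:
  assumes "S \<subseteq> T" "sset S"
  shows "ntr (ConP X Xm T) (ConP X Xm S) (\<lambda>c. restrict c S)"
  by (rule ntrI) (use restrict_ConP[OF _ assms] assms(1) in \<open>auto simp: ConP_ac fun_eq_iff restrict_def\<close>)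

text \<open>The map from X_m to Map(R,X), applied to a generalized element \<open>x\<close> of
  \<open>X m\<close>.\<close>

definition faces :: "(nat \<Rightarrow> nat list \<Rightarrow> 'm) \<Rightarrow> nat \<Rightarrow> nat list set \<Rightarrow> 'm \<Rightarrow> nat list \<Rightarrow> 'm" where
  "faces Xm m R x = (\<lambda>\<theta>\<in>R. Xm m \<theta> \<cdot> x)"

lemma faces_ConP:
  assumes so: "simplicial_object C X Xm" and R: "R \<subseteq> simplex m" "sset R" and x: "x \<in> hom U (X m)"
  shows "faces Xm m R x \<in> El (ConP X Xm R) U"
  unfolding faces_def
proof (rule ConPI)
  show "U \<in> Ob C" using hom_obs[OF x] by blast
  fix \<theta> assume t: "\<theta> \<in> R"
  then have t': "\<theta> \<in> simplex m" using R by blast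
  show "(\<lambda>\<theta>\<in>R. Xm m \<theta> \<cdot> x) \<theta> \<in> hom U (X (dm \<theta>))" using cmp_hom[OF so_hom[OF so t'] x] t by simp
  fix \<psi> assume p: "\<psi> \<in> simplex (dm \<theta>)"
  show "Xm (dm \<theta>) \<psi> \<cdot> (\<lambda>\<theta>\<in>R. Xm m \<theta> \<cdot> x) \<theta> = (\<lambda>\<theta>\<in>R. Xm m \<theta> \<cdot> x) (\<theta> \<odot> \<psi>)"
    using ssetD[OF R(2) t p] assoc[OF so_hom[OF so p] so_hom[OF so t'] x] so_cmp[OF so t' p] t by simp
qed simp

lemma ntr_faces:
  assumes so: "simplicial_object C X Xm" and R: "R \<subseteq> simplex m" "sset R"
  shows "ntr (HomP (X m)) (ConP X Xm R) (faces Xm m R)"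
proof (rule ntrI)
  fix U x assume x: "x \<in> El (HomP (X m)) U"
  then show "faces Xm m R x \<in> El (ConP X Xm R) U" using faces_ConP[OF so R] by (simp add: HomP_def)
  fix V g assume g: "g \<in> hom V U"
  show "faces Xm m R (ac (HomP (X m)) x g) = ac (ConP X Xm R) (faces Xm m R x) g"
    unfolding faces_def ConP_ac
    by (rule restrict_ext) (use x g R in \<open>auto simp: HomP_def assoc[OF so_hom[OF so] _ g]\<close>)
qed

text \<open>\<open>T\<close> is the pushout of \<open>S\<close> and the standard
  \<open>m\<close>-simplex along \<open>R\<close>, hence a cone on \<open>T\<close> is a cone on
  \<open>S\<close> together with a simplex \<open>a\<close> agreeing with it on \<open>R\<close>.
  The leg at a new word \<open>\<tau> \<odot> \<theta>\<close> must be
  \<open>Xm m \<theta> \<cdot> a\<close>; injectivity off \<open>R\<close> makes this well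
  defined.\<close>

lemma attach_glue:
  assumes so: "simplicial_object C X Xm" and at: "attach \<tau> m R S T"
    and a: "a \<in> hom U (X m)" and b: "b \<in> El (ConP X Xm S) U"
    and e: "\<And>\<theta>. \<theta> \<in> R \<Longrightarrow> Xm m \<theta> \<cdot> a = b (\<tau> \<odot> \<theta>)"
  shows "\<exists>!x. x \<in> El (ConP X Xm T) U \<and> x \<tau> = a \<and> restrict x S = b"
proof -
  note af = attach_facts[OF at]
  have at': "T = S \<union> (\<lambda>\<theta>. \<tau> \<odot> \<theta>) ` simplex m" "\<And>\<theta>. \<theta> \<in> simplex m \<Longrightarrow> \<tau> \<odot> \<theta> \<in> S \<longleftrightarrow> \<theta> \<in> R"
    "inj_on (\<lambda>\<theta>. \<tau> \<odot> \<theta>) (simplex m - R)" using at unfolding attach_def by auto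
  define x where "x = (\<lambda>w\<in>T. if w \<in> S then b w else Xm m (inv_into (simplex m - R) (\<lambda>\<theta>. \<tau> \<odot> \<theta>) w) \<cdot> a)"
  have xS: "x w = b w" if "w \<in> S" for w using that af(3) unfolding x_def by auto
  have x\<tau>: "x (\<tau> \<odot> \<theta>) = Xm m \<theta> \<cdot> a" if t: "\<theta> \<in> simplex m" for \<theta>
  proof (cases "\<theta> \<in> R")
    case True
    then show ?thesis using xS at'(2)[OF t] e by simp
  next
    case False
    then have "inv_into (simplex m - R) (\<lambda>\<theta>. \<tau> \<odot> \<theta>) (\<tau> \<odot> \<theta>) = \<theta>"
      using inv_into_f_f[OF at'(3), of \<theta>] t by blast
    then show ?thesis using False at' t unfolding x_def by auto
  qed
  have ext: "x \<in> extensional T" unfolding x_def by simp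
  have U: "U \<in> Ob C" using hom_obs[OF a] by blast
  have xC: "x \<in> El (ConP X Xm T) U"
  proof (rule ConPI[OF U ext])
    fix w assume w: "w \<in> T"
    show "x w \<in> hom U (X (dm w))"
    proof (cases "w \<in> S")
      case True then show ?thesis using xS ConP_hom[OF b] by simp
    next
      case False
      then obtain \<theta> where t: "\<theta> \<in> simplex m" "w = \<tau> \<odot> \<theta>" using w at'(1) by blast
      then show ?thesis using x\<tau> cmp_hom[OF so_hom[OF so t(1)] a] by simp
    qed
    fix \<psi> assume p: "\<psi> \<in> simplex (dm w)"
    show "Xm (dm w) \<psi> \<cdot> x w = x (w \<odot> \<psi>)"
    proof (cases "w \<in> S")
      case True then show ?thesis using xS ConP_face[OF b True p] ssetD[OF af(1) True p] by simp
    next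
      case False
      then obtain \<theta> where t: "\<theta> \<in> simplex m" "w = \<tau> \<odot> \<theta>" using w at'(1) by blast
      have ne: "\<theta> \<noteq> []" using t unfolding simplex_iff by blast
      have p': "\<psi> \<in> simplex (dm \<theta>)" using p t by simp
      have "w \<odot> \<psi> = \<tau> \<odot> (\<theta> \<odot> \<psi>)" using sub_sub[OF p' ne] t by simp
      then have "x (w \<odot> \<psi>) = Xm m (\<theta> \<odot> \<psi>) \<cdot> a" using x\<tau>[OF sub_simplex[OF t(1) p']] by (simp only:)
      also have "\<dots> = Xm (dm \<theta>) \<psi> \<cdot> x w"
        unfolding t(2) x\<tau>[OF t(1)] so_cmp[OF so t(1) p', symmetric]
        by (rule assoc[OF so_hom[OF so p'] so_hom[OF so t(1)] a])
      finally show ?thesis using t(2) by simp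
    qed
  qed
  have "x \<tau> = a"
    using x\<tau>[OF id_simplex] sub_id[OF af(6)] af(5) so_id[OF so] id_left[OF a] by simp
  moreover have "restrict x S = b"
    by (rule extensionalityI[OF restrict_extensional ConP_ext[OF b]]) (simp add: xS)
  ultimately show ?thesis
  proof (intro ex1I[of _ x])
    fix y assume y: "y \<in> El (ConP X Xm T) U \<and> y \<tau> = a \<and> restrict y S = b"
    show "y = x"
    proof (rule ConP_eqI)
      show "y \<in> El (ConP X Xm T) U" "x \<in> El (ConP X Xm T) U" using y xC by auto
      fix w assume w: "w \<in> T"
      show "y w = x w"
      proof (cases "w \<in> S")
        case True then show ?thesis using xS y by auto
      next
        case False
        then obtain \<theta> where t: "\<theta> \<in> simplex m" "w = \<tau> \<odot> \<theta>" using w at'(1) by blast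
        then show ?thesis using x\<tau> ConP_face[of y X Xm T U \<tau> \<theta>] y af by simp
      qed
    qed
  qed (use xC in auto)
qed

text \<open>The restriction is the base change of the map from X_m to Map(R,X) along the map \<beta>
  that pulls a cone on \<open>S\<close> back along \<tau>.\<close>

lemma attach_cov:
  assumes so: "simplicial_object C X Xm" and at: "attach \<tau> m R S T"
    and c: "cov M (HomP (X m)) (ConP X Xm R) (faces Xm m R)"
  shows "cov M (ConP X Xm T) (ConP X Xm S) (\<lambda>c. restrict c S)"
proof (rule cov_base[OF c])
  note af = attach_facts[OF at]
  have at': "\<And>\<theta>. \<theta> \<in> R \<Longrightarrow> \<tau> \<odot> \<theta> \<in> S" using at unfolding attach_def by auto
  have Rs: "\<theta> \<in> simplex (dm \<tau>)" if "\<theta> \<in> R" for \<theta> using that af by auto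
  define \<beta> :: "(nat list \<Rightarrow> 'm) \<Rightarrow> (nat list \<Rightarrow> 'm)" where "\<beta> = (\<lambda>c. \<lambda>\<theta>\<in>R. c (\<tau> \<odot> \<theta>))"
  show "psh (ConP X Xm R)" "psh (ConP X Xm T)" "psh (ConP X Xm S)"
    using psh_ConP[OF so] af by auto
  show "ntr (ConP X Xm T) (ConP X Xm S) (\<lambda>c. restrict c S)" using ntr_restrict af by blast
  show "ntr (ConP X Xm T) (HomP (X m)) (\<lambda>c. c \<tau>)"
    by (rule ntrI) (use ConP_hom[of _ X Xm T _ \<tau>] af in \<open>auto simp: HomP_def ConP_ac\<close>)
  show "ntr (ConP X Xm S) (ConP X Xm R) \<beta>"
  proof (rule ntrI)
    fix U x assume x: "x \<in> El (ConP X Xm S) U"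
    show "\<beta> x \<in> El (ConP X Xm R) U" unfolding \<beta>_def
    proof (rule ConPI)
      show "U \<in> Ob C" using ConP_ob[OF x] .
      fix \<theta> assume t: "\<theta> \<in> R"
      then have ne: "\<theta> \<noteq> []" using sset_ne af by blast
      show "(\<lambda>\<theta>\<in>R. x (\<tau> \<odot> \<theta>)) \<theta> \<in> hom U (X (dm \<theta>))" using t ConP_hom[OF x at'[OF t]] by simp
      fix \<psi> assume p: "\<psi> \<in> simplex (dm \<theta>)"
      show "Xm (dm \<theta>) \<psi> \<cdot> (\<lambda>\<theta>\<in>R. x (\<tau> \<odot> \<theta>)) \<theta> = (\<lambda>\<theta>\<in>R. x (\<tau> \<odot> \<theta>)) (\<theta> \<odot> \<psi>)"
        using t ssetD[OF af(8) t p] ConP_face[OF x at'[OF t], of \<psi>] p sub_sub[OF p ne, of \<tau>] by simp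
    qed simp
    fix V g
    show "\<beta> (ac (ConP X Xm S) x g) = ac (ConP X Xm R) (\<beta> x) g"
      unfolding \<beta>_def ConP_ac by (rule restrict_ext) (simp add: at')
  qed
  show "faces Xm m R (x \<tau>) = \<beta> (restrict x S)" if "x \<in> El (ConP X Xm T) U" for U x
    unfolding faces_def \<beta>_def
    by (rule restrict_ext) (use ConP_face[OF that af(4) Rs] af(5) at' in auto)
  fix U a b assume a: "a \<in> El (HomP (X m)) U" and b: "b \<in> El (ConP X Xm S) U" and e: "faces Xm m R a = \<beta> b"
  show "\<exists>!x. x \<in> El (ConP X Xm T) U \<and> x \<tau> = a \<and> restrict x S = b"
  proof (rule attach_glue[OF so at _ b])
    show "a \<in> hom U (X m)" using a by (simp add: HomP_def)
    show "Xm m \<theta> \<cdot> a = b (\<tau> \<odot> \<theta>)" if "\<theta> \<in> R" for \<theta>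
      using fun_cong[OF e, of \<theta>] that unfolding faces_def \<beta>_def by simp
  qed
qed

lemma restrict_cov_refl:
  assumes so: "simplicial_object C X Xm" and S: "sset S" and M: "mor_class M"
  shows "cov M (ConP X Xm S) (ConP X Xm S) (\<lambda>c. restrict c S)"
proof (rule bijn_cov[OF M psh_ConP[OF so S] psh_ConP[OF so S] ntr_restrict[OF order_refl S]])
  have r: "restrict c S = c" if "c \<in> El (ConP X Xm S) U" for c U
    using extensional_restrict[OF ConP_ext[OF that]] .
  show "bijn (ConP X Xm S) (ConP X Xm S) (\<lambda>c. restrict c S)"
    by (rule bijnI[OF ntr_restrict[OF order_refl S]]) (use r in auto)
qed

lemma restrict_cov_trans:
  assumes so: "simplicial_object C X Xm" and M: "mor_class M"
    and S: "sset S" "sset T" "sset R" "S \<subseteq> T" "T \<subseteq> R"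
    and 1: "cov M (ConP X Xm T) (ConP X Xm S) (\<lambda>c. restrict c S)"
    and 2: "cov M (ConP X Xm R) (ConP X Xm T) (\<lambda>c. restrict c T)"
  shows "cov M (ConP X Xm R) (ConP X Xm S) (\<lambda>c. restrict c S)"
proof -
  have "(\<lambda>c. restrict (restrict c T) S) = (\<lambda>c::nat list \<Rightarrow> 'm. restrict c S)"
    using S(4) by (auto simp: restrict_restrict Int_absorb1)
  then show ?thesis
    using cov_comp[OF M psh_ConP[OF so S(3)] psh_ConP[OF so S(2)] psh_ConP[OF so S(1)]
       ntr_restrict[OF S(5,2)] ntr_restrict[OF S(4,1)] 2 1] by simp
qed

end

subsection \<open>Nondegenerate words\<close>

lemma remdups_adj_Cons_hd: "\<exists>r. remdups_adj (x # xs) = x # r"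
  using remdups_adj_Cons_alt[of x xs] by metis

lemma remdups_adj_map: "remdups_adj (map f xs) = remdups_adj (map f (remdups_adj xs))"
proof (induction xs rule: remdups_adj.induct)
  case (3 x y xs)
  obtain r where r: "remdups_adj (y # xs) = y # r" by (rule exE[OF remdups_adj_Cons_hd])
  show ?case
  proof (cases "x = y")
    case False
    have "remdups_adj (f y # map f xs) = remdups_adj (f y # map f r)" using 3(2)[OF False] r by simp
    then show ?thesis using False r by simp
  qed (use 3(1) in simp)
qed auto

text \<open>Existence half of the Eilenberg-Zilber lemma for words: the nondegenerate simplex
  underlying a word is obtained by merging equal neighbours.\<close>

lemma remdups_adj_degeneracy:
  "w \<noteq> [] \<Longrightarrow> \<exists>\<theta>\<in>simplex (dm (remdups_adj w)). hd \<theta> = 0 \<and> w = remdups_adj w \<odot> \<theta>"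
proof (induction w rule: remdups_adj.induct)
  case (2 x)
  then show ?case by (intro bexI[of _ "[0]"]) (auto simp: simplex_iff)
next
  case (3 x y zs)
  show ?case
  proof (cases "x = y")
    case True
    then obtain \<theta> where t: "\<theta> \<in> simplex (dm (remdups_adj (y # zs)))" "hd \<theta> = 0"
      "y # zs = remdups_adj (y # zs) \<odot> \<theta>" using 3(1) by auto
    obtain r where "remdups_adj (y # zs) = y # r" by (rule exE[OF remdups_adj_Cons_hd])
    then have "remdups_adj (y # zs) ! 0 = y" by simp
    moreover have "0 # \<theta> \<in> simplex (dm (remdups_adj (y # zs)))" using t(1) unfolding simplex_iff by simp
    ultimately have "x # y # zs = remdups_adj (y # zs) \<odot> (0 # \<theta>)" using t(3) True by (simp del: remdups_adj.simps)
    then show ?thesis using \<open>0 # \<theta> \<in> _\<close> True by (intro bexI[of _ "0 # \<theta>"]) simp_all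
  next
    case False
    then obtain \<theta> where t: "\<theta> \<in> simplex (dm (remdups_adj (y # zs)))" "hd \<theta> = 0"
      "y # zs = remdups_adj (y # zs) \<odot> \<theta>" using 3(2) by auto
    have r: "remdups_adj (x # y # zs) = x # remdups_adj (y # zs)" using False by simp
    have ne: "remdups_adj (y # zs) \<noteq> []" by simp
    have "x # y # zs = (x # remdups_adj (y # zs)) \<odot> (0 # map Suc \<theta>)"
      using t(3) by (simp add: comp_def del: remdups_adj.simps)
    moreover have "0 # map Suc \<theta> \<in> simplex (dm (x # remdups_adj (y # zs)))"
      using t(1) ne unfolding simplex_iff
      by (cases "remdups_adj (y # zs)") (auto simp: sorted_map sorted_wrt_map simp del: remdups_adj.simps)
    ultimately show ?thesis unfolding r by (intro bexI[of _ "0 # map Suc \<theta>"]) auto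
  qed
qed simp

lemma remdups_adj_face:
  "w \<noteq> [] \<Longrightarrow> \<exists>\<theta>\<in>simplex (dm w). remdups_adj w = w \<odot> \<theta>"
proof (induction w rule: remdups_adj.induct)
  case (2 x)
  then show ?case by (intro bexI[of _ "[0]"]) (auto simp: simplex_iff)
next
  case (3 x y zs)
  obtain \<theta> where t: "\<theta> \<in> simplex (dm (y # zs))" "remdups_adj (y # zs) = (y # zs) \<odot> \<theta>"
    using 3 by (cases "x = y") auto
  show ?case
  proof (cases "x = y")
    case True
    then show ?thesis using t
      by (intro bexI[of _ "map Suc \<theta>"])
        (auto simp: simplex_iff comp_def sorted_map sorted_wrt_map)
  next
    case False
    then show ?thesis using t
      by (intro bexI[of _ "0 # map Suc \<theta>"])
        (auto simp: simplex_iff comp_def sorted_map sorted_wrt_map)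
  qed
qed simp

text \<open>A word is a degeneracy of its core, and the core is a face of the word; so a subcomplex
  is determined by its nondegenerate words.\<close>

lemma sset_remdups_adj: "sset S \<Longrightarrow> w \<noteq> [] \<Longrightarrow> remdups_adj w \<in> S \<longleftrightarrow> w \<in> S"
proof
  assume S: "sset S" and ne: "w \<noteq> []"
  show "w \<in> S" if r: "remdups_adj w \<in> S"
    using remdups_adj_degeneracy[OF ne] ssetD[OF S r] by metis
  show "remdups_adj w \<in> S" if r: "w \<in> S"
    using remdups_adj_face[OF ne] ssetD[OF S r] by metis
qed

text \<open>Uniqueness half of the Eilenberg-Zilber lemma. Neighbouring letters of \<kappa> keep
  distinct images, so the blocks of equal letters in \<theta> can be read off from
  \<open>map f \<theta>\<close>, and \<theta> is recovered from these blocks and \<kappa>.\<close>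

lemma remdups_adj_map_inj:
  "map f \<theta> = map f \<theta>' \<Longrightarrow> remdups_adj \<theta> = \<kappa> \<Longrightarrow> remdups_adj \<theta>' = \<kappa> \<Longrightarrow>
    distinct_adj (map f \<kappa>) \<Longrightarrow> \<theta> = \<theta>'"
proof (induction \<theta> arbitrary: \<theta>' \<kappa> rule: remdups_adj.induct)
  case (1 \<theta>')
  then show ?case by simp
next
  case (2 x)
  have "length \<theta>' = length [x]" using map_eq_imp_length_eq[OF 2(1)] by simp
  then obtain x' where "\<theta>' = [x']" by (auto simp: length_Suc_conv)
  then show ?case using 2(2,3) by simp
next
  case (3 x y zs)
  have "length \<theta>' = length (x # y # zs)" using map_eq_imp_length_eq[OF 3(3)] by simp
  then obtain x' y' zs' where t: "\<theta>' = x' # y' # zs'" by (auto simp: length_Suc_conv)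
  have hx: "x' = x" using 3(4,5) hd_remdups_adj[of "x # y # zs"] hd_remdups_adj[of "x' # y' # zs'"] t by simp
  have e: "map f (y # zs) = map f (y' # zs')" using 3(3) t by simp
  have second: "f a \<noteq> f b" if "remdups_adj (a # b # cs) = \<kappa>" "a \<noteq> b" for a b cs
  proof -
    have "\<kappa> = a # remdups_adj (b # cs)" using that by simp
    then obtain r where "\<kappa> = a # b # r" using hd_remdups_adj[of "b # cs"]
      by (cases "remdups_adj (b # cs)") (auto simp del: remdups_adj.simps)
    then show ?thesis using 3(6) by simp
  qed
  show ?case
  proof (cases "x = y")
    case True
    have "f x' = f y'" using e hx True by simp
    then have "y' = x'"
      using second[of x' y' zs'] 3(5) t by metis
    then show ?thesis
      using 3(1)[OF True, of "y' # zs'" \<kappa>] 3(4,5,6) e t hx True by simp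
  next
    case False
    have "y' \<noteq> x'"
      using second[OF 3(4) False] e hx by auto
    then have k: "\<kappa> = x # remdups_adj (y' # zs')" "\<kappa> = x # remdups_adj (y # zs)"
      using 3(4,5) t False hx by auto
    have "distinct_adj (map f (remdups_adj (y # zs)))"
      using 3(6) k(2) by (cases "remdups_adj (y # zs)") (auto simp del: remdups_adj.simps)
    then show ?thesis
      using 3(2)[OF False e refl] k t hx by simp
  qed
qed

text \<open>The nondegenerate simplices of a standard simplex correspond to sets of
  vertices.\<close>

lemma remdups_adj_sorted:
  fixes \<theta> :: "'a :: linorder list"
  assumes "sorted \<theta>"
  shows "remdups_adj \<theta> = sorted_list_of_set (set \<theta>)"
proof -
  have "sorted (remdups_adj \<theta>) \<and> distinct (remdups_adj \<theta>)" using assms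
  proof (induction \<theta> rule: remdups_adj.induct)
    case (3 x y xs)
    show ?case
    proof (cases "x = y")
      case False
      then have "sorted (remdups_adj (y # xs))" "distinct (remdups_adj (y # xs))" "\<forall>z\<in>set (y # xs). x < z"
        using 3 by auto
      then show ?thesis using False remdups_adj_set[of "y # xs"] by (auto simp del: remdups_adj_set)
    qed (use 3 in simp)
  qed auto
  then show ?thesis
    using sorted_distinct_set_unique[of "remdups_adj \<theta>" "sorted_list_of_set (set \<theta>)"] by simp
qed

text \<open>The face operator d_j on words.\<close>

definition del :: "nat \<Rightarrow> 'a list \<Rightarrow> 'a list" where
  "del j xs = take j xs @ drop (Suc j) xs"

lemma length_del: "j < length xs \<Longrightarrow> length (del j xs) = length xs - 1"
  unfolding del_def by auto

lemma nth_del: "j < length xs \<Longrightarrow> x \<noteq> j \<Longrightarrow> x < length xs \<Longrightarrow>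
    del j xs ! (if x < j then x else x - 1) = xs ! x"
  unfolding del_def by (auto simp: nth_append)

text \<open>Gluing a word \<open>\<tau>\<close> of length \<open>m + 1\<close> along the faces opposite to the vertices outside \<open>I\<close>;
  the nondegenerate simplices that get added are the subwords of \<open>\<tau>\<close> indexed by sets \<open>A\<close>
  containing these vertices.\<close>

lemma attach_faces:
  assumes S: "sset S" and l: "length \<tau> = Suc m"
    and R: "R = {\<theta>\<in>simplex m. \<not> {..m} \<subseteq> I \<union> set \<theta>}"
    and d: "\<And>j. j \<le> m \<Longrightarrow> j \<notin> I \<Longrightarrow> 0 < m \<Longrightarrow> del j \<tau> \<in> S"
    and nd: "\<And>A. {..m} - I \<subseteq> A \<Longrightarrow> A \<subseteq> {..m} \<Longrightarrow> A \<noteq> {} \<Longrightarrow>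
       distinct_adj (\<tau> \<odot> sorted_list_of_set A) \<and> \<tau> \<odot> sorted_list_of_set A \<notin> S"
    and inj: "\<And>A B. {..m} - I \<subseteq> A \<Longrightarrow> A \<subseteq> {..m} \<Longrightarrow> {..m} - I \<subseteq> B \<Longrightarrow> B \<subseteq> {..m} \<Longrightarrow>
       \<tau> \<odot> sorted_list_of_set A = \<tau> \<odot> sorted_list_of_set B \<Longrightarrow> A = B"
    and T: "T = S \<union> {w. w \<noteq> [] \<and> (\<exists>A. A \<noteq> {} \<and> {..m} - I \<subseteq> A \<and> A \<subseteq> {..m} \<and> remdups_adj w = \<tau> \<odot> sorted_list_of_set A)}"
  shows "attach \<tau> m R S T"
proof -
  have core: "\<theta> \<noteq> [] \<and> {..m} - I \<subseteq> set \<theta> \<and> set \<theta> \<subseteq> {..m} \<and> set \<theta> \<noteq> {} \<and> remdups_adj \<theta> = sorted_list_of_set (set \<theta>) \<and>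
      remdups_adj (\<tau> \<odot> \<theta>) = \<tau> \<odot> sorted_list_of_set (set \<theta>)"
    if t: "\<theta> \<in> simplex m" "\<theta> \<notin> R" for \<theta>
  proof -
    have "sorted \<theta>" using t unfolding simplex_iff by blast
    then have c: "remdups_adj \<theta> = sorted_list_of_set (set \<theta>)" by (rule remdups_adj_sorted)
    have s: "{..m} - I \<subseteq> set \<theta>" "set \<theta> \<subseteq> {..m}" "set \<theta> \<noteq> {}" using t unfolding R simplex_iff by auto
    have "remdups_adj (\<tau> \<odot> \<theta>) = \<tau> \<odot> sorted_list_of_set (set \<theta>)"
      using remdups_adj_map[of "\<lambda>j. \<tau> ! j" \<theta>] c distinct_adj_conv_length_remdups_adj nd[OF s]
        remdups_adj_length_ge1 by (metis distinct_adj_altdef)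
    then show ?thesis using c s by auto
  qed
  have inS: "\<tau> \<odot> \<theta> \<in> S" if t: "\<theta> \<in> R" for \<theta>
  proof -
    obtain j where j: "j \<le> m" "j \<notin> I" "j \<notin> set \<theta>" using t unfolding R by blast
    have t': "\<theta> \<in> simplex m" using t R by blast
    have m: "0 < m" using j t' unfolding simplex_iff by (cases m; cases \<theta>) auto
    \<comment> \<open>Since \<theta> avoids \<open>j\<close>, it factors through the face opposite
      to \<open>j\<close>; \<open>f\<close> renumbers the remaining vertices.\<close>
    define f where "f x = (if x < j then x else x - 1)" for x
    have "map f \<theta> \<in> simplex (dm (del j \<tau>))"
      using t' j l m unfolding simplex_iff length_del[of j \<tau>, unfolded l, OF le_imp_less_Suc[OF j(1)]] f_def
      by (fastforce simp: sorted_map sorted_wrt_map intro: sorted_wrt_mono_rel[of _ "(\<le>)"])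
    from ssetD[OF S d[OF j(1,2) m] this] have "del j \<tau> \<odot> map f \<theta> \<in> S" .
    moreover have "del j \<tau> \<odot> map f \<theta> = \<tau> \<odot> \<theta>"
    proof (simp, intro ballI)
      fix x assume x: "x \<in> set \<theta>"
      then have "x \<noteq> j" "x \<le> m" using j t' unfolding simplex_iff by auto
      then show "del j \<tau> ! f x = \<tau> ! x" using nth_del[of j \<tau> x] j l unfolding f_def by simp
    qed
    ultimately show ?thesis by (simp only:)
  qed
  have outS: "\<tau> \<odot> \<theta> \<notin> S" if "\<theta> \<in> simplex m" "\<theta> \<notin> R" for \<theta>
    using core[OF that] nd sset_remdups_adj[OF S, of "\<tau> \<odot> \<theta>"] by auto
  have "T = S \<union> (\<lambda>\<theta>. \<tau> \<odot> \<theta>) ` simplex m"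
  proof (intro equalityI subsetI)
    fix w assume "w \<in> T"
    then consider "w \<in> S" | A where "w \<noteq> []" "A \<noteq> {}" "A \<subseteq> {..m}" "remdups_adj w = \<tau> \<odot> sorted_list_of_set A"
      unfolding T by blast
    then show "w \<in> S \<union> (\<lambda>\<theta>. \<tau> \<odot> \<theta>) ` simplex m"
    proof cases
      case 2
      obtain \<theta> where t: "\<theta> \<in> simplex (dm (remdups_adj w))" "w = remdups_adj w \<odot> \<theta>"
        using remdups_adj_degeneracy[OF 2(1)] by blast
      have fin: "finite A" using 2(3) finite_subset by blast
      have A: "sorted_list_of_set A \<in> simplex m" using 2(2,3) fin unfolding simplex_iff by auto
      have "\<theta> \<in> simplex (dm (sorted_list_of_set A))" using t(1) 2(4) by simp
      moreover have "sorted_list_of_set A \<noteq> []" using A simplex_iff by blast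
      ultimately have "w = \<tau> \<odot> (sorted_list_of_set A \<odot> \<theta>)" "sorted_list_of_set A \<odot> \<theta> \<in> simplex m"
        using sub_sub t(2) 2(4) sub_simplex[OF A] by metis+
      then show ?thesis by blast
    qed simp
  next
    fix w assume "w \<in> S \<union> (\<lambda>\<theta>. \<tau> \<odot> \<theta>) ` simplex m"
    then consider "w \<in> S" | \<theta> where "\<theta> \<in> simplex m" "w = \<tau> \<odot> \<theta>" by blast
    then show "w \<in> T"
    proof cases
      case 2
      then show ?thesis using inS core[OF 2(1)] unfolding T by (cases "\<theta> \<in> R") auto
    qed (simp add: T)
  qed
  moreover have "inj_on (\<lambda>\<theta>. \<tau> \<odot> \<theta>) (simplex m - R)"
  proof (rule inj_onI)
    fix \<theta> \<theta>' assume "\<theta> \<in> simplex m - R" "\<theta>' \<in> simplex m - R" and e: "\<tau> \<odot> \<theta> = \<tau> \<odot> \<theta>'"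
    then have c: "\<theta> \<in> simplex m" "\<theta> \<notin> R" "\<theta>' \<in> simplex m" "\<theta>' \<notin> R" by auto
    note c1 = core[OF c(1,2)] and c2 = core[OF c(3,4)]
    have "set \<theta> = set \<theta>'" using inj[of "set \<theta>" "set \<theta>'"] c1 c2 e by metis
    then show "\<theta> = \<theta>'" using remdups_adj_map_inj[OF e] c1 c2 nd[of "set \<theta>"] by auto
  qed
  ultimately show ?thesis unfolding attach_def using S l inS outS R by auto
qed

text \<open>The case of empty \<open>I\<close> in \<open>attach_faces\<close>: \<tau> is the only
  new nondegenerate simplex.\<close>

lemma attach_bdry:
  assumes S: "sset S" and l: "length \<tau> = Suc m" and nd: "distinct_adj \<tau>" "\<tau> \<notin> S"
    and d: "\<And>j. j \<le> m \<Longrightarrow> 0 < m \<Longrightarrow> del j \<tau> \<in> S"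
    and T: "T = S \<union> {w. remdups_adj w = \<tau>}"
  shows "attach \<tau> m (bdry m) S T"
proof -
  have f: "\<tau> \<odot> sorted_list_of_set {..m} = \<tau>"
  proof -
    have "\<tau> \<noteq> []" "sorted_list_of_set {..m} = [0..<Suc (dm \<tau>)]"
      using l by (auto simp: lessThan_Suc_atMost[symmetric] atLeast0LessThan[symmetric] simp del: upt_Suc)
    then show ?thesis using sub_id by metis
  qed
  have A: "A = {..m}" if "{..m} - {} \<subseteq> A" "A \<subseteq> {..m}" for A :: "nat set" using that by auto
  show ?thesis
  proof (rule attach_faces[OF S l, of _ "{}"])
    show "bdry m = {\<theta> \<in> simplex m. \<not> {..m} \<subseteq> {} \<union> set \<theta>}" unfolding bdry_def by simp
    show "distinct_adj (\<tau> \<odot> sorted_list_of_set A) \<and> \<tau> \<odot> sorted_list_of_set A \<notin> S"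
      if "{..m} - {} \<subseteq> A" "A \<subseteq> {..m}" for A
      using A[OF that] f nd by simp
    show "T = S \<union> {w. w \<noteq> [] \<and> (\<exists>A. A \<noteq> {} \<and> {..m} - {} \<subseteq> A \<and> A \<subseteq> {..m} \<and>
        remdups_adj w = \<tau> \<odot> sorted_list_of_set A)}" (is "_ = S \<union> ?W")
    proof -
      have "w \<in> ?W \<longleftrightarrow> remdups_adj w = \<tau>" for w
      proof
        show "w \<in> ?W \<Longrightarrow> remdups_adj w = \<tau>" using A f by auto
        show "w \<in> ?W" if "remdups_adj w = \<tau>" using that f l by (auto intro!: exI[of _ "{..m}"])
      qed
      then show ?thesis unfolding T by blast
    qed
  qed (use d A in auto)
qed

text \<open>The case \<open>I = {i}\<close> in \<open>attach_faces\<close>: the new nondegenerate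
  simplices are the filler \<tau> and its face opposite to \<open>i\<close>.\<close>

lemma attach_horn:
  assumes S: "sset S" and l: "length \<tau> = Suc m" and nd: "distinct_adj \<tau>" "\<tau> \<notin> S"
    and i: "i \<le> m" "0 < m" and nd': "distinct_adj (del i \<tau>)" "del i \<tau> \<notin> S"
    and d: "\<And>j. j \<le> m \<Longrightarrow> j \<noteq> i \<Longrightarrow> del j \<tau> \<in> S"
    and T: "T = S \<union> {w. remdups_adj w = \<tau> \<or> remdups_adj w = del i \<tau>}"
  shows "attach \<tau> m (horn m i) S T"
proof -
  have f: "\<tau> \<odot> sorted_list_of_set {..m} = \<tau>"
  proof -
    have "\<tau> \<noteq> []" "sorted_list_of_set {..m} = [0..<Suc (dm \<tau>)]"
      using l by (auto simp: lessThan_Suc_atMost[symmetric] atLeast0LessThan[symmetric] simp del: upt_Suc)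
    then show ?thesis using sub_id by metis
  qed
  have "sorted_list_of_set ({..m} - {i}) = [0..<i] @ [Suc i..<Suc m]"
    by (rule sorted_distinct_set_unique) (use i in \<open>auto simp: sorted_append\<close>)
  then have f': "\<tau> \<odot> sorted_list_of_set ({..m} - {i}) = del i \<tau>"
    using i l unfolding del_def
    by (auto intro!: nth_equalityI simp: nth_append simp del: upt_Suc)
  have A: "A = {..m} \<or> A = {..m} - {i}" if "{..m} - {i} \<subseteq> A" "A \<subseteq> {..m}" for A :: "nat set" using that by auto
  have ne: "\<tau> \<noteq> del i \<tau>" using length_del[of i \<tau>] l i by auto
  have ne': "{..m} - {i} \<noteq> {}" using i by (metis Diff_eq_empty_iff atMost_iff empty_iff insert_iff le0 order_refl subsetD not_gr_zero)
  show ?thesis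
  proof (rule attach_faces[OF S l, of _ "{i}"])
    show "horn m i = {\<theta> \<in> simplex m. \<not> {..m} \<subseteq> {i} \<union> set \<theta>}" unfolding horn_def by simp
    show "distinct_adj (\<tau> \<odot> sorted_list_of_set A) \<and> \<tau> \<odot> sorted_list_of_set A \<notin> S"
      if "{..m} - {i} \<subseteq> A" "A \<subseteq> {..m}" for A
      using A[OF that] f f' nd nd' by auto
    show "A = B" if "{..m} - {i} \<subseteq> A" "A \<subseteq> {..m}" "{..m} - {i} \<subseteq> B" "B \<subseteq> {..m}"
      "\<tau> \<odot> sorted_list_of_set A = \<tau> \<odot> sorted_list_of_set B" for A B
      using A[OF that(1,2)] A[OF that(3,4)] that(5) f f' ne by metis
    show "T = S \<union> {w. w \<noteq> [] \<and> (\<exists>A. A \<noteq> {} \<and> {..m} - {i} \<subseteq> A \<and> A \<subseteq> {..m} \<and>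
        remdups_adj w = \<tau> \<odot> sorted_list_of_set A)}" (is "_ = S \<union> ?W")
    proof -
      have "w \<in> ?W \<longleftrightarrow> remdups_adj w = \<tau> \<or> remdups_adj w = del i \<tau>" for w
      proof
        assume "w \<in> ?W"
        then obtain B where "{..m} - {i} \<subseteq> B" "B \<subseteq> {..m}" "remdups_adj w = \<tau> \<odot> sorted_list_of_set B" by blast
        then show "remdups_adj w = \<tau> \<or> remdups_adj w = del i \<tau>" using A[of B] f f' by metis
      next
        assume r: "remdups_adj w = \<tau> \<or> remdups_adj w = del i \<tau>"
        have "w \<noteq> []" using r l length_del[of i \<tau>] i by auto
        have "\<exists>A. A \<noteq> {} \<and> {..m} - {i} \<subseteq> A \<and> A \<subseteq> {..m} \<and> remdups_adj w = \<tau> \<odot> sorted_list_of_set A"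
          using r
        proof
          assume "remdups_adj w = \<tau>"
          then show ?thesis using f by (intro exI[of _ "{..m}"]) auto
        next
          assume "remdups_adj w = del i \<tau>"
          then show ?thesis using f' ne' by (intro exI[of _ "{..m} - {i}"] conjI) (simp, blast, blast, simp only:)
        qed
        then show "w \<in> ?W" using \<open>w \<noteq> []\<close> by blast
      qed
      then show ?thesis unfolding T by blast
    qed
  qed (use d in auto)
qed

lemma del_sub:
  assumes "j < length xs" "1 < length xs"
  shows "[0..<j] @ [Suc j..<length xs] \<in> simplex (dm xs)" "del j xs = xs \<odot> ([0..<j] @ [Suc j..<length xs])"
proof -
  show "[0..<j] @ [Suc j..<length xs] \<in> simplex (dm xs)"
    using assms unfolding simplex_iff by (auto simp: sorted_append)
  show "del j xs = xs \<odot> ([0..<j] @ [Suc j..<length xs])"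
    using assms unfolding del_def by (auto intro!: nth_equalityI simp: nth_append)
qed

lemma sset_del: "sset S \<Longrightarrow> xs \<in> S \<Longrightarrow> j < length xs \<Longrightarrow> 1 < length xs \<Longrightarrow> del j xs \<in> S"
  using ssetD[of S xs "[0..<j] @ [Suc j..<length xs]"] del_sub[of j xs] by simp

lemma set_del_distinct: "distinct xs \<Longrightarrow> j < length xs \<Longrightarrow> xs ! j \<notin> set (del j xs)"
  unfolding del_def using id_take_nth_drop[of j xs] by (metis distinct_append not_distinct_conv_prefix disjoint_iff distinct.simps(2) list.set_intros(1) set_append UnE)

section \<open>Induction on cells and existence of mapping objects\<close>

text \<open>Read backwards: from a subcomplex of a standard simplex one can remove a simplex of
  maximal dimension among those outside \<open>S\<close>. The induction counts supports, since words
  themselves are infinitely many.\<close>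

lemma cell_induct [consumes 4, case_names base step]:
  assumes S: "sset S" and T: "sset T" and ST: "S \<subseteq> T" and N: "T \<subseteq> simplex N"
    and base: "P S"
    and step: "\<And>S' T' \<sigma> m. attach \<sigma> m (bdry m) S' T' \<Longrightarrow> S \<subseteq> S' \<Longrightarrow> T' \<subseteq> T \<Longrightarrow> \<sigma> \<in> T \<Longrightarrow> \<sigma> \<notin> S \<Longrightarrow>
      sorted \<sigma> \<Longrightarrow> distinct \<sigma> \<Longrightarrow> length \<sigma> = Suc m \<Longrightarrow> P S' \<Longrightarrow> P T'"
  shows "P T"
proof -
  have "P T'" if "sset T'" "S \<subseteq> T'" "T' \<subseteq> T" for T'
    using that
  proof (induction "card (set ` (T' - S))" arbitrary: T' rule: less_induct)
    case less
    note T' = less.prems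
    have TN: "T' \<subseteq> simplex N" using T' N by blast
    have fin: "finite (set ` (T' - S))"
      by (rule finite_subset[of _ "Pow {..N}"]) (use TN in \<open>auto simp: simplex_iff\<close>)
    show ?case
    proof (cases "T' = S")
      case True then show ?thesis using base by simp
    next
      case False
      then have ne: "T' - S \<noteq> {}" using T' by blast
      define c where "c = Max (card ` set ` (T' - S))"
      have "c \<in> card ` set ` (T' - S)" unfolding c_def using fin ne by (intro Max_in) auto
      then obtain \<sigma>0 where s0: "\<sigma>0 \<in> T'" "\<sigma>0 \<notin> S" "card (set \<sigma>0) = c" by auto
      have mx: "card (set w) \<le> c" if "w \<in> T'" "w \<notin> S" for w
        unfolding c_def by (rule Max_ge) (use fin that in simp_all)
      define \<sigma> where "\<sigma> = sorted_list_of_set (set \<sigma>0)"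
      have core: "remdups_adj w = sorted_list_of_set (set w)" if "w \<in> T'" for w
      proof (rule remdups_adj_sorted)
        have "w \<in> simplex N" using that TN by blast
        then show "sorted w" unfolding simplex_iff by simp
      qed
      have ne0: "\<sigma>0 \<noteq> []" using sset_ne[OF T'(1) s0(1)] .
      have sT: "\<sigma> \<in> T'" "\<sigma> \<notin> S"
        using sset_remdups_adj[OF T'(1) ne0] sset_remdups_adj[OF S ne0] core[OF s0(1)] s0 unfolding \<sigma>_def by auto
      have ssd: "sorted \<sigma>" "distinct \<sigma>" "set \<sigma> = set \<sigma>0" unfolding \<sigma>_def by auto
      have sne: "\<sigma> \<noteq> []" using ne0 unfolding \<sigma>_def by simp
      define m where "m = dm \<sigma>"
      have l: "length \<sigma> = Suc m" using sne unfolding m_def by (cases \<sigma>) auto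
      \<comment> \<open>All words with the support of \<sigma> are removed, degenerate ones
        included. By maximality of \<open>c\<close> no remaining word has one of them as a face, so
        \<open>T1\<close> is a subcomplex.\<close>
      define T1 where "T1 = {w\<in>T'. set w \<noteq> set \<sigma>}"
      have nS: "set w \<noteq> set \<sigma>" if "w \<in> S" for w
        using sset_remdups_adj[OF S sset_ne[OF S that]] core[of w] that T' sT ssd unfolding \<sigma>_def by auto
      have T1: "sset T1" unfolding sset_def
      proof (intro ballI conjI)
        fix w assume w: "w \<in> T1"
        then have w': "w \<in> T'" unfolding T1_def by blast
        then show wn: "w \<noteq> []" using sset_ne[OF T'(1)] by blast
        fix \<theta> assume t: "\<theta> \<in> simplex (dm w)"
        have wt: "w \<odot> \<theta> \<in> T'" using ssetD[OF T'(1) w' t] .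
        moreover have "set (w \<odot> \<theta>) \<noteq> set \<sigma>"
        proof
          assume e: "set (w \<odot> \<theta>) = set \<sigma>"
          then have sub: "set \<sigma> \<subseteq> set w" using sub_set[OF t wn] by simp
          have "w \<notin> S" using nS[of "w \<odot> \<theta>"] ssetD[OF S _ t] e by blast
          then have "card (set w) \<le> card (set \<sigma>)" using mx[OF w'] ssd s0 by simp
          then have "set w = set \<sigma>" using card_seteq[OF finite_set sub] by simp
          then show False using w unfolding T1_def by blast
        qed
        ultimately show "w \<odot> \<theta> \<in> T1" unfolding T1_def by blast
      qed
      have ST1: "S \<subseteq> T1" using nS T' unfolding T1_def by blast
      have at: "attach \<sigma> m (bdry m) T1 T'"
      proof (rule attach_bdry[OF T1 l])
        show "distinct_adj \<sigma>" using ssd(2) by (simp add: distinct_adj_altdef remdups_adj_distinct)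
        show "\<sigma> \<notin> T1" unfolding T1_def by simp
        show "del j \<sigma> \<in> T1" if "j \<le> m" "0 < m" for j
          using sset_del[OF T'(1) sT(1), of j] set_del_distinct[OF ssd(2), of j] l that
          unfolding T1_def by (metis (mono_tags, lifting) One_nat_def Suc_less_eq le_imp_less_Suc mem_Collect_eq nth_mem)
        show "T' = T1 \<union> {w. remdups_adj w = \<sigma>}"
        proof (intro equalityI subsetI)
          fix w assume "w \<in> T'"
          then show "w \<in> T1 \<union> {w. remdups_adj w = \<sigma>}" using core[of w] ssd unfolding T1_def \<sigma>_def by auto
        next
          fix w assume "w \<in> T1 \<union> {w. remdups_adj w = \<sigma>}"
          then consider "w \<in> T'" | "remdups_adj w = \<sigma>" unfolding T1_def by blast
          then show "w \<in> T'"
          proof cases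
            case 2
            then have "w \<noteq> []" using sne by auto
            then show ?thesis using sset_remdups_adj[OF T'(1)] 2 sT by metis
          qed
        qed
      qed
      have "set ` (T1 - S) \<subseteq> set ` (T' - S)" unfolding T1_def by blast
      moreover have "set \<sigma> \<in> set ` (T' - S)" "set \<sigma> \<notin> set ` (T1 - S)" using sT unfolding T1_def by auto
      ultimately have "set ` (T1 - S) \<subset> set ` (T' - S)" by blast
      then have "card (set ` (T1 - S)) < card (set ` (T' - S))" by (rule psubset_card_mono[OF fin])
      moreover have "T1 \<subseteq> T" "\<sigma> \<in> T" using T'(3) sT(1) unfolding T1_def by blast+
      ultimately have "P T1" using less.hyps[OF _ T1 ST1] by blast
      then show ?thesis by (rule step[OF at ST1 T'(3) \<open>\<sigma> \<in> T\<close> sT(2) ssd(1,2) l])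
    qed
  qed
  then show ?thesis using T ST by blast
qed

context cat_ctx
begin

lemma limit_reps:
  assumes S: "sset S" and l: "is_limit C (map_diag X Xm S) L p"
  shows "reps (ConP X Xm S) L (restrict p S)"
  unfolding reps_def
proof (intro conjI allI impI)
  have c: "is_cone C (map_diag X Xm S) L p" using l unfolding is_limit_def by blast
  then show "restrict p S \<in> El (ConP X Xm S) L"
    unfolding is_cone_map_diag using ssetD[OF S] by (intro ConPI) auto
  fix W e assume e: "e \<in> El (ConP X Xm S) W"
  then have "is_cone C (map_diag X Xm S) W e" unfolding ConP_def by simp
  then have "\<exists>!u. u \<in> hom W L \<and> (\<forall>v\<in>S. p v \<cdot> u = e v)"
    using l unfolding is_limit_def map_diag_def by simp
  moreover have "(\<forall>v\<in>S. p v \<cdot> u = e v) \<longleftrightarrow> ac (ConP X Xm S) (restrict p S) u = e" for u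
    unfolding ConP_ac using ConP_ext[OF e] by (auto simp: fun_eq_iff restrict_def extensional_def)
  ultimately show "\<exists>!v. v \<in> hom W L \<and> ac (ConP X Xm S) (restrict p S) v = e" by simp
qed

lemma reps_limit:
  assumes S: "sset S" and r: "reps (ConP X Xm S) L \<xi>"
  shows "is_limit C (map_diag X Xm S) L \<xi>"
  unfolding is_limit_def
proof (intro conjI allI impI)
  show "is_cone C (map_diag X Xm S) L \<xi>" using r unfolding reps_def ConP_def by simp
  fix W e assume e: "is_cone C (map_diag X Xm S) W e"
  then have "restrict e S \<in> El (ConP X Xm S) W"
    unfolding is_cone_map_diag using ssetD[OF S] by (intro ConPI) auto
  then have "\<exists>!v. v \<in> hom W L \<and> ac (ConP X Xm S) \<xi> v = restrict e S" using r unfolding reps_def by blast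
  moreover have "(\<forall>v\<in>S. \<xi> v \<cdot> u = e v) \<longleftrightarrow> ac (ConP X Xm S) \<xi> u = restrict e S" for u
    unfolding ConP_ac by (auto simp: fun_eq_iff restrict_def)
  ultimately show "\<exists>!u. u \<in> hom W L \<and> (\<forall>v\<in>DV (map_diag X Xm S). \<xi> v \<cdot> u = e v)"
    unfolding map_diag_def by simp
qed

text \<open>A section of \<open>P\<close> determines the arrow to \<open>L\<close> that classifies
  its image, so the fibre of \<phi> over the universal element is all of \<open>P\<close>, and the
  object representing this fibre represents \<open>P\<close>.\<close>

lemma reps_of_cov:
  assumes P: "psh P" and Q: "psh Q" and n: "ntr P Q \<phi>" and c: "cov M P Q \<phi>" and r: "reps Q L \<xi>"
  shows "\<exists>V a. reps P V a"
proof -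
  have x: "\<xi> \<in> El Q L" using r unfolding reps_def by blast
  obtain V g a where 1: "g \<in> M" "g \<in> hom V L" "a \<in> El P V" "\<phi> a = ac Q \<xi> g"
    "\<And>W h e. h \<in> hom W L \<Longrightarrow> e \<in> El P W \<Longrightarrow> \<phi> e = ac Q \<xi> h \<Longrightarrow>
         (\<exists>!u. u \<in> hom W V \<and> g \<cdot> u = h \<and> ac P a u = e)"
    by (rule covE[OF c x], rule that) (assumption | simp)+
  have "reps P V a" unfolding reps_def
  proof (intro conjI allI impI)
    fix W e assume e: "e \<in> El P W"
    obtain h where h: "h \<in> hom W L" "ac Q \<xi> h = \<phi> e"
      and hu: "\<And>h'. h' \<in> hom W L \<Longrightarrow> ac Q \<xi> h' = \<phi> e \<Longrightarrow> h' = h"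
      using r ntr_el[OF n e] unfolding reps_def by metis
    obtain u where u: "u \<in> hom W V" "g \<cdot> u = h" "ac P a u = e"
      and uu: "\<And>u'. u' \<in> hom W V \<Longrightarrow> g \<cdot> u' = h \<Longrightarrow> ac P a u' = e \<Longrightarrow> u' = u"
      using 1(5)[OF h(1) e h(2)[symmetric]] by metis
    show "\<exists>!u. u \<in> hom W V \<and> ac P a u = e"
    proof (rule ex1I[of _ u])
      fix v assume v: "v \<in> hom W V \<and> ac P a v = e"
      then have v1: "v \<in> hom W V" by simp
      have "ac Q \<xi> (g \<cdot> v) = \<phi> e"
        using psh_cmp[OF Q x 1(2) v1] 1(4) ntr_ac[OF n 1(3) v1] v by simp
      then have "g \<cdot> v = h" using hu cmp_hom[OF 1(2) v1] by blast
      then show "v = u" using uu v by blast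
    qed (use u in simp)
  qed (fact 1(3))
  then show ?thesis by blast
qed

text \<open>For this class \<open>cov\<close> says just that the morphism of presheaves is
  representable.\<close>

lemma mor_class_Ar: "mor_class (Ar C)"
  unfolding mor_class_def
proof (intro conjI allI impI; (elim conjE)?)
  show "f \<in> Ar C" if "iso C f" for f using that unfolding iso_def by blast
  show "g \<cdot> f \<in> Ar C" if "f \<in> hom a b" "g \<in> hom b c" for f g a b c
    using ar_hom[OF cmp_hom[OF that(2,1)]] by blast
  show "pullback_stable C (Ar C)" unfolding pullback_stable_def is_pullback_def homs_def by simp
qed simp

end

context fl_ctx
begin

lemma ConP_empty_reps: "\<exists>L \<xi>. reps (ConP X Xm {}) L \<xi>"
proof -
  obtain L where L: "L \<in> Ob C" "\<And>U. U \<in> Ob C \<Longrightarrow> \<exists>!u. u \<in> hom U L"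
    by (rule terminal_ex, rule that) (assumption | simp)+
  have e: "x \<in> El (ConP X Xm {}) U \<longleftrightarrow> U \<in> Ob C \<and> x = (\<lambda>_. undefined)" for x U
    unfolding ConP_def is_cone_map_diag by auto
  have "reps (ConP X Xm {}) L (\<lambda>_. undefined)"
    unfolding reps_def e using L by (auto simp: ConP_ac restrict_def)
  then show ?thesis by blast
qed

lemma ConP_reps_attach:
  assumes so: "simplicial_object C X Xm" and at: "attach \<tau> m R S T"
    and R: "\<exists>L \<xi>. reps (ConP X Xm R) L \<xi>" and S: "\<exists>L \<xi>. reps (ConP X Xm S) L \<xi>"
  shows "\<exists>L \<xi>. reps (ConP X Xm T) L \<xi>"
proof -
  note af = attach_facts[OF at]
  obtain L \<xi> where r: "reps (ConP X Xm R) L \<xi>" using R by blast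
  note pR = psh_ConP[OF so af(8)]
  have i: "Idm C (X m) \<in> hom (X m) (X m)" using so_ob[OF so] by blast
  have "faces Xm m R (Idm C (X m)) \<in> El (ConP X Xm R) (X m)"
    using faces_ConP[OF so af(7,8) i] .
  then obtain u where u: "u \<in> hom (X m) L" "ac (ConP X Xm R) \<xi> u = faces Xm m R (Idm C (X m))"
    using r unfolding reps_def by blast
  have "u \<in> Ar C" using u by (simp add: homs_def)
  then have "cov (Ar C) (HomP (X m)) (ConP X Xm R) (faces Xm m R)"
    using arrow_reps_cov[OF mor_class_Ar pR ntr_faces[OF so af(7,8)] r u(1)] u(2) by simp
  from attach_cov[OF so at this]
  have c: "cov (Ar C) (ConP X Xm T) (ConP X Xm S) (\<lambda>c. restrict c S)" .
  obtain L' \<xi>' where "reps (ConP X Xm S) L' \<xi>'" using S by blast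
  then show ?thesis
    using reps_of_cov[OF psh_ConP[OF so af(2)] psh_ConP[OF so af(1)] ntr_restrict[OF af(3,1)] c] by blast
qed

text \<open>The limit is assembled by pullbacks, one cell at a time, from the terminal object.
  Attaching an \<open>m\<close>-cell requires the mapping object of the boundary of the
  \<open>m\<close>-simplex, whence the induction on \<open>N\<close>.\<close>

lemma ConP_reps:
  assumes so: "simplicial_object C X Xm"
  shows "sset T \<Longrightarrow> T \<subseteq> simplex N \<Longrightarrow> \<exists>L \<xi>. reps (ConP X Xm T) L \<xi>"
proof (induction N arbitrary: T rule: less_induct)
  case (less N)
  have bd: "bdry m \<subseteq> simplex m" for m unfolding bdry_def by blast
  have m_le: "m \<le> N \<and> (m = N \<longrightarrow> \<sigma> = [0..<Suc N])"
    if "\<sigma> \<in> simplex N" "sorted \<sigma>" "distinct \<sigma>" "length \<sigma> = Suc m" for \<sigma> m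
  proof -
    have sub: "set \<sigma> \<subseteq> {..N}" using that unfolding simplex_iff by auto
    have c: "card (set \<sigma>) = Suc m" using that distinct_card by metis
    have "m \<le> N" using card_mono[OF _ sub] c by simp
    moreover have "\<sigma> = [0..<Suc N]" if "m = N"
    proof (rule sorted_distinct_set_unique)
      have "set \<sigma> = {..N}" by (rule card_seteq[OF finite_atMost sub]) (use c that in simp)
      then show "set \<sigma> = set [0..<Suc N]" by (simp only: set_upt atLeast0LessThan lessThan_Suc_atMost)
    qed (use \<open>sorted \<sigma>\<close> \<open>distinct \<sigma>\<close> in \<open>simp_all only: sorted_upt distinct_upt\<close>)
    ultimately show ?thesis by blast
  qed
  \<comment> \<open>Without the top simplex only cells of dimension below \<open>N\<close> occur,
    and the induction hypothesis covers their boundaries. This settles the boundary of the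
    \<open>N\<close>-simplex, which is what attaching the top cell requires.\<close>
  have 1: "\<exists>L \<xi>. reps (ConP X Xm T) L \<xi>" if T: "sset T" "T \<subseteq> simplex N" "[0..<Suc N] \<notin> T" for T
    using sset_empty T(1) empty_subsetI T(2)
  proof (induction rule: cell_induct)
    case base
    then show ?case by (rule ConP_empty_reps)
  next
    case (step S' T' \<sigma> m)
    have "m < N" using m_le[of \<sigma> m] step T by (metis le_neq_implies_less subsetD)
    then show ?case using ConP_reps_attach[OF so step(1) less.IH[OF _ sset_bdry bd] step(9)] by blast
  qed
  have 2: "\<exists>L \<xi>. reps (ConP X Xm (bdry N)) L \<xi>"
    by (rule 1[OF sset_bdry bd]) (auto simp: bdry_def)
  show ?case
    using sset_empty less.prems(1) empty_subsetI less.prems(2)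
  proof (induction rule: cell_induct)
    case base
    then show ?case by (rule ConP_empty_reps)
  next
    case (step S' T' \<sigma> m)
    have "m \<le> N" using m_le[of \<sigma> m] step less.prems by (metis subsetD)
    then have "\<exists>L \<xi>. reps (ConP X Xm (bdry m)) L \<xi>"
      using 2 less.IH[OF _ sset_bdry bd] by (cases "m = N") auto
    then show ?case using ConP_reps_attach[OF so step(1) _ step(9)] by blast
  qed
qed

lemma faces_reps_arrow:
  assumes so: "simplicial_object C X Xm" and S: "sset S" "S \<subseteq> simplex n"
    and u: "u \<in> hom (X n) L" "\<forall>\<sigma>\<in>S. p \<sigma> \<cdot> u = Xm n \<sigma>"
  shows "faces Xm n S (Idm C (X n)) = ac (ConP X Xm S) (restrict p S) u"
  unfolding faces_def ConP_ac
  by (rule restrict_ext) (use u(2) S id_right[OF so_hom[OF so]] in auto)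

text \<open>\<open>restr_prop\<close> quantifies over all limits and becomes usable once
  \<open>ConP_reps\<close> provides one; its statement about an arrow then turns into
  \<open>cov\<close>.\<close>

lemma restr_prop_cov:
  assumes so: "simplicial_object C X Xm" and S: "sset S" "S \<subseteq> simplex n" and M: "mor_class M"
    and r: "restr_prop C (\<lambda>u. u \<in> M) X Xm n S"
  shows "cov M (HomP (X n)) (ConP X Xm S) (faces Xm n S)"
proof -
  obtain L \<xi> where r0: "reps (ConP X Xm S) L \<xi>" using ConP_reps[OF so S] by blast
  have "\<xi> \<in> extensional S" using r0 ConP_ext unfolding reps_def by blast
  then have \<xi>r: "restrict \<xi> S = \<xi>" by (rule extensional_restrict)
  have l: "is_limit C (map_diag X Xm S) L \<xi>" by (rule reps_limit[OF S(1) r0])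
  have i: "Idm C (X n) \<in> hom (X n) (X n)" using so_ob[OF so] by blast
  obtain u where u: "u \<in> hom (X n) L" "ac (ConP X Xm S) \<xi> u = faces Xm n S (Idm C (X n))"
    using r0 faces_ConP[OF so S(2,1) i] unfolding reps_def by blast
  have "\<xi> \<sigma> \<cdot> u = Xm n \<sigma>" if "\<sigma> \<in> S" for \<sigma>
    using fun_cong[OF u(2), of \<sigma>] that S id_right[OF so_hom[OF so, of \<sigma> n]]
    unfolding ConP_ac faces_def by auto
  then have "u \<in> M" using r l u(1) unfolding restr_prop_def by blast
  then show ?thesis
    using arrow_reps_cov[OF M psh_ConP[OF so S(1)] ntr_faces[OF so S(2,1)] r0 u(1)] u(2) by simp
qed

end

subsection \<open>Inner expansions from matchings\<close>

text \<open>The nondegenerate words of \<open>T\<close> outside \<open>S\<close> are paired by inserting an inner letter: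
  \<open>w \<in> I\<close> is the inner face number \<open>ix w\<close> of \<open>up w\<close>. The rank \<open>rk\<close> makes the matching acyclic,
  so that \<open>T\<close> arises from \<open>S\<close> by attaching the \<open>up w\<close> along inner horns, ordered
  lexicographically by \<open>length w\<close> and \<open>rk w\<close>.\<close>

locale matching =
  fixes n :: nat and S T I :: "nat list set" and up :: "nat list \<Rightarrow> nat list"
    and ix rk :: "nat list \<Rightarrow> nat"
  assumes S: "sset S" and T: "sset T" and ST: "S \<subseteq> T" and Tn: "T \<subseteq> thick n"
    and I: "\<And>w. w \<in> I \<Longrightarrow> w \<in> T \<and> w \<notin> S \<and> distinct_adj w"
    and up: "\<And>w. w \<in> I \<Longrightarrow> up w \<in> T \<and> up w \<notin> S \<and> up w \<notin> I \<and> distinct_adj (up w)"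
    and ix: "\<And>w. w \<in> I \<Longrightarrow> 0 < ix w \<and> Suc (ix w) < length (up w) \<and> del (ix w) (up w) = w"
    and inj: "inj_on up I"
    and covers: "\<And>w. w \<in> T \<Longrightarrow> w \<notin> S \<Longrightarrow> distinct_adj w \<Longrightarrow> w \<in> I \<union> up ` I"
    and rank: "\<And>w j. w \<in> I \<Longrightarrow> j < length (up w) \<Longrightarrow> j \<noteq> ix w \<Longrightarrow> del j (up w) \<in> I \<Longrightarrow>
      rk (del j (up w)) < rk w"
begin

text \<open>The words added with the pairs indexed by \<open>A\<close>, recognised by their cores.
  That this is a subcomplex is proved along with the attachments.\<close>

definition cells :: "nat list set \<Rightarrow> nat list set" where
  "cells A = S \<union> {w. remdups_adj w \<in> A \<union> up ` A}"

lemma length_up: "w \<in> I \<Longrightarrow> length (up w) = Suc (length w)"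
  using ix[of w] length_del[of "ix w" "up w"] by auto

lemma cells_empty: "cells {} = S"
  unfolding cells_def by simp

lemma cells_mono: "A \<subseteq> B \<Longrightarrow> cells A \<subseteq> cells B"
  unfolding cells_def by blast

lemma cells_T: "A \<subseteq> I \<Longrightarrow> cells A \<subseteq> T"
proof
  fix w assume A: "A \<subseteq> I" and w: "w \<in> cells A"
  show "w \<in> T"
  proof (cases "w \<in> S")
    case False
    then have "remdups_adj w \<in> A \<union> up ` A" using w unfolding cells_def by simp
    then have r: "remdups_adj w \<in> T"
    proof
      assume "remdups_adj w \<in> A" then show ?thesis using A I by blast
    next
      assume "remdups_adj w \<in> up ` A"
      then obtain v where "v \<in> A" "remdups_adj w = up v" by (rule imageE)
      then show ?thesis using up[of v] A by auto
    qed
    have "remdups_adj w \<noteq> []" using sset_ne[OF T r] .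
    then have "w \<noteq> []" by simp
    from sset_remdups_adj[OF T this] show ?thesis using r by simp
  qed (use ST in blast)
qed

lemma T_cells: "w \<in> T \<Longrightarrow> w \<in> S \<or> remdups_adj w \<in> I \<union> up ` I"
proof -
  assume w: "w \<in> T"
  have "w \<noteq> []" using sset_ne[OF T w] .
  then have "remdups_adj w \<in> T" "remdups_adj w \<in> S \<longleftrightarrow> w \<in> S"
    using sset_remdups_adj[OF T \<open>w \<noteq> []\<close>] sset_remdups_adj[OF S \<open>w \<noteq> []\<close>] w by simp_all
  then show ?thesis using covers[of "remdups_adj w"] by auto
qed

text \<open>The horn along which \<open>up w\<close> is to be attached is already present.\<close>

definition good :: "nat list set \<Rightarrow> nat list \<Rightarrow> bool" where
  "good A w \<longleftrightarrow> (\<forall>j < length (up w). j \<noteq> ix w \<longrightarrow> del j (up w) \<in> cells A)"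

lemma good_mono: "A \<subseteq> B \<Longrightarrow> good A w \<Longrightarrow> good B w"
  unfolding good_def using cells_mono by blast

text \<open>The two new nondegenerate words are \<open>up w\<close> and its missing face
  \<open>w\<close>, so this fills an inner horn of dimension \<open>length w\<close>.\<close>

lemma attach_cells:
  assumes A: "A \<subseteq> I" "sset (cells A)" and w: "w \<in> I" "w \<notin> A" "good A w"
  shows "attach (up w) (length w) (horn (length w) (ix w)) (cells A) (cells (insert w A))"
proof (rule attach_horn[OF A(2) length_up[OF w(1)]])
  have nd: "distinct_adj (up w)" "distinct_adj w" and nS: "up w \<notin> S" "w \<notin> S"
    using I up w by auto
  show "distinct_adj (up w)" by fact
  have d: "del (ix w) (up w) = w" using ix w by blast
  show "distinct_adj (del (ix w) (up w))" using d nd by simp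
  have r: "remdups_adj (up w) = up w" "remdups_adj w = w" using nd distinct_adj_altdef by auto
  have "up w \<notin> up ` A" using inj_on_image_mem_iff[OF inj w(1) A(1)] w(2) by simp
  then have "up w \<notin> A \<union> up ` A" using up[OF w(1)] A by blast
  then show "up w \<notin> cells A" using nS r unfolding cells_def by simp
  have "w \<notin> A \<union> up ` A" using up w A by blast
  then show "del (ix w) (up w) \<notin> cells A" using nS r d unfolding cells_def by simp
  show "ix w \<le> length w" "0 < length w" using ix[OF w(1)] length_up[OF w(1)] by auto
  show "del j (up w) \<in> cells A" if "j \<le> length w" "j \<noteq> ix w" for j
    using w(3) that length_up[OF w(1)] unfolding good_def by simp
  show "cells (insert w A) = cells A \<union> {v. remdups_adj v = up w \<or> remdups_adj v = del (ix w) (up w)}"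
    unfolding d cells_def by blast
qed

text \<open>The face has the length of \<open>w\<close>. Outside \<open>S\<close> its core is a
  shorter lower partner, or the face itself with smaller rank, or an upper partner
  \<open>up v\<close> with \<open>v\<close> shorter than \<open>w\<close>; in each case it has been
  added before.\<close>

lemma face_cells:
  assumes w: "w \<in> I" and j: "j < length (up w)" "j \<noteq> ix w"
    and short: "\<And>v. v \<in> I \<Longrightarrow> length v < length w \<Longrightarrow> v \<in> A"
    and same: "\<And>v. v \<in> I \<Longrightarrow> length v = length w \<Longrightarrow> rk v < rk w \<Longrightarrow> v \<in> A"
  shows "del j (up w) \<in> cells A"
proof (cases "del j (up w) \<in> S")
  case True then show ?thesis unfolding cells_def by blast
next
  case False
  define f where "f = del j (up w)"
  have lf: "length f = length w" unfolding f_def using length_del[OF j(1)] length_up[OF w] by simp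
  have "0 < length w" using ix[OF w] length_up[OF w] by auto
  then have fT: "f \<in> T" unfolding f_def using sset_del[OF T _ j(1)] up[OF w] length_up[OF w] by simp
  from T_cells[OF fT] False have "remdups_adj f \<in> I \<union> up ` I" unfolding f_def by blast
  then consider "remdups_adj f \<in> I" "length (remdups_adj f) < length w" | "remdups_adj f \<in> I" "remdups_adj f = f"
    | v where "v \<in> I" "remdups_adj f = up v"
    using lf remdups_adj_length[of f] distinct_adj_conv_length_remdups_adj[of f] distinct_adj_altdef[of f]
    by (metis UnE imageE le_neq_implies_less)
  then show ?thesis
  proof cases
    case 1
    then show ?thesis using short unfolding cells_def f_def by blast
  next
    case 2
    then have "remdups_adj f \<in> A" using same[of f] lf rank[OF w j] unfolding f_def by simp
    then show ?thesis unfolding cells_def f_def by blast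
  next
    case (3 v)
    then have "length v < length w" using length_up[OF 3(1)] lf remdups_adj_length[of f] by simp
    then have "up v \<in> up ` A" using short[OF 3(1)] by blast
    then show ?thesis using 3 unfolding cells_def f_def by simp
  qed
qed

text \<open>A pair indexed by a word of length \<open>N\<close> fills a horn of dimension
  \<open>N\<close>, so the stages go by dimension.\<close>

definition stage :: "nat \<Rightarrow> nat list set" where
  "stage N = {w\<in>I. length w < N}"

lemma finite_length: "finite {w\<in>I. length w < N}"
proof (rule finite_subset)
  show "{w\<in>I. length w < N} \<subseteq> {w. set w \<subseteq> {..n} \<and> length w \<le> N}"
    using I Tn unfolding thick_def by fastforce
qed (rule finite_lists_length_le, simp)

end

section \<open>Restriction of cones along inner expansions\<close>

context cat_ctx
begin

text \<open>Composition handles only finitely many steps. A cone on the union is a compatible family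
  of cones on the \<open>D N\<close>, and such a family is determined by its member at 0.\<close>

lemma ConP_union_bijn:
  assumes so: "simplicial_object C X Xm" and D: "\<And>N. sset (D N)" "\<And>N. D N \<subseteq> D (Suc N)"
    and T: "sset T" "T = (\<Union>N. D N)"
    and b: "\<And>N. bijn (ConP X Xm (D (Suc N))) (ConP X Xm (D N)) (\<lambda>c. restrict c (D N))"
  shows "bijn (ConP X Xm T) (ConP X Xm (D 0)) (\<lambda>c. restrict c (D 0))"
proof (rule bijnI)
  have DT: "D N \<subseteq> T" for N using T by blast
  have mono: "D N \<subseteq> D M" if "N \<le> M" for N M using lift_Suc_mono_le[of D, OF D(2) that] .
  show "ntr (ConP X Xm T) (ConP X Xm (D 0)) (\<lambda>c. restrict c (D 0))" using ntr_restrict[OF DT D(1)] .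
  fix U
  show "x = y" if x: "x \<in> El (ConP X Xm T) U" and y: "y \<in> El (ConP X Xm T) U"
    and e: "restrict x (D 0) = restrict y (D 0)" for x y
  proof -
    have rr: "restrict (restrict z (D (Suc N))) (D N) = restrict z (D N)" for z :: "nat list \<Rightarrow> 'm" and N
      using D(2)[of N] by (auto simp: restrict_restrict Int_absorb1)
    have "restrict x (D N) = restrict y (D N)" for N
    proof (induction N)
      case (Suc N)
      then show ?case
        using bijn_inj[OF b[of N] restrict_ConP[OF x DT D(1)] restrict_ConP[OF y DT D(1)]] unfolding rr by blast
    qed (rule e)
    then have "x w = y w" if "w \<in> T" for w using that T by (metis UN_E restrict_apply')
    then show ?thesis using ConP_eqI[OF x y] by blast
  qed
  fix c0 assume c0: "c0 \<in> El (ConP X Xm (D 0)) U"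
  have ex: "\<exists>x. x \<in> El (ConP X Xm (D (Suc N))) U \<and> restrict x (D N) = c" if "c \<in> El (ConP X Xm (D N)) U" for N c
    using bijn_ex[OF b that] by blast
  define c where "c = rec_nat c0 (\<lambda>N c. SOME x. x \<in> El (ConP X Xm (D (Suc N))) U \<and> restrict x (D N) = c)"
  have cN: "c N \<in> El (ConP X Xm (D N)) U" for N
  proof (induction N)
    case (Suc N)
    then show ?case unfolding c_def using someI_ex[OF ex[OF Suc]] unfolding c_def by simp
  qed (simp add: c_def c0)
  have cS: "restrict (c (Suc N)) (D N) = c N" for N
    unfolding c_def using someI_ex[OF ex[OF cN[of N]]] unfolding c_def by simp
  have cc: "c (N + r) w = c N w" if "w \<in> D N" for N r w
  proof (induction r)
    case (Suc r)
    have "w \<in> D (N + r)" using mono[of N "N + r"] that by auto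
    then show ?case using cS[of "N + r"] Suc by (metis add_Suc_right restrict_apply')
  qed simp
  \<comment> \<open>Every stage containing \<open>w\<close> gives the same leg; taking the least one
    makes the choice definite.\<close>
  define x where "x = (\<lambda>w\<in>T. c (LEAST N. w \<in> D N) w)"
  have xc: "x w = c N w" if "w \<in> D N" for w N
  proof -
    have "w \<in> D (LEAST N. w \<in> D N)" "(LEAST N. w \<in> D N) \<le> N" using that by (rule LeastI, rule Least_le)
    then have "c N w = c (LEAST N. w \<in> D N) w" using cc[of w "LEAST N. w \<in> D N" "N - (LEAST N. w \<in> D N)"] by simp
    then show ?thesis using that DT unfolding x_def by auto
  qed
  have "x \<in> El (ConP X Xm T) U"
  proof (rule ConPI)
    show "U \<in> Ob C" using ConP_ob[OF c0] .
    fix w assume "w \<in> T"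
    then obtain N where N: "w \<in> D N" using T by blast
    show "x w \<in> hom U (X (dm w))" using xc[OF N] ConP_hom[OF cN N] by simp
    fix \<theta> assume t: "\<theta> \<in> simplex (dm w)"
    show "Xm (dm w) \<theta> \<cdot> x w = x (w \<odot> \<theta>)"
      using xc[OF N] xc[OF ssetD[OF D(1) N t]] ConP_face[OF cN N t] by simp
  qed (simp add: x_def)
  moreover have "restrict x (D 0) = c0"
    by (rule extensionalityI[OF restrict_extensional ConP_ext[OF c0]]) (use xc[of _ 0] in \<open>simp add: c_def\<close>)
  ultimately show "\<exists>x. x \<in> El (ConP X Xm T) U \<and> restrict x (D 0) = c0" by blast
qed

text \<open>The horns of all \<open>up w\<close> with \<open>w\<close> in \<open>F\<close> lie in
  \<open>cells A\<close> already, so the pairs can be attached in any order.\<close>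

lemma expansion_finite:
  assumes so: "simplicial_object C X Xm" and mt: "matching n S T I up ix rk" and M: "mor_class M"
    and A: "A \<subseteq> I" "sset (matching.cells S up A)"
    and F: "finite F" "F \<subseteq> I" "\<And>w. w \<in> F \<Longrightarrow> matching.good S up ix A w"
    and h: "\<And>w. w \<in> F \<Longrightarrow> cov M (HomP (X (length w))) (ConP X Xm (horn (length w) (ix w)))
        (faces Xm (length w) (horn (length w) (ix w)))"
  shows "sset (matching.cells S up (A \<union> F)) \<and>
    cov M (ConP X Xm (matching.cells S up (A \<union> F))) (ConP X Xm (matching.cells S up A))
      (\<lambda>c. restrict c (matching.cells S up A))"
  using F h
proof (induction F rule: finite_induct)
  case empty
  then show ?case using restrict_cov_refl[OF so A(2) M] A(2) by (simp del: restrict_apply)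
next
  case (insert w F)
  interpret matching n S T I up ix rk by (rule mt)
  have IH: "sset (cells (A \<union> F))" "cov M (ConP X Xm (cells (A \<union> F))) (ConP X Xm (cells A)) (\<lambda>c. restrict c (cells A))"
    using insert by (auto simp del: restrict_apply)
  have e: "A \<union> insert w F = insert w (A \<union> F)" by simp
  show ?case
  proof (cases "w \<in> A \<union> F")
    case True
    then have "A \<union> insert w F = A \<union> F" by blast
    then show ?thesis using IH by (simp del: restrict_apply)
  next
    case False
    have g: "good (A \<union> F) w" using good_mono[of A "A \<union> F"] insert by auto
    have wI: "w \<in> I" "A \<union> F \<subseteq> I" using insert A by auto
    note at = attach_cells[OF wI(2) IH(1) wI(1) False g]
    have c: "cov M (ConP X Xm (cells (insert w (A \<union> F)))) (ConP X Xm (cells (A \<union> F))) (\<lambda>c. restrict c (cells (A \<union> F)))"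
      using attach_cov[OF so at] insert by auto
    have "cov M (ConP X Xm (cells (insert w (A \<union> F)))) (ConP X Xm (cells A)) (\<lambda>c. restrict c (cells A))"
      by (rule restrict_cov_trans[OF so M A(2) IH(1) attach_facts(2)[OF at] cells_mono cells_mono IH(2) c]) auto
    then show ?thesis using attach_facts(2)[OF at] e by (simp del: restrict_apply)
  qed
qed

text \<open>Pairs of equal length are attached by increasing rank. There are finitely many words of
  a given length with letters up to \<open>n\<close>, so the ranks are bounded and the composite is
  finite.\<close>

lemma expansion_stage:
  assumes so: "simplicial_object C X Xm" and mt: "matching n S T I up ix rk" and M: "mor_class M"
    and A: "sset (matching.cells S up (matching.stage I N))"
    and h: "\<And>i. 0 < i \<Longrightarrow> i < N \<Longrightarrow> cov M (HomP (X N)) (ConP X Xm (horn N i)) (faces Xm N (horn N i))"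
  shows "sset (matching.cells S up (matching.stage I (Suc N))) \<and>
    cov M (ConP X Xm (matching.cells S up (matching.stage I (Suc N)))) (ConP X Xm (matching.cells S up (matching.stage I N)))
      (\<lambda>c. restrict c (matching.cells S up (matching.stage I N)))"
proof -
  interpret matching n S T I up ix rk by (rule mt)
  define B where "B r = stage N \<union> {w\<in>I. length w = N \<and> rk w < r}" for r
  have BI: "B r \<subseteq> I" for r unfolding B_def stage_def by blast
  have fin: "finite {w\<in>I. length w = N}" by (rule finite_subset[OF _ finite_length[of "Suc N"]]) auto
  have *: "sset (cells (B r)) \<and> cov M (ConP X Xm (cells (B r))) (ConP X Xm (cells (stage N))) (\<lambda>c. restrict c (cells (stage N)))" for r
  proof (induction r)
    case 0
    have "B 0 = stage N" unfolding B_def by auto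
    then show ?case using restrict_cov_refl[OF so A M] A by (simp del: restrict_apply)
  next
    case (Suc r)
    define F where "F = {w\<in>I. length w = N \<and> rk w = r}"
    have e: "B (Suc r) = B r \<union> F" unfolding B_def F_def by auto
    have *: "sset (cells (B r \<union> F)) \<and> cov M (ConP X Xm (cells (B r \<union> F))) (ConP X Xm (cells (B r))) (\<lambda>c. restrict c (cells (B r)))"
    proof (rule expansion_finite[OF so mt M BI])
      show "sset (cells (B r))" using Suc by blast
      show "finite F" by (rule finite_subset[OF _ fin]) (auto simp: F_def)
      show "F \<subseteq> I" unfolding F_def by blast
      fix w assume "w \<in> F"
      then have w: "w \<in> I" "length w = N" "rk w = r" unfolding F_def by auto
      show "good (B r) w" unfolding good_def
      proof (intro allI impI)
        fix j assume j: "j < length (up w)" "j \<noteq> ix w"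
        show "del j (up w) \<in> cells (B r)"
          by (rule face_cells[OF w(1) j]) (use w in \<open>auto simp: B_def stage_def\<close>)
      qed
      show "cov M (HomP (X (length w))) (ConP X Xm (horn (length w) (ix w))) (faces Xm (length w) (horn (length w) (ix w)))"
        using h[of "ix w"] ix[OF w(1)] length_up[OF w(1)] w(2) by simp
    qed
    have "stage N \<subseteq> B r" unfolding B_def by blast
    then show ?case
      using restrict_cov_trans[OF so M A _ _ cells_mono cells_mono, of "B r" "B r \<union> F"] * Suc e by (auto simp del: restrict_apply)
  qed
  obtain r where r: "\<And>w. w \<in> I \<Longrightarrow> length w = N \<Longrightarrow> rk w < r"
  proof -
    have "finite (rk ` {w\<in>I. length w = N})" using fin by blast
    then obtain r where "\<forall>x\<in>rk ` {w\<in>I. length w = N}. x < r" using finite_nat_set_iff_bounded by blast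
    then show ?thesis using that by blast
  qed
  have "B r = stage (Suc N)" unfolding B_def stage_def using r by (auto simp: less_Suc_eq)
  then show ?thesis using *[of r] by simp
qed

text \<open>Up to dimension \<open>k\<close> this is a finite composite in \<open>M\<close>. In the
  remaining, infinitely many, stages each step is bijective on cones, and so is the passage to their
  union.\<close>

lemma expansion_cov:
  assumes so: "simplicial_object C X Xm" and mt: "matching n S T I up ix rk" and M: "mor_class M"
    and h: "\<And>m i. 0 < i \<Longrightarrow> i < m \<Longrightarrow> cov M (HomP (X m)) (ConP X Xm (horn m i)) (faces Xm m (horn m i))"
    and hi: "\<And>m i. k < m \<Longrightarrow> 0 < i \<Longrightarrow> i < m \<Longrightarrow>
      cov {f. iso C f} (HomP (X m)) (ConP X Xm (horn m i)) (faces Xm m (horn m i))"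
  shows "cov M (ConP X Xm T) (ConP X Xm S) (\<lambda>c. restrict c S)"
    and "(\<And>w. w \<in> I \<Longrightarrow> k < length w) \<Longrightarrow> bijn (ConP X Xm T) (ConP X Xm S) (\<lambda>c. restrict c S)"
proof -
  interpret matching n S T I up ix rk by (rule mt)
  have st: "stage N \<subseteq> stage (Suc N)" "stage N \<subseteq> I" for N unfolding stage_def by auto
  have s0: "stage 0 = {}" unfolding stage_def by simp
  have *: "sset (cells (stage N)) \<and> cov M (ConP X Xm (cells (stage N))) (ConP X Xm S) (\<lambda>c. restrict c S)" for N
  proof (induction N)
    case 0
    then show ?case using restrict_cov_refl[OF so S M] S s0 cells_empty by (simp del: restrict_apply)
  next
    case (Suc N)
    have "S \<subseteq> cells (stage N)" unfolding cells_def by blast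
    then show ?case
      using expansion_stage[OF so mt M _ h, of N] Suc
        restrict_cov_trans[OF so M S _ _ _ cells_mono, of "stage N" "stage (Suc N)"] st by (auto simp del: restrict_apply)
  qed
  \<comment> \<open>Passing from \<open>stage N\<close> to \<open>stage (Suc N)\<close> fills horns
    of dimension \<open>N\<close>; starting at \<open>Suc k\<close>, all of them have dimension
    above \<open>k\<close>.\<close>
  define D where "D r = cells (stage (Suc k + r))" for r
  have sD: "sset (D r)" for r unfolding D_def using * by blast
  have DD: "D r \<subseteq> D (Suc r)" for r unfolding D_def using cells_mono st by simp
  have bD: "bijn (ConP X Xm (D (Suc r))) (ConP X Xm (D r)) (\<lambda>c. restrict c (D r))" for r
  proof -
    have "cov {f. iso C f} (ConP X Xm (D (Suc r))) (ConP X Xm (D r)) (\<lambda>c. restrict c (D r))"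
      using expansion_stage[OF so mt iso_mor_class, of "Suc k + r"] sD[of r] hi unfolding D_def by simp
    then show ?thesis
      by (rule bijn_iso_cov[OF psh_ConP[OF so sD] psh_ConP[OF so sD] ntr_restrict[OF DD sD]])
  qed
  have TD: "T = (\<Union>r. D r)"
  proof (intro equalityI subsetI)
    fix w assume w: "w \<in> T"
    have "w \<in> D (length w)"
    proof (cases "w \<in> S")
      case False
      then consider "remdups_adj w \<in> I" | v where "v \<in> I" "remdups_adj w = up v" using T_cells[OF w] by blast
      then show ?thesis
      proof cases
        case 1
        then have "remdups_adj w \<in> stage (Suc k + length w)" unfolding stage_def using remdups_adj_length[of w] by (simp add: less_Suc_eq_le trans_le_add2)
        then show ?thesis unfolding D_def cells_def by blast
      next
        case 2
        then have "v \<in> stage (Suc k + length w)" unfolding stage_def using remdups_adj_length[of w] length_up[OF 2(1)] by simp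
        then show ?thesis using 2 unfolding D_def cells_def by simp
      qed
    qed (simp add: D_def cells_def)
    then show "w \<in> (\<Union>r. D r)" by blast
  next
    show "w \<in> T" if "w \<in> (\<Union>r. D r)" for w
      using that cells_T[OF st(2)] unfolding D_def by auto
  qed
  have b: "bijn (ConP X Xm T) (ConP X Xm (D 0)) (\<lambda>c. restrict c (D 0))"
    by (rule ConP_union_bijn[OF so sD DD T TD bD])
  have D0T: "D 0 \<subseteq> T" using TD by blast
  have SD0: "S \<subseteq> D 0" unfolding D_def cells_def by blast
  show "cov M (ConP X Xm T) (ConP X Xm S) (\<lambda>c. restrict c S)"
  proof (rule restrict_cov_trans[OF so M S sD T SD0 D0T])
    show "cov M (ConP X Xm (D 0)) (ConP X Xm S) (\<lambda>c. restrict c S)" unfolding D_def using * by blast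
    show "cov M (ConP X Xm T) (ConP X Xm (D 0)) (\<lambda>c. restrict c (D 0))"
      by (rule bijn_cov[OF M psh_ConP[OF so T] psh_ConP[OF so sD] ntr_restrict[OF D0T sD] b])
  qed
  assume long: "\<And>w. w \<in> I \<Longrightarrow> k < length w"
  \<comment> \<open>No pair has length at most \<open>k\<close>, so the stages up to
    \<open>Suc k\<close> add nothing.\<close>
  have "D 0 = S" unfolding D_def stage_def using long cells_empty by (metis (mono_tags, lifting) Collect_empty_eq add.right_neutral less_Suc_eq_le linorder_not_less)
  then show "bijn (ConP X Xm T) (ConP X Xm S) (\<lambda>c. restrict c S)" using b by simp
qed

end

subsection \<open>The matchings\<close>

lemma del_0 [simp]: "del 0 (x # xs) = xs"
  and del_Suc [simp]: "del (Suc j) (x # xs) = x # del j xs"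
  unfolding del_def by auto

lemma del_append: "del j (xs @ ys) = (if j < length xs then del j xs @ ys else xs @ del (j - length xs) ys)"
  unfolding del_def by (auto simp: Suc_diff_le)

lemma set_del: "set (del j xs) \<subseteq> set xs"
  unfolding del_def using set_take_subset set_drop_subset by fastforce

lemma filter_del: "j < length xs \<Longrightarrow> length (filter P (del j xs)) = length (filter P xs) - (if P (xs ! j) then 1 else 0)"
proof (induction xs arbitrary: j)
  case (Cons x xs)
  show ?case
  proof (cases j)
    case (Suc j')
    then show ?thesis using Cons nth_mem[of j' xs] length_pos_if_in_set[of "xs ! j'" "filter P xs"]
      by (auto simp: Suc_diff_le)
  qed simp
qed simp

text \<open>The star matching with centre \<open>c\<close> inserts or deletes \<open>c\<close> at the end of the maximal initial
  segment of the word whose letters are \<open>c\<close> and the first letter other than \<open>c\<close>.\<close>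

definition first_other :: "nat \<Rightarrow> nat list \<Rightarrow> nat" where
  "first_other c w = hd (filter (\<lambda>x. x \<noteq> c) w)"

definition alt_prefix :: "nat \<Rightarrow> nat list \<Rightarrow> nat list" where
  "alt_prefix c w = takeWhile (\<lambda>x. x = c \<or> x = first_other c w) w"

definition alt_rest :: "nat \<Rightarrow> nat list \<Rightarrow> nat list" where
  "alt_rest c w = dropWhile (\<lambda>x. x = c \<or> x = first_other c w) w"

definition star_up :: "nat \<Rightarrow> nat list \<Rightarrow> nat list" where
  "star_up c w = alt_prefix c w @ c # alt_rest c w"

definition star_down :: "nat \<Rightarrow> nat list \<Rightarrow> nat list" where
  "star_down c w = butlast (alt_prefix c w) @ alt_rest c w"

text \<open>\<open>u\<close> is the maximal initial segment with letters in \<open>{a, c}\<close> of \<open>u @ b # r\<close>.\<close>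

definition alt_dec :: "nat \<Rightarrow> nat list \<Rightarrow> nat \<Rightarrow> nat \<Rightarrow> bool" where
  "alt_dec c u a b \<longleftrightarrow> a \<noteq> c \<and> a \<in> set u \<and> set u \<subseteq> {a, c} \<and> b \<noteq> a \<and> b \<noteq> c"

lemma alt_prefix_dec:
  assumes "alt_dec c u a b"
  shows "first_other c (u @ b # r) = a" "alt_prefix c (u @ b # r) = u" "alt_rest c (u @ b # r) = b # r"
proof -
  have "filter (\<lambda>x. x \<noteq> c) u \<noteq> []" using assms unfolding alt_dec_def by (auto simp: filter_empty_conv)
  then have "hd (filter (\<lambda>x. x \<noteq> c) u) \<in> set (filter (\<lambda>x. x \<noteq> c) u)" by (rule hd_in_set)
  then have "hd (filter (\<lambda>x. x \<noteq> c) u) = a" using assms unfolding alt_dec_def by auto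
  then show 1: "first_other c (u @ b # r) = a"
    using \<open>filter (\<lambda>x. x \<noteq> c) u \<noteq> []\<close> unfolding first_other_def by simp
  have "\<And>x. x \<in> set u \<Longrightarrow> x = c \<or> x = a" using assms unfolding alt_dec_def by auto
  then show "alt_prefix c (u @ b # r) = u" "alt_rest c (u @ b # r) = b # r"
    using assms unfolding alt_prefix_def alt_rest_def 1 alt_dec_def by (auto simp: takeWhile_append dropWhile_append3)
qed

text \<open>Two distinct letters other than \<open>c\<close> force the alternating prefix to stop
  inside the word; \<open>b\<close> is the letter that stops it.\<close>

lemma alt_dec_ex:
  assumes "x \<in> set w" "y \<in> set w" "x \<noteq> y" "x \<noteq> c" "y \<noteq> c"
  obtains u a b r where "w = u @ b # r" "alt_dec c u a b"
proof -
  have ne: "filter (\<lambda>x. x \<noteq> c) w \<noteq> []" using assms by (auto simp: filter_empty_conv)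
  define a where "a = first_other c w"
  have a: "a \<in> set w" "a \<noteq> c" using hd_in_set[OF ne] unfolding a_def first_other_def by auto
  have "\<exists>z\<in>set w. \<not> (z = c \<or> z = a)" using assms by metis
  then have "alt_rest c w \<noteq> []" unfolding alt_rest_def a_def[symmetric] by (auto simp: dropWhile_eq_Nil_conv)
  then obtain b r where br: "alt_rest c w = b # r" by (cases "alt_rest c w") auto
  have w: "w = alt_prefix c w @ b # r" using br unfolding alt_prefix_def alt_rest_def by (metis takeWhile_dropWhile_id)
  have b: "b \<noteq> c" "b \<noteq> a" using hd_dropWhile[of "\<lambda>x. x = c \<or> x = a" w] br \<open>alt_rest c w \<noteq> []\<close>
    unfolding alt_rest_def a_def by auto
  have s: "set (alt_prefix c w) \<subseteq> {a, c}" using set_takeWhileD unfolding alt_prefix_def a_def by fastforce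
  have "a \<in> set (alt_prefix c w)"
  proof (rule ccontr)
    assume n: "a \<notin> set (alt_prefix c w)"
    then have "filter (\<lambda>x. x \<noteq> c) (alt_prefix c w) = []" using s by (auto simp: filter_empty_conv)
    then have "filter (\<lambda>x. x \<noteq> c) w = b # filter (\<lambda>x. x \<noteq> c) r"
      using arg_cong[OF w, of "filter (\<lambda>x. x \<noteq> c)"] b by simp
    then have "first_other c w = b" unfolding first_other_def by simp
    then show False using b a_def by simp
  qed
  then show ?thesis using that[OF w] s a b unfolding alt_dec_def by blast
qed

lemma alt_dec_last: "alt_dec c u a b \<Longrightarrow> u \<noteq> [] \<and> (last u = a \<or> last u = c)"
  unfolding alt_dec_def using last_in_set[of u] empty_iff by (cases "u = []") (simp, blast)

text \<open>The insertion is inner because \<open>u\<close> is nonempty and \<open>b\<close>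
  follows. The new prefix ends in \<open>c\<close>, which tells the upper partner from the lower one
  and lets \<open>star_down\<close> undo the insertion.\<close>

lemma star_up_dec:
  assumes "alt_dec c u a b" "last u \<noteq> c" "distinct_adj (u @ b # r)"
  shows "star_up c (u @ b # r) = u @ c # b # r" "distinct_adj (u @ c # b # r)" "alt_dec c (u @ [c]) a b"
    "star_down c (u @ c # b # r) = u @ b # r"
proof -
  show 1: "alt_dec c (u @ [c]) a b" using assms(1) unfolding alt_dec_def by auto
  show "star_up c (u @ b # r) = u @ c # b # r" unfolding star_up_def alt_prefix_dec[OF assms(1)] ..
  show "star_down c (u @ c # b # r) = u @ b # r" using alt_prefix_dec[OF 1, of r] unfolding star_down_def by simp
  have "b \<noteq> c" "u \<noteq> []" using assms(1) alt_dec_last unfolding alt_dec_def by auto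
  then show "distinct_adj (u @ c # b # r)"
    using assms(2,3) unfolding distinct_adj_append_iff by (auto simp: distinct_adj_Cons)
qed

lemma star_down_dec:
  assumes "alt_dec c u a b" "last u = c" "distinct_adj (u @ b # r)"
  shows "alt_dec c (butlast u) a b" "last (butlast u) = a" "star_down c (u @ b # r) = butlast u @ b # r"
    "u = butlast u @ [c]" "distinct_adj (butlast u @ b # r)" "star_up c (butlast u @ b # r) = u @ b # r"
proof -
  have ne: "u \<noteq> []" using alt_dec_last[OF assms(1)] by blast
  show u: "u = butlast u @ [c]" using append_butlast_last_id[OF ne] assms(2) by simp
  have su: "set u = insert c (set (butlast u))" using arg_cong[OF u, of set] by simp
  then show 1: "alt_dec c (butlast u) a b" using assms(1) unfolding alt_dec_def by auto
  have ua: "butlast u @ c # v = u @ v" for v using arg_cong[OF u, of "\<lambda>x. x @ v"] by simp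
  have da: "distinct_adj (butlast u @ c # b # r)" using assms(3) unfolding ua .
  have bn: "butlast u \<noteq> []" using alt_dec_last[OF 1] by blast
  have lc: "last (butlast u) \<noteq> c" using da bn unfolding distinct_adj_append_iff by auto
  then show la: "last (butlast u) = a" using alt_dec_last[OF 1] by blast
  show "star_down c (u @ b # r) = butlast u @ b # r" unfolding star_down_def alt_prefix_dec[OF assms(1)] ..
  show da': "distinct_adj (butlast u @ b # r)"
    using da bn la 1 unfolding distinct_adj_append_iff alt_dec_def by (auto simp: distinct_adj_Cons)
  show "star_up c (butlast u @ b # r) = u @ b # r"
    using star_up_dec(1)[OF 1 lc da'] unfolding ua .
qed

text \<open>In an alternating word the two neighbours of an inner letter coincide.\<close>

lemma alternating_del:
  assumes "distinct_adj u" "set u \<subseteq> {a, c}" "0 < j" "Suc j < length u"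
  shows "\<not> distinct_adj (del j u @ v)"
proof
  assume "distinct_adj (del j u @ v)"
  then have d: "distinct_adj (del j u)" by blast
  obtain i where i: "j = Suc i" using assms(3) by (cases j) auto
  have "u ! i \<noteq> u ! Suc i" "u ! Suc i \<noteq> u ! Suc (Suc i)"
    using distinct_adj_nth[OF assms(1)] assms(4) i by auto
  moreover have "u ! i \<in> {a,c}" "u ! Suc i \<in> {a,c}" "u ! Suc (Suc i) \<in> {a,c}"
    using assms(2,4) i nth_mem by (meson Suc_lessD subsetD)+
  ultimately have e: "u ! i = u ! Suc (Suc i)" by auto
  have "del j u ! i = u ! i" "del j u ! Suc i = u ! Suc (Suc i)"
    using i assms(4) nth_del[of j u i] nth_del[of j u "Suc (Suc i)"] by auto
  moreover have "Suc i < length (del j u)" using assms(4) i length_del[of j u] by simp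
  ultimately show False using distinct_adj_nth[OF d] e by metis
qed

text \<open>Deleting an inner letter of the alternating part gives a degenerate face; this leaves
  the first letter, the letter \<open>b\<close> and the letters behind it.\<close>

lemma star_up_face_cases:
  assumes u: "alt_dec c u a b" "last u \<noteq> c" "distinct_adj (u @ b # r)"
    and j: "j < length (u @ c # b # r)" "j \<noteq> length u"
    and d: "distinct_adj (del j (u @ c # b # r))"
  obtains (first) "j = 0" "del j (u @ c # b # r) = tl u @ c # b # r"
    | (bb) "j = Suc (length u)" "del j (u @ c # b # r) = u @ c # r"
    | (later) j' where "j' < length r" "j = j' + length u + 2" "del j (u @ c # b # r) = u @ c # b # del j' r"
proof -
  have ne: "u \<noteq> []" using alt_dec_last[OF u(1)] by blast
  consider "j = 0" | "0 < j" "j < length u" | "j = Suc (length u)" | "j > Suc (length u)" using j by linarith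
  then show ?thesis
  proof cases
    case 1
    then show ?thesis using first ne by (cases u) auto
  next
    case 2
    have "distinct_adj (u @ [c])" using star_up_dec(2)[OF u] distinct_adj_appendD1[of "u @ [c]" "b # r"] by simp
    moreover have "set (u @ [c]) \<subseteq> {a,c}" using u(1) unfolding alt_dec_def by auto
    ultimately have "\<not> distinct_adj (del j (u @ [c]) @ b # r)" using alternating_del[of "u @ [c]" a c j "b # r"] 2 by simp
    moreover have "del j (u @ [c]) @ b # r = del j (u @ c # b # r)" using 2 by (simp add: del_append)
    ultimately show ?thesis using d by simp
  next
    case 3
    then show ?thesis using bb by (simp add: del_append)
  next
    case 4
    then have "j = (j - length u - 2) + length u + 2" by simp
    then obtain j' where "j = j' + length u + 2" by blast
    then show ?thesis using later[of j'] j by (simp add: del_append)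
  qed
qed

definition thick_horn :: "nat \<Rightarrow> nat \<Rightarrow> nat list set" where
  "thick_horn n i = {w\<in>thick n. \<not> {..n} \<subseteq> insert i (set w)}"

definition thick_bdry :: "nat \<Rightarrow> nat list set" where
  "thick_bdry n = {w\<in>thick n. \<not> {..n} \<subseteq> set w}"

lemma sset_thick_horn: "sset (thick_horn n i)"
  unfolding thick_horn_def by (rule sset_support[OF sset_thick]) blast

lemma sset_thick_bdry: "sset (thick_bdry n)"
  unfolding thick_bdry_def by (rule sset_support[OF sset_thick]) blast

text \<open>The conditions on support and neighbours describe the nondegenerate words outside
  \<open>thick_horn n i\<close>; the last one selects the partner without the extra letter
  \<open>i\<close>.\<close>

definition starI :: "nat \<Rightarrow> nat \<Rightarrow> nat list set" where
  "starI n i = {w. set w \<subseteq> {..n} \<and> distinct_adj w \<and> {..n} \<subseteq> insert i (set w) \<and> last (alt_prefix i w) \<noteq> i}"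

text \<open>This is how \<open>n \<ge> 2\<close> enters the star matching: for \<open>n = 1\<close>
  only one letter differs from \<open>i\<close>, and the alternating prefix would be the whole
  word.\<close>

lemma two_letters:
  assumes "{..n} \<subseteq> insert i A" "(2::nat) \<le> n"
  obtains x y where "x \<in> A" "y \<in> A" "x \<noteq> y" "x \<noteq> i" "y \<noteq> i"
proof -
  have "0 \<in> {..n}" "1 \<in> {..n}" "2 \<in> {..n}" using assms(2) by auto
  then have "0 \<in> insert i A" "1 \<in> insert i A" "2 \<in> insert i A" using assms(1) by blast+
  then show ?thesis using that[of 0 1] that[of 0 2] that[of 1 2] by (cases "i = 0"; cases "i = 1"; auto)
qed

text \<open>The rank counts the letters different from the centre, and inserting \<open>i\<close>
  does not change it. A face of \<open>star_up i w\<close> that is again a lower partner has lost a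
  letter different from \<open>i\<close>, since otherwise its alternating prefix would still end in
  \<open>i\<close>.\<close>

lemma star_matching:
  assumes n: "2 \<le> n" and i: "i \<le> n"
  shows "matching n (thick_horn n i) (thick n) (starI n i) (star_up i) (\<lambda>w. length (alt_prefix i w))
    (\<lambda>w. length (filter (\<lambda>x. x \<noteq> i) w))"
proof -
  have dec: "\<exists>u a b r. w = u @ b # r \<and> alt_dec i u a b" if "{..n} \<subseteq> insert i (set w)" for w
    using two_letters[OF that n] alt_dec_ex by metis
  have starD: "\<exists>u a b r. w = u @ b # r \<and> alt_dec i u a b \<and> last u \<noteq> i \<and> distinct_adj w \<and> set w \<subseteq> {..n} \<and> {..n} \<subseteq> insert i (set w)"
    if w: "w \<in> starI n i" for w
  proof -
    obtain u a b r where 1: "w = u @ b # r" "alt_dec i u a b" using dec[of w] w unfolding starI_def by blast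
    then show ?thesis using w alt_prefix_dec(2)[OF 1(2)] unfolding starI_def by auto
  qed
  show ?thesis
  proof
    show "sset (thick_horn n i)" "sset (thick n)" by (rule sset_thick_horn, rule sset_thick)
    show "thick_horn n i \<subseteq> thick n" "thick n \<subseteq> thick n" unfolding thick_horn_def by auto
    fix w assume w: "w \<in> starI n i"
    then obtain u a b r where 1: "w = u @ b # r" "alt_dec i u a b" "last u \<noteq> i" "distinct_adj w"
      "set w \<subseteq> {..n}" "{..n} \<subseteq> insert i (set w)" using starD by metis
    note ud = star_up_dec[OF 1(2,3) 1(4)[unfolded 1(1)]]
    have ne: "w \<noteq> []" using 1 by auto
    show "w \<in> thick n \<and> w \<notin> thick_horn n i \<and> distinct_adj w"
      using 1 ne unfolding thick_def thick_horn_def by auto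
    have r: "alt_prefix i w = u" using alt_prefix_dec(2)[OF 1(2)] 1(1) by simp
    have r': "alt_prefix i (u @ i # b # r) = u @ [i]" using alt_prefix_dec(2)[OF ud(3), of r] by simp
    have in_le: "i \<le> n \<or> {..n} \<subseteq> set w" using 1(6) by auto
    show "0 < length (alt_prefix i w) \<and> Suc (length (alt_prefix i w)) < length (star_up i w) \<and> del (length (alt_prefix i w)) (star_up i w) = w"
      using alt_dec_last[OF 1(2)] unfolding r unfolding 1(1) ud(1) by (simp add: del_append)
    fix j assume j: "j < length (star_up i w)" "j \<noteq> length (alt_prefix i w)" and f: "del j (star_up i w) \<in> starI n i"
    have j': "j < length (u @ i # b # r)" "j \<noteq> length u" and f': "del j (u @ i # b # r) \<in> starI n i"
      using j f unfolding r unfolding 1(1) ud(1) by auto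
    have da: "distinct_adj (del j (u @ i # b # r))" using f' unfolding starI_def by blast
    have "(u @ i # b # r) ! j \<noteq> i"
    proof
      assume ji: "(u @ i # b # r) ! j = i"
      from 1(2,3) 1(4)[unfolded 1(1)] j' da show False
      proof (cases rule: star_up_face_cases)
        case first
        then have "tl u \<noteq> []" "u = i # tl u" using ji 1(3) alt_dec_last[OF 1(2)]
          by (cases u; auto)+
        then have "alt_dec i (tl u @ [i]) a b" using 1(2) unfolding alt_dec_def
          by (cases u) auto
        then have "alt_prefix i (del j (u @ i # b # r)) = tl u @ [i]" using alt_prefix_dec(2)[of i "tl u @ [i]" a b r] first by simp
        then show False using f' unfolding starI_def by simp
      next
        case bb
        then have "(u @ i # b # r) ! j = b" by (simp add: nth_append)
        then show False using ji 1(2) unfolding alt_dec_def by simp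
      next
        case (later j')
        then have "alt_prefix i (del j (u @ i # b # r)) = u @ [i]" using alt_prefix_dec(2)[OF ud(3), of "del j' r"] by simp
        then show False using f' unfolding starI_def by simp
      qed
    qed
    moreover have "0 < length (filter (\<lambda>x. x \<noteq> i) w)"
      using 1(1,2) unfolding alt_dec_def by simp
    ultimately show "length (filter (\<lambda>x. x \<noteq> i) (del j (star_up i w))) < length (filter (\<lambda>x. x \<noteq> i) w)"
      using filter_del[OF j'(1), of "\<lambda>x. x \<noteq> i"] unfolding 1(1) ud(1) by simp
  next
    fix w assume w: "w \<in> starI n i"
    then obtain u a b r where 1: "w = u @ b # r" "alt_dec i u a b" "last u \<noteq> i" "distinct_adj w"
      "set w \<subseteq> {..n}" "{..n} \<subseteq> insert i (set w)" using starD by metis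
    note ud = star_up_dec[OF 1(2,3) 1(4)[unfolded 1(1)]]
    have r': "alt_prefix i (u @ i # b # r) = u @ [i]" using alt_prefix_dec(2)[OF ud(3), of r] by simp
    with i show "star_up i w \<in> thick n \<and> star_up i w \<notin> thick_horn n i \<and> star_up i w \<notin> starI n i \<and> distinct_adj (star_up i w)"
      using 1 ud r' unfolding thick_def thick_horn_def starI_def by auto
  next
    show "inj_on (star_up i) (starI n i)"
    proof (rule inj_on_inverseI)
      fix w assume "w \<in> starI n i"
      then obtain u a b r where 1: "w = u @ b # r" "alt_dec i u a b" "last u \<noteq> i" "distinct_adj w" using starD by metis
      show "star_down i (star_up i w) = w" using star_up_dec[OF 1(2,3) 1(4)[unfolded 1(1)]] 1(1) by simp
    qed
  next
    fix w assume w: "w \<in> thick n" "w \<notin> thick_horn n i" "distinct_adj w"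
    then have s: "set w \<subseteq> {..n}" "{..n} \<subseteq> insert i (set w)" unfolding thick_def thick_horn_def by auto
    obtain u a b r where 1: "w = u @ b # r" "alt_dec i u a b" using dec[OF s(2)] by blast
    have r: "alt_prefix i w = u" using alt_prefix_dec(2)[OF 1(2)] 1(1) by simp
    show "w \<in> starI n i \<union> star_up i ` starI n i"
    proof (cases "last u = i")
      case False
      then show ?thesis using s w r unfolding starI_def by simp
    next
      case True
      note sd = star_down_dec[OF 1(2) True w(3)[unfolded 1(1)]]
      have "set u = insert i (set (butlast u))" using arg_cong[OF sd(4), of set] by simp
      then have "set w = insert i (set (butlast u @ b # r))" using 1(1) by auto
      then have "insert i (set w) = insert i (set (butlast u @ b # r))" "set (butlast u @ b # r) \<subseteq> set w" by auto
      moreover have "last (alt_prefix i (butlast u @ b # r)) \<noteq> i"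
        using alt_prefix_dec(2)[OF sd(1)] sd(2) 1(2) unfolding alt_dec_def by simp
      ultimately have "butlast u @ b # r \<in> starI n i" using s sd(5) unfolding starI_def by auto
      moreover have "w = star_up i (butlast u @ b # r)" using sd(6) 1(1) by simp
      ultimately show ?thesis by blast
    qed
  qed
qed

section \<open>A filtration starting at the simplex with thick boundary\<close>

text \<open>\<open>Kset n l\<close> is the nerve of the preorder in which \<open>0, \<dots>, l\<close> are equivalent and lie below
  \<open>l + 1 < \<dots> < n\<close>.\<close>

definition Kset :: "nat \<Rightarrow> nat \<Rightarrow> nat list set" where
  "Kset n l = {w\<in>thick n. sorted_wrt (\<lambda>x y. x \<le> l \<or> x \<le> y) w}"

text \<open>At \<open>l = 0\<close> this is the ordinary simplex together with the thick boundary.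
  With the thick boundary included at every \<open>l\<close>, only words using all letters remain to
  be matched.\<close>

definition Kext :: "nat \<Rightarrow> nat \<Rightarrow> nat list set" where
  "Kext n l = Kset n l \<union> thick_bdry n"

lemma sset_Kset: "sset (Kset n l)"
  unfolding sset_def
proof (intro ballI conjI)
  fix w assume w: "w \<in> Kset n l"
  then have wt: "w \<in> thick n" and ws: "sorted_wrt (\<lambda>x y. x \<le> l \<or> x \<le> y) w" unfolding Kset_def by auto
  show ne: "w \<noteq> []" using sset_ne[OF sset_thick wt] .
  fix \<theta> assume t: "\<theta> \<in> simplex (dm w)"
  have "sorted_wrt (\<lambda>i j. w ! i \<le> l \<or> w ! i \<le> w ! j) \<theta>"
  proof (rule sorted_wrt_mono_rel[of \<theta> "(\<le>)"])
    show "w ! x \<le> l \<or> w ! x \<le> w ! y" if "x \<in> set \<theta>" "y \<in> set \<theta>" "x \<le> y" for x y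
      using that sorted_wrt_nth_less[OF ws, of x y] simplex_lt[OF t ne, of y] by (cases "x = y") auto
  qed (use t in \<open>simp add: simplex_iff\<close>)
  then show "w \<odot> \<theta> \<in> Kset n l"
    using ssetD[OF sset_thick wt t] unfolding Kset_def by (simp add: sorted_wrt_map)
qed

lemma sset_Kext: "sset (Kext n l)"
  unfolding Kext_def by (rule sset_Un[OF sset_Kset sset_thick_bdry])

lemma Kset_0: "Kset n 0 = simplex n"
proof -
  have "sorted_wrt (\<lambda>x y. x \<le> 0 \<or> x \<le> y) w = sorted w" for w :: "nat list"
    by (rule iffI; erule sorted_wrt_mono_rel[rotated]) auto
  then show ?thesis unfolding Kset_def simplex_def by simp
qed

text \<open>Letters above \<open>l\<close> come last and in increasing order; nondegeneracy and full
  support leave each of them exactly once.\<close>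

lemma Kset_dec:
  assumes w: "w \<in> Kset n l" and f: "{..n} \<subseteq> set w" and d: "distinct_adj w" and l: "l < n"
  obtains u where "w = u @ [Suc l..<Suc n]" "set u = {..l}" "distinct_adj u"
proof -
  define u where "u = takeWhile (\<lambda>x. x \<le> l) w"
  define v where "v = dropWhile (\<lambda>x. x \<le> l) w"
  have wuv: "w = u @ v" unfolding u_def v_def by simp
  have sw: "sorted_wrt (\<lambda>x y. x \<le> l \<or> x \<le> y) (u @ v)" and wn: "set w \<subseteq> {..n}"
    using w wuv unfolding Kset_def thick_def by auto
  have sv: "sorted_wrt (\<lambda>x y. x \<le> l \<or> x \<le> y) v" using sw unfolding sorted_wrt_append by blast
  have vl: "l < x" if "x \<in> set v" for x
  proof -
    obtain h t where v: "v = h # t" using \<open>x \<in> set v\<close> by (cases v) auto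
    have "\<not> h \<le> l" using hd_dropWhile[of "\<lambda>x. x \<le> l" w] v unfolding v_def by auto
    then show ?thesis using sv that v by auto
  qed
  have ul: "x \<le> l" if "x \<in> set u" for x using that unfolding u_def by (rule set_takeWhileD[THEN conjunct2])
  have "sorted v"
    by (rule sorted_wrt_mono_rel[OF _ sv]) (use vl in fastforce)
  then have r: "remdups_adj v = sorted_list_of_set (set v)" by (rule remdups_adj_sorted)
  have "distinct_adj v" using d unfolding wuv distinct_adj_append_iff by blast
  then have rv: "remdups_adj v = v" by (simp add: distinct_adj_altdef)
  have sets: "set w = set u \<union> set v" using wuv by simp
  have "set v = {Suc l..n}"
  proof (intro equalityI subsetI)
    show "x \<in> {Suc l..n}" if "x \<in> set v" for x using vl[OF that] wn that sets by auto
    show "x \<in> set v" if "x \<in> {Suc l..n}" for x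
    proof -
      have "x \<in> set w" "x \<notin> set u" using f that ul[of x] by auto
      then show ?thesis using sets by blast
    qed
  qed
  moreover have "sorted_list_of_set {Suc l..n} = [Suc l..<Suc n]"
    by (metis atLeastLessThanSuc_atLeastAtMost sorted_list_of_set_range)
  ultimately have v: "v = [Suc l..<Suc n]" using r rv by simp
  have "set u = {..l}"
  proof (intro equalityI subsetI)
    show "x \<in> {..l}" if "x \<in> set u" for x using ul[OF that] by simp
    show "x \<in> set u" if "x \<in> {..l}" for x
    proof -
      have "x \<in> set w" "x \<notin> set v" using f that l vl[of x] by auto
      then show ?thesis using sets by blast
    qed
  qed
  moreover have "distinct_adj u" using d unfolding wuv distinct_adj_append_iff by blast
  ultimately show ?thesis using that[of u] wuv v by simp
qed

lemma Kset_app: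
  assumes "set u \<subseteq> {..l}" "u \<noteq> [] \<or> l < n" "l \<le> n"
  shows "u @ [Suc l..<Suc n] \<in> Kset n l"
proof -
  have "sorted_wrt (\<lambda>x y. x \<le> l \<or> x \<le> y) u"
    by (rule sorted_wrt_mono_rel[of _ "\<lambda>_ _. True"]) (use assms in \<open>auto simp: sorted_wrt_iff_nth_less\<close>)
  moreover have "sorted_wrt (\<lambda>x y. x \<le> l \<or> x \<le> y) [Suc l..<Suc n]"
    by (rule sorted_wrt_mono_rel[of _ "(\<le>)"]) (simp_all add: sorted_upt del: upt_Suc)
  ultimately show ?thesis
    using assms unfolding Kset_def thick_def by (auto simp: sorted_wrt_append simp del: upt_Suc)
qed

text \<open>Lower partners. The tail \<open>[Suc l..<Suc n]\<close> is nonempty for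
  \<open>l < n\<close>, so that appending \<open>l\<close> to \<open>u\<close> is an inner
  insertion.\<close>

definition KI :: "nat \<Rightarrow> nat \<Rightarrow> nat list set" where
  "KI n l = {u @ [Suc l..<Suc n] |u. set u = {..l} \<and> distinct_adj u \<and> last u \<noteq> l}"

definition Kpre :: "nat \<Rightarrow> nat list \<Rightarrow> nat list" where
  "Kpre l w = takeWhile (\<lambda>x. x \<le> l) w"

definition Kup :: "nat \<Rightarrow> nat \<Rightarrow> nat list \<Rightarrow> nat list" where
  "Kup n l w = Kpre l w @ l # [Suc l..<Suc n]"

lemma Kpre_app: "set u \<subseteq> {..l} \<Longrightarrow> Kpre l (u @ [Suc l..<Suc n]) = u"
  unfolding Kpre_def by (cases "Suc l < Suc n") (auto simp: takeWhile_append upt_conv_Cons simp del: upt_Suc)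

text \<open>Some occurrence of \<open>l\<close> is followed by the last letter of \<open>u\<close>,
  which is smaller; the preorder for \<open>l - 1\<close> forbids this.\<close>

lemma Kset_step_out:
  assumes "set u \<subseteq> {..l}" "l \<in> set u" "last u \<noteq> l" "0 < l"
  shows "u @ v \<notin> Kset n (l - 1)"
proof
  assume "u @ v \<in> Kset n (l - 1)"
  then have s: "sorted_wrt (\<lambda>x y. x \<le> l - 1 \<or> x \<le> y) u" unfolding Kset_def by (simp add: sorted_wrt_append)
  obtain p t where u: "u = p @ l # t" using split_list[OF assms(2)] by blast
  then have t: "t \<noteq> []" using assms(3) by auto
  then have "last u \<in> set t" using u by simp
  then have "l \<le> l - 1 \<or> l \<le> last u" using s unfolding u by (auto simp: sorted_wrt_append)
  moreover have "last u \<le> l" using assms(1) \<open>last u \<in> set t\<close> u by auto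
  ultimately show False using assms(3,4) by linarith
qed

text \<open>A constant rank is enough, because no other face of \<open>Kup n l w\<close> is a lower
  partner: deleting a letter of \<open>u\<close> leaves the final \<open>l\<close> in front of the
  tail, and deleting a letter of the tail destroys the full support.\<close>

lemma K_matching:
  assumes l: "0 < l" "l < n"
  shows "matching n (Kext n (l - 1)) (Kext n l) (KI n l) (Kup n l) (\<lambda>w. length (Kpre l w)) (\<lambda>w. 0)"
proof -
  define V where "V = [Suc l..<Suc n]"
  have V: "V \<noteq> []" "hd V = Suc l" "set V = {Suc l..n}" "distinct V"
    unfolding V_def using l by (auto simp del: upt_Suc)
  have dV: "distinct_adj V" using V(4) by (simp add: distinct_adj_altdef remdups_adj_distinct)
  have full: "{..n} \<subseteq> set u \<union> set V" if "set u = {..l}" for u using that V(3) by auto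
  have daV: "distinct_adj (u @ V)" if "distinct_adj u" "set u \<subseteq> {..l}" for u
  proof (cases "u = []")
    case False
    then have "last u \<in> set u" by simp
    then have "last u \<le> l" using that(2) by auto
    then show ?thesis using that dV V unfolding distinct_adj_append_iff by auto
  qed (use dV in simp)
  have KT: "u @ V \<in> Kext n l \<and> (last u \<noteq> l \<longrightarrow> u @ V \<notin> Kext n (l - 1)) \<and> (u @ V \<notin> thick_bdry n)" if "set u = {..l}" for u
    using Kset_app[of u l n] Kset_step_out[of u l V n] that l full[OF that]
    unfolding Kext_def V_def thick_bdry_def by auto
  have pre: "Kpre l (u @ V) = u" if "set u \<subseteq> {..l}" for u using Kpre_app[OF that] unfolding V_def .
  have KID: "\<exists>u. w = u @ V \<and> set u = {..l} \<and> distinct_adj u \<and> last u \<noteq> l" if "w \<in> KI n l" for w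
    using that unfolding KI_def V_def by blast
  have KII: "u @ V \<in> KI n l \<longleftrightarrow> set u = {..l} \<and> distinct_adj u \<and> last u \<noteq> l" if "set u \<subseteq> {..l}" for u
  proof
    assume "u @ V \<in> KI n l"
    then obtain u' where u': "u @ V = u' @ V" "set u' = {..l}" "distinct_adj u'" "last u' \<noteq> l" using KID by blast
    then show "set u = {..l} \<and> distinct_adj u \<and> last u \<noteq> l" by simp
  qed (auto simp: KI_def V_def)
  have upe: "Kup n l (u @ V) = (u @ [l]) @ V" if "set u \<subseteq> {..l}" for u
    unfolding Kup_def pre[OF that] unfolding V_def by simp
  show ?thesis
  proof
    show "sset (Kext n (l - 1))" "sset (Kext n l)" by (rule sset_Kext)+
    have "Kset n (l - 1) \<subseteq> Kset n l"
      unfolding Kset_def by (auto elim: sorted_wrt_mono_rel[rotated])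
    then show "Kext n (l - 1) \<subseteq> Kext n l" unfolding Kext_def by blast
    show "Kext n l \<subseteq> thick n" unfolding Kext_def Kset_def thick_bdry_def by blast
  next
    fix w assume "w \<in> KI n l"
    then obtain u where u: "w = u @ V" "set u = {..l}" "distinct_adj u" "last u \<noteq> l" using KID by blast
    then show "w \<in> Kext n l \<and> w \<notin> Kext n (l - 1) \<and> distinct_adj w" using KT daV by simp
    have ne: "u \<noteq> []" using u by auto
    have ul: "distinct_adj (u @ [l])" "set (u @ [l]) = {..l}"
      using u ne unfolding distinct_adj_append_iff by auto
    have "Kup n l w \<notin> Kset n (l - 1)"
      using Kset_step_out[of u l "[l] @ V" n] u l upe by simp
    then show "Kup n l w \<in> Kext n l \<and> Kup n l w \<notin> Kext n (l - 1) \<and> Kup n l w \<notin> KI n l \<and> distinct_adj (Kup n l w)"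
      using KT[OF ul(2)] KII[of "u @ [l]"] daV[OF ul(1)] ul upe u unfolding Kext_def by auto
    have wpre: "length (Kpre l w) = length u" using pre u by simp
    have wup: "Kup n l w = u @ l # V" using upe u by simp
    show "0 < length (Kpre l w) \<and> Suc (length (Kpre l w)) < length (Kup n l w) \<and> del (length (Kpre l w)) (Kup n l w) = w"
      unfolding wpre wup using ne V u(1) by (simp add: del_append)
    fix j assume j: "j < length (Kup n l w)" "j \<noteq> length (Kpre l w)" "del j (Kup n l w) \<in> KI n l"
    have j': "j \<noteq> length u" "del j (u @ l # V) \<in> KI n l" using j unfolding wpre wup by auto
    have False
    proof (cases "j < length u")
      case True
      then have "(del j u @ [l]) @ V \<in> KI n l" using j' by (simp add: del_append)
      then show False using KII[of "del j u @ [l]"] set_del[of j u] u by auto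
    next
      case False
      then obtain i where i: "j = length u + Suc i" using j'(1) by (metis add_diff_inverse_nat not0_implies_Suc add.right_neutral)
      have il: "i < length V" using j(1) i wup by simp
      have "u @ l # del i V \<in> KI n l" using j' i by (simp add: del_append)
      then obtain u' where u': "u @ l # del i V = u' @ V" "set u' = {..l}" using KID by metis
      have "V ! i \<in> set V" using il by simp
      moreover have "V ! i \<notin> set (del i V)" using set_del_distinct[OF V(4) il] .
      moreover have "set V \<subseteq> set u \<union> {l} \<union> set (del i V)" using arg_cong[OF u'(1), of set] by auto
      ultimately have "V ! i \<in> {..l}" using u(2) by auto
      then show False using \<open>V ! i \<in> set V\<close> V(3) by auto
    qed
    then show "(0::nat) < 0" by simp
  next
    show "inj_on (Kup n l) (KI n l)"
    proof (rule inj_onI)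
      fix w w' assume "w \<in> KI n l" "w' \<in> KI n l" and e: "Kup n l w = Kup n l w'"
      then obtain u u' where "w = u @ V" "set u = {..l}" "w' = u' @ V" "set u' = {..l}" using KID by metis
      then show "w = w'" using e upe[of u] upe[of u'] by simp
    qed
  next
    fix w assume w: "w \<in> Kext n l" "w \<notin> Kext n (l - 1)" "distinct_adj w"
    then have wK: "w \<in> Kset n l" and f: "{..n} \<subseteq> set w" unfolding Kext_def thick_bdry_def Kset_def by auto
    obtain u where u: "w = u @ V" "set u = {..l}" "distinct_adj u"
      unfolding V_def using Kset_dec[OF wK f w(3) l(2)] by blast
    show "w \<in> KI n l \<union> Kup n l ` KI n l"
    proof (cases "last u = l")
      case False
      then show ?thesis using KII[of u] u by simp
    next
      case True
      have une: "u \<noteq> []" using u by auto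
      define u' where "u' = butlast u"
      have uu: "u = u' @ [l]" unfolding u'_def using append_butlast_last_id[OF une] True by simp
      \<comment> \<open>If the final \<open>l\<close> of \<open>u\<close> were its only occurrence,
        the word would already belong to the preceding step of the filtration.\<close>
      have "l \<in> set u'"
      proof (rule ccontr)
        assume n: "l \<notin> set u'"
        have s: "set u' \<subseteq> {..l - 1}"
        proof
          fix x assume "x \<in> set u'"
          then have "x \<le> l" "x \<noteq> l" using u(2) uu n by auto
          then show "x \<in> {..l - 1}" by simp
        qed
        have "[Suc (l - 1)..<Suc n] = l # V" unfolding V_def using l by (simp add: upt_conv_Cons del: upt_Suc)
        moreover have "l - 1 < n" using l by linarith
        then have "u' @ [Suc (l - 1)..<Suc n] \<in> Kset n (l - 1)" using Kset_app[OF s, of n] by simp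
        ultimately have "u' @ l # V \<in> Kset n (l - 1)" by simp
        then show False using w(2) u(1) uu unfolding Kext_def by simp
      qed
      then have su: "set u' = {..l}" using u(2) uu by auto
      have "u' \<noteq> []" using \<open>l \<in> set u'\<close> by auto
      then have "distinct_adj u'" "last u' \<noteq> l" using u(3) unfolding uu distinct_adj_append_iff by auto
      then have "u' @ V \<in> KI n l" using KII[of u'] su by simp
      moreover have "w = Kup n l (u' @ V)" using upe[of u'] su u(1) uu by simp
      ultimately show ?thesis by blast
    qed
  qed
qed

section \<open>The last step of the filtration\<close>

text \<open>The last step \<open>Kext n (n - 1) \<subseteq> thick n\<close> adds the words \<open>v @ n # y # r\<close> with \<open>n \<notin> set v\<close>.
  If \<open>v\<close> is empty or \<open>[y]\<close>, they are matched by the star at \<open>n\<close>, otherwise by appending \<open>y\<close> to \<open>v\<close>.\<close>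

definition Mcase :: "nat \<Rightarrow> nat list \<Rightarrow> bool" where
  "Mcase n w \<longleftrightarrow> (\<exists>y r. y \<noteq> n \<and> (w = n # y # r \<or> w = y # n # y # r))"

definition Mpre :: "nat \<Rightarrow> nat list \<Rightarrow> nat list" where
  "Mpre n w = takeWhile (\<lambda>x. x \<noteq> n) w"

text \<open>Lower partners of the second kind: the letter before the first \<open>n\<close> differs
  from the letter \<open>y\<close> behind it, so \<open>y\<close> can be inserted between
  \<open>v\<close> and \<open>n\<close>.\<close>

definition MIb :: "nat \<Rightarrow> nat list set" where
  "MIb n = {w. set w = {..n} \<and> distinct_adj w \<and>
     (\<exists>v y r. w = v @ n # y # r \<and> n \<notin> set v \<and> v \<noteq> [] \<and> last v \<noteq> y)}"

definition MIa :: "nat \<Rightarrow> nat list set" where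
  "MIa n = {w. set w = {..n} \<and> distinct_adj w \<and> Mcase n w \<and> last (alt_prefix n w) \<noteq> n}"

definition Mup :: "nat \<Rightarrow> nat list \<Rightarrow> nat list" where
  "Mup n w = (if Mcase n w then star_up n w
     else Mpre n w @ w ! Suc (length (Mpre n w)) # drop (length (Mpre n w)) w)"

definition Mdn :: "nat \<Rightarrow> nat list \<Rightarrow> nat list" where
  "Mdn n w = (if Mcase n w then star_down n w
     else butlast (Mpre n w) @ drop (length (Mpre n w)) w)"

definition Mix :: "nat \<Rightarrow> nat list \<Rightarrow> nat" where
  "Mix n w = (if Mcase n w then length (alt_prefix n w) else length (Mpre n w))"

text \<open>A lexicographic order coded as one number in base \<open>Suc (length w)\<close>: a
  longer segment before the first \<open>n\<close> means smaller rank, then a longer alternating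
  prefix does. Outside \<open>Mcase\<close> the prefix counts as 0, so such words come last among
  those of the same length with equal leading digit.\<close>

definition Mrk :: "nat \<Rightarrow> nat list \<Rightarrow> nat" where
  "Mrk n w = (length w - length (Mpre n w)) * Suc (length w) +
     (length w - (if Mcase n w then length (alt_prefix n w) else 0))"

lemma Mpre_app: "n \<notin> set v \<Longrightarrow> Mpre n (v @ n # s) = v"
  unfolding Mpre_def by (auto simp: takeWhile_append)

lemma Mcase_app:
  assumes "n \<notin> set v" "y \<noteq> n"
  shows "Mcase n (v @ n # y # r) \<longleftrightarrow> v = [] \<or> v = [y]"
proof (cases v)
  case Nil
  then show ?thesis using assms unfolding Mcase_def by auto
next
  case (Cons x v')
  then show ?thesis using assms unfolding Mcase_def by (cases v') auto
qed

text \<open>The other letter of the alternating prefix is the \<open>y\<close> of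
  \<open>Mcase\<close>. The prefix alone thus shows that \<open>Mcase\<close> applies, and so it
  does to all words beginning with this prefix.\<close>

lemma Mcase_alt_prefix:
  assumes m: "Mcase n w" and s: "set w = {..n}" and n: "2 \<le> n" and d: "distinct_adj w"
  obtains y u b r where "y \<noteq> n" "w = u @ b # r" "alt_dec n u y b" "alt_prefix n w = u"
    "(\<exists>t. u = n # y # t) \<or> (\<exists>t. u = y # n # y # t)"
proof -
  obtain y t where y: "y \<noteq> n" "w = n # y # t \<or> w = y # n # y # t" using m unfolding Mcase_def by blast
  have f: "first_other n w = y" using y unfolding first_other_def by auto
  have "{..n} \<subseteq> insert n (set w)" using s by auto
  then obtain u a b r where 1: "w = u @ b # r" "alt_dec n u a b"
    using two_letters[OF _ n] alt_dec_ex by metis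
  have a: "a = y" using alt_prefix_dec(1)[OF 1(2), of r] 1(1) f by simp
  have r: "alt_prefix n w = u" using alt_prefix_dec(2)[OF 1(2), of r] 1(1) by simp
  have "(\<exists>t. u = n # y # t) \<or> (\<exists>t. u = y # n # y # t)"
    using y(2)
  proof
    assume e: "w = n # y # t"
    show ?thesis using r f y(1) unfolding alt_prefix_def e by auto
  next
    assume e: "w = y # n # y # t"
    show ?thesis using r f y(1) unfolding alt_prefix_def e by auto
  qed
  then show ?thesis using that[OF y(1) 1(1)] 1(2) a r by blast
qed

lemma Mcase_app_alt_prefix:
  assumes "(\<exists>t. u = n # y # t) \<or> (\<exists>t. u = y # n # y # t)" "y \<noteq> n"
  shows "Mcase n (u @ v)"
  using assms unfolding Mcase_def by auto

lemma MIa_dec: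
  assumes w: "w \<in> MIa n" and n: "2 \<le> n"
  obtains y u b r where "y \<noteq> n" "w = u @ b # r" "alt_dec n u y b" "alt_prefix n w = u" "last u = y"
    "(\<exists>t. u = n # y # t) \<or> (\<exists>t. u = y # n # y # t)" "set w = {..n}" "distinct_adj w"
    "Mup n w = u @ n # b # r" "Mcase n w" "Mix n w = length u" "Mdn n (Mup n w) = w"
    "Mcase n (Mup n w)" "alt_prefix n (Mup n w) = u @ [n]" "distinct_adj (Mup n w)"
proof -
  have 0: "set w = {..n}" "distinct_adj w" "Mcase n w" "last (alt_prefix n w) \<noteq> n" using w unfolding MIa_def by auto
  obtain y u b r where 1: "y \<noteq> n" "w = u @ b # r" "alt_dec n u y b" "alt_prefix n w = u"
    "(\<exists>t. u = n # y # t) \<or> (\<exists>t. u = y # n # y # t)" using Mcase_alt_prefix[OF 0(3,1) n 0(2)] by blast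
  have l: "last u \<noteq> n" using 0 1 by simp
  note su = star_up_dec[OF 1(3) l 0(2)[unfolded 1(2)]]
  have up: "Mup n w = u @ n # b # r" using 0(3) su(1) 1(2) unfolding Mup_def by simp
  have mc: "Mcase n (u @ n # b # r)" using Mcase_app_alt_prefix[OF 1(5,1)] .
  show ?thesis
  proof (rule that[OF 1(1-4) _ 1(5) 0(1,2) up 0(3)])
    show "last u = y" using alt_dec_last[OF 1(3)] l by blast
    show "Mix n w = length u" unfolding Mix_def using 0(3) 1(4) by simp
    show "Mdn n (Mup n w) = w" unfolding Mdn_def up using mc su(4) 1(2) by simp
    show "Mcase n (Mup n w)" unfolding up by (rule mc)
    show "alt_prefix n (Mup n w) = u @ [n]" unfolding up using alt_prefix_dec(2)[OF su(3), of r] by simp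
    show "distinct_adj (Mup n w)" unfolding up by (rule su(2))
  qed
qed

lemma MIb_dec:
  assumes w: "w \<in> MIb n"
  obtains v y r where "w = v @ n # y # r" "n \<notin> set v" "v \<noteq> []" "last v \<noteq> y" "y \<noteq> n"
    "set w = {..n}" "distinct_adj w" "\<not> Mcase n w" "Mup n w = v @ y # n # y # r" "Mix n w = length v"
    "Mdn n (Mup n w) = w" "\<not> Mcase n (Mup n w)" "Mpre n w = v" "distinct_adj (Mup n w)"
proof -
  obtain v y r where 1: "w = v @ n # y # r" "n \<notin> set v" "v \<noteq> []" "last v \<noteq> y"
    and 0: "set w = {..n}" "distinct_adj w" using w unfolding MIb_def by blast
  have y: "y \<noteq> n" using 0(2) 1(1) by (auto simp: distinct_adj_append_iff)
  have c: "\<not> Mcase n w" using Mcase_app[OF 1(2) y, of r] 1 by auto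
  have pre: "Mpre n w = v" using Mpre_app[OF 1(2)] 1(1) by simp
  have up: "Mup n w = v @ y # n # y # r" using c pre 1(1) unfolding Mup_def by (simp add: nth_append)
  have vy: "n \<notin> set (v @ [y])" using 1(2) y by simp
  have c': "\<not> Mcase n (Mup n w)" using Mcase_app[OF vy y, of r] 1(3) up by simp
  have pre': "Mpre n (Mup n w) = v @ [y]" using Mpre_app[OF vy, of "y # r"] up by simp
  have "Mdn n (Mup n w) = w" unfolding Mdn_def using c' pre' up 1(1) by simp
  moreover have "Mix n w = length v" unfolding Mix_def using c pre by simp
  moreover have "distinct_adj (Mup n w)"
    unfolding up using 0(2) 1 y by (auto simp: distinct_adj_append_iff)
  ultimately show ?thesis using that[OF 1 y 0 c up] c' pre by blast
qed

text \<open>A change of the leading digit outweighs the second digit, which is at most the common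
  length.\<close>

lemma Mrk_less_pre:
  assumes "length f = length w" "length (Mpre n w) < length (Mpre n f)"
  shows "Mrk n f < Mrk n w"
proof -
  have le: "length (Mpre n f) \<le> length f" unfolding Mpre_def by (rule length_takeWhile_le)
  define L where "L = length w"
  define a where "a = L - length (Mpre n f)"
  define b where "b = L - length (Mpre n w)"
  have "Suc a \<le> b" unfolding a_def b_def L_def using assms le by simp
  then have "Suc a * Suc L \<le> b * Suc L" by (rule mult_le_mono1)
  then have "a * Suc L + L < b * Suc L" by simp
  moreover have "Mrk n f \<le> a * Suc L + L" unfolding Mrk_def a_def L_def using assms(1) by simp
  moreover have "b * Suc L \<le> Mrk n w" unfolding Mrk_def b_def L_def by simp
  ultimately show ?thesis by linarith
qed

lemma Mrk_less_alt_prefix: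
  assumes "length f = length w" "length (Mpre n w) = length (Mpre n f)" "Mcase n f"
    "(if Mcase n w then length (alt_prefix n w) else 0) < length (alt_prefix n f)"
  shows "Mrk n f < Mrk n w"
proof -
  have le: "length (alt_prefix n f) \<le> length f" unfolding alt_prefix_def by (rule length_takeWhile_le)
  define r where "r = (if Mcase n w then length (alt_prefix n w) else 0)"
  have "length w - length (alt_prefix n f) < length w - r" using le assms unfolding r_def by linarith
  then show ?thesis unfolding Mrk_def r_def using assms by simp
qed

text \<open>Faces whose alternating prefix still ends in \<open>n\<close> are not lower partners
  (\<open>star_no\<close>). Two kinds remain: for \<open>u = [n, y]\<close> dropping the first
  letter lengthens the segment before \<open>n\<close>, and dropping \<open>b\<close> in front of
  another \<open>y\<close> lengthens the alternating prefix. Both lower the rank.\<close>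

lemma M_face_a:
  assumes n: "2 \<le> n" and w: "w \<in> MIa n" and j: "j < length (Mup n w)" "j \<noteq> Mix n w"
    and f: "del j (Mup n w) \<in> MIa n \<union> MIb n"
  shows "Mrk n (del j (Mup n w)) < Mrk n w"
proof -
  obtain y u b r where 1: "y \<noteq> n" "w = u @ b # r" "alt_dec n u y b" "alt_prefix n w = u" "last u = y"
    "(\<exists>t. u = n # y # t) \<or> (\<exists>t. u = y # n # y # t)" "set w = {..n}" "distinct_adj w"
    "Mup n w = u @ n # b # r" "Mcase n w" "Mix n w = length u" by (rule MIa_dec[OF w n])
  define g where "g = del j (Mup n w)"
  have gI: "g \<in> MIa n \<or> g \<in> MIb n" using f unfolding g_def by blast
  have da: "distinct_adj g" and full: "set g = {..n}" using gI unfolding MIa_def MIb_def by auto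
  have lg: "length g = length w" unfolding g_def using length_del[OF j(1)] 1(2,9) by simp
  have b: "b \<noteq> y" "b \<noteq> n" using 1(3) unfolding alt_dec_def by auto
  have ln: "last u \<noteq> n" using 1 by simp
  have star_no: "g \<notin> MIa n \<union> MIb n" if "g = x @ n # b # s" "alt_dec n (x @ [n]) y b"
    "(\<exists>t. x @ [n] = n # y # t) \<or> (\<exists>t. x @ [n] = y # n # y # t)" for x s
  proof -
    have "alt_prefix n g = x @ [n]" using alt_prefix_dec(2)[OF that(2), of s] that(1) by simp
    then have "g \<notin> MIa n" unfolding MIa_def by simp
    moreover have "Mcase n g" using Mcase_app_alt_prefix[OF that(3) 1(1), of "b # s"] that(1) by simp
    then have "g \<notin> MIb n" by (meson MIb_dec)
    ultimately show ?thesis by blast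
  qed
  have ru: "alt_dec n (u @ [n]) y b" using 1(3) unfolding alt_dec_def by auto
  have cu: "(\<exists>t. u @ [n] = n # y # t) \<or> (\<exists>t. u @ [n] = y # n # y # t)" using 1(6) by auto
  have j': "j < length (u @ n # b # r)" "j \<noteq> length u" "distinct_adj (del j (u @ n # b # r))"
    using j da 1 unfolding g_def by auto
  from 1(3) ln 1(8)[unfolded 1(2)] j' have "Mrk n g < Mrk n w"
  proof (cases rule: star_up_face_cases)
    case first
    then have g: "g = tl u @ n # b # r" unfolding g_def 1(9) by simp
    consider "u = [n, y]" | t where "u = n # y # n # t" | t where "u = n # y # t" "t \<noteq> []" "hd t \<noteq> n" | t where "u = y # n # y # t"
      using 1(6) by (metis list.collapse)
    then show ?thesis
    proof cases
      case 1
      then have "Mpre n g = [y]" "Mpre n w = []" using \<open>y \<noteq> n\<close> g \<open>w = u @ b # r\<close> unfolding Mpre_def by auto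
      then show ?thesis using Mrk_less_pre[OF lg] by simp
    next
      case (2 t)
      have t: "t \<noteq> []" using 2 \<open>last u = y\<close> \<open>y \<noteq> n\<close> by auto
      have "hd t \<noteq> n" using \<open>distinct_adj w\<close> \<open>w = u @ b # r\<close> 2 t by (cases t) auto
      then have "hd t = y" using 1(3) 2 t unfolding alt_dec_def by (cases t) auto
      then obtain t' where "t = y # t'" using t by (cases t) auto
      then have "g \<notin> MIa n \<union> MIb n"
        by (intro star_no[OF g]) (use 2 1(3) in \<open>auto simp: alt_dec_def\<close>)
      then show ?thesis using gI by blast
    next
      \<comment> \<open>Impossible: after \<open>n\<close> and \<open>y\<close> the alternating word
        continues with \<open>n\<close>.\<close>
      case (3 t)
      have "hd t \<noteq> y" using \<open>distinct_adj w\<close> \<open>w = u @ b # r\<close> 3 by (cases t) auto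
      moreover have "hd t \<in> {y, n}" using 1(3) 3 unfolding alt_dec_def by (cases t) auto
      ultimately show ?thesis using 3 by simp
    next
      case (4 t)
      then have "g \<notin> MIa n \<union> MIb n"
        by (intro star_no[OF g]) (use 1(3) in \<open>auto simp: alt_dec_def\<close>)
      then show ?thesis using gI by blast
    qed
  next
    case bb
    then have g: "g = u @ n # r" unfolding g_def 1(9) by simp
    \<comment> \<open>Otherwise the face would contain only the letters \<open>y\<close> and
      \<open>n\<close>, whereas a lower partner contains all \<open>n + 1\<close> letters, which are
      at least three.\<close>
    have "r \<noteq> []"
    proof
      assume "r = []"
      then have "set g \<subseteq> {y, n}" using g 1(3) unfolding alt_dec_def by auto
      then have "card {..n} \<le> card {y, n}" using full card_mono[of "{y,n}" "{..n}"] by simp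
      then show False using n card_insert_le_m1[of 2 "{n}" y] by (simp split: if_splits)
    qed
    then obtain s0 s where r: "r = s0 # s" by (cases r) auto
    have s0: "s0 \<noteq> n" using da g r by (auto simp: distinct_adj_append_iff)
    show ?thesis
    proof (cases "s0 = y")
      case True
      have mg: "Mcase n g" using Mcase_app_alt_prefix[OF 1(6,1)] g by simp
      have fg: "first_other n g = y"
        using 1(6,1) g unfolding first_other_def by auto
      have "takeWhile (\<lambda>x. x = n \<or> x = y) (u @ n # y # s) = u @ n # y # takeWhile (\<lambda>x. x = n \<or> x = y) s"
        using 1(3) unfolding alt_dec_def by (subst takeWhile_append2) auto
      then have "length (alt_prefix n g) > length u" unfolding alt_prefix_def fg using g r True by simp
      moreover have "length (Mpre n g) = length (Mpre n w)"
        using 1(6,1,2) g unfolding Mpre_def by auto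
      ultimately show ?thesis using Mrk_less_alt_prefix[OF lg _ mg] 1(4,10) by simp
    next
      case False
      have "alt_dec n (u @ [n]) y s0" using ru False s0 unfolding alt_dec_def by blast
      then have "alt_prefix n g = u @ [n]" using alt_prefix_dec(2)[of n "u @ [n]" y s0 s] g r by simp
      then have "g \<notin> MIa n" unfolding MIa_def by simp
      moreover have "Mcase n g" using Mcase_app_alt_prefix[OF 1(6,1)] g by simp
      then have "g \<notin> MIb n" by (meson MIb_dec)
      ultimately show ?thesis using gI by blast
    qed
  next
    case (later j')
    then have "g = u @ n # b # del j' r" unfolding g_def 1(9) by simp
    then show ?thesis using star_no[OF _ ru cu] gI by blast
  qed
  then show ?thesis unfolding g_def .
qed

text \<open>In \<open>v @ y # n # y # r\<close>, deleting \<open>n\<close> gives equal neighbours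
  and deleting the second \<open>y\<close> moves the first \<open>n\<close> further back. Other
  deletions keep the shape of an upper partner, unless \<open>v\<close> has a single letter: then
  \<open>y # n # y # r\<close> falls under \<open>Mcase\<close> and has a smaller second
  digit.\<close>

lemma M_face_b:
  assumes n: "2 \<le> n" and w: "w \<in> MIb n" and j: "j < length (Mup n w)" "j \<noteq> Mix n w"
    and f: "del j (Mup n w) \<in> MIa n \<union> MIb n"
  shows "Mrk n (del j (Mup n w)) < Mrk n w"
proof -
  obtain v y r where 1: "w = v @ n # y # r" "n \<notin> set v" "v \<noteq> []" "last v \<noteq> y" "y \<noteq> n"
    "set w = {..n}" "distinct_adj w" "\<not> Mcase n w" "Mup n w = v @ y # n # y # r" "Mix n w = length v"
    "Mpre n w = v" by (rule MIb_dec[OF w])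
  define g where "g = del j (Mup n w)"
  have gI: "g \<in> MIa n \<or> g \<in> MIb n" using f unfolding g_def by blast
  have da: "distinct_adj g" and full: "set g = {..n}" using gI unfolding MIa_def MIb_def by auto
  have lg: "length g = length w" unfolding g_def using length_del[OF j(1)] 1(1,9) by simp
  have typ2: "g \<notin> MIa n \<union> MIb n" if g: "g = x @ n # y # s" and x: "n \<notin> set x" "x \<noteq> []" "x \<noteq> [y]" "last x = y" for x s
  proof -
    have "\<not> Mcase n g" using Mcase_app[OF x(1) 1(5), of s] x g by simp
    then have "g \<notin> MIa n" unfolding MIa_def by simp
    moreover have "g \<notin> MIb n"
    proof
      assume "g \<in> MIb n"
      then obtain v' y' r' where 2: "g = v' @ n # y' # r'" "n \<notin> set v'" "last v' \<noteq> y'" by (rule MIb_dec)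
      have "v' = x" using Mpre_app[OF 2(2)] Mpre_app[OF x(1)] 2(1) g by metis
      then show False using 2 g x(4) by simp
    qed
    ultimately show ?thesis by blast
  qed
  consider "j < length v" | "j = Suc (length v)" | "j = Suc (Suc (length v))" | i where "j = length v + Suc (Suc (Suc i))" "i < length r"
  proof -
    have "j < length v \<or> j = Suc (length v) \<or> j = Suc (Suc (length v)) \<or> (\<exists>i<length r. j = length v + Suc (Suc (Suc i)))"
      using j unfolding 1(9,10) by simp presburger
    then show ?thesis using that by blast
  qed
  then have "Mrk n g < Mrk n w"
  proof cases
    case 1
    then have g: "g = (del j v @ [y]) @ n # y # r" unfolding g_def \<open>Mup n w = _\<close> by (simp add: del_append)
    have nd: "n \<notin> set (del j v @ [y])" using set_del[of j v] \<open>n \<notin> set v\<close> \<open>y \<noteq> n\<close> by auto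
    show ?thesis
    proof (cases "del j v = []")
      case True
      then have "length v = 1" using length_del[OF 1] 1 by (metis One_nat_def Suc_pred length_greater_0_conv list.size(3) \<open>v \<noteq> []\<close>)
      have gg: "g = y # n # y # r" using g True by simp
      then have mg: "Mcase n g" unfolding Mcase_def using \<open>y \<noteq> n\<close> by blast
      have "length (Mpre n g) = 1" using Mpre_app[OF nd] g True by (metis One_nat_def append_Nil length_Cons list.size(3))
      moreover have "0 < length (alt_prefix n g)" unfolding gg alt_prefix_def first_other_def using \<open>y \<noteq> n\<close> by simp
      ultimately show ?thesis
        using Mrk_less_alt_prefix[OF lg _ mg] \<open>length v = 1\<close> \<open>Mpre n w = v\<close> \<open>\<not> Mcase n w\<close> by simp
    next
      case False
      then have "g \<notin> MIa n \<union> MIb n" by (intro typ2[OF g nd]) auto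
      then show ?thesis using gI by blast
    qed
  next
    case 2
    then have "g = v @ y # y # r" unfolding g_def \<open>Mup n w = _\<close> by (simp add: del_append)
    then show ?thesis using da by (simp add: distinct_adj_append_iff)
  next
    case 3
    then have g: "g = (v @ [y]) @ n # r" unfolding g_def \<open>Mup n w = _\<close> by (simp add: del_append numeral_2_eq_2)
    have "n \<notin> set (v @ [y])" using \<open>n \<notin> set v\<close> \<open>y \<noteq> n\<close> by simp
    then have "Mpre n g = v @ [y]" using Mpre_app g by metis
    then show ?thesis using Mrk_less_pre[OF lg] \<open>Mpre n w = v\<close> by simp
  next
    case (4 i)
    then have g: "g = (v @ [y]) @ n # y # del i r" unfolding g_def \<open>Mup n w = _\<close> by (simp add: del_append numeral_3_eq_3)
    have "g \<notin> MIa n \<union> MIb n"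
      by (rule typ2[OF g]) (use \<open>n \<notin> set v\<close> \<open>y \<noteq> n\<close> \<open>v \<noteq> []\<close> in auto)
    then show ?thesis using gI by blast
  qed
  then show ?thesis unfolding g_def .
qed

text \<open>For words with all letters, \<open>Kset n (n - 1)\<close> requires that no smaller
  letter follows an \<open>n\<close>; without equal neighbours this puts \<open>n\<close> at the end
  only.\<close>

lemma Kext_last:
  assumes s: "set w = {..n}" and n: "0 < n" and d: "distinct_adj w"
  shows "w \<in> Kext n (n - 1) \<longleftrightarrow> \<not> (\<exists>v y r. w = v @ n # y # r \<and> n \<notin> set v)"
proof -
  have "n \<in> set w" using s by simp
  then obtain v t where w: "w = v @ n # t" "n \<notin> set v" using split_list_first by metis
  have 1: "w \<in> Kext n (n - 1) \<longleftrightarrow> sorted_wrt (\<lambda>x y. x \<le> n - 1 \<or> x \<le> y) w"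
    using s unfolding Kext_def Kset_def thick_bdry_def thick_def by auto
  show ?thesis
  proof
    assume "w \<in> Kext n (n - 1)"
    then have so: "sorted_wrt (\<lambda>x y. x \<le> n - 1 \<or> x \<le> y) w" using 1 by blast
    show "\<not> (\<exists>v y r. w = v @ n # y # r \<and> n \<notin> set v)"
    proof (rule notI, elim exE conjE)
      fix v y r assume w: "w = v @ n # y # r"
      have "n \<le> n - 1 \<or> n \<le> y" using so unfolding w by (auto simp: sorted_wrt_append)
      moreover have "y \<in> set w" using w by simp
      then have "y \<le> n" using s by simp
      moreover have "y \<noteq> n" using d unfolding w distinct_adj_append_iff by auto
      ultimately show False using n by linarith
    qed
  next
    assume no: "\<not> (\<exists>v y r. w = v @ n # y # r \<and> n \<notin> set v)"
    have "t = []" using no w by (cases t) auto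
    then have w': "w = v @ [n]" using w by simp
    have v: "x \<le> n - 1" if "x \<in> set v" for x
    proof -
      have "x \<in> set w" using w that by simp
      then have "x \<le> n" using s by simp
      moreover have "x \<noteq> n" using w(2) that by blast
      ultimately show ?thesis by linarith
    qed
    have "sorted_wrt (\<lambda>x y. x \<le> n - 1 \<or> x \<le> y) v"
      unfolding sorted_wrt_iff_nth_less using v nth_mem by (meson order.strict_trans)
    then have "sorted_wrt (\<lambda>x y. x \<le> n - 1 \<or> x \<le> y) w"
      using v unfolding w' by (simp add: sorted_wrt_append)
    then show "w \<in> Kext n (n - 1)" using 1 by blast
  qed
qed

text \<open>For empty \<open>v\<close>, putting \<open>y\<close> in front of
  \<open>n # y # r\<close> would be an outer insertion. Hence the words \<open>n # y # r\<close> and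
  \<open>y # n # y # r\<close> are withdrawn from the main rule and matched by the star with centre
  \<open>n\<close>, whose insertions are inner.\<close>

lemma M_matching:
  assumes n: "2 \<le> n"
  shows "matching n (Kext n (n - 1)) (thick n) (MIa n \<union> MIb n) (Mup n) (Mix n) (Mrk n)"
proof -
  have n0: "0 < n" using n by simp
  have thick: "w \<in> thick n" if "set w = {..n}" for w using that unfolding thick_def by auto
  have out: "w \<notin> Kext n (n - 1)" if o: "Mcase n w" "set w = {..n}" "distinct_adj w" for w
  proof -
    obtain y r where y: "y \<noteq> n" "w = [] @ n # y # r \<or> w = [y] @ n # y # r" using o(1) unfolding Mcase_def append_Nil append_Cons by blast
    have "\<exists>v y r. w = v @ n # y # r \<and> n \<notin> set v"
    proof (rule disjE[OF y(2)])
      show ?thesis if "w = [] @ n # y # r" using that by (intro exI[of _ "[]"]) simp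
      show ?thesis if "w = [y] @ n # y # r" using that y(1) by (intro exI[of _ "[y]"]) simp
    qed
    then show ?thesis using Kext_last[OF o(2) n0 o(3)] by blast
  qed
  show ?thesis
  proof
    show "sset (Kext n (n - 1))" "sset (thick n)" by (rule sset_Kext, rule sset_thick)
    show "Kext n (n - 1) \<subseteq> thick n" unfolding Kext_def Kset_def thick_bdry_def by blast
    show "thick n \<subseteq> thick n" ..
  next
    fix w assume "w \<in> MIa n \<union> MIb n"
    then consider "w \<in> MIa n" | "w \<in> MIb n" by blast
    then show "w \<in> thick n \<and> w \<notin> Kext n (n - 1) \<and> distinct_adj w"
    proof cases
      case 1
      then show ?thesis using out[of w] thick unfolding MIa_def by blast
    next
      case 2
      then show ?thesis using Kext_last[OF _ n0, of w] thick unfolding MIb_def by blast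
    qed
  next
    fix w assume "w \<in> MIa n \<union> MIb n"
    then consider "w \<in> MIa n" | "w \<in> MIb n" by blast
    then show "Mup n w \<in> thick n \<and> Mup n w \<notin> Kext n (n - 1) \<and> Mup n w \<notin> MIa n \<union> MIb n \<and> distinct_adj (Mup n w)"
    proof cases
      case 1
      then obtain y u b r where 2: "w = u @ b # r" "set w = {..n}" "Mup n w = u @ n # b # r" "Mcase n (Mup n w)"
        "alt_prefix n (Mup n w) = u @ [n]" "distinct_adj (Mup n w)" by (rule MIa_dec[OF _ n])
      have "set (u @ n # b # r) = insert n (set (u @ b # r))" by auto
      then have s: "set (Mup n w) = {..n}" using 2(1,2,3) by (metis atMost_iff insert_absorb order_refl)
      have "Mup n w \<notin> MIa n" using 2(5) unfolding MIa_def by simp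
      moreover have "Mup n w \<notin> MIb n" using 2(4) by (meson MIb_dec)
      ultimately show ?thesis using out[OF 2(4) s 2(6)] thick[OF s] 2(6) by blast
    next
      case 2
      then obtain v y r where 3: "w = v @ n # y # r" "n \<notin> set v" "y \<noteq> n" "set w = {..n}" "Mup n w = v @ y # n # y # r"
        "\<not> Mcase n (Mup n w)" "distinct_adj (Mup n w)" by (rule MIb_dec)
      have "set (v @ y # n # y # r) = set (v @ n # y # r)" by auto
      then have s: "set (Mup n w) = {..n}" using 3(1,4,5) by metis
      have nv: "n \<notin> set (v @ [y])" using 3 by simp
      have e: "Mup n w = (v @ [y]) @ n # y # r" using 3 by simp
      have "Mup n w \<notin> MIa n" using 3(6) unfolding MIa_def by blast
      moreover have "Mup n w \<notin> MIb n"
      proof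
        assume "Mup n w \<in> MIb n"
        then obtain v' y' r' where 4: "Mup n w = v' @ n # y' # r'" "n \<notin> set v'" "last v' \<noteq> y'" by (rule MIb_dec)
        have "v' = v @ [y]" using Mpre_app[OF 4(2)] Mpre_app[OF nv] 4(1) e by metis
        then show False using 4 e by simp
      qed
      moreover have "Mup n w \<notin> Kext n (n - 1)" using Kext_last[OF s n0 3(7)] e nv by blast
      ultimately show ?thesis using thick[OF s] 3(7) by blast
    qed
  next
    fix w assume "w \<in> MIa n \<union> MIb n"
    then consider "w \<in> MIa n" | "w \<in> MIb n" by blast
    then show "0 < Mix n w \<and> Suc (Mix n w) < length (Mup n w) \<and> del (Mix n w) (Mup n w) = w"
    proof cases
      case 1
      then obtain u b r y where 2: "w = u @ b # r" "alt_dec n u y b" "Mup n w = u @ n # b # r" "Mix n w = length u"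
        by (rule MIa_dec[OF _ n])
      then show ?thesis using alt_dec_last[OF 2(2)] by (simp add: del_append)
    next
      case 2
      then obtain v y r where 3: "w = v @ n # y # r" "v \<noteq> []" "Mup n w = v @ y # n # y # r" "Mix n w = length v"
        by (rule MIb_dec)
      then show ?thesis by (simp add: del_append)
    qed
  next
    show "inj_on (Mup n) (MIa n \<union> MIb n)"
    proof (rule inj_on_inverseI)
      fix w assume "w \<in> MIa n \<union> MIb n"
      then show "Mdn n (Mup n w) = w"
      proof
        assume "w \<in> MIa n" then show ?thesis by (rule MIa_dec[OF _ n])
      next
        assume "w \<in> MIb n" then show ?thesis by (rule MIb_dec)
      qed
    qed
  next
    fix w assume w: "w \<in> thick n" "w \<notin> Kext n (n - 1)" and d: "distinct_adj w"
    have s: "set w = {..n}" using w unfolding Kext_def thick_bdry_def thick_def by auto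
    obtain v y r where 1: "w = v @ n # y # r" "n \<notin> set v" using w(2) Kext_last[OF s n0 d] by blast
    have y: "y \<noteq> n" using d unfolding 1(1) distinct_adj_append_iff by auto
    show "w \<in> (MIa n \<union> MIb n) \<union> Mup n ` (MIa n \<union> MIb n)"
    proof (cases "Mcase n w")
      case True
      obtain y u b r where 2: "y \<noteq> n" "w = u @ b # r" "alt_dec n u y b" "alt_prefix n w = u"
        "(\<exists>t. u = n # y # t) \<or> (\<exists>t. u = y # n # y # t)" by (rule Mcase_alt_prefix[OF True s n d])
      show ?thesis
      proof (cases "last u = n")
        case False
        then show ?thesis using True s d 2(4) unfolding MIa_def by blast
      next
        case l: True
        note sd = star_down_dec[OF 2(3) l d[unfolded 2(2)]]
        \<comment> \<open>Removing the final \<open>n\<close> keeps the initial \<open>n\<close>,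
          \<open>y\<close> or \<open>y\<close>, \<open>n\<close>, \<open>y\<close>, because these
          end in \<open>y\<close>.\<close>
        have c: "(\<exists>t. butlast u = n # y # t) \<or> (\<exists>t. butlast u = y # n # y # t)"
        proof (rule disjE[OF 2(5)])
          show ?thesis if e: "\<exists>t. u = n # y # t"
          proof -
            obtain t where t: "u = n # y # t" using e by blast
            then have "t \<noteq> []" using l 2(1) by auto
            then show ?thesis using t by auto
          qed
          show ?thesis if e: "\<exists>t. u = y # n # y # t"
          proof -
            obtain t where t: "u = y # n # y # t" using e by blast
            then have "t \<noteq> []" using l 2(1) by auto
            then show ?thesis using t by auto
          qed
        qed
        have mc: "Mcase n (butlast u @ b # r)" using Mcase_app_alt_prefix[OF c 2(1)] .
        have su: "set u = insert n (set (butlast u))" using arg_cong[OF sd(4), of set] by simp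
        have "n \<in> set (butlast u)" using c by auto
        then have "set (butlast u @ b # r) = {..n}" using s su 2(2) by auto
        moreover have "last (alt_prefix n (butlast u @ b # r)) \<noteq> n"
          using alt_prefix_dec(2)[OF sd(1), of r] sd(2) 2(1) by simp
        ultimately have "butlast u @ b # r \<in> MIa n" unfolding MIa_def using sd(5) mc by simp
        moreover have "Mup n (butlast u @ b # r) = w" unfolding Mup_def using mc sd(6) 2(2) by simp
        ultimately show ?thesis by blast
      qed
    next
      case False
      have vc: "v \<noteq> []" "v \<noteq> [y]" using Mcase_app[OF 1(2) y, of r] False 1(1) by auto
      show ?thesis
      proof (cases "last v = y")
        case False
        then have "w \<in> MIb n" unfolding MIb_def using s d 1 vc by blast
        then show ?thesis by blast
      next
        case True
        define v' where "v' = butlast v"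
        have vv: "v = v' @ [y]" unfolding v'_def using append_butlast_last_id[OF vc(1)] True by simp
        have v': "v' \<noteq> []" "n \<notin> set v'" using vc vv 1(2) by auto
        have da: "distinct_adj (v' @ n # y # r)" and lv: "last v' \<noteq> y"
          using d v' 1 unfolding 1(1) vv distinct_adj_append_iff by (auto dest: last_in_set)
        have "set (v' @ n # y # r) = {..n}" using s unfolding 1(1) vv by auto
        then have "v' @ n # y # r \<in> MIb n" unfolding MIb_def using da lv v' by blast
        moreover have "Mup n (v' @ n # y # r) = w"
        proof -
          have "\<not> Mcase n (v' @ n # y # r)" using Mcase_app[OF v'(2) y, of r] v'(1) lv by auto
          then show ?thesis unfolding Mup_def using Mpre_app[OF v'(2)] 1(1) vv by (simp add: nth_append)
        qed
        ultimately show ?thesis by blast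
      qed
    qed
  next
    fix w j assume w: "w \<in> MIa n \<union> MIb n" and j: "j < length (Mup n w)" "j \<noteq> Mix n w"
      "del j (Mup n w) \<in> MIa n \<union> MIb n"
    then show "Mrk n (del j (Mup n w)) < Mrk n w"
      using M_face_a[OF n _ j] M_face_b[OF n _ j] by blast
  qed
qed

section \<open>Thick simplices as inner expansions\<close>

context cat_ctx
begin

text \<open>A word outside the thick horn contains all letters except possibly \<open>i\<close>,
  hence has length at least \<open>n\<close>. For \<open>k < n\<close> all horns to be filled thus
  have dimension above \<open>k\<close>.\<close>

lemma thick_horn_expansion:
  assumes so: "simplicial_object C X Xm" and M: "mor_class M"
    and h: "\<And>m i. 0 < i \<Longrightarrow> i < m \<Longrightarrow> cov M (HomP (X m)) (ConP X Xm (horn m i)) (faces Xm m (horn m i))"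
    and hi: "\<And>m i. k < m \<Longrightarrow> 0 < i \<Longrightarrow> i < m \<Longrightarrow>
      cov {f. iso C f} (HomP (X m)) (ConP X Xm (horn m i)) (faces Xm m (horn m i))"
    and n: "2 \<le> n" and i: "i \<le> n"
  shows "cov M (ConP X Xm (thick n)) (ConP X Xm (thick_horn n i)) (\<lambda>c. restrict c (thick_horn n i))"
    and "k < n \<Longrightarrow> bijn (ConP X Xm (thick n)) (ConP X Xm (thick_horn n i)) (\<lambda>c. restrict c (thick_horn n i))"
proof -
  note e = expansion_cov[OF so star_matching[OF n i] M, where k = k]
  show "cov M (ConP X Xm (thick n)) (ConP X Xm (thick_horn n i)) (\<lambda>c. restrict c (thick_horn n i))"
    by (rule e(1)) (rule h hi; assumption)+
  assume k: "k < n"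
  have long: "k < length w" if w: "w \<in> starI n i" for w
  proof -
    have "{..n} \<subseteq> insert i (set w)" using w unfolding starI_def by blast
    then have "card {..n} \<le> card (insert i (set w))" by (rule card_mono[rotated]) simp
    also have "\<dots> \<le> Suc (card (set w))" by (rule card_insert_le_m1[of "Suc (card (set w))", simplified]) simp_all
    also have "\<dots> \<le> Suc (length w)" using card_length[of w] by simp
    finally show ?thesis using k by simp
  qed
  show "bijn (ConP X Xm (thick n)) (ConP X Xm (thick_horn n i)) (\<lambda>c. restrict c (thick_horn n i))"
    by (rule e(2)) (rule h hi long; assumption)+
qed

text \<open>The chain \<open>Kext n 0\<close>, ..., \<open>Kext n (n - 1)\<close>,
  \<open>thick n\<close>: \<open>K_matching\<close> supplies every step but the last, and
  \<open>M_matching\<close> supplies the last.\<close>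

lemma thick_bdry_expansion:
  assumes so: "simplicial_object C X Xm" and M: "mor_class M"
    and h: "\<And>m i. 0 < i \<Longrightarrow> i < m \<Longrightarrow> cov M (HomP (X m)) (ConP X Xm (horn m i)) (faces Xm m (horn m i))"
    and hi: "\<And>m i. k < m \<Longrightarrow> 0 < i \<Longrightarrow> i < m \<Longrightarrow>
      cov {f. iso C f} (HomP (X m)) (ConP X Xm (horn m i)) (faces Xm m (horn m i))"
    and n: "2 \<le> n"
  shows "cov M (ConP X Xm (thick n)) (ConP X Xm (simplex n \<union> thick_bdry n)) (\<lambda>c. restrict c (simplex n \<union> thick_bdry n))"
proof -
  have K: "cov M (ConP X Xm (Kext n l)) (ConP X Xm (Kext n 0)) (\<lambda>c. restrict c (Kext n 0)) \<and> Kext n 0 \<subseteq> Kext n l" if "l < n" for l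
    using that
  proof (induction l)
    case 0
    show ?case using restrict_cov_refl[OF so sset_Kext M] by blast
  next
    case (Suc l)
    have mt: "matching n (Kext n l) (Kext n (Suc l)) (KI n (Suc l)) (Kup n (Suc l)) (\<lambda>w. length (Kpre (Suc l) w)) (\<lambda>w. 0)"
      using K_matching[of "Suc l" n] Suc by simp
    have sub: "Kext n l \<subseteq> Kext n (Suc l)" by (rule matching.ST[OF mt])
    have 1: "cov M (ConP X Xm (Kext n l)) (ConP X Xm (Kext n 0)) (\<lambda>c. restrict c (Kext n 0))" "Kext n 0 \<subseteq> Kext n l"
      using Suc by (auto simp del: restrict_apply)
    show ?case
      using restrict_cov_trans[OF so M sset_Kext sset_Kext sset_Kext 1(2) sub 1(1) expansion_cov(1)[OF so mt M h hi]]
        1(2) sub by blast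
  qed
  have "n - 1 < n" using n by simp
  note K' = K[OF this]
  note mt = M_matching[OF n]
  have "cov M (ConP X Xm (thick n)) (ConP X Xm (Kext n 0)) (\<lambda>c. restrict c (Kext n 0))"
    using restrict_cov_trans[OF so M sset_Kext sset_Kext sset_thick _ matching.ST[OF mt] _ expansion_cov(1)[OF so mt M h hi]] K'
    by blast
  then show ?thesis unfolding Kext_def Kset_0 .
qed

end

subsection \<open>Maps out of thick simplices\<close>

definition pos :: "'a list \<Rightarrow> 'a \<Rightarrow> nat" where
  "pos s x = (SOME j. j < length s \<and> s ! j = x)"

lemma pos: "x \<in> set s \<Longrightarrow> pos s x < length s \<and> s ! pos s x = x"
  unfolding pos_def using someI_ex[of "\<lambda>j. j < length s \<and> s ! j = x"] by (auto simp: in_set_conv_nth)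

lemma pos_thick: "w \<noteq> [] \<Longrightarrow> set w \<subseteq> set s \<Longrightarrow> map (pos s) w \<in> thick (dm s) \<and> s \<odot> map (pos s) w = w"
  unfolding thick_def using pos[of _ s] by (fastforce intro: map_idI)

lemma pos_simplex:
  assumes "sorted s" "sorted \<sigma>" "distinct \<sigma>" "s \<noteq> []" "set s \<subseteq> set \<sigma>"
  shows "map (pos \<sigma>) s \<in> simplex (dm \<sigma>) \<and> \<sigma> \<odot> map (pos \<sigma>) s = s"
proof -
  have st: "sorted_wrt (<) \<sigma>" using assms(2,3) by (simp add: strict_sorted_iff)
  have "pos \<sigma> x \<le> pos \<sigma> y" if xy: "x \<in> set s" "y \<in> set s" "x \<le> y" for x y
  proof (rule ccontr)
    have p: "pos \<sigma> x < length \<sigma>" "\<sigma> ! pos \<sigma> x = x" "pos \<sigma> y < length \<sigma>" "\<sigma> ! pos \<sigma> y = y"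
      using pos[of x \<sigma>] pos[of y \<sigma>] xy assms(5) by auto
    assume "\<not> pos \<sigma> x \<le> pos \<sigma> y"
    then have "\<sigma> ! pos \<sigma> y < \<sigma> ! pos \<sigma> x" using sorted_wrt_nth_less[OF st _ p(1)] by simp
    then show False using p xy by simp
  qed
  then have "sorted_wrt (\<lambda>x y. pos \<sigma> x \<le> pos \<sigma> y) s"
    using sorted_wrt_mono_rel[of s "(\<le>)" "\<lambda>x y. pos \<sigma> x \<le> pos \<sigma> y"] assms(1) by blast
  then show ?thesis
    using pos_thick[OF assms(4,5)] unfolding simplex_def by (simp add: sorted_wrt_map)
qed

lemma sub_thick: "\<sigma> \<in> thick n \<Longrightarrow> v \<in> thick (dm \<sigma>) \<Longrightarrow> \<sigma> \<odot> v \<in> thick n \<and> set (\<sigma> \<odot> v) \<subseteq> set \<sigma>"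
proof -
  assume s: "\<sigma> \<in> thick n" and v: "v \<in> thick (dm \<sigma>)"
  have ne: "\<sigma> \<noteq> []" using s unfolding thick_def by blast
  have "j < length \<sigma>" if "j \<in> set v" for j using v ne that unfolding thick_def by (cases \<sigma>) auto
  then have "set (\<sigma> \<odot> v) \<subseteq> set \<sigma>" by auto
  then show ?thesis using s v unfolding thick_def by auto
qed

lemma sub_sub_thick:
  assumes "\<theta> \<noteq> []" "w \<in> thick (dm \<theta>)"
  shows "\<sigma> \<odot> \<theta> \<odot> w = \<sigma> \<odot> (\<theta> \<odot> w)"
proof -
  have "j < length \<theta>" if "j \<in> set w" for j using assms that unfolding thick_def by (cases \<theta>) auto
  then show ?thesis by simp
qed

lemma sub_id_thick: "w \<in> thick n \<Longrightarrow> [0..<Suc n] \<odot> w = w"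
  unfolding thick_def by (auto intro!: map_idI simp: nth_append less_Suc_eq_le simp del: upt_Suc)

text \<open>The words supported on a simplex of \<open>T\<close>.\<close>

definition thickT :: "nat list set \<Rightarrow> nat list set" where
  "thickT T = {w. w \<noteq> [] \<and> sorted_list_of_set (set w) \<in> T}"

text \<open>A subset of the vertices of a simplex spans a face, so a subcomplex of a standard
  simplex is closed under shrinking supports.\<close>

lemma support_in:
  assumes T: "sset T" "T \<subseteq> simplex N" and s: "\<sigma> \<in> T" and A: "A \<subseteq> set \<sigma>" "A \<noteq> {}"
  shows "sorted_list_of_set A \<in> T"
proof -
  have fin: "finite A" using A finite_subset by blast
  have "\<sigma> \<in> simplex N" using T s by blast
  then have so: "sorted \<sigma>" unfolding simplex_iff by simp
  have ne: "\<sigma> \<noteq> []" using sset_ne[OF T(1) s] .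
  have k: "sorted_list_of_set (set \<sigma>) \<in> T"
    using sset_remdups_adj[OF T(1) ne] remdups_adj_sorted[OF so] s by simp
  have "sorted_list_of_set A \<noteq> []" using fin A by simp
  then have "map (pos (sorted_list_of_set (set \<sigma>))) (sorted_list_of_set A) \<in> simplex (dm (sorted_list_of_set (set \<sigma>)))"
    "sorted_list_of_set (set \<sigma>) \<odot> map (pos (sorted_list_of_set (set \<sigma>))) (sorted_list_of_set A) = sorted_list_of_set A"
    using pos_simplex[of "sorted_list_of_set A" "sorted_list_of_set (set \<sigma>)"] fin A by auto
  then show ?thesis using ssetD[OF T(1) k] by metis
qed

lemma sset_thickT:
  assumes T: "sset T" "T \<subseteq> simplex N"
  shows "sset (thickT T)"
  unfolding sset_def
proof (intro ballI conjI)
  fix w assume w: "w \<in> thickT T"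
  then show ne: "w \<noteq> []" unfolding thickT_def by blast
  fix \<theta> assume t: "\<theta> \<in> simplex (dm w)"
  then have "\<theta> \<noteq> []" unfolding simplex_iff by blast
  moreover have "sorted_list_of_set (set w) \<in> T" using w unfolding thickT_def by blast
  then have "sorted_list_of_set (set (w \<odot> \<theta>)) \<in> T"
    using support_in[OF T, of "sorted_list_of_set (set w)" "set (w \<odot> \<theta>)"] sub_set[OF t ne] \<open>\<theta> \<noteq> []\<close> by simp
  ultimately show "w \<odot> \<theta> \<in> thickT T" unfolding thickT_def by simp
qed

lemma thickT_bdry: "thickT (bdry n) = thick_bdry n"
  unfolding thickT_def thick_bdry_def bdry_def thick_def simplex_iff by auto

lemma thickT_horn: "thickT (horn n i) = thick_horn n i"
  unfolding thickT_def thick_horn_def horn_def thick_def simplex_iff by auto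

section \<open>Maps from a subcomplex into the thick mapping objects\<close>

locale thick_ctx = cat_ctx C for C :: "('o,'m) cat" +
  fixes X :: "nat \<Rightarrow> 'o" and Xm :: "nat \<Rightarrow> nat list \<Rightarrow> 'm"
    and Gb :: "nat \<Rightarrow> 'o" and p :: "nat \<Rightarrow> nat list \<Rightarrow> 'm"
  assumes so: "simplicial_object C X Xm"
    and lim: "\<And>n. is_limit C (map_diag X Xm (thick n)) (Gb n) (p n)"
begin

abbreviation gm where "gm \<equiv> thick_map C Gb p"

lemma p_cone: "is_cone C (map_diag X Xm (thick n)) (Gb n) (p n)"
  using lim unfolding is_limit_def by blast

lemma p_hom: "w \<in> thick n \<Longrightarrow> p n w \<in> hom (Gb n) (X (dm w))"
  and p_face: "w \<in> thick n \<Longrightarrow> \<theta> \<in> simplex (dm w) \<Longrightarrow> Xm (dm w) \<theta> \<cdot> p n w = p n (w \<odot> \<theta>)"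
  and Gb_ob: "Gb n \<in> Ob C"
  using p_cone[of n] unfolding is_cone_map_diag by blast+

definition ev :: "nat \<Rightarrow> 'm \<Rightarrow> nat list \<Rightarrow> 'm" where
  "ev n y = (\<lambda>w\<in>thick n. p n w \<cdot> y)"

lemma ev_bijn: "ntr (HomP (Gb n)) (ConP X Xm (thick n)) (ev n)"
  "bijn (HomP (Gb n)) (ConP X Xm (thick n)) (ev n)"
proof -
  have r: "reps (ConP X Xm (thick n)) (Gb n) (restrict (p n) (thick n))"
    by (rule limit_reps[OF sset_thick lim])
  have e: "ac (ConP X Xm (thick n)) (restrict (p n) (thick n)) = ev n"
    unfolding ConP_ac ev_def by (intro ext) simp
  show "ntr (HomP (Gb n)) (ConP X Xm (thick n)) (ev n)" "bijn (HomP (Gb n)) (ConP X Xm (thick n)) (ev n)"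
    using reps_bijn[OF psh_ConP[OF so sset_thick] r] unfolding e by blast+
qed

lemma p_inj:
  assumes "y \<in> hom U (Gb n)" "y' \<in> hom U (Gb n)" "\<And>w. w \<in> thick n \<Longrightarrow> p n w \<cdot> y = p n w \<cdot> y'"
  shows "y = y'"
proof -
  have "ev n y = ev n y'" unfolding ev_def by (rule restrict_ext) (rule assms(3))
  then show ?thesis using bijn_inj[OF ev_bijn(2), of y n U y'] assms(1,2) by (simp add: HomP_def)
qed

lemma p_ex:
  assumes "c \<in> El (ConP X Xm (thick n)) U"
  obtains y where "y \<in> hom U (Gb n)" "\<And>w. w \<in> thick n \<Longrightarrow> p n w \<cdot> y = c w"
proof -
  obtain y where "y \<in> El (HomP (Gb n)) U" "ev n y = c" using bijn_ex[OF ev_bijn(2) assms] by blast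
  then show ?thesis using that[of y] unfolding HomP_def ev_def by auto
qed

lemma sub_cone_gen:
  assumes s: "\<sigma> \<noteq> []" and S: "\<And>v. v \<in> thick (dm \<sigma>) \<Longrightarrow> \<sigma> \<odot> v \<in> S" and d: "d \<in> El (ConP X Xm S) U"
  shows "(\<lambda>v\<in>thick (dm \<sigma>). d (\<sigma> \<odot> v)) \<in> El (ConP X Xm (thick (dm \<sigma>))) U"
proof (rule ConPI)
  show "U \<in> Ob C" by (rule ConP_ob[OF d])
  fix v assume v: "v \<in> thick (dm \<sigma>)"
  show "(\<lambda>v\<in>thick (dm \<sigma>). d (\<sigma> \<odot> v)) v \<in> hom U (X (dm v))" using ConP_hom[OF d S[OF v]] v by simp
  fix \<theta> assume t: "\<theta> \<in> simplex (dm v)"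
  have ne: "v \<noteq> []" using v unfolding thick_def by blast
  show "Xm (dm v) \<theta> \<cdot> (\<lambda>v\<in>thick (dm \<sigma>). d (\<sigma> \<odot> v)) v = (\<lambda>v\<in>thick (dm \<sigma>). d (\<sigma> \<odot> v)) (v \<odot> \<theta>)"
    using ConP_face[OF d S[OF v], of \<theta>] t v ssetD[OF sset_thick v t] sub_sub[OF t ne, of \<sigma>] by simp
qed simp

lemma p_ConP: "restrict (p n) (thick n) \<in> El (ConP X Xm (thick n)) (Gb n)"
  using limit_reps[OF sset_thick lim] unfolding reps_def by blast

text \<open>\<theta> need not be monotone, since any function of vertices acts on thick simplices.
  The flip \<open>[1, 0]\<close> later exchanges the two vertices of the thick 1-simplex.\<close>

lemma gm:
  assumes t: "\<theta> \<in> thick n"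
  shows "gm n \<theta> \<in> hom (Gb n) (Gb (dm \<theta>))" "\<And>w. w \<in> thick (dm \<theta>) \<Longrightarrow> p (dm \<theta>) w \<cdot> gm n \<theta> = p n (\<theta> \<odot> w)"
proof -
  have ne: "\<theta> \<noteq> []" using t unfolding thick_def by blast
  have th: "\<theta> \<odot> v \<in> thick n" if "v \<in> thick (dm \<theta>)" for v using sub_thick[OF t that] by blast
  obtain y where y: "y \<in> hom (Gb n) (Gb (dm \<theta>))" "\<And>w. w \<in> thick (dm \<theta>) \<Longrightarrow> p (dm \<theta>) w \<cdot> y = p n (\<theta> \<odot> w)"
    by (rule p_ex[OF sub_cone_gen[OF ne th p_ConP]]) (use th in auto)
  have "gm n \<theta> = y" unfolding thick_map_def
  proof (rule the_equality)
    fix z assume z: "z \<in> hom (Gb n) (Gb (dm \<theta>)) \<and> (\<forall>\<sigma>\<in>thick (dm \<theta>). p (dm \<theta>) \<sigma> \<cdot> z = p n (\<theta> \<odot> \<sigma>))"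
    show "z = y" by (rule p_inj[of _ "Gb n"]) (use z y in auto)
  qed (use y in auto)
  then show "gm n \<theta> \<in> hom (Gb n) (Gb (dm \<theta>))" "\<And>w. w \<in> thick (dm \<theta>) \<Longrightarrow> p (dm \<theta>) w \<cdot> gm n \<theta> = p n (\<theta> \<odot> w)"
    using y by auto
qed

lemma simplex_thick: "\<theta> \<in> simplex n \<Longrightarrow> \<theta> \<in> thick n"
  unfolding simplex_def by blast

lemma p_gm_cmp:
  assumes "\<theta> \<in> thick n" "w \<in> thick (dm \<theta>)" "y \<in> hom U (Gb n)"
  shows "p (dm \<theta>) w \<cdot> (gm n \<theta> \<cdot> y) = p n (\<theta> \<odot> w) \<cdot> y"
  using assoc[OF p_hom[OF assms(2)] gm(1)[OF assms(1)] assms(3)] gm(2)[OF assms(1,2)] by simp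

lemma gm_cmp:
  assumes t: "\<theta> \<in> thick n" and p: "\<psi> \<in> thick (dm \<theta>)"
  shows "gm (dm \<theta>) \<psi> \<cdot> gm n \<theta> = gm n (\<theta> \<odot> \<psi>)"
proof (rule p_inj)
  have tp: "\<theta> \<odot> \<psi> \<in> thick n" using sub_thick[OF t p] by blast
  have d: "dm (\<theta> \<odot> \<psi>) = dm \<psi>" by simp
  show "gm (dm \<theta>) \<psi> \<cdot> gm n \<theta> \<in> hom (Gb n) (Gb (dm \<psi>))" using cmp_hom[OF gm(1)[OF p] gm(1)[OF t]] .
  show "gm n (\<theta> \<odot> \<psi>) \<in> hom (Gb n) (Gb (dm \<psi>))" using gm(1)[OF tp] unfolding d .
  fix w assume w: "w \<in> thick (dm \<psi>)"
  have pw: "\<psi> \<odot> w \<in> thick (dm \<theta>)" using sub_thick[OF p w] by blast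
  have "\<psi> \<noteq> []" using p unfolding thick_def by blast
  then have e: "\<theta> \<odot> \<psi> \<odot> w = \<theta> \<odot> (\<psi> \<odot> w)" using sub_sub_thick w by blast
  have w': "w \<in> thick (dm (\<theta> \<odot> \<psi>))" using w unfolding d .
  have "p (dm \<psi>) w \<cdot> gm n (\<theta> \<odot> \<psi>) = p n (\<theta> \<odot> (\<psi> \<odot> w))"
    using gm(2)[OF tp w'] unfolding d e .
  then show "p (dm \<psi>) w \<cdot> (gm (dm \<theta>) \<psi> \<cdot> gm n \<theta>) = p (dm \<psi>) w \<cdot> gm n (\<theta> \<odot> \<psi>)"
    using p_gm_cmp[OF p w gm(1)[OF t]] gm(2)[OF t pw] by (simp only:)
qed

lemma so_Gb: "simplicial_object C Gb gm"
  unfolding simplicial_object_def mono_list_simplex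
proof (intro conjI allI impI)
  show "Gb n \<in> Ob C" for n by (rule Gb_ob)
  show "gm n \<theta> \<in> hom (Gb n) (Gb (dm \<theta>))" if "\<theta> \<in> simplex n" for n \<theta>
    using gm(1) simplex_thick[OF that] by blast
  show "gm n [0..<Suc n] = Idm C (Gb n)" for n
  proof (rule p_inj)
    have i: "[0..<Suc n] \<in> thick n" using simplex_thick[OF id_simplex] .
    have d: "dm [0..<Suc n] = n" by simp
    show "gm n [0..<Suc n] \<in> hom (Gb n) (Gb n)" using gm(1)[OF i] unfolding d .
    show "Idm C (Gb n) \<in> hom (Gb n) (Gb n)" using Gb_ob by blast
    fix w assume w: "w \<in> thick n"
    then show "p n w \<cdot> gm n [0..<Suc n] = p n w \<cdot> Idm C (Gb n)"
      using gm(2)[OF i, of w] sub_id_thick[OF w] id_right[OF p_hom[OF w]] unfolding d by simp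
  qed
  show "gm (dm \<theta>) \<psi> \<cdot> gm n \<theta> = gm n (\<theta> \<odot> \<psi>)" if "\<theta> \<in> simplex n \<and> \<psi> \<in> simplex (dm \<theta>)" for n \<theta> \<psi>
    using gm_cmp that simplex_thick by blast
qed

definition supp :: "nat list \<Rightarrow> nat list" where
  "supp w = sorted_list_of_set (set w)"

text \<open>The comparison of Map(T,Gb) with Map(thickT T,X). A word \<open>w\<close> is supported
  on the simplex \<open>supp w\<close> of \<open>T\<close>; its leg is the component of
  \<open>c\<close> there, evaluated at the word of positions of the letters.\<close>

definition thicken :: "nat list set \<Rightarrow> (nat list \<Rightarrow> 'm) \<Rightarrow> nat list \<Rightarrow> 'm" where
  "thicken T c = (\<lambda>w\<in>thickT T. p (dm (supp w)) (map (pos (supp w)) w) \<cdot> c (supp w))"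

lemma supp: "w \<noteq> [] \<Longrightarrow> sorted (supp w) \<and> distinct (supp w) \<and> set (supp w) = set w \<and> supp w \<noteq> [] \<and>
    map (pos (supp w)) w \<in> thick (dm (supp w)) \<and> supp w \<odot> map (pos (supp w)) w = w"
  using pos_thick[of w "supp w"] unfolding supp_def by simp

context
  fixes T N
  assumes T: "sset T" "T \<subseteq> simplex N"
begin

lemma thickT_sub: "\<sigma> \<in> T \<Longrightarrow> v \<in> thick (dm \<sigma>) \<Longrightarrow> \<sigma> \<odot> v \<in> thickT T"
proof -
  assume s: "\<sigma> \<in> T" and v: "v \<in> thick (dm \<sigma>)"
  have "\<sigma> \<in> thick N" using s T simplex_thick by blast
  then have "set (\<sigma> \<odot> v) \<subseteq> set \<sigma>" "\<sigma> \<odot> v \<noteq> []" using sub_thick[OF _ v] v unfolding thick_def by auto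
  then show ?thesis unfolding thickT_def using support_in[OF T s] by auto
qed

text \<open>The value does not depend on how a word is written as \<open>\<sigma> \<odot> v\<close>.
  If \<sigma> has distinct letters, the support of the word is a face of \<sigma>, and positions in
  \<sigma> are unique; a degenerate \<sigma> is replaced by its core \<kappa>.\<close>

lemma thicken_sub:
  assumes c: "c \<in> El (ConP Gb gm T) U" and s: "\<sigma> \<in> T" and v: "v \<in> thick (dm \<sigma>)"
  shows "thicken T c (\<sigma> \<odot> v) = p (dm \<sigma>) v \<cdot> c \<sigma>"
proof -
  have *: "thicken T c (\<sigma> \<odot> v) = p (dm \<sigma>) v \<cdot> c \<sigma>" if s: "\<sigma> \<in> T" and v: "v \<in> thick (dm \<sigma>)" and d: "distinct \<sigma>" for \<sigma> v
  proof -
    define w where "w = \<sigma> \<odot> v"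
    have wT: "w \<in> thickT T" unfolding w_def by (rule thickT_sub[OF s v])
    then have wn: "w \<noteq> []" unfolding thickT_def by blast
    note sp = supp[OF wn]
    have sN': "\<sigma> \<in> simplex N" using s T by blast
    have sN: "\<sigma> \<in> thick N" by (rule simplex_thick[OF sN'])
    have ss: "sorted \<sigma>" using sN' unfolding simplex_iff by blast
    have sw: "set w \<subseteq> set \<sigma>" unfolding w_def using sub_thick[OF sN v] by blast
    define \<theta> where "\<theta> = map (pos \<sigma>) (supp w)"
    have t: "\<theta> \<in> simplex (dm \<sigma>)" "\<sigma> \<odot> \<theta> = supp w"
      using pos_simplex[of "supp w" \<sigma>] sp ss d sw unfolding \<theta>_def by auto
    define x where "x = map (pos (supp w)) w"
    have x: "x \<in> thick (dm \<theta>)" using sp unfolding x_def \<theta>_def by simp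
    have sne: "\<sigma> \<noteq> []" using sN unfolding thick_def by blast
    \<comment> \<open>In each place both sides give the position in \<sigma> of the same letter of
      \<open>w\<close>, and \<sigma> has distinct letters.\<close>
    have "\<theta> \<odot> x = v"
    proof (rule nth_equalityI)
      show l: "length (\<theta> \<odot> x) = length v" unfolding x_def w_def by simp
      fix j assume j: "j < length (\<theta> \<odot> x)"
      then have jl: "j < length w" "j < length v" using l unfolding x_def by auto
      have wj: "w ! j \<in> set w" using jl by simp
      have pw: "pos (supp w) (w ! j) < length (supp w)" "supp w ! pos (supp w) (w ! j) = w ! j"
        using pos[of "w ! j" "supp w"] sp wj by auto
      have "(\<theta> \<odot> x) ! j = pos \<sigma> (w ! j)" using jl pw unfolding x_def \<theta>_def by simp
      moreover have "v ! j \<le> dm \<sigma>" using v jl unfolding thick_def by auto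
      then have vj: "v ! j < length \<sigma>" using sne by (cases \<sigma>) auto
      have "w ! j = \<sigma> ! (v ! j)" unfolding w_def using jl by simp
      moreover have "pos \<sigma> (w ! j) < length \<sigma>" "\<sigma> ! pos \<sigma> (w ! j) = w ! j" using pos[of "w ! j" \<sigma>] sw wj by auto
      ultimately show "(\<theta> \<odot> x) ! j = v ! j" using nth_eq_iff_index_eq[OF d] vj by metis
    qed
    moreover have "c (supp w) = gm (dm \<sigma>) \<theta> \<cdot> c \<sigma>" using ConP_face[OF c s t(1)] t(2) by simp
    moreover have "dm (supp w) = dm \<theta>" unfolding \<theta>_def by simp
    ultimately show ?thesis
      using p_gm_cmp[OF simplex_thick[OF t(1)] x ConP_hom[OF c s]] wT unfolding thicken_def w_def[symmetric] x_def by simp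
  qed
  have "\<sigma> \<in> simplex N" using s T by blast
  then have ne: "\<sigma> \<noteq> []" and ss: "sorted \<sigma>" unfolding simplex_iff by auto
  define \<kappa> where "\<kappa> = remdups_adj \<sigma>"
  have k: "\<kappa> \<in> T" "distinct \<kappa>" unfolding \<kappa>_def using sset_remdups_adj[OF T(1) ne] s remdups_adj_sorted[OF ss] by auto
  obtain \<epsilon> where e: "\<epsilon> \<in> simplex (dm \<kappa>)" "\<sigma> = \<kappa> \<odot> \<epsilon>" using remdups_adj_degeneracy[OF ne] unfolding \<kappa>_def by blast
  have d: "dm \<sigma> = dm \<epsilon>" using e by simp
  have v': "v \<in> thick (dm \<epsilon>)" using v d by simp
  have ev: "\<epsilon> \<odot> v \<in> thick (dm \<kappa>)" using sub_thick[OF simplex_thick[OF e(1)] v'] by blast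
  have "\<sigma> \<odot> v = \<kappa> \<odot> (\<epsilon> \<odot> v)"
  proof -
    have "\<epsilon> \<noteq> []" using e unfolding simplex_iff by blast
    then show ?thesis using sub_sub_thick[OF _ v', of \<kappa>] unfolding e(2) by blast
  qed
  moreover have "c \<sigma> = gm (dm \<kappa>) \<epsilon> \<cdot> c \<kappa>" using ConP_face[OF c k(1) e(1)] e(2) by simp
  ultimately show ?thesis
    using *[OF k(1) ev k(2)] p_gm_cmp[OF simplex_thick[OF e(1)] v' ConP_hom[OF c k(1)]] d by metis
qed

lemma thickT_dec: "w \<in> thickT T \<Longrightarrow> \<exists>\<sigma> v. \<sigma> \<in> T \<and> v \<in> thick (dm \<sigma>) \<and> w = \<sigma> \<odot> v"
proof (intro exI conjI)
  assume "w \<in> thickT T"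
  then have "w \<noteq> []" "supp w \<in> T" unfolding thickT_def supp_def by auto
  then show "supp w \<in> T" "map (pos (supp w)) w \<in> thick (dm (supp w))" "w = supp w \<odot> map (pos (supp w)) w"
    using supp[of w] by simp_all
qed

lemma thicken_ConP:
  assumes c: "c \<in> El (ConP Gb gm T) U"
  shows "thicken T c \<in> El (ConP X Xm (thickT T)) U"
proof (rule ConPI)
  show "U \<in> Ob C" by (rule ConP_ob[OF c])
  show "thicken T c \<in> extensional (thickT T)" unfolding thicken_def by simp
  fix w assume "w \<in> thickT T"
  then obtain \<sigma> v where s: "\<sigma> \<in> T" "v \<in> thick (dm \<sigma>)" "w = \<sigma> \<odot> v" using thickT_dec by blast
  have d: "dm w = dm v" using s by simp
  have ne: "v \<noteq> []" using s unfolding thick_def by blast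
  show "thicken T c w \<in> hom U (X (dm w))"
    unfolding d using thicken_sub[OF c s(1,2)] cmp_hom[OF p_hom[OF s(2)] ConP_hom[OF c s(1)]] s(3) by simp
  fix \<theta> assume t: "\<theta> \<in> simplex (dm w)"
  then have t': "\<theta> \<in> simplex (dm v)" using d by simp
  have vt: "v \<odot> \<theta> \<in> thick (dm \<sigma>)" using ssetD[OF sset_thick s(2) t'] .
  have "thicken T c (w \<odot> \<theta>) = p (dm \<sigma>) (v \<odot> \<theta>) \<cdot> c \<sigma>"
    using thicken_sub[OF c s(1) vt] sub_sub[OF t' ne, of \<sigma>] unfolding s(3) by (simp only:)
  also have "\<dots> = Xm (dm v) \<theta> \<cdot> (p (dm \<sigma>) v \<cdot> c \<sigma>)"
    using assoc[OF so_hom[OF so t'] p_hom[OF s(2)] ConP_hom[OF c s(1)]] p_face[OF s(2) t'] by simp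
  also have "\<dots> = Xm (dm w) \<theta> \<cdot> thicken T c w" unfolding s(3) thicken_sub[OF c s(1,2)] by simp
  finally show "Xm (dm w) \<theta> \<cdot> thicken T c w = thicken T c (w \<odot> \<theta>)" ..
qed

lemma thicken_ntr: "ntr (ConP Gb gm T) (ConP X Xm (thickT T)) (thicken T)"
proof (rule ntrI)
  fix U c assume c: "c \<in> El (ConP Gb gm T) U"
  then show "thicken T c \<in> El (ConP X Xm (thickT T)) U" by (rule thicken_ConP)
  fix V g assume g: "g \<in> hom V U"
  have cg: "ac (ConP Gb gm T) c g \<in> El (ConP Gb gm T) V" using psh_ac[OF psh_ConP[OF so_Gb T(1)] c g] .
  show "thicken T (ac (ConP Gb gm T) c g) = ac (ConP X Xm (thickT T)) (thicken T c) g"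
  proof (rule ConP_eqI[OF thicken_ConP[OF cg]])
    show "ac (ConP X Xm (thickT T)) (thicken T c) g \<in> El (ConP X Xm (thickT T)) V"
      using psh_ac[OF psh_ConP[OF so sset_thickT[OF T]] thicken_ConP[OF c] g] .
    fix w assume w: "w \<in> thickT T"
    then obtain \<sigma> v where s: "\<sigma> \<in> T" "v \<in> thick (dm \<sigma>)" "w = \<sigma> \<odot> v" using thickT_dec by blast
    show "thicken T (ac (ConP Gb gm T) c g) w = ac (ConP X Xm (thickT T)) (thicken T c) g w"
      using thicken_sub[OF cg s(1,2)] thicken_sub[OF c s(1,2)] assoc[OF p_hom[OF s(2)] ConP_hom[OF c s(1)] g] w s
      unfolding ConP_ac by simp
  qed
qed

text \<open>For surjectivity, the component at \<sigma> is the arrow into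
  \<open>Gb (dm \<sigma>)\<close> whose legs are those of the given cone at the words
  \<open>\<sigma> \<odot> v\<close>.\<close>

lemma thicken_bijn: "bijn (ConP Gb gm T) (ConP X Xm (thickT T)) (thicken T)"
proof (rule bijnI[OF thicken_ntr])
  fix U c c' assume c: "c \<in> El (ConP Gb gm T) U" and c': "c' \<in> El (ConP Gb gm T) U" and e: "thicken T c = thicken T c'"
  show "c = c'"
  proof (rule ConP_eqI[OF c c'])
    fix \<sigma> assume s: "\<sigma> \<in> T"
    show "c \<sigma> = c' \<sigma>"
      by (rule p_inj[OF ConP_hom[OF c s] ConP_hom[OF c' s]])
        (use thicken_sub[OF c s] thicken_sub[OF c' s] e in simp)
  qed
next
  fix U d assume d: "d \<in> El (ConP X Xm (thickT T)) U"
  define c where "c = (\<lambda>\<sigma>\<in>T. SOME y. y \<in> hom U (Gb (dm \<sigma>)) \<and> (\<forall>v\<in>thick (dm \<sigma>). p (dm \<sigma>) v \<cdot> y = d (\<sigma> \<odot> v)))"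
  have c: "c \<sigma> \<in> hom U (Gb (dm \<sigma>)) \<and> (\<forall>v\<in>thick (dm \<sigma>). p (dm \<sigma>) v \<cdot> c \<sigma> = d (\<sigma> \<odot> v))" if s: "\<sigma> \<in> T" for \<sigma>
  proof -
    have ne: "\<sigma> \<noteq> []" using sset_ne[OF T(1) s] .
    obtain y where "y \<in> hom U (Gb (dm \<sigma>))" "\<And>v. v \<in> thick (dm \<sigma>) \<Longrightarrow> p (dm \<sigma>) v \<cdot> y = d (\<sigma> \<odot> v)"
      by (rule p_ex[OF sub_cone_gen[OF ne thickT_sub[OF s] d]]) auto
    then have "\<exists>y. y \<in> hom U (Gb (dm \<sigma>)) \<and> (\<forall>v\<in>thick (dm \<sigma>). p (dm \<sigma>) v \<cdot> y = d (\<sigma> \<odot> v))" by blast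
    from someI_ex[OF this] show ?thesis unfolding c_def using s by simp
  qed
  have cC: "c \<in> El (ConP Gb gm T) U"
  proof (rule ConPI)
    show "U \<in> Ob C" by (rule ConP_ob[OF d])
    show "c \<in> extensional T" unfolding c_def by simp
    fix \<sigma> assume s: "\<sigma> \<in> T"
    show "c \<sigma> \<in> hom U (Gb (dm \<sigma>))" using c[OF s] by blast
    fix \<theta> assume t: "\<theta> \<in> simplex (dm \<sigma>)"
    have st: "\<sigma> \<odot> \<theta> \<in> T" using ssetD[OF T(1) s t] .
    have dd: "dm (\<sigma> \<odot> \<theta>) = dm \<theta>" by simp
    show "gm (dm \<sigma>) \<theta> \<cdot> c \<sigma> = c (\<sigma> \<odot> \<theta>)"
    proof (rule p_inj)
      show "gm (dm \<sigma>) \<theta> \<cdot> c \<sigma> \<in> hom U (Gb (dm \<theta>))"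
        using cmp_hom[OF so_hom[OF so_Gb t]] c[OF s] by blast
      show "c (\<sigma> \<odot> \<theta>) \<in> hom U (Gb (dm \<theta>))" using c[OF st] unfolding dd by blast
      fix v assume v: "v \<in> thick (dm \<theta>)"
      have tv: "\<theta> \<odot> v \<in> thick (dm \<sigma>)" using sub_thick[OF simplex_thick[OF t] v] by blast
      have "\<theta> \<noteq> []" using t unfolding simplex_iff by blast
      then have "\<sigma> \<odot> \<theta> \<odot> v = \<sigma> \<odot> (\<theta> \<odot> v)" using sub_sub_thick[OF _ v] by blast
      then show "p (dm \<theta>) v \<cdot> (gm (dm \<sigma>) \<theta> \<cdot> c \<sigma>) = p (dm \<theta>) v \<cdot> c (\<sigma> \<odot> \<theta>)"
        using p_gm_cmp[OF simplex_thick[OF t] v, of "c \<sigma>" U] c[OF s] c[OF st] tv v unfolding dd by metis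
    qed
  qed
  have "thicken T c = d"
  proof (rule ConP_eqI[OF thicken_ConP[OF cC] d])
    fix w assume w: "w \<in> thickT T"
    then obtain \<sigma> v where s: "\<sigma> \<in> T" "v \<in> thick (dm \<sigma>)" "w = \<sigma> \<odot> v" using thickT_dec by blast
    then show "thicken T c w = d w" using thicken_sub[OF cC s(1,2)] c[OF s(1)] by simp
  qed
  then show "\<exists>c. c \<in> El (ConP Gb gm T) U \<and> thicken T c = d" using cC by blast
qed

lemma thickT_thick: "thickT T \<subseteq> thick N"
proof
  fix w assume "w \<in> thickT T"
  then have "w \<noteq> []" "sorted_list_of_set (set w) \<in> simplex N" using T unfolding thickT_def by auto
  then show "w \<in> thick N" unfolding simplex_iff thick_def by simp
qed

text \<open>Under the bijections \<open>ev\<close> and \<open>thicken\<close>, the face map of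
  \<open>Gb\<close> becomes restriction of cones from the thick simplex to \<open>thickT T\<close>,
  and the expansion results apply to the latter.\<close>

lemma thicken_faces:
  assumes y: "y \<in> hom U (Gb N)"
  shows "thicken T (faces gm N T y) = restrict (ev N y) (thickT T)"
proof (rule extensionalityI)
  show "thicken T (faces gm N T y) \<in> extensional (thickT T)" unfolding thicken_def by simp
  show "restrict (ev N y) (thickT T) \<in> extensional (thickT T)" by simp
  have f: "faces gm N T y \<in> El (ConP Gb gm T) U" using faces_ConP[OF so_Gb T(2,1) y] .
  fix w assume w: "w \<in> thickT T"
  then obtain \<sigma> v where s: "\<sigma> \<in> T" "v \<in> thick (dm \<sigma>)" "w = \<sigma> \<odot> v" using thickT_dec by blast
  have st: "\<sigma> \<in> thick N" using s T simplex_thick by blast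
  have "thicken T (faces gm N T y) w = p (dm \<sigma>) v \<cdot> (gm N \<sigma> \<cdot> y)"
    using thicken_sub[OF f s(1,2)] s unfolding faces_def by simp
  also have "\<dots> = p N w \<cdot> y" using p_gm_cmp[OF st s(2) y] s(3) by simp
  finally show "thicken T (faces gm N T y) w = restrict (ev N y) (thickT T) w"
    using w thickT_thick unfolding ev_def by auto
qed

lemma thicken_cov:
  assumes c: "cov M (ConP X Xm (thick N)) (ConP X Xm (thickT T)) (\<lambda>c. restrict c (thickT T))"
  shows "cov M (HomP (Gb N)) (ConP Gb gm T) (faces gm N T)"
  by (rule cov_bijn_transfer[OF c psh_ConP[OF so sset_thick] psh_ConP[OF so sset_thickT[OF T]] psh_HomP
        psh_ConP[OF so_Gb T(1)] ntr_faces[OF so_Gb T(2,1)] ev_bijn(1) thicken_ntr ev_bijn(2) thicken_bijn])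
    (simp add: HomP_def thicken_faces)

lemma thicken_faces_bijn:
  assumes c: "bijn (ConP X Xm (thick N)) (ConP X Xm (thickT T)) (\<lambda>c. restrict c (thickT T))"
  shows "bijn (HomP (Gb N)) (ConP Gb gm T) (faces gm N T)"
  by (rule bijn_transfer[OF c ntr_faces[OF so_Gb T(2,1)] ev_bijn(1) thicken_ntr ev_bijn(2) thicken_bijn])
    (simp add: HomP_def thicken_faces)

end

end

subsection \<open>Covers and coimages\<close>

locale descent_ctx = fl_ctx C for C :: "('o,'m) cat" +
  fixes Cov Reg :: "'m set"
  assumes rdc: "regular_descent_cat C Cov Reg"
begin

lemma covM: "mor_class Cov"
  using rdc wide_subcat_mor_class unfolding regular_descent_cat_def subcanonical_def descent_cat_def by blast

lemma cov_cancel: "f \<in> Cov \<Longrightarrow> f \<in> hom a b \<Longrightarrow> g \<in> hom b c \<Longrightarrow> g \<cdot> f \<in> Cov \<Longrightarrow> g \<in> Cov"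
proof -
  assume a: "f \<in> Cov" "f \<in> hom a b" "g \<in> hom b c" "g \<cdot> f \<in> Cov"
  have "\<forall>f g. f \<in> Cov \<and> g \<in> Ar C \<and> Cod C f = Dom C g \<and> g \<cdot> f \<in> Cov \<longrightarrow> g \<in> Cov"
    using rdc unfolding regular_descent_cat_def subcanonical_def descent_cat_def by (elim conjE)
  from this[rule_format, of f g] show ?thesis using a ar_hom[OF a(2)] ar_hom[OF a(3)] by simp
qed

lemma cov_effective:
  assumes f: "f \<in> Cov" "f \<in> hom a b"
  obtains p i K s t where "is_coequalizer C s t p" "i \<in> hom (Cod C p) (Cod C f)" "i \<cdot> p = f" "iso C i"
    "is_pullback C f f K s t"
proof -
  have "effective_epi C f" using rdc f(1) unfolding regular_descent_cat_def subcanonical_def by (elim conjE) simp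
  then show ?thesis unfolding effective_epi_def is_coimage_def by (elim exE conjE) (rule that)
qed

lemma coeq_epi:
  assumes c: "is_coequalizer C a b p" and x: "x \<in> hom (Cod C p) d" and y: "y \<in> hom (Cod C p) d"
    and e: "x \<cdot> p = y \<cdot> p"
  shows "x = y"
proof -
  have p: "p \<in> hom (Cod C a) (Cod C p)" and pa: "p \<cdot> a = p \<cdot> b" and a: "a \<in> hom (Dom C a) (Cod C a)" and b: "b \<in> hom (Dom C a) (Cod C a)"
    using c unfolding is_coequalizer_def homs_def by auto
  have xp: "x \<cdot> p \<in> hom (Cod C a) d" using cmp_hom[OF x p] .
  have "x \<cdot> p \<cdot> a = x \<cdot> p \<cdot> b" using assoc[OF x p a] assoc[OF x p b] pa by simp
  then have "\<exists>!u. u \<in> hom (Cod C p) (Cod C (x \<cdot> p)) \<and> u \<cdot> p = x \<cdot> p"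
    using c[unfolded is_coequalizer_def, THEN conjunct2, THEN conjunct2, THEN conjunct2, THEN conjunct2, THEN conjunct2,
      rule_format, of "x \<cdot> p"] ar_hom[OF xp] by simp
  then show ?thesis using x y e ar_hom[OF xp] by auto
qed

lemma coeq_fact:
  assumes c: "is_coequalizer C a b p" and h: "h \<in> hom (Cod C a) d" and e: "h \<cdot> a = h \<cdot> b"
  obtains u where "u \<in> hom (Cod C p) d" "u \<cdot> p = h"
  using c ar_hom[OF h] e unfolding is_coequalizer_def by blast

text \<open>A cover is a coequalizer followed by an isomorphism.\<close>

lemma cov_epi:
  assumes f: "f \<in> Cov" "f \<in> hom a b" and x: "x \<in> hom b d" and y: "y \<in> hom b d" and e: "x \<cdot> f = y \<cdot> f"
  shows "x = y"
proof -
  obtain p i K s t where 1: "is_coequalizer C s t p" "i \<in> hom (Cod C p) (Cod C f)" "i \<cdot> p = f" "iso C i"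
    "is_pullback C f f K s t" by (rule cov_effective[OF f])
  have i: "i \<in> hom (Cod C p) b" using 1(2) ar_hom[OF f(2)] by simp
  have p: "p \<in> hom a (Cod C p)" using 1(1,5) ar_hom[OF f(2)] unfolding is_coequalizer_def is_pullback_def homs_def by auto
  have "x \<cdot> i \<cdot> p = y \<cdot> i \<cdot> p" using assoc[OF x i p] assoc[OF y i p] 1(3) e by simp
  then have xy: "x \<cdot> i = y \<cdot> i" using coeq_epi[OF 1(1) cmp_hom[OF x i] cmp_hom[OF y i]] by blast
  obtain j where j: "j \<in> hom b (Cod C p)" "i \<cdot> j = Idm C b" by (rule isoE[OF 1(4) i])
  have "x = x \<cdot> (i \<cdot> j)" unfolding j(2) id_right[OF x] ..
  also have "\<dots> = y \<cdot> i \<cdot> j" unfolding assoc[OF x i j(1), symmetric] xy ..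
  also have "\<dots> = y" unfolding assoc[OF y i j(1)] j(2) id_right[OF y] ..
  finally show ?thesis .
qed

text \<open>The kernel pair of a monic arrow consists of two equal arrows, so the identity factors
  through their coequalizer \<open>p\<close>, which is thereby invertible.\<close>

lemma cov_mono_iso:
  assumes f: "f \<in> Cov" "f \<in> hom a b"
    and m: "\<And>U x y. x \<in> hom U a \<Longrightarrow> y \<in> hom U a \<Longrightarrow> f \<cdot> x = f \<cdot> y \<Longrightarrow> x = y"
  shows "iso C f"
proof -
  obtain p i K s t where 1: "is_coequalizer C s t p" "i \<in> hom (Cod C p) (Cod C f)" "i \<cdot> p = f" "iso C i"
    "is_pullback C f f K s t" by (rule cov_effective[OF f])
  have i: "i \<in> hom (Cod C p) b" using 1(2) ar_hom[OF f(2)] by simp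
  note pb = 1(5)[unfolded is_pullback_hom[OF f(2) f(2)]]
  have st: "s \<in> hom K a" "t \<in> hom K a" "f \<cdot> s = f \<cdot> t" using pb by auto
  have "s = t" by (rule m[OF st])
  have a: "a \<in> Ob C" using f(2) hom_obs by blast
  have cs: "Cod C s = a" using ar_hom[OF st(1)] by simp
  have p: "p \<in> hom a (Cod C p)" using 1(1) cs unfolding is_coequalizer_def homs_def by auto
  obtain u where u: "u \<in> hom (Cod C p) a" "u \<cdot> p = Idm C a"
    by (rule coeq_fact[OF 1(1), of "Idm C a" a]) (use cs a \<open>s = t\<close> in auto)
  have cp: "Cod C p \<in> Ob C" using p hom_obs by blast
  have "p \<cdot> u = Idm C (Cod C p)"
    by (rule coeq_epi[OF 1(1) cmp_hom[OF p u(1)] id_hom[OF cp]])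
      (use assoc[OF p u(1) p] u p in simp)
  then have "iso C p" using isoI[OF p u(1)] u by blast
  then have "p \<in> {f. iso C f}" "i \<in> {f. iso C f}" using 1(4) by auto
  then show ?thesis using mor_class_comp[OF iso_mor_class _ _ p i] 1(3) by simp
qed

text \<open>Local lifting: a generalized element lifts along \<open>q\<close> after passing to a
  cover, namely the base change of \<open>q\<close>.\<close>

lemma cov_lift:
  assumes q: "q \<in> Cov" "q \<in> hom a b" and x: "x \<in> hom U b"
  obtains V g s where "g \<in> Cov" "g \<in> hom V U" "s \<in> hom V a" "q \<cdot> s = x \<cdot> g"
proof -
  obtain P p1 p2 where pb: "is_pullback C q x P p1 p2" using pullback_ex[OF q(2) x] .
  have "p2 \<in> Cov" using covM q(1) pb unfolding mor_class_def pullback_stable_def by blast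
  then show ?thesis using that[of p2 P p1] pb[unfolded is_pullback_hom[OF q(2) x]] by blast
qed

lemma pullback_lift:
  assumes "is_pullback C f g P p1 p2" "f \<in> hom a c" "g \<in> hom b c" "x \<in> hom Q a" "y \<in> hom Q b" "f \<cdot> x = g \<cdot> y"
  obtains u where "u \<in> hom Q P" "p1 \<cdot> u = x" "p2 \<cdot> u = y"
proof -
  have "\<exists>!u. u \<in> hom Q P \<and> p1 \<cdot> u = x \<and> p2 \<cdot> u = y"
    using assms(1)[unfolded is_pullback_hom[OF assms(2,3)]] assms(4-6) by simp
  then show ?thesis by (elim ex1E conjE) (rule that)
qed

text \<open>The axiom provides some coimage that is a cover; any two coimages are isomorphic, so the
  given \<open>q\<close> is a cover too. Two elements identified by \<open>i\<close> lift along
  \<open>q\<close> over a cover; the lifts agree under \<open>f\<close>, hence under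
  \<open>q\<close>, and covers are epic. Thus \<open>i\<close> is monic.\<close>

lemma coimage_regular:
  assumes f: "f \<in> Reg" "f \<in> hom a c" and ci: "is_coimage C f q i"
  shows "q \<in> Cov" "q \<in> hom a (Cod C q)" "i \<in> hom (Cod C q) c" "i \<cdot> q = f"
    "\<And>U x y. x \<in> hom U (Cod C q) \<Longrightarrow> y \<in> hom U (Cod C q) \<Longrightarrow> i \<cdot> x = i \<cdot> y \<Longrightarrow> x = y"
    "\<And>h d. h \<in> hom a d \<Longrightarrow> (\<And>U x y. x \<in> hom U a \<Longrightarrow> y \<in> hom U a \<Longrightarrow> f \<cdot> x = f \<cdot> y \<Longrightarrow> h \<cdot> x = h \<cdot> y) \<Longrightarrow>
      \<exists>u. u \<in> hom (Cod C q) d \<and> u \<cdot> q = h"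
proof -
  obtain K s t where 1: "is_pullback C f f K s t" "is_coequalizer C s t q"
    and i: "i \<in> hom (Cod C q) (Cod C f)" "i \<cdot> q = f"
    using ci unfolding is_coimage_def by (elim exE conjE) (rule that)
  have "\<exists>p i. is_coimage C f p i \<and> p \<in> Cov" using rdc f(1) unfolding regular_descent_cat_def by (elim conjE) simp
  then obtain q' i' K' s' t' where 2: "is_pullback C f f K' s' t'" "is_coequalizer C s' t' q'" "q' \<in> Cov"
    unfolding is_coimage_def by (elim exE conjE) (rule that)
  note pb = 1(1)[unfolded is_pullback_hom[OF f(2) f(2)]] and pb' = 2(1)[unfolded is_pullback_hom[OF f(2) f(2)]]
  have st: "s \<in> hom K a" "t \<in> hom K a" "f \<cdot> s = f \<cdot> t" using pb by auto
  have st': "s' \<in> hom K' a" "t' \<in> hom K' a" "f \<cdot> s' = f \<cdot> t'" using pb' by auto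
  have cs: "Cod C s = a" "Cod C s' = a" using ar_hom[OF st(1)] ar_hom[OF st'(1)] by auto
  show q: "q \<in> hom a (Cod C q)" using 1(2) cs unfolding is_coequalizer_def homs_def by auto
  have q': "q' \<in> hom a (Cod C q')" using 2(2) cs unfolding is_coequalizer_def homs_def by auto
  have qe: "q \<cdot> s = q \<cdot> t" using 1(2) unfolding is_coequalizer_def by blast
  have qe': "q' \<cdot> s' = q' \<cdot> t'" using 2(2) unfolding is_coequalizer_def by blast
  \<comment> \<open>\<open>q\<close> and \<open>q'\<close> may belong to different choices of the
    kernel pair, so coequalizing is restated for arbitrary pairs identified by
    \<open>f\<close>.\<close>
  have kq: "q \<cdot> x = q \<cdot> y" if xy: "x \<in> hom U a" "y \<in> hom U a" "f \<cdot> x = f \<cdot> y" for U x y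
  proof -
    obtain w where w: "w \<in> hom U K" "s \<cdot> w = x" "t \<cdot> w = y" by (rule pullback_lift[OF 1(1) f(2) f(2) xy])
    then show ?thesis using assoc[OF q st(1) w(1)] assoc[OF q st(2) w(1)] qe by simp
  qed
  have kq': "q' \<cdot> x = q' \<cdot> y" if xy: "x \<in> hom U a" "y \<in> hom U a" "f \<cdot> x = f \<cdot> y" for U x y
  proof -
    obtain w where w: "w \<in> hom U K'" "s' \<cdot> w = x" "t' \<cdot> w = y" by (rule pullback_lift[OF 2(1) f(2) f(2) xy])
    then show ?thesis using assoc[OF q' st'(1) w(1)] assoc[OF q' st'(2) w(1)] qe' by simp
  qed
  obtain u where u: "u \<in> hom (Cod C q) (Cod C q')" "u \<cdot> q = q'"
    by (rule coeq_fact[OF 1(2), of q' "Cod C q'"]) (use q' cs kq'[OF st] in auto)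
  obtain v where v: "v \<in> hom (Cod C q') (Cod C q)" "v \<cdot> q' = q"
    by (rule coeq_fact[OF 2(2), of q "Cod C q"]) (use q cs kq[OF st'] in auto)
  have ob: "Cod C q \<in> Ob C" "Cod C q' \<in> Ob C" using hom_obs[OF q] hom_obs[OF q'] by auto
  have "v \<cdot> u = Idm C (Cod C q)"
    by (rule coeq_epi[OF 1(2) cmp_hom[OF v(1) u(1)] id_hom[OF ob(1)]]) (use assoc[OF v(1) u(1) q] u v q in simp)
  moreover have "u \<cdot> v = Idm C (Cod C q')"
    by (rule coeq_epi[OF 2(2) cmp_hom[OF u(1) v(1)] id_hom[OF ob(2)]]) (use assoc[OF u(1) v(1) q'] u v q' in simp)
  ultimately have "iso C v" using isoI[OF v(1) u(1)] by blast
  then have "v \<in> Cov" using mor_class_iso[OF covM] by blast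
  then show qC: "q \<in> Cov" using mor_class_comp[OF covM 2(3) _ q' v(1)] v(2) by simp
  show ih: "i \<in> hom (Cod C q) c" using i(1) ar_hom[OF f(2)] by simp
  show "i \<cdot> q = f" by fact
  show "x = y" if x: "x \<in> hom U (Cod C q)" and y: "y \<in> hom U (Cod C q)" and e: "i \<cdot> x = i \<cdot> y" for U x y
  proof -
    obtain V g z where g: "g \<in> Cov" "g \<in> hom V U" "z \<in> hom V a" "q \<cdot> z = x \<cdot> g" using cov_lift[OF qC q x] .
    have yg: "y \<cdot> g \<in> hom V (Cod C q)" using cmp_hom[OF y g(2)] .
    obtain V' g' z' where g': "g' \<in> Cov" "g' \<in> hom V' V" "z' \<in> hom V' a" "q \<cdot> z' = y \<cdot> g \<cdot> g'" using cov_lift[OF qC q yg] .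
    have zg: "z \<cdot> g' \<in> hom V' a" using cmp_hom[OF g(3) g'(2)] .
    have qz: "q \<cdot> (z \<cdot> g') = x \<cdot> g \<cdot> g'" using assoc[OF q g(3) g'(2)] g(4) by simp
    have "f \<cdot> (z \<cdot> g') = i \<cdot> (x \<cdot> g \<cdot> g')" using assoc[OF ih q zg] i(2) qz by simp
    also have "\<dots> = i \<cdot> x \<cdot> g \<cdot> g'" using assoc[OF ih cmp_hom[OF x g(2)] g'(2)] assoc[OF ih x g(2)] by simp
    also have "\<dots> = i \<cdot> (y \<cdot> g \<cdot> g')" using assoc[OF ih yg g'(2)] assoc[OF ih y g(2)] e by simp
    also have "\<dots> = f \<cdot> z'" using assoc[OF ih q g'(3)] i(2) g'(4) by simp
    finally have "q \<cdot> (z \<cdot> g') = q \<cdot> z'" using kq[OF zg g'(3)] by blast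
    then have "x \<cdot> g \<cdot> g' = y \<cdot> g \<cdot> g'" using qz g'(4) by simp
    then have "x \<cdot> g = y \<cdot> g" using cov_epi[OF g'(1,2) cmp_hom[OF x g(2)] yg] by blast
    then show ?thesis using cov_epi[OF g(1,2) x y] by blast
  qed
  show "\<exists>u. u \<in> hom (Cod C q) d \<and> u \<cdot> q = h" if h: "h \<in> hom a d"
    and k: "\<And>U x y. x \<in> hom U a \<Longrightarrow> y \<in> hom U a \<Longrightarrow> f \<cdot> x = f \<cdot> y \<Longrightarrow> h \<cdot> x = h \<cdot> y" for h d
  proof -
    obtain u where "u \<in> hom (Cod C q) d" "u \<cdot> q = h"
      by (rule coeq_fact[OF 1(2), of h d]) (use h cs k[OF st] in auto)
    then show ?thesis by blast
  qed
qed

end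

subsection \<open>Hypercovers out of a groupoid\<close>

locale hyper_ctx = descent_ctx C Cov Reg for C :: "('o,'m) cat" and Cov Reg :: "'m set" +
  fixes Y Z :: "nat \<Rightarrow> 'o" and Ym Zm :: "nat \<Rightarrow> nat list \<Rightarrow> 'm" and f :: "nat \<Rightarrow> 'm"
  assumes soY: "simplicial_object C Y Ym" and soZ: "simplicial_object C Z Zm"
    and fh: "\<And>n. f n \<in> hom (Y n) (Z n)"
    and fn: "\<And>n \<theta>. \<theta> \<in> simplex n \<Longrightarrow> f (dm \<theta>) \<cdot> Ym n \<theta> = Zm n \<theta> \<cdot> f n"
begin

lemma f_face:
  assumes t: "\<theta> \<in> simplex n" and y: "y \<in> hom U (Y n)"
  shows "f (dm \<theta>) \<cdot> (Ym n \<theta> \<cdot> y) = Zm n \<theta> \<cdot> (f n \<cdot> y)"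
  using assoc[OF fh so_hom[OF soY t] y] assoc[OF so_hom[OF soZ t] fh y] fn[OF t] by simp

definition map_cone :: "nat list set \<Rightarrow> (nat list \<Rightarrow> 'm) \<Rightarrow> nat list \<Rightarrow> 'm" where
  "map_cone S c = (\<lambda>\<sigma>\<in>S. f (dm \<sigma>) \<cdot> c \<sigma>)"

lemma map_cone_ConP:
  assumes S: "sset S" and c: "c \<in> El (ConP Y Ym S) U"
  shows "map_cone S c \<in> El (ConP Z Zm S) U"
  unfolding map_cone_def
proof (rule ConPI)
  show "U \<in> Ob C" by (rule ConP_ob[OF c])
  fix \<sigma> assume s: "\<sigma> \<in> S"
  show "(\<lambda>\<sigma>\<in>S. f (dm \<sigma>) \<cdot> c \<sigma>) \<sigma> \<in> hom U (Z (dm \<sigma>))" using s cmp_hom[OF fh ConP_hom[OF c s]] by simp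
  fix \<theta> assume t: "\<theta> \<in> simplex (dm \<sigma>)"
  have d: "dm (\<sigma> \<odot> \<theta>) = dm \<theta>" by simp
  show "Zm (dm \<sigma>) \<theta> \<cdot> (\<lambda>\<sigma>\<in>S. f (dm \<sigma>) \<cdot> c \<sigma>) \<sigma> = (\<lambda>\<sigma>\<in>S. f (dm \<sigma>) \<cdot> c \<sigma>) (\<sigma> \<odot> \<theta>)"
    using s ssetD[OF S s t] f_face[OF t ConP_hom[OF c s]] ConP_face[OF c s t] unfolding d by simp
qed simp

lemma map_cone_ntr: "sset S \<Longrightarrow> ntr (ConP Y Ym S) (ConP Z Zm S) (map_cone S)"
proof (rule ntrI)
  assume S: "sset S"
  fix U c assume c: "c \<in> El (ConP Y Ym S) U"
  then show "map_cone S c \<in> El (ConP Z Zm S) U" using map_cone_ConP[OF S] by blast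
  fix V g assume g: "g \<in> hom V U"
  show "map_cone S (ac (ConP Y Ym S) c g) = ac (ConP Z Zm S) (map_cone S c) g"
    unfolding map_cone_def ConP_ac by (rule restrict_ext) (use assoc[OF fh ConP_hom[OF c] g] in simp)
qed

text \<open>The presheaf of cones for the relative mapping object of \<open>f\<close> and an
  inclusion of \<open>S\<close> into \<open>T\<close>.\<close>

definition RelP :: "nat list set \<Rightarrow> nat list set \<Rightarrow>
    ('o \<Rightarrow> ((nat list \<Rightarrow> 'm) \<times> (nat list \<Rightarrow> 'm)) set) \<times> ((nat list \<Rightarrow> 'm) \<times> (nat list \<Rightarrow> 'm) \<Rightarrow> 'm \<Rightarrow> (nat list \<Rightarrow> 'm) \<times> (nat list \<Rightarrow> 'm))" where
  "RelP S T = (\<lambda>U. {(c, b). c \<in> El (ConP Y Ym S) U \<and> b \<in> El (ConP Z Zm T) U \<and> (\<forall>\<sigma>\<in>S. f (dm \<sigma>) \<cdot> c \<sigma> = b \<sigma>)},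
     \<lambda>(c, b) g. (ac (ConP Y Ym S) c g, ac (ConP Z Zm T) b g))"

text \<open>The target of the hypercover condition in dimension \<open>n\<close>. In contrast to
  \<open>RelP (bdry n) (simplex n)\<close> it stores an arrow to \<open>Z n\<close> in place of a
  cone on the standard simplex.\<close>

definition BdryP :: "nat \<Rightarrow>
    ('o \<Rightarrow> ((nat list \<Rightarrow> 'm) \<times> 'm) set) \<times> ((nat list \<Rightarrow> 'm) \<times> 'm \<Rightarrow> 'm \<Rightarrow> (nat list \<Rightarrow> 'm) \<times> 'm)" where
  "BdryP n = (\<lambda>U. {(c, z). c \<in> El (ConP Y Ym (bdry n)) U \<and> z \<in> hom U (Z n) \<and>
       (\<forall>\<sigma>\<in>bdry n. f (dm \<sigma>) \<cdot> c \<sigma> = Zm n \<sigma> \<cdot> z)},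
     \<lambda>(c, z) g. (ac (ConP Y Ym (bdry n)) c g, z \<cdot> g))"

definition bdry_map :: "nat \<Rightarrow> 'm \<Rightarrow> (nat list \<Rightarrow> 'm) \<times> 'm" where
  "bdry_map n y = (faces Ym n (bdry n) y, f n \<cdot> y)"

lemma bdry_sub: "bdry n \<subseteq> simplex n"
  unfolding bdry_def by blast

lemma RelP_El: "(c, b) \<in> El (RelP S T) U \<longleftrightarrow> c \<in> El (ConP Y Ym S) U \<and> b \<in> El (ConP Z Zm T) U \<and> (\<forall>\<sigma>\<in>S. f (dm \<sigma>) \<cdot> c \<sigma> = b \<sigma>)"
  and RelP_ac: "ac (RelP S T) (c, b) g = (ac (ConP Y Ym S) c g, ac (ConP Z Zm T) b g)"
  unfolding RelP_def by simp_all

lemma BdryP_El: "(c, z) \<in> El (BdryP n) U \<longleftrightarrow> c \<in> El (ConP Y Ym (bdry n)) U \<and> z \<in> hom U (Z n) \<and>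
       (\<forall>\<sigma>\<in>bdry n. f (dm \<sigma>) \<cdot> c \<sigma> = Zm n \<sigma> \<cdot> z)"
  and BdryP_ac: "ac (BdryP n) (c, z) g = (ac (ConP Y Ym (bdry n)) c g, z \<cdot> g)"
  unfolding BdryP_def by simp_all

lemma pshI2:
  assumes "\<And>U x y. (x, y) \<in> El P U \<Longrightarrow> U \<in> Ob C \<and> ac P (x, y) (Idm C U) = (x, y)"
    "\<And>U V x y g. (x, y) \<in> El P U \<Longrightarrow> g \<in> hom V U \<Longrightarrow> ac P (x, y) g \<in> El P V"
    "\<And>U V W x y g h. (x, y) \<in> El P U \<Longrightarrow> g \<in> hom V U \<Longrightarrow> h \<in> hom W V \<Longrightarrow> ac P (ac P (x, y) g) h = ac P (x, y) (g \<cdot> h)"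
  shows "psh P"
  unfolding psh_def split_paired_All using assms by blast

lemma psh_RelP:
  assumes S: "sset S" and T: "sset T" and ST: "S \<subseteq> T"
  shows "psh (RelP S T)"
proof (rule pshI2)
  note pY = psh_ConP[OF soY S] and pZ = psh_ConP[OF soZ T]
  fix U c b assume "(c, b) \<in> El (RelP S T) U"
  then have c: "c \<in> El (ConP Y Ym S) U" and b: "b \<in> El (ConP Z Zm T) U" and e: "\<forall>\<sigma>\<in>S. f (dm \<sigma>) \<cdot> c \<sigma> = b \<sigma>"
    unfolding RelP_El by auto
  show "U \<in> Ob C \<and> ac (RelP S T) (c, b) (Idm C U) = (c, b)"
    unfolding RelP_ac using psh_id[OF pY c] psh_id[OF pZ b] psh_ob[OF pY c] by simp
  fix V g assume g: "g \<in> hom V U"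
  have "\<forall>\<sigma>\<in>S. f (dm \<sigma>) \<cdot> ac (ConP Y Ym S) c g \<sigma> = ac (ConP Z Zm T) b g \<sigma>"
    using e assoc[OF fh ConP_hom[OF c] g] ST unfolding ConP_ac by (auto simp: subset_iff)
  then show "ac (RelP S T) (c, b) g \<in> El (RelP S T) V"
    unfolding RelP_ac RelP_El using psh_ac[OF pY c g] psh_ac[OF pZ b g] by blast
  show "ac (RelP S T) (ac (RelP S T) (c, b) g) h = ac (RelP S T) (c, b) (g \<cdot> h)" if h: "h \<in> hom W V" for W h
    unfolding RelP_ac using psh_cmp[OF pY c g h] psh_cmp[OF pZ b g h] by simp
qed

lemma psh_BdryP: "psh (BdryP n)"
proof (rule pshI2)
  note pY = psh_ConP[OF soY sset_bdry[of n]]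
  fix U c z assume "(c, z) \<in> El (BdryP n) U"
  then have c: "c \<in> El (ConP Y Ym (bdry n)) U" and z: "z \<in> hom U (Z n)" and e: "\<forall>\<sigma>\<in>bdry n. f (dm \<sigma>) \<cdot> c \<sigma> = Zm n \<sigma> \<cdot> z"
    unfolding BdryP_El by auto
  show "U \<in> Ob C \<and> ac (BdryP n) (c, z) (Idm C U) = (c, z)"
    unfolding BdryP_ac using psh_id[OF pY c] psh_ob[OF pY c] id_right[OF z] by simp
  fix V g assume g: "g \<in> hom V U"
  have "f (dm \<sigma>) \<cdot> ac (ConP Y Ym (bdry n)) c g \<sigma> = Zm n \<sigma> \<cdot> (z \<cdot> g)" if s: "\<sigma> \<in> bdry n" for \<sigma>
  proof -
    have "\<sigma> \<in> simplex n" using s bdry_sub by blast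
    then show ?thesis
      using e s assoc[OF fh ConP_hom[OF c s] g] assoc[OF so_hom[OF soZ, of \<sigma> n] z g] unfolding ConP_ac by simp
  qed
  then show "ac (BdryP n) (c, z) g \<in> El (BdryP n) V"
    unfolding BdryP_ac BdryP_El using psh_ac[OF pY c g] cmp_hom[OF z g] by blast
  show "ac (BdryP n) (ac (BdryP n) (c, z) g) h = ac (BdryP n) (c, z) (g \<cdot> h)" if h: "h \<in> hom W V" for W h
    unfolding BdryP_ac using psh_cmp[OF pY c g h] assoc[OF z g h] by simp
qed

lemma ntr_bdry_map: "ntr (HomP (Y n)) (BdryP n) (bdry_map n)"
proof (rule ntrI)
  fix U y assume "y \<in> El (HomP (Y n)) U"
  then have y: "y \<in> hom U (Y n)" by (simp add: HomP_def)
  have "f (dm \<sigma>) \<cdot> faces Ym n (bdry n) y \<sigma> = Zm n \<sigma> \<cdot> (f n \<cdot> y)" if s: "\<sigma> \<in> bdry n" for \<sigma>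
    using f_face[OF _ y, of \<sigma>] s bdry_sub unfolding faces_def by auto
  then show "bdry_map n y \<in> El (BdryP n) U"
    unfolding bdry_map_def BdryP_El using faces_ConP[OF soY bdry_sub sset_bdry y] cmp_hom[OF fh y] by blast
  fix V g assume g: "g \<in> hom V U"
  have "faces Ym n (bdry n) (y \<cdot> g) = ac (ConP Y Ym (bdry n)) (faces Ym n (bdry n) y) g"
    using ntr_ac[OF ntr_faces[OF soY bdry_sub sset_bdry], of y n U g V] y g by (simp add: HomP_def)
  then show "bdry_map n (ac (HomP (Y n)) y g) = ac (BdryP n) (bdry_map n y) g"
    unfolding bdry_map_def BdryP_ac using assoc[OF fh y g] by (simp add: HomP_def)
qed

lemma ntr_RelP:
  assumes S: "sset S" and ST: "S \<subseteq> R"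
  shows "ntr (RelP R T) (RelP S T) (\<lambda>(c, b). (restrict c S, b))"
proof (rule ntrI)
  fix U x assume x: "x \<in> El (RelP R T) U"
  obtain c b where cb: "x = (c, b)" by (cases x)
  have c: "c \<in> El (ConP Y Ym R) U" and b: "b \<in> El (ConP Z Zm T) U" and e: "\<forall>\<sigma>\<in>R. f (dm \<sigma>) \<cdot> c \<sigma> = b \<sigma>"
    using x unfolding cb RelP_El by auto
  have "\<forall>\<sigma>\<in>S. f (dm \<sigma>) \<cdot> restrict c S \<sigma> = b \<sigma>" using e ST by auto
  then show "(case x of (c, b) \<Rightarrow> (restrict c S, b)) \<in> El (RelP S T) U"
    unfolding cb prod.case RelP_El using restrict_ConP[OF c ST S] b by blast
  fix V g assume g: "g \<in> hom V U"
  show "(case ac (RelP R T) x g of (c, b) \<Rightarrow> (restrict c S, b)) = ac (RelP S T) (case x of (c, b) \<Rightarrow> (restrict c S, b)) g"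
    unfolding cb RelP_ac prod.case using ntr_ac[OF ntr_restrict[OF ST S] c g] by blast
qed

text \<open>The cone on \<open>Tb\<close> in \<open>Z\<close> stays fixed while the cone in
  \<open>Y\<close> is extended over one cell. This means filling the cell in \<open>Y\<close> with
  given boundary and given image in \<open>Z\<close>, so the map is a base change of
  \<open>bdry_map m\<close>.\<close>

lemma RelP_step:
  assumes hc: "cov Cov (HomP (Y m)) (BdryP m) (bdry_map m)"
    and at: "attach \<sigma> m (bdry m) S' T'" and Tb: "sset Tb" "T' \<subseteq> Tb"
  shows "cov Cov (RelP T' Tb) (RelP S' Tb) (\<lambda>(c, b). (restrict c S', b))"
proof -
  note af = attach_facts[OF at]
  have S'b: "S' \<subseteq> Tb" using af(3) Tb by blast
  have sTb: "\<sigma> \<in> Tb" using af(4) Tb by blast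
  have att: "T' = S' \<union> (\<lambda>\<theta>. \<sigma> \<odot> \<theta>) ` simplex m" "\<And>\<theta>. \<theta> \<in> bdry m \<Longrightarrow> \<sigma> \<odot> \<theta> \<in> S'"
    using at af(7) unfolding attach_def by auto
  define \<beta> :: "(nat list \<Rightarrow> 'm) \<times> (nat list \<Rightarrow> 'm) \<Rightarrow> (nat list \<Rightarrow> 'm) \<times> 'm" where
    "\<beta> = (\<lambda>(c, b). (\<lambda>\<theta>\<in>bdry m. c (\<sigma> \<odot> \<theta>), b \<sigma>))"
  have bs: "\<theta> \<in> simplex (dm \<sigma>)" if "\<theta> \<in> bdry m" for \<theta> using that af by auto
  show ?thesis
  proof (rule cov_base[OF hc psh_BdryP psh_RelP[OF af(2) Tb] psh_RelP[OF af(1) Tb(1) S'b], where \<alpha> = "\<lambda>(c, b). c \<sigma>" and \<beta> = \<beta>])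
    show "ntr (RelP T' Tb) (RelP S' Tb) (\<lambda>(c, b). (restrict c S', b))"
      by (rule ntr_RelP[OF af(1,3)])
    show "ntr (RelP T' Tb) (HomP (Y m)) (\<lambda>(c, b). c \<sigma>)"
    proof (rule ntrI)
      fix U x assume x: "x \<in> El (RelP T' Tb) U"
      obtain c b where cb: "x = (c, b)" by (cases x)
      show "(case x of (c, b) \<Rightarrow> c \<sigma>) \<in> El (HomP (Y m)) U"
        using x ConP_hom[of c Y Ym T' U \<sigma>] af unfolding cb RelP_El HomP_def by simp
      show "(case ac (RelP T' Tb) x g of (c, b) \<Rightarrow> c \<sigma>) = ac (HomP (Y m)) (case x of (c, b) \<Rightarrow> c \<sigma>) g" for g
        using af(4) unfolding cb RelP_ac ConP_ac HomP_def by simp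
    qed
    show "ntr (RelP S' Tb) (BdryP m) \<beta>"
    proof (rule ntrI)
      fix U x assume x: "x \<in> El (RelP S' Tb) U"
      obtain c b where cb: "x = (c, b)" by (cases x)
      have c: "c \<in> El (ConP Y Ym S') U" and b: "b \<in> El (ConP Z Zm Tb) U" and e: "\<forall>\<sigma>\<in>S'. f (dm \<sigma>) \<cdot> c \<sigma> = b \<sigma>"
        using x unfolding cb RelP_El by auto
      have "(\<lambda>\<theta>\<in>bdry m. c (\<sigma> \<odot> \<theta>)) \<in> El (ConP Y Ym (bdry m)) U"
      proof (rule ConPI)
        show "U \<in> Ob C" by (rule ConP_ob[OF c])
        fix \<theta> assume t: "\<theta> \<in> bdry m"
        then have ne: "\<theta> \<noteq> []" using sset_ne[OF sset_bdry] by blast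
        show "(\<lambda>\<theta>\<in>bdry m. c (\<sigma> \<odot> \<theta>)) \<theta> \<in> hom U (Y (dm \<theta>))" using t ConP_hom[OF c att(2)[OF t]] by simp
        fix \<psi> assume p: "\<psi> \<in> simplex (dm \<theta>)"
        show "Ym (dm \<theta>) \<psi> \<cdot> (\<lambda>\<theta>\<in>bdry m. c (\<sigma> \<odot> \<theta>)) \<theta> = (\<lambda>\<theta>\<in>bdry m. c (\<sigma> \<odot> \<theta>)) (\<theta> \<odot> \<psi>)"
          using t ssetD[OF sset_bdry t p] ConP_face[OF c att(2)[OF t], of \<psi>] p sub_sub[OF p ne, of \<sigma>] by simp
      qed simp
      moreover have "b \<sigma> \<in> hom U (Z m)" using ConP_hom[OF b sTb] af(5) by simp
      moreover have "f (dm \<theta>) \<cdot> (\<lambda>\<theta>\<in>bdry m. c (\<sigma> \<odot> \<theta>)) \<theta> = Zm m \<theta> \<cdot> b \<sigma>" if t: "\<theta> \<in> bdry m" for \<theta>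
        using e att(2)[OF t] ConP_face[OF b sTb bs[OF t]] af(5) t by (metis length_map restrict_apply')
      ultimately show "\<beta> x \<in> El (BdryP m) U" unfolding cb \<beta>_def prod.case BdryP_El by blast
      fix V g
      have "(\<lambda>\<theta>\<in>bdry m. ac (ConP Y Ym S') c g (\<sigma> \<odot> \<theta>)) = ac (ConP Y Ym (bdry m)) (\<lambda>\<theta>\<in>bdry m. c (\<sigma> \<odot> \<theta>)) g"
        unfolding ConP_ac by (rule restrict_ext) (simp add: att(2))
      moreover have "ac (ConP Z Zm Tb) b g \<sigma> = b \<sigma> \<cdot> g" using sTb unfolding ConP_ac by simp
      ultimately show "\<beta> (ac (RelP S' Tb) x g) = ac (BdryP m) (\<beta> x) g" unfolding cb \<beta>_def prod.case RelP_ac BdryP_ac by simp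
    qed
    show "bdry_map m ((\<lambda>(c, b). c \<sigma>) x) = \<beta> ((\<lambda>(c, b). (restrict c S', b)) x)" if x: "x \<in> El (RelP T' Tb) U" for U x
    proof -
      obtain c b where cb: "x = (c, b)" by (cases x)
      have c: "c \<in> El (ConP Y Ym T') U" and e: "\<forall>\<sigma>\<in>T'. f (dm \<sigma>) \<cdot> c \<sigma> = b \<sigma>" using x unfolding cb RelP_El by auto
      have "faces Ym m (bdry m) (c \<sigma>) = (\<lambda>\<theta>\<in>bdry m. restrict c S' (\<sigma> \<odot> \<theta>))"
        unfolding faces_def by (rule restrict_ext) (use ConP_face[OF c af(4) bs] af(5) att(2) in simp)
      moreover have "f m \<cdot> c \<sigma> = b \<sigma>" using bspec[OF e af(4)] af(5) by simp
      ultimately show ?thesis unfolding cb prod.case bdry_map_def \<beta>_def by simp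
    qed
    fix U a x assume a: "a \<in> El (HomP (Y m)) U" and x: "x \<in> El (RelP S' Tb) U" and eq: "bdry_map m a = \<beta> x"
    obtain c b where cb: "x = (c, b)" by (cases x)
    have c: "c \<in> El (ConP Y Ym S') U" and b: "b \<in> El (ConP Z Zm Tb) U" and e: "\<forall>\<sigma>\<in>S'. f (dm \<sigma>) \<cdot> c \<sigma> = b \<sigma>"
      using x unfolding cb RelP_El by auto
    have a': "a \<in> hom U (Y m)" using a by (simp add: HomP_def)
    have eq1: "faces Ym m (bdry m) a = (\<lambda>\<theta>\<in>bdry m. c (\<sigma> \<odot> \<theta>))" and eq2: "f m \<cdot> a = b \<sigma>"
      using eq unfolding bdry_map_def \<beta>_def cb prod.case by auto
    have "Ym m \<theta> \<cdot> a = c (\<sigma> \<odot> \<theta>)" if "\<theta> \<in> bdry m" for \<theta>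
      using fun_cong[OF eq1, of \<theta>] that unfolding faces_def by simp
    from attach_glue[OF soY at a' c this] obtain d where d: "d \<in> El (ConP Y Ym T') U" "d \<sigma> = a" "restrict d S' = c"
      and du: "\<And>d'. d' \<in> El (ConP Y Ym T') U \<Longrightarrow> d' \<sigma> = a \<Longrightarrow> restrict d' S' = c \<Longrightarrow> d' = d" by metis
    \<comment> \<open>On the new cell, compatibility at \<sigma> spreads to the words
      \<open>\<sigma> \<odot> \<theta>\<close> because \<open>f\<close> is simplicial.\<close>
    have "f (dm w) \<cdot> d w = b w" if w: "w \<in> T'" for w
    proof (cases "w \<in> S'")
      case True
      then show ?thesis using e fun_cong[OF d(3), of w] by simp
    next
      case False
      then obtain \<theta> where t: "\<theta> \<in> simplex m" "w = \<sigma> \<odot> \<theta>" using w att(1) by blast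
      have t': "\<theta> \<in> simplex (dm \<sigma>)" using t af by simp
      have "d w = Ym m \<theta> \<cdot> a" using ConP_face[OF d(1) af(4) t'] d(2) af(5) t(2) by simp
      moreover have "b w = Zm m \<theta> \<cdot> b \<sigma>" using ConP_face[OF b sTb t'] af(5) t(2) by simp
      ultimately show ?thesis using f_face[OF t(1) a'] eq2 t(2) by simp
    qed
    then have "(d, b) \<in> El (RelP T' Tb) U" unfolding RelP_El using d b by blast
    then show "\<exists>!x'. x' \<in> El (RelP T' Tb) U \<and> (\<lambda>(c, b). c \<sigma>) x' = a \<and> (\<lambda>(c, b). (restrict c S', b)) x' = x"
    proof (intro ex1I[of _ "(d, b)"])
      fix x' assume x': "x' \<in> El (RelP T' Tb) U \<and> (\<lambda>(c, b). c \<sigma>) x' = a \<and> (\<lambda>(c, b). (restrict c S', b)) x' = x"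
      obtain d' b' where x'e: "x' = (d', b')" by (cases x')
      have "d' \<in> El (ConP Y Ym T') U" "d' \<sigma> = a" "restrict d' S' = c" "b' = b" using x' unfolding x'e cb RelP_El by auto
      then show "x' = (d, b)" using du x'e by blast
    qed (use d cb in simp)
  qed
qed

text \<open>The relative lifting property against every inclusion of subcomplexes of a standard
  simplex, by composing cell steps. Naturality is part of the induction predicate because composing
  \<open>cov\<close> asks for it.\<close>

lemma RelP_cov:
  assumes hc: "\<And>m. cov Cov (HomP (Y m)) (BdryP m) (bdry_map m)"
    and S: "sset S" and T: "sset T" and ST: "S \<subseteq> T" and N: "T \<subseteq> simplex N"
  shows "cov Cov (RelP T T) (RelP S T) (\<lambda>(c, b). (restrict c S, b))"
proof -
  define P where "P R \<longleftrightarrow> ntr (RelP R T) (RelP S T) (\<lambda>(c, b). (restrict c S, b)) \<and>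
    cov Cov (RelP R T) (RelP S T) (\<lambda>(c, b). (restrict c S, b))" for R
  have "P T"
    using S T ST N
  proof (induction rule: cell_induct)
    case base
    have r: "(\<lambda>(c, b). (restrict c S, b)) x = x" if "x \<in> El (RelP S T) U" for x U
      using that extensional_restrict[OF ConP_ext] by (cases x) (auto simp: RelP_El simp del: restrict_apply)
    have n: "ntr (RelP S T) (RelP S T) (\<lambda>(c, b). (restrict c S, b))"
      by (rule ntr_RelP[OF S order_refl])
    have "bijn (RelP S T) (RelP S T) (\<lambda>(c, b). (restrict c S, b))"
    proof (rule bijnI[OF n])
      show "\<exists>x. x \<in> El (RelP S T) U \<and> (\<lambda>(c, b). (restrict c S, b)) x = b" if "b \<in> El (RelP S T) U" for U b
        by (rule exI[of _ b], rule conjI[OF that r[OF that]])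
      show "x = y" if "x \<in> El (RelP S T) U" "y \<in> El (RelP S T) U"
        "(\<lambda>(c, b). (restrict c S, b)) x = (\<lambda>(c, b). (restrict c S, b)) y" for U x y
        using that(3) unfolding r[OF that(1)] r[OF that(2)] .
    qed
    from bijn_cov[OF covM psh_RelP[OF S T ST] psh_RelP[OF S T ST] n this] show ?case
      unfolding P_def by (intro conjI n)
  next
    case (step S' T' \<sigma> m)
    note af = attach_facts[OF step(1)]
    have S': "S' \<subseteq> T" "S \<subseteq> T'" using step(2,3) af(3) by auto
    have p: "psh (RelP T' T)" "psh (RelP S' T)" "psh (RelP S T)" using psh_RelP af S T ST S' step(3) by auto
    have n1: "ntr (RelP T' T) (RelP S' T) (\<lambda>(c, b). (restrict c S', b))"
      by (rule ntr_RelP[OF af(1,3)])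
    have IH: "ntr (RelP S' T) (RelP S T) (\<lambda>(c, b). (restrict c S, b))" "cov Cov (RelP S' T) (RelP S T) (\<lambda>(c, b). (restrict c S, b))"
      using step(9) unfolding P_def by auto
    have e: "(\<lambda>x. (\<lambda>(c, b). (restrict c S, b)) ((\<lambda>(c, b). (restrict c S', b)) x)) =
       (\<lambda>(c::nat list \<Rightarrow> 'm, b::nat list \<Rightarrow> 'm). (restrict c S, b))"
      using step(2) by (auto simp: fun_eq_iff restrict_def)
    show ?case
      using cov_comp[OF covM p n1 IH(1) RelP_step[OF hc step(1) T step(3)] IH(2)] ntr_comp[OF n1 IH(1)]
      unfolding e P_def by blast
  qed
  then show ?thesis unfolding P_def by blast
qed

text \<open>The case of the empty subcomplex, where \<open>RelP T T\<close> and
  \<open>RelP {} T\<close> reduce to the cones in \<open>Y\<close> and in \<open>Z\<close>.\<close>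

lemma map_cone_cov:
  assumes hc: "\<And>m. cov Cov (HomP (Y m)) (BdryP m) (bdry_map m)" and T: "sset T" and N: "T \<subseteq> simplex N"
  shows "cov Cov (ConP Y Ym T) (ConP Z Zm T) (map_cone T)"
proof -
  have q: "cov Cov (RelP T T) (RelP {} T) (\<lambda>(c, b). (restrict c {}, b))"
    by (rule RelP_cov[OF hc sset_empty T _ N]) simp
  have E: "c \<in> El (ConP Y Ym {}) U \<longleftrightarrow> U \<in> Ob C \<and> c = (\<lambda>_. undefined)" for c U
    unfolding ConP_def is_cone_map_diag by auto
  have re: "restrict c {} = (\<lambda>_. undefined)" for c :: "nat list \<Rightarrow> 'm" by (auto simp: restrict_def)
  have n1: "ntr (ConP Y Ym T) (RelP T T) (\<lambda>c. (c, map_cone T c))"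
  proof (rule ntrI)
    fix U c assume c: "c \<in> El (ConP Y Ym T) U"
    show "(c, map_cone T c) \<in> El (RelP T T) U" unfolding RelP_El using c map_cone_ConP[OF T c] by (simp add: map_cone_def)
    fix V g assume "g \<in> hom V U"
    then show "(ac (ConP Y Ym T) c g, map_cone T (ac (ConP Y Ym T) c g)) = ac (RelP T T) (c, map_cone T c) g"
      unfolding RelP_ac using ntr_ac[OF map_cone_ntr[OF T] c] by simp
  qed
  have n2: "ntr (ConP Z Zm T) (RelP {} T) (\<lambda>b. ((\<lambda>_. undefined), b))"
  proof (rule ntrI)
    fix U b assume b: "b \<in> El (ConP Z Zm T) U"
    show "((\<lambda>_. undefined), b) \<in> El (RelP {} T) U" unfolding RelP_El E using b ConP_ob[OF b] by simp
    fix V g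
    show "((\<lambda>_. undefined), ac (ConP Z Zm T) b g) = ac (RelP {} T) ((\<lambda>_. undefined), b) g"
      unfolding RelP_ac ConP_ac[of Y] re by simp
  qed
  have b1: "bijn (ConP Y Ym T) (RelP T T) (\<lambda>c. (c, map_cone T c))"
  proof (rule bijnI[OF n1])
    fix U x assume x: "x \<in> El (RelP T T) U"
    obtain c b where cb: "x = (c, b)" by (cases x)
    have c: "c \<in> El (ConP Y Ym T) U" and b: "b \<in> El (ConP Z Zm T) U" and e: "\<forall>\<sigma>\<in>T. f (dm \<sigma>) \<cdot> c \<sigma> = b \<sigma>"
      using x unfolding cb RelP_El by auto
    have "map_cone T c = b" by (rule ConP_eqI[OF map_cone_ConP[OF T c] b]) (use e in \<open>simp add: map_cone_def\<close>)
    then show "\<exists>c. c \<in> El (ConP Y Ym T) U \<and> (c, map_cone T c) = x" using c cb by blast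
  qed simp
  have b2: "bijn (ConP Z Zm T) (RelP {} T) (\<lambda>b. ((\<lambda>_. undefined), b))"
  proof (rule bijnI[OF n2])
    fix U x assume x: "x \<in> El (RelP {} T) U"
    obtain c b where cb: "x = (c, b)" by (cases x)
    then show "\<exists>b. b \<in> El (ConP Z Zm T) U \<and> ((\<lambda>_. undefined), b) = x" using x unfolding cb RelP_El E by blast
  qed simp
  show ?thesis
  proof (rule cov_bijn_transfer[OF q psh_RelP[OF T T order_refl] psh_RelP[OF sset_empty T empty_subsetI] psh_ConP[OF soY T]
      psh_ConP[OF soZ T] map_cone_ntr[OF T] n1 n2 b1 b2])
    show "(\<lambda>(c, b). (restrict c {}, b)) (c, map_cone T c) = ((\<lambda>_. undefined), map_cone T c)" for c
      unfolding prod.case re ..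
  qed
qed

lemma map_cone_faces:
  assumes "S \<subseteq> simplex n" "y \<in> hom U (Y n)"
  shows "map_cone S (faces Ym n S y) = faces Zm n S (f n \<cdot> y)"
  unfolding map_cone_def faces_def by (rule restrict_ext) (use f_face[OF _ assms(2)] assms(1) in auto)

text \<open>\<open>u \<cdot> f n\<close> corresponds to the composite of Y_n, Map(S,Y) and Map(S,Z),
  both of whose maps are covers; \<open>f n\<close> is then cancelled.\<close>

lemma groupoid_horn_cov:
  assumes hc: "\<And>m. cov Cov (HomP (Y m)) (BdryP m) (bdry_map m)" and fCov: "f n \<in> Cov"
    and S: "sset S" "S \<subseteq> simplex n"
    and Yc: "cov Cov (HomP (Y n)) (ConP Y Ym S) (faces Ym n S)"
  shows "restr_prop C (\<lambda>u. u \<in> Cov) Z Zm n S"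
  unfolding restr_prop_def
proof (intro allI impI; elim conjE)
  fix L p u assume l: "is_limit C (map_diag Z Zm S) L p" and u: "u \<in> hom (Z n) L" "\<forall>\<sigma>\<in>S. p \<sigma> \<cdot> u = Zm n \<sigma>"
  note r = limit_reps[OF S(1) l] and pY = psh_ConP[OF soY S(1)] and pZ = psh_ConP[OF soZ S(1)]
  note n1 = ntr_faces[OF soY S(2,1)] and n2 = map_cone_ntr[OF S(1)]
  have c: "cov Cov (HomP (Y n)) (ConP Z Zm S) (\<lambda>y. map_cone S (faces Ym n S y))"
    by (rule cov_comp[OF covM psh_HomP pY pZ n1 n2 Yc map_cone_cov[OF hc S]])
  have uf: "u \<cdot> f n \<in> hom (Y n) L" using cmp_hom[OF u(1) fh] .
  have x: "restrict p S \<in> El (ConP Z Zm S) L" using r unfolding reps_def by blast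
  have i: "Idm C (Y n) \<in> hom (Y n) (Y n)" using so_ob[OF soY] by blast
  have "map_cone S (faces Ym n S (Idm C (Y n))) = faces Zm n S (f n)"
    using map_cone_faces[OF S(2) i] id_right[OF fh] by simp
  also have "\<dots> = ac (ConP Z Zm S) (faces Zm n S (Idm C (Z n))) (f n)"
    using ntr_ac[OF ntr_faces[OF soZ S(2,1)], of "Idm C (Z n)" "Z n" "f n" "Y n"] fh id_left[OF fh] so_ob[OF soZ]
    by (simp add: HomP_def id_hom)
  also have "\<dots> = ac (ConP Z Zm S) (restrict p S) (u \<cdot> f n)"
    unfolding faces_reps_arrow[OF soZ S u] by (rule psh_cmp[OF pZ x u(1) fh])
  finally have "u \<cdot> f n \<in> Cov"
    by (rule cov_reps_arrow[OF covM pZ c ntr_comp[OF n1 n2] r uf])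
  then show "u \<in> Cov" by (rule cov_cancel[OF fCov fh u(1)])
qed

text \<open>A monic cover is invertible, so only monicity is left. The order of the lifts matters:
  the common horn is lifted to \<open>Y\<close> before its two fillers are lifted relative to it, so
  that \<open>Yb\<close> can identify them. The equality descends because covers are epic.\<close>

lemma groupoid_horn_iso:
  assumes hc: "\<And>m. cov Cov (HomP (Y m)) (BdryP m) (bdry_map m)" and fCov: "f n \<in> Cov"
    and S: "sset S" "S \<subseteq> simplex n"
    and Yc: "cov Cov (HomP (Y n)) (ConP Y Ym S) (faces Ym n S)"
    and Yb: "bijn (HomP (Y n)) (ConP Y Ym S) (faces Ym n S)"
  shows "restr_prop C (iso C) Z Zm n S"
  unfolding restr_prop_def
proof (intro allI impI; elim conjE)
  fix L p u assume l: "is_limit C (map_diag Z Zm S) L p" and u: "u \<in> hom (Z n) L" "\<forall>\<sigma>\<in>S. p \<sigma> \<cdot> u = Zm n \<sigma>"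
  have uC: "u \<in> Cov" using groupoid_horn_cov[OF hc fCov S Yc] l u unfolding restr_prop_def by blast
  have lp: "p \<sigma> \<in> hom L (Z (dm \<sigma>))" if "\<sigma> \<in> S" for \<sigma>
    using l that unfolding is_limit_def is_cone_map_diag by blast
  define D where "D = simplex n"
  have D: "sset D" "S \<subseteq> D" "D \<subseteq> simplex n" using S sset_simplex unfolding D_def by auto
  define e where "e = [0..<Suc n]"
  have eD: "e \<in> D" "dm e = n" unfolding D_def e_def using id_simplex by auto
  have Qc: "cov Cov (RelP D D) (RelP S D) (\<lambda>(c, b). (restrict c S, b))" by (rule RelP_cov[OF hc S(1) D(1,2,3)])
  \<comment> \<open>Relative lifting for \<open>S\<close> inside the standard simplex; evaluating
    the resulting cone at the top simplex \<open>e\<close> turns it into a filler in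
    \<open>Y n\<close>.\<close>
  have lift: "\<exists>V' g' y. g' \<in> Cov \<and> g' \<in> hom V' V \<and> y \<in> hom V' (Y n) \<and> faces Ym n S y = ac (ConP Y Ym S) c g' \<and> f n \<cdot> y = z \<cdot> g'"
    if c: "c \<in> El (ConP Y Ym S) V" and z: "z \<in> hom V (Z n)" and cz: "map_cone S c = faces Zm n S z" for c z V
  proof -
    have b: "faces Zm n D z \<in> El (ConP Z Zm D) V" using faces_ConP[OF soZ D(3,1) z] .
    have "\<forall>\<sigma>\<in>S. f (dm \<sigma>) \<cdot> c \<sigma> = faces Zm n D z \<sigma>"
    proof
      fix \<sigma> assume s: "\<sigma> \<in> S"
      show "f (dm \<sigma>) \<cdot> c \<sigma> = faces Zm n D z \<sigma>"
        using fun_cong[OF cz, of \<sigma>] s D(2) unfolding map_cone_def faces_def by auto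
    qed
    then have "(c, faces Zm n D z) \<in> El (RelP S D) V" unfolding RelP_El using c b by blast
    from Qc this obtain V' g' a where 1: "g' \<in> Cov" "g' \<in> hom V' V" "a \<in> El (RelP D D) V'"
      "(\<lambda>(c, b). (restrict c S, b)) a = ac (RelP S D) (c, faces Zm n D z) g'"
      by (rule covE) (rule that)
    obtain d b' where a: "a = (d, b')" by (cases a)
    have d: "d \<in> El (ConP Y Ym D) V'" "\<forall>\<sigma>\<in>D. f (dm \<sigma>) \<cdot> d \<sigma> = b' \<sigma>" using 1(3) unfolding a RelP_El by auto
    have eq: "restrict d S = ac (ConP Y Ym S) c g'" "b' = ac (ConP Z Zm D) (faces Zm n D z) g'"
      using 1(4) unfolding a prod.case RelP_ac by auto
    have y: "d e \<in> hom V' (Y n)" using ConP_hom[OF d(1) eD(1)] eD(2) by simp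
    have "faces Ym n S (d e) = restrict d S" unfolding faces_def
    proof (rule restrict_ext)
      fix \<sigma> assume s: "\<sigma> \<in> S"
      then have s': "\<sigma> \<in> simplex n" using S by blast
      have "e \<odot> \<sigma> = \<sigma>" unfolding e_def by (rule sub_id_thick) (use s' in \<open>simp add: simplex_def\<close>)
      then show "Ym n \<sigma> \<cdot> d e = d \<sigma>" using ConP_face[OF d(1) eD(1), of \<sigma>] s' eD(2) by simp
    qed
    moreover have "f n \<cdot> d e = z \<cdot> g'"
    proof -
      have "b' e = Zm n e \<cdot> z \<cdot> g'" unfolding eq(2) ConP_ac faces_def using eD by simp
      moreover have "Zm n e \<cdot> z = z" unfolding e_def so_id[OF soZ] by (rule id_left[OF z])
      moreover have "f n \<cdot> d e = b' e" using bspec[OF d(2) eD(1)] eD(2) by simp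
      ultimately show ?thesis by simp
    qed
    ultimately show ?thesis using 1(1,2) y eq(1) by auto
  qed
  have mono: "z = z'" if z: "z \<in> hom U (Z n)" and z': "z' \<in> hom U (Z n)" and zz: "u \<cdot> z = u \<cdot> z'" for U z z'
  proof -
    have "Zm n \<sigma> \<cdot> z = Zm n \<sigma> \<cdot> z'" if s: "\<sigma> \<in> S" for \<sigma>
      using assoc[OF lp[OF s] u(1) z] assoc[OF lp[OF s] u(1) z'] u(2) s zz by simp
    then have fz: "faces Zm n S z = faces Zm n S z'" unfolding faces_def by (intro restrict_ext)
    have "faces Zm n S z \<in> El (ConP Z Zm S) U" using faces_ConP[OF soZ S(2,1) z] .
    from map_cone_cov[OF hc S] this obtain V g c where 1: "g \<in> Cov" "g \<in> hom V U" "c \<in> El (ConP Y Ym S) V"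
      "map_cone S c = ac (ConP Z Zm S) (faces Zm n S z) g" by (rule covE) (rule that)
    have ez: "ac (ConP Z Zm S) (faces Zm n S x) h = faces Zm n S (x \<cdot> h)" if "x \<in> hom A (Z n)" "h \<in> hom B A" for x h A B
      using ntr_ac[OF ntr_faces[OF soZ S(2,1)], of x A h B] that by (simp add: HomP_def)
    have ey: "ac (ConP Y Ym S) (faces Ym n S x) h = faces Ym n S (x \<cdot> h)" if "x \<in> hom A (Y n)" "h \<in> hom B A" for x h A B
      using ntr_ac[OF ntr_faces[OF soY S(2,1)], of x A h B] that by (simp add: HomP_def)
    have zg: "z \<cdot> g \<in> hom V (Z n)" and zg': "z' \<cdot> g \<in> hom V (Z n)" using cmp_hom[OF z 1(2)] cmp_hom[OF z' 1(2)] .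
    have c1: "map_cone S c = faces Zm n S (z \<cdot> g)" "map_cone S c = faces Zm n S (z' \<cdot> g)"
      using 1(4) ez[OF z 1(2)] ez[OF z' 1(2)] fz by simp_all
    obtain V1 g1 y1 where 2: "g1 \<in> Cov" "g1 \<in> hom V1 V" "y1 \<in> hom V1 (Y n)" "faces Ym n S y1 = ac (ConP Y Ym S) c g1"
      "f n \<cdot> y1 = z \<cdot> g \<cdot> g1" using lift[OF 1(3) zg c1(1)] by (elim exE conjE) (rule that)
    note pY = psh_ConP[OF soY S(1)]
    \<comment> \<open>The second filler is lifted over the cover \<open>g1\<close> on which the
      first one exists, so that the two can be compared.\<close>
    have cg: "ac (ConP Y Ym S) c g1 \<in> El (ConP Y Ym S) V1" using psh_ac[OF pY 1(3) 2(2)] .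
    have zgg: "z' \<cdot> g \<cdot> g1 \<in> hom V1 (Z n)" using cmp_hom[OF zg' 2(2)] .
    have "map_cone S (ac (ConP Y Ym S) c g1) = faces Zm n S (z' \<cdot> g \<cdot> g1)"
      using ntr_ac[OF map_cone_ntr[OF S(1)] 1(3) 2(2)] c1(2) ez[OF zg' 2(2)] by simp
    from lift[OF cg zgg this] obtain V2 g2 y2 where 3: "g2 \<in> Cov" "g2 \<in> hom V2 V1" "y2 \<in> hom V2 (Y n)"
      "faces Ym n S y2 = ac (ConP Y Ym S) (ac (ConP Y Ym S) c g1) g2" "f n \<cdot> y2 = z' \<cdot> g \<cdot> g1 \<cdot> g2"
      by (elim exE conjE) (rule that)
    have "faces Ym n S (y1 \<cdot> g2) = faces Ym n S y2" using ey[OF 2(3) 3(2)] 2(4) 3(4) by simp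
    then have "y1 \<cdot> g2 = y2"
      using bijn_inj[OF Yb, of "y1 \<cdot> g2" V2 y2] cmp_hom[OF 2(3) 3(2)] 3(3) by (simp add: HomP_def)
    then have "z \<cdot> g \<cdot> g1 \<cdot> g2 = z' \<cdot> g \<cdot> g1 \<cdot> g2"
      using assoc[OF fh 2(3) 3(2)] 2(5) 3(5) by simp
    then have "z \<cdot> g \<cdot> g1 = z' \<cdot> g \<cdot> g1" using cov_epi[OF 3(1,2) cmp_hom[OF zg 2(2)] zgg] by blast
    then have "z \<cdot> g = z' \<cdot> g" using cov_epi[OF 2(1,2) zg zg'] by blast
    then show ?thesis using cov_epi[OF 1(1,2) z z'] by blast
  qed
  show "iso C u" by (rule cov_mono_iso[OF uC u(1) mono])
qed

text \<open>The pullback in the definition of a hypercover represents the presheaf \<open>BdryP n\<close>.\<close>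

lemma bdry_map_hypercover:
  assumes hc: "\<And>m. cov Cov (HomP (Y m)) (BdryP m) (bdry_map m)"
  shows "hypercover C Cov Y Ym Z Zm f"
  unfolding hypercover_def
proof (intro allI impI; elim conjE)
  fix n LY pY LZ pZ g h r P p1 p2 u
  assume lY: "is_limit C (map_diag Y Ym (bdry n)) LY pY" and lZ: "is_limit C (map_diag Z Zm (bdry n)) LZ pZ"
    and g: "g \<in> hom LY LZ" and ge: "\<forall>\<sigma>\<in>bdry n. pZ \<sigma> \<cdot> g = f (dm \<sigma>) \<cdot> pY \<sigma>"
    and h: "h \<in> hom (Z n) LZ" and he: "\<forall>\<sigma>\<in>bdry n. pZ \<sigma> \<cdot> h = Zm n \<sigma>"
    and r: "r \<in> hom (Y n) LY" and re: "\<forall>\<sigma>\<in>bdry n. pY \<sigma> \<cdot> r = Ym n \<sigma>"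
    and pb: "is_pullback C g h P p1 p2" and u: "u \<in> hom (Y n) P" "p1 \<cdot> u = r" "p2 \<cdot> u = f n"
  have hY: "pY \<sigma> \<in> hom LY (Y (dm \<sigma>))" and hZ: "pZ \<sigma> \<in> hom LZ (Z (dm \<sigma>))" if "\<sigma> \<in> bdry n" for \<sigma>
    using lY lZ that unfolding is_limit_def is_cone_map_diag by blast+
  have sb: "\<sigma> \<in> simplex n" if "\<sigma> \<in> bdry n" for \<sigma> using that bdry_sub by blast
  note pp = pb[unfolded is_pullback_hom[OF g h]]
  have p1: "p1 \<in> hom P LY" and p2: "p2 \<in> hom P (Z n)" and pe: "g \<cdot> p1 = h \<cdot> p2" using pp by blast+
  note rY = limit_reps[OF sset_bdry lY] and rZ = limit_reps[OF sset_bdry lZ]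
  note psY = psh_ConP[OF soY sset_bdry[of n]] and psZ = psh_ConP[OF soZ sset_bdry[of n]]
  have xY: "restrict pY (bdry n) \<in> El (ConP Y Ym (bdry n)) LY" using rY unfolding reps_def by blast
  define \<xi> where "\<xi> = (ac (ConP Y Ym (bdry n)) (restrict pY (bdry n)) p1, p2)"
  have key: "f (dm \<sigma>) \<cdot> (pY \<sigma> \<cdot> a) = pZ \<sigma> \<cdot> (g \<cdot> a)" "Zm n \<sigma> \<cdot> z = pZ \<sigma> \<cdot> (h \<cdot> z)"
    if "\<sigma> \<in> bdry n" "a \<in> hom W LY" "z \<in> hom W (Z n)" for \<sigma> a z W
    using assoc[OF fh hY[OF that(1)] that(2)] assoc[OF hZ[OF that(1)] g that(2)] ge
      assoc[OF hZ[OF that(1)] h that(3)] he that(1) by simp_all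
  \<comment> \<open>Compatibility over the boundary amounts to one equation, because the legs
    \<open>pZ \<sigma>\<close> are jointly monic.\<close>
  have BPa: "(ac (ConP Y Ym (bdry n)) (restrict pY (bdry n)) a, z) \<in> El (BdryP n) W \<longleftrightarrow> g \<cdot> a = h \<cdot> z"
    if a: "a \<in> hom W LY" and z: "z \<in> hom W (Z n)" for a z W
  proof -
    have "(ac (ConP Y Ym (bdry n)) (restrict pY (bdry n)) a, z) \<in> El (BdryP n) W \<longleftrightarrow>
      (\<forall>\<sigma>\<in>bdry n. pZ \<sigma> \<cdot> (g \<cdot> a) = pZ \<sigma> \<cdot> (h \<cdot> z))"
      unfolding BdryP_El using psh_ac[OF psY xY a] z key[OF _ a z] by (simp add: ConP_ac)
    also have "\<dots> \<longleftrightarrow> g \<cdot> a = h \<cdot> z"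
    proof
      assume "\<forall>\<sigma>\<in>bdry n. pZ \<sigma> \<cdot> (g \<cdot> a) = pZ \<sigma> \<cdot> (h \<cdot> z)"
      then have "ac (ConP Z Zm (bdry n)) (restrict pZ (bdry n)) (g \<cdot> a) = ac (ConP Z Zm (bdry n)) (restrict pZ (bdry n)) (h \<cdot> z)"
        unfolding ConP_ac by (intro restrict_ext) simp
      moreover have "bijn (HomP LZ) (ConP Z Zm (bdry n)) (ac (ConP Z Zm (bdry n)) (restrict pZ (bdry n)))"
        using reps_bijn[OF psZ rZ] by blast
      ultimately show "g \<cdot> a = h \<cdot> z"
        using bijn_inj[of "HomP LZ" _ _ "g \<cdot> a" W "h \<cdot> z"] cmp_hom[OF g a] cmp_hom[OF h z] by (simp add: HomP_def)
    qed simp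
    finally show ?thesis .
  qed
  have rep: "reps (BdryP n) P \<xi>" unfolding reps_def
  proof (intro conjI allI impI)
    show "\<xi> \<in> El (BdryP n) P" unfolding \<xi>_def using BPa[OF p1 p2] pe by blast
    fix W x assume x: "x \<in> El (BdryP n) W"
    obtain c z where cz: "x = (c, z)" by (cases x)
    have c: "c \<in> El (ConP Y Ym (bdry n)) W" and z: "z \<in> hom W (Z n)" using x unfolding cz BdryP_El by auto
    have ex: "\<exists>!a. a \<in> hom W LY \<and> ac (ConP Y Ym (bdry n)) (restrict pY (bdry n)) a = c" using rY c unfolding reps_def by blast
    then obtain a where a: "a \<in> hom W LY" "ac (ConP Y Ym (bdry n)) (restrict pY (bdry n)) a = c" by blast
    have "g \<cdot> a = h \<cdot> z" using BPa[OF a(1) z] x unfolding cz a(2) by blast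
    then obtain v where v: "v \<in> hom W P" "p1 \<cdot> v = a" "p2 \<cdot> v = z" by (rule pullback_lift[OF pb g h a(1) z])
    have act: "ac (BdryP n) \<xi> v = (ac (ConP Y Ym (bdry n)) (restrict pY (bdry n)) (p1 \<cdot> v), p2 \<cdot> v)" if "v \<in> hom W P" for v
      unfolding \<xi>_def BdryP_ac using psh_cmp[OF psY xY p1 that] by simp
    show "\<exists>!v. v \<in> hom W P \<and> ac (BdryP n) \<xi> v = x"
    proof (rule ex1I[of _ v])
      show "v \<in> hom W P \<and> ac (BdryP n) \<xi> v = x" using v act a cz by simp
      fix v' assume v': "v' \<in> hom W P \<and> ac (BdryP n) \<xi> v' = x"
      then have v'h: "v' \<in> hom W P" by blast
      then have e: "ac (ConP Y Ym (bdry n)) (restrict pY (bdry n)) (p1 \<cdot> v') = c" "p2 \<cdot> v' = z" using v' act cz by auto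
      have "p1 \<cdot> v' = a" using ex e(1) a cmp_hom[OF p1 v'h] by blast
      moreover have "\<exists>!v. v \<in> hom W P \<and> p1 \<cdot> v = a \<and> p2 \<cdot> v = z" using pp a(1) z \<open>g \<cdot> a = h \<cdot> z\<close> by simp
      ultimately show "v' = v" using v v'h e(2) by blast
    qed
  qed
  have i: "Idm C (Y n) \<in> hom (Y n) (Y n)" using so_ob[OF soY] by blast
  have "faces Ym n (bdry n) (Idm C (Y n)) = ac (ConP Y Ym (bdry n)) (restrict pY (bdry n)) r"
    by (rule faces_reps_arrow[OF soY sset_bdry bdry_sub r re])
  then have "bdry_map n (Idm C (Y n)) = ac (BdryP n) \<xi> u"
    unfolding bdry_map_def \<xi>_def BdryP_ac using psh_cmp[OF psY xY p1 u(1)] u(2,3) id_right[OF fh] by simp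
  then show "u \<in> Cov" by (rule cov_reps_arrow[OF covM psh_BdryP hc ntr_bdry_map rep u(1)])
qed

end

section \<open>Subcomplexes in dimensions 0 and 1\<close>

lemma set_singleton_word: "remdups_adj w = [x] \<longleftrightarrow> set w = {x}"
proof
  show "set w = {x}" if "remdups_adj w = [x]" using remdups_adj_set[of w] that by simp
  assume s: "set w = {x}"
  then have ne: "w \<noteq> []" by auto
  then obtain r where r: "remdups_adj w = hd w # r" using remdups_adj_Cons_hd[of "hd w" "tl w"] by auto
  have sr: "set (remdups_adj w) = {x}" using s by simp
  have "r = []"
  proof (cases r)
    case (Cons y r')
    have "distinct_adj (hd w # y # r')" using r Cons distinct_adj_remdups_adj[of w] by metis
    then have "hd w \<noteq> y" by simp
    moreover have "hd w = x" "y = x" using sr r Cons by auto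
    ultimately show ?thesis by simp
  qed
  then show "remdups_adj w = [x]" using r sr by auto
qed

lemma bdry_0: "bdry 0 = {}"
proof -
  have "set \<sigma> = {0}" if "\<sigma> \<in> simplex 0" for \<sigma> using that unfolding simplex_iff by (cases \<sigma>) auto
  then show ?thesis unfolding bdry_def by auto
qed

lemma simplex_set: "\<sigma> \<in> simplex n \<Longrightarrow> \<sigma> \<noteq> [] \<and> set \<sigma> \<noteq> {} \<and> set \<sigma> \<subseteq> {..n}"
  unfolding simplex_iff by auto

lemma subset_pair:
  assumes "A \<subseteq> {a, b}" "A \<noteq> {}"
  shows "a \<notin> A \<Longrightarrow> A = {b}" "b \<notin> A \<Longrightarrow> A = {a}"
proof -
  have x: "x = a \<or> x = b" if "x \<in> A" for x using that assms(1) by auto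
  obtain y where y: "y \<in> A" using assms(2) by auto
  show "A = {b}" if "a \<notin> A"
  proof (rule set_eqI)
    show "z \<in> A \<longleftrightarrow> z \<in> {b}" for z using x[of z] x[OF y] y that by auto
  qed
  show "A = {a}" if "b \<notin> A"
  proof (rule set_eqI)
    show "z \<in> A \<longleftrightarrow> z \<in> {a}" for z using x[of z] x[OF y] y that by auto
  qed
qed

lemma bdry_1:
  assumes "\<sigma> \<in> bdry (Suc 0)"
  obtains x where "x \<le> Suc 0" "set \<sigma> = {x}"
proof -
  have s: "set \<sigma> \<noteq> {}" "set \<sigma> \<subseteq> {..Suc 0}" "\<not> {..Suc 0} \<subseteq> set \<sigma>"
    using assms simplex_set unfolding bdry_def by auto
  have a: "{..Suc 0} = {0, Suc 0}" by auto
  show ?thesis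
  proof (cases "0 \<in> set \<sigma>")
    case True
    then have "Suc 0 \<notin> set \<sigma>" using s(3) unfolding a by auto
    then have "set \<sigma> = {0}" by (rule subset_pair(2)[OF s(2)[unfolded a] s(1)])
    then show ?thesis using that[of 0] by simp
  next
    case False
    then have "set \<sigma> = {Suc 0}" by (rule subset_pair(1)[OF s(2)[unfolded a] s(1)])
    then show ?thesis using that[of "Suc 0"] by simp
  qed
qed

text \<open>The one face in this horn is opposite to the vertex other than \<open>i\<close>, hence
  it is the vertex \<open>i\<close>; the other words are its degeneracies.\<close>

lemma horn_1: "i \<le> Suc 0 \<Longrightarrow> horn (Suc 0) i = {w. remdups_adj w = [i]}"
proof -
  assume i: "i \<le> Suc 0"
  have a: "{..Suc 0} = {0, Suc 0}" by auto
  have "w \<in> horn (Suc 0) i \<longleftrightarrow> set w = {i}" for w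
  proof
    assume "w \<in> horn (Suc 0) i"
    then have s: "set w \<noteq> {}" "set w \<subseteq> {..Suc 0}" "\<not> {..Suc 0} \<subseteq> insert i (set w)"
      using simplex_set unfolding horn_def by auto
    show "set w = {i}"
    proof (cases "i = 0")
      case True
      then have "Suc 0 \<notin> set w" using s(3) unfolding a by auto
      then have "set w = {0}" by (rule subset_pair(2)[OF s(2)[unfolded a] s(1)])
      then show ?thesis using True by simp
    next
      case False
      then have i1: "i = Suc 0" using i by simp
      then have "0 \<notin> set w" using s(3) unfolding a by auto
      then have "set w = {Suc 0}" by (rule subset_pair(1)[OF s(2)[unfolded a] s(1)])
      then show ?thesis using i1 by simp
    qed
  next
    assume s: "set w = {i}"
    have nt: "w ! a = i" if "a < length w" for a using nth_mem[OF that] s by simp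
    have "sorted w" unfolding sorted_iff_nth_mono
    proof (intro allI impI)
      fix a b assume "a \<le> b" "b < length w"
      then show "w ! a \<le> w ! b" using nt[of a] nt[of b] by simp
    qed
    moreover have "w \<noteq> []" using s by (metis empty_set insert_not_empty)
    moreover have "\<forall>j\<in>set w. j \<le> Suc 0" unfolding s using i by simp
    ultimately have "w \<in> simplex (Suc 0)" unfolding simplex_iff by (intro conjI)
    moreover have "\<not> {..Suc 0} \<subseteq> {i}" unfolding a by auto
    ultimately show "w \<in> horn (Suc 0) i" using s unfolding horn_def by auto
  qed
  then show ?thesis unfolding set_singleton_word by blast
qed

lemma constant_word:
  assumes "set \<sigma> = {x}"
  obtains \<theta> where "\<theta> \<in> simplex 0" "\<sigma> = [x] \<odot> \<theta>"
proof -
  have r: "remdups_adj \<sigma> = [x]" unfolding set_singleton_word by (rule assms)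
  then have "\<sigma> \<noteq> []" by auto
  from remdups_adj_degeneracy[OF this] have "\<exists>\<theta>\<in>simplex 0. \<sigma> = [x] \<odot> \<theta>" unfolding r by auto
  then show ?thesis by (elim bexE) (rule that)
qed

lemma horn_sub: "horn n i \<subseteq> simplex n"
  unfolding horn_def by blast

section \<open>The simplicial object of images\<close>

locale core_ctx = descent_ctx C Cov Reg + thick_ctx C X Xm Gb p
  for C :: "('o,'m) cat" and Cov Reg :: "'m set" and X Xm Gb p +
  fixes k :: nat and q i :: "nat \<Rightarrow> 'm"
  assumes k: "0 < k" and rk: "regular_k_category C Cov Reg X Xm k"
    and reg: "\<And>n. p n [0..<Suc n] \<in> Reg"
    and ci: "\<And>n. is_coimage C (p n [0..<Suc n]) (q n) (i n)"
begin

lemma horn_cov: "0 < j \<Longrightarrow> j < m \<Longrightarrow> cov Cov (HomP (X m)) (ConP X Xm (horn m j)) (faces Xm m (horn m j))"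
proof -
  assume j: "0 < j" "j < m"
  then have "restr_prop C (\<lambda>u. u \<in> Cov) X Xm m (horn m j)"
    using rk unfolding regular_k_category_def k_category_def by simp
  then show ?thesis by (rule restr_prop_cov[OF so sset_horn horn_sub covM])
qed

lemma horn_iso: "k < m \<Longrightarrow> 0 < j \<Longrightarrow> j < m \<Longrightarrow>
    cov {f. iso C f} (HomP (X m)) (ConP X Xm (horn m j)) (faces Xm m (horn m j))"
proof -
  assume j: "k < m" "0 < j" "j < m"
  then have "restr_prop C (iso C) X Xm m (horn m j)"
    using rk unfolding regular_k_category_def k_category_def by simp
  then have "restr_prop C (\<lambda>u. u \<in> {f. iso C f}) X Xm m (horn m j)" by simp
  then show ?thesis by (rule restr_prop_cov[OF so sset_horn horn_sub iso_mor_class])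
qed

abbreviation e where "e n \<equiv> [0..<Suc n]"
abbreviation Zo where "Zo n \<equiv> Cod C (q n)"

lemma e_thick: "e n \<in> thick n"
  by (rule simplex_thick[OF id_simplex])

lemma pe: "p n (e n) \<in> hom (Gb n) (X n)"
  using p_hom[OF e_thick] by simp

lemmas coim = coimage_regular[OF reg pe ci]

lemma p_simplex: "\<theta> \<in> simplex n \<Longrightarrow> Xm n \<theta> \<cdot> p n (e n) = p n \<theta>"
  using p_face[OF e_thick, of \<theta> n] sub_id_thick[OF simplex_thick, of \<theta> n] by simp

lemma pe_gm: "\<theta> \<in> simplex n \<Longrightarrow> p (dm \<theta>) (e (dm \<theta>)) \<cdot> gm n \<theta> = p n \<theta>"
proof -
  assume t: "\<theta> \<in> simplex n"
  then have "\<theta> \<noteq> []" unfolding simplex_iff by blast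
  then have "\<theta> \<odot> e (dm \<theta>) = \<theta>" by (rule sub_id)
  then show ?thesis using gm(2)[OF simplex_thick[OF t] e_thick] by (simp only:)
qed

definition Gm :: "nat \<Rightarrow> nat list \<Rightarrow> 'm" where
  "Gm n \<theta> = (SOME u. u \<in> hom (Zo n) (Zo (dm \<theta>)) \<and> u \<cdot> q n = q (dm \<theta>) \<cdot> gm n \<theta>)"

text \<open>The arrow \<open>q (dm \<theta>) \<cdot> gm n \<theta>\<close> factors through the
  coimage \<open>q n\<close> if it identifies what \<open>p n (e n)\<close> identifies. This can be
  tested after the monic \<open>i (dm \<theta>)\<close>, where the arrow becomes
  \<open>Xm n \<theta>\<close> after \<open>p n (e n)\<close>.\<close>

lemma Gm:
  assumes t: "\<theta> \<in> simplex n"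
  shows "Gm n \<theta> \<in> hom (Zo n) (Zo (dm \<theta>))" "Gm n \<theta> \<cdot> q n = q (dm \<theta>) \<cdot> gm n \<theta>"
proof -
  note g = gm(1)[OF simplex_thick[OF t]]
  have h: "q (dm \<theta>) \<cdot> gm n \<theta> \<in> hom (Gb n) (Zo (dm \<theta>))" using cmp_hom[OF coim(2) g] .
  have ker: "i (dm \<theta>) \<cdot> (q (dm \<theta>) \<cdot> gm n \<theta> \<cdot> x) = Xm n \<theta> \<cdot> (p n (e n) \<cdot> x)" if x: "x \<in> hom U (Gb n)" for x U
  proof -
    have "i (dm \<theta>) \<cdot> (q (dm \<theta>) \<cdot> gm n \<theta> \<cdot> x) = i (dm \<theta>) \<cdot> (q (dm \<theta>) \<cdot> gm n \<theta>) \<cdot> x"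
      by (rule assoc[OF coim(3) h x, symmetric])
    also have "i (dm \<theta>) \<cdot> (q (dm \<theta>) \<cdot> gm n \<theta>) = p n \<theta>"
      unfolding assoc[OF coim(3) coim(2) g, symmetric] coim(4) by (rule pe_gm[OF t])
    also have "p n \<theta> \<cdot> x = Xm n \<theta> \<cdot> (p n (e n) \<cdot> x)"
      unfolding p_simplex[OF t, symmetric] by (rule assoc[OF so_hom[OF so t] pe x])
    finally show ?thesis .
  qed
  have "\<exists>u. u \<in> hom (Zo n) (Zo (dm \<theta>)) \<and> u \<cdot> q n = q (dm \<theta>) \<cdot> gm n \<theta>"
  proof (rule coim(6)[OF h])
    fix U x y assume x: "x \<in> hom U (Gb n)" and y: "y \<in> hom U (Gb n)" and xy: "p n (e n) \<cdot> x = p n (e n) \<cdot> y"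
    show "q (dm \<theta>) \<cdot> gm n \<theta> \<cdot> x = q (dm \<theta>) \<cdot> gm n \<theta> \<cdot> y"
      by (rule coim(5)[OF cmp_hom[OF h x] cmp_hom[OF h y]]) (simp only: ker[OF x] ker[OF y] xy)
  qed
  from someI_ex[OF this] show "Gm n \<theta> \<in> hom (Zo n) (Zo (dm \<theta>))" "Gm n \<theta> \<cdot> q n = q (dm \<theta>) \<cdot> gm n \<theta>"
    unfolding Gm_def by auto
qed

lemma i_Gm:
  assumes t: "\<theta> \<in> simplex n"
  shows "i (dm \<theta>) \<cdot> Gm n \<theta> = Xm n \<theta> \<cdot> i n"
proof (rule cov_epi[OF coim(1,2)])
  note g = gm(1)[OF simplex_thick[OF t]]
  show "i (dm \<theta>) \<cdot> Gm n \<theta> \<in> hom (Zo n) (X (dm \<theta>))" using cmp_hom[OF coim(3) Gm(1)[OF t]] .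
  show "Xm n \<theta> \<cdot> i n \<in> hom (Zo n) (X (dm \<theta>))" using cmp_hom[OF so_hom[OF so t] coim(3)] .
  show "i (dm \<theta>) \<cdot> Gm n \<theta> \<cdot> q n = Xm n \<theta> \<cdot> i n \<cdot> q n"
    unfolding assoc[OF coim(3) Gm(1)[OF t] coim(2)] Gm(2)[OF t] assoc[OF coim(3) coim(2) g, symmetric] coim(4)
      assoc[OF so_hom[OF so t] coim(3) coim(2)] p_simplex[OF t] by (rule pe_gm[OF t])
qed

text \<open>The simplicial identities hold in \<open>X\<close>, and the monic arrows
  \<open>i n\<close> reflect them.\<close>

lemma so_Gm: "simplicial_object C Zo Gm"
  unfolding simplicial_object_def mono_list_simplex
proof (intro conjI allI impI)
  show "Zo n \<in> Ob C" for n using hom_obs[OF coim(2)] by blast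
  show "Gm n \<theta> \<in> hom (Zo n) (Zo (dm \<theta>))" if "\<theta> \<in> simplex n" for n \<theta> by (rule Gm(1)[OF that])
  show "Gm n (e n) = Idm C (Zo n)" for n
  proof (rule coim(5))
    have d: "dm (e n) = n" by simp
    show "Gm n (e n) \<in> hom (Zo n) (Zo n)" using Gm(1)[OF id_simplex[of n]] unfolding d .
    show "Idm C (Zo n) \<in> hom (Zo n) (Zo n)" using hom_obs[OF coim(2)] by blast
    show "i n \<cdot> Gm n (e n) = i n \<cdot> Idm C (Zo n)"
      using i_Gm[OF id_simplex[of n]] unfolding d so_id[OF so] id_right[OF coim(3)] id_left[OF coim(3)] .
  qed
  fix n \<theta> \<psi> assume "\<theta> \<in> simplex n \<and> \<psi> \<in> simplex (dm \<theta>)"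
  then have t: "\<theta> \<in> simplex n" and p: "\<psi> \<in> simplex (dm \<theta>)" by auto
  have tp: "\<theta> \<odot> \<psi> \<in> simplex n" by (rule sub_simplex[OF t p])
  have d: "dm (\<theta> \<odot> \<psi>) = dm \<psi>" by simp
  show "Gm (dm \<theta>) \<psi> \<cdot> Gm n \<theta> = Gm n (\<theta> \<odot> \<psi>)"
  proof (rule coim(5))
    show "Gm (dm \<theta>) \<psi> \<cdot> Gm n \<theta> \<in> hom (Zo n) (Zo (dm \<psi>))" using cmp_hom[OF Gm(1)[OF p] Gm(1)[OF t]] .
    show "Gm n (\<theta> \<odot> \<psi>) \<in> hom (Zo n) (Zo (dm \<psi>))" using Gm(1)[OF tp] unfolding d .
    have "i (dm \<psi>) \<cdot> (Gm (dm \<theta>) \<psi> \<cdot> Gm n \<theta>) = Xm (dm \<theta>) \<psi> \<cdot> i (dm \<theta>) \<cdot> Gm n \<theta>"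
      unfolding assoc[OF coim(3) Gm(1)[OF p] Gm(1)[OF t], symmetric] i_Gm[OF p] ..
    also have "\<dots> = Xm (dm \<theta>) \<psi> \<cdot> (Xm n \<theta> \<cdot> i n)"
      unfolding assoc[OF so_hom[OF so p] coim(3) Gm(1)[OF t]] i_Gm[OF t] ..
    also have "\<dots> = Xm n (\<theta> \<odot> \<psi>) \<cdot> i n"
      unfolding assoc[OF so_hom[OF so p] so_hom[OF so t] coim(3), symmetric] so_cmp[OF so t p] ..
    also have "\<dots> = i (dm \<psi>) \<cdot> Gm n (\<theta> \<odot> \<psi>)" using i_Gm[OF tp] unfolding d by simp
    finally show "i (dm \<psi>) \<cdot> (Gm (dm \<theta>) \<psi> \<cdot> Gm n \<theta>) = i (dm \<psi>) \<cdot> Gm n (\<theta> \<odot> \<psi>)" .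
  qed
qed

sublocale hyper_ctx C Cov Reg Gb Zo gm Gm q
proof
  show "simplicial_object C Gb gm" by (rule so_Gb)
  show "simplicial_object C Zo Gm" by (rule so_Gm)
  show "q n \<in> hom (Gb n) (Zo n)" for n by (rule coim(2))
  show "q (dm \<theta>) \<cdot> gm n \<theta> = Gm n \<theta> \<cdot> q n" if "\<theta> \<in> simplex n" for n \<theta> using Gm(2)[OF that] by simp
qed

lemma i_face:
  assumes s: "\<sigma> \<in> simplex n" and z: "z \<in> hom U (Zo n)"
  shows "i (dm \<sigma>) \<cdot> (Gm n \<sigma> \<cdot> z) = Xm n \<sigma> \<cdot> (i n \<cdot> z)"
  unfolding assoc[OF coim(3) Gm(1)[OF s] z, symmetric] i_Gm[OF s] by (rule assoc[OF so_hom[OF so s] coim(3) z])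

lemma iq: "y \<in> hom U (Gb n) \<Longrightarrow> i n \<cdot> (q n \<cdot> y) = p n (e n) \<cdot> y"
  using assoc[OF coim(3) coim(2), of y U n] coim(4)[of n] by simp

lemma iq_face: "w \<in> simplex n \<Longrightarrow> y \<in> hom U (Gb n) \<Longrightarrow> Xm n w \<cdot> (i n \<cdot> (q n \<cdot> y)) = p n w \<cdot> y"
  using iq[of y U n] assoc[OF so_hom[OF so] pe, of w n y U] p_simplex[of w n] by simp

text \<open>An ordinary word in the thick boundary receives a leg both from the cone
  \<open>c\<close> and from \<open>z\<close>; this shows that they agree.\<close>

lemma thicken_bdry_simplex:
  assumes x: "(c, z) \<in> El (BdryP n) U" and w: "w \<in> simplex n" "w \<in> thick_bdry n"
  shows "thicken (bdry n) c w = Xm n w \<cdot> (i n \<cdot> z)"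
proof -
  have wb: "w \<in> bdry n" using w unfolding bdry_def thick_bdry_def by blast
  have ne: "w \<noteq> []" using w(1) unfolding simplex_iff by blast
  have c: "c \<in> El (ConP Gb gm (bdry n)) U" and z: "z \<in> hom U (Zo n)" and e: "q (dm w) \<cdot> c w = Gm n w \<cdot> z"
    using x wb unfolding BdryP_El by auto
  have "thicken (bdry n) c w = p (dm w) (e (dm w)) \<cdot> c w"
    using thicken_sub[OF sset_bdry bdry_sub c wb e_thick] unfolding sub_id[OF ne] .
  also have "\<dots> = i (dm w) \<cdot> (q (dm w) \<cdot> c w)" using iq[OF ConP_hom[OF c wb]] by simp
  also have "\<dots> = Xm n w \<cdot> (i n \<cdot> z)" unfolding e by (rule i_face[OF w(1) z])
  finally show ?thesis .
qed

lemma bdry_map_cov_ge2: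
  assumes n: "2 \<le> n"
  shows "cov Cov (HomP (Gb n)) (BdryP n) (bdry_map n)"
proof -
  define S where "S = simplex n \<union> thick_bdry n"
  have S: "sset S" "S \<subseteq> thick n"
    unfolding S_def using sset_Un[OF sset_simplex sset_thick_bdry] simplex_thick thick_bdry_def by auto
  have c0: "cov Cov (ConP X Xm (thick n)) (ConP X Xm S) (\<lambda>c. restrict c S)"
    unfolding S_def by (rule thick_bdry_expansion[OF so covM _ _ n, of k]) (rule horn_cov horn_iso; assumption)+
  \<comment> \<open>The base change takes place along \<beta>: a pair is turned into a cone on the
    union by using \<open>thicken\<close> of \<open>c\<close> on the thick boundary and the faces of
    \<open>i n \<cdot> z\<close> elsewhere, that is, on the remaining ordinary words.\<close>
  define \<beta> :: "(nat list \<Rightarrow> 'm) \<times> 'm \<Rightarrow> nat list \<Rightarrow> 'm" where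
    "\<beta> = (\<lambda>(c, z). \<lambda>w\<in>S. if w \<in> thick_bdry n then thicken (bdry n) c w else Xm n w \<cdot> (i n \<cdot> z))"
  have \<beta>b: "\<beta> (c, z) w = thicken (bdry n) c w" if "w \<in> thick_bdry n" for c z w
    using that unfolding \<beta>_def S_def by simp
  have \<beta>s: "\<beta> (c, z) w = Xm n w \<cdot> (i n \<cdot> z)" if "w \<in> simplex n" "(c, z) \<in> El (BdryP n) U" for c z w U
    using that thicken_bdry_simplex[OF that(2,1)] unfolding \<beta>_def S_def by simp
  have \<beta>e: "\<beta> x \<in> extensional S" for x unfolding \<beta>_def by (cases x) simp
  note tT = thickT_bdry[of n]
  have tC: "thicken (bdry n) c \<in> El (ConP X Xm (thick_bdry n)) U" if "c \<in> El (ConP Gb gm (bdry n)) U" for c U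
    using thicken_ConP[OF sset_bdry bdry_sub that] unfolding tT .
  have Scase: "w \<in> simplex n \<or> w \<in> thick_bdry n" if "w \<in> S" for w using that unfolding S_def by blast
  have \<beta>C: "\<beta> x \<in> El (ConP X Xm S) U" if x: "x \<in> El (BdryP n) U" for x U
  proof -
    obtain c z where cz: "x = (c, z)" by (cases x)
    have c: "c \<in> El (ConP Gb gm (bdry n)) U" and z: "z \<in> hom U (Zo n)" using x unfolding cz BdryP_El by auto
    have iz: "i n \<cdot> z \<in> hom U (X n)" using cmp_hom[OF coim(3) z] .
    note xz = x[unfolded cz]
    show ?thesis unfolding cz
    proof (rule ConPI)
      show "U \<in> Ob C" by (rule ConP_ob[OF c])
      show "\<beta> (c, z) \<in> extensional S" by (rule \<beta>e)
      fix w assume w: "w \<in> S"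
      then show "\<beta> (c, z) w \<in> hom U (X (dm w))"
        using Scase[OF w] \<beta>b[of w c z] \<beta>s[OF _ xz, of w] cmp_hom[OF so_hom[OF so, of w n] iz] ConP_hom[OF tC[OF c], of w] by auto
      fix \<theta> assume t: "\<theta> \<in> simplex (dm w)"
      from Scase[OF w] show "Xm (dm w) \<theta> \<cdot> \<beta> (c, z) w = \<beta> (c, z) (w \<odot> \<theta>)"
      proof
        assume ws: "w \<in> simplex n"
        show ?thesis
          unfolding \<beta>s[OF ws xz] \<beta>s[OF sub_simplex[OF ws t] xz] so_cmp[OF so ws t, symmetric]
          by (rule assoc[OF so_hom[OF so t] so_hom[OF so ws] iz, symmetric])
      next
        assume wb: "w \<in> thick_bdry n"
        show ?thesis
          unfolding \<beta>b[OF wb] \<beta>b[OF ssetD[OF sset_thick_bdry wb t]] by (rule ConP_face[OF tC[OF c] wb t])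
      qed
    qed
  qed
  show ?thesis
  proof (rule cov_base[OF c0 psh_ConP[OF so S(1)] psh_HomP psh_BdryP ntr_bdry_map ev_bijn(1), where \<beta> = \<beta>])
    show "ntr (BdryP n) (ConP X Xm S) \<beta>"
    proof (rule ntrI[OF \<beta>C])
      fix U V x g assume x: "x \<in> El (BdryP n) U" and g: "g \<in> hom V U"
      obtain c z where cz: "x = (c, z)" by (cases x)
      have c: "c \<in> El (ConP Gb gm (bdry n)) U" and z: "z \<in> hom U (Zo n)" using x unfolding cz BdryP_El by auto
      have iz: "i n \<cdot> z \<in> hom U (X n)" using cmp_hom[OF coim(3) z] .
      note xg = psh_ac[OF psh_BdryP x g, unfolded cz BdryP_ac]
      show "\<beta> (ac (BdryP n) x g) = ac (ConP X Xm S) (\<beta> x) g"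
      proof (rule extensionalityI[OF \<beta>e])
        show "ac (ConP X Xm S) (\<beta> x) g \<in> extensional S" unfolding ConP_ac by simp
        fix w assume w: "w \<in> S"
        have a: "ac (ConP X Xm S) (\<beta> x) g w = \<beta> x w \<cdot> g" using w unfolding ConP_ac by simp
        from Scase[OF w] show "\<beta> (ac (BdryP n) x g) w = ac (ConP X Xm S) (\<beta> x) g w"
        proof
          assume ws: "w \<in> simplex n"
          show ?thesis
            unfolding a unfolding cz BdryP_ac \<beta>s[OF ws xg] \<beta>s[OF ws x[unfolded cz]]
              assoc[OF so_hom[OF so ws] iz g] assoc[OF coim(3) z g] ..
        next
          assume wb: "w \<in> thick_bdry n"
          have "thicken (bdry n) (ac (ConP Gb gm (bdry n)) c g) = ac (ConP X Xm (thick_bdry n)) (thicken (bdry n) c) g"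
            using ntr_ac[OF thicken_ntr[OF sset_bdry bdry_sub] c g] unfolding tT .
          then show ?thesis
            unfolding a unfolding cz BdryP_ac \<beta>b[OF wb] using wb unfolding ConP_ac by simp
        qed
      qed
    qed
    have sq: "restrict (ev n y) S = \<beta> (bdry_map n y)" if y: "y \<in> hom U (Gb n)" for U y
    proof (rule extensionalityI[OF restrict_extensional \<beta>e])
      have b: "bdry_map n y \<in> El (BdryP n) U" using ntr_el[OF ntr_bdry_map, of y n U] y by (simp add: HomP_def)
      fix w assume w: "w \<in> S"
      then have r: "restrict (ev n y) S w = p n w \<cdot> y" using S(2) unfolding ev_def by auto
      from Scase[OF w] show "restrict (ev n y) S w = \<beta> (bdry_map n y) w"
      proof
        assume ws: "w \<in> simplex n"
        show ?thesis unfolding r using \<beta>s[OF ws b[unfolded bdry_map_def]] iq_face[OF ws y] unfolding bdry_map_def by simp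
      next
        assume wb: "w \<in> thick_bdry n"
        have "thicken (bdry n) (faces gm n (bdry n) y) = restrict (ev n y) (thick_bdry n)"
          using thicken_faces[OF sset_bdry bdry_sub y] unfolding tT .
        then show ?thesis unfolding r using \<beta>b[OF wb] wb w S(2) unfolding bdry_map_def ev_def by auto
      qed
    qed
    show "restrict (ev n y) S = \<beta> (bdry_map n y)" if "y \<in> El (HomP (Gb n)) U" for U y
      using sq that by (simp add: HomP_def)
    fix U a x assume a: "a \<in> El (ConP X Xm (thick n)) U" and x: "x \<in> El (BdryP n) U" and eq: "restrict a S = \<beta> x"
    obtain c z where cz: "x = (c, z)" by (cases x)
    have c: "c \<in> El (ConP Gb gm (bdry n)) U" and z: "z \<in> hom U (Zo n)" using x unfolding cz BdryP_El by auto
    obtain y where y: "y \<in> hom U (Gb n)" "\<And>w. w \<in> thick n \<Longrightarrow> p n w \<cdot> y = a w" using p_ex[OF a] by blast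
    have ya: "ev n y = a"
      by (rule extensionalityI[OF _ ConP_ext[OF a]]) (use y in \<open>auto simp: ev_def\<close>)
    \<comment> \<open>Monicity of \<open>i n\<close> makes the square a pullback: evaluating at the
      top simplex compares both sides in \<open>X n\<close>.\<close>
    have "q n \<cdot> y = z"
    proof (rule coim(5)[OF cmp_hom[OF coim(2) y(1)] z])
      have "a (e n) = \<beta> x (e n)" using fun_cong[OF eq, of "e n"] id_simplex[of n] unfolding S_def by (simp del: upt_Suc)
      also have "\<dots> = Xm n (e n) \<cdot> (i n \<cdot> z)" unfolding cz by (rule \<beta>s[OF id_simplex x[unfolded cz]])
      also have "\<dots> = i n \<cdot> z" unfolding so_id[OF so] by (rule id_left[OF cmp_hom[OF coim(3) z]])
      finally show "i n \<cdot> (q n \<cdot> y) = i n \<cdot> z" using iq[OF y(1)] y(2)[OF e_thick] by (simp del: upt_Suc)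
    qed
    moreover have "faces gm n (bdry n) y = c"
    proof (rule bijn_inj[OF thicken_bijn[OF sset_bdry bdry_sub] _ c])
      show "faces gm n (bdry n) y \<in> El (ConP Gb gm (bdry n)) U" by (rule faces_ConP[OF so_Gb bdry_sub sset_bdry y(1)])
      have "thicken (bdry n) (faces gm n (bdry n) y) = restrict a (thick_bdry n)"
        using thicken_faces[OF sset_bdry bdry_sub y(1)] unfolding tT ya .
      also have "\<dots> = thicken (bdry n) c"
      proof (rule extensionalityI[OF restrict_extensional ConP_ext[OF tC[OF c]]])
        fix w assume w: "w \<in> thick_bdry n"
        then have "w \<in> S" unfolding S_def by blast
        then show "restrict a (thick_bdry n) w = thicken (bdry n) c w"
          using fun_cong[OF eq, of w] \<beta>b[OF w, of c z] w unfolding cz by simp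
      qed
      finally show "thicken (bdry n) (faces gm n (bdry n) y) = thicken (bdry n) c" .
    qed
    ultimately have "bdry_map n y = x" unfolding bdry_map_def cz by simp
    then show "\<exists>!y. y \<in> El (HomP (Gb n)) U \<and> ev n y = a \<and> bdry_map n y = x"
    proof (intro ex1I[of _ y])
      fix y' assume y': "y' \<in> El (HomP (Gb n)) U \<and> ev n y' = a \<and> bdry_map n y' = x"
      show "y' = y"
        by (rule bijn_inj[OF ev_bijn(2)[of n], of _ U]) (use y' ya y(1) in \<open>auto simp: HomP_def\<close>)
    qed (use y(1) ya in \<open>simp add: HomP_def\<close>)
  qed
qed

text \<open>Every word over the single letter 0 is a degeneracy of \<open>[0]\<close>, so the leg at
  \<open>[0]\<close> determines the others.\<close>

lemma p0_mono:
  assumes x: "x \<in> hom U (Gb 0)" and y: "y \<in> hom U (Gb 0)" and xy: "p 0 [0] \<cdot> x = p 0 [0] \<cdot> y"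
  shows "x = y"
proof (rule p_inj[OF x y])
  fix w assume w: "w \<in> thick 0"
  then have "set w = {0}" unfolding thick_def by (cases w) auto
  then obtain \<theta> where t: "\<theta> \<in> simplex 0" "w = [0] \<odot> \<theta>" by (rule constant_word)
  have e0: "[0] \<in> thick 0" unfolding thick_def by simp
  have t': "\<theta> \<in> simplex (dm [0::nat])" using t(1) by simp
  have pw: "p 0 w = Xm 0 \<theta> \<cdot> p 0 [0]" using p_face[OF e0 t'] t(2) by simp
  have p0: "p 0 [0] \<in> hom (Gb 0) (X 0)" using p_hom[OF e0] by simp
  show "p 0 w \<cdot> x = p 0 w \<cdot> y"
    unfolding pw assoc[OF so_hom[OF so t(1)] p0 x] assoc[OF so_hom[OF so t(1)] p0 y] xy ..
qed

lemma q0_mono: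
  assumes x: "x \<in> hom U (Gb 0)" and y: "y \<in> hom U (Gb 0)" and xy: "q 0 \<cdot> x = q 0 \<cdot> y"
  shows "x = y"
  by (rule p0_mono[OF x y]) (use iq[OF x] iq[OF y] xy in simp)

lemma arrow_cov: "f \<in> Cov \<Longrightarrow> f \<in> hom a b \<Longrightarrow>
    ntr (HomP a) (HomP b) (\<lambda>x. f \<cdot> x) \<and> cov Cov (HomP a) (HomP b) (\<lambda>x. f \<cdot> x)"
proof -
  assume f: "f \<in> Cov" "f \<in> hom a b"
  have b: "Idm C b \<in> hom b b" using hom_obs[OF f(2)] by blast
  have n: "ntr (HomP a) (HomP b) (\<lambda>x. f \<cdot> x)"
    by (rule ntrI) (use cmp_hom[OF f(2)] assoc[OF f(2)] in \<open>simp_all add: HomP_def\<close>)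
  have r: "reps (HomP b) b (Idm C b)"
    unfolding reps_def
  proof (intro conjI allI impI)
    show "Idm C b \<in> El (HomP b) b" using b by (simp add: HomP_def)
    fix W e assume "e \<in> El (HomP b) W"
    then have e: "e \<in> hom W b" by (simp add: HomP_def)
    show "\<exists>!v. v \<in> hom W b \<and> ac (HomP b) (Idm C b) v = e"
    proof (rule ex1I[of _ e])
      show "e \<in> hom W b \<and> ac (HomP b) (Idm C b) e = e" using e id_left[OF e] by (simp add: HomP_def)
      show "v = e" if "v \<in> hom W b \<and> ac (HomP b) (Idm C b) v = e" for v
        using that id_left[of v W b] by (simp add: HomP_def)
    qed
  qed
  have "f \<cdot> Idm C a = ac (HomP b) (Idm C b) f" using id_right[OF f(2)] id_left[OF f(2)] by (simp add: HomP_def)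
  then show ?thesis using n arrow_reps_cov[OF covM psh_HomP n r f(2) _ f(1)] by blast
qed

text \<open>\<open>bdry_map n\<close> is the base change of the cover \<open>q n\<close> along
  \<open>snd\<close>. The boundary part of a pair is forced by a lift of \<open>z\<close>: the
  boundary is empty or consists of vertices with their degeneracies, and \<open>q 0\<close> is
  monic.\<close>

lemma bdry_map_cov_le1:
  assumes n: "n \<le> 1"
  shows "cov Cov (HomP (Gb n)) (BdryP n) (bdry_map n)"
proof (rule cov_base[OF arrow_cov[OF coim(1,2), THEN conjunct2] psh_HomP psh_HomP psh_BdryP ntr_bdry_map,
    where \<alpha> = "\<lambda>y. y" and \<beta> = snd])
  show "ntr (HomP (Gb n)) (HomP (Gb n)) (\<lambda>y. y)" by (rule ntrI) auto
  show "ntr (BdryP n) (HomP (Zo n)) snd"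
  proof (rule ntrI)
    fix U x assume x: "x \<in> El (BdryP n) U"
    obtain c z where cz: "x = (c, z)" by (cases x)
    show "snd x \<in> El (HomP (Zo n)) U" using x unfolding cz BdryP_El by (simp add: HomP_def)
    show "snd (ac (BdryP n) x g) = ac (HomP (Zo n)) (snd x) g" for g unfolding cz BdryP_ac by (simp add: HomP_def)
  qed
  show "q n \<cdot> y = snd (bdry_map n y)" for y unfolding bdry_map_def by simp
  fix U a x assume "a \<in> El (HomP (Gb n)) U" and x: "x \<in> El (BdryP n) U" and eq: "q n \<cdot> a = snd x"
  then have a: "a \<in> hom U (Gb n)" by (simp add: HomP_def)
  obtain c z where cz: "x = (c, z)" by (cases x)
  have c: "c \<in> El (ConP Gb gm (bdry n)) U" and e: "\<And>\<sigma>. \<sigma> \<in> bdry n \<Longrightarrow> q (dm \<sigma>) \<cdot> c \<sigma> = Gm n \<sigma> \<cdot> z"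
    using x unfolding cz BdryP_El by auto
  have f: "faces gm n (bdry n) a \<in> El (ConP Gb gm (bdry n)) U" by (rule faces_ConP[OF so_Gb bdry_sub sset_bdry a])
  have "faces gm n (bdry n) a = c"
  proof (rule ConP_eqI[OF f c])
    fix \<sigma> assume s: "\<sigma> \<in> bdry n"
    have "n \<noteq> 0"
    proof
      assume "n = 0"
      then show False using s bdry_0 by simp
    qed
    then have n1: "n = Suc 0" using n by simp
    obtain x where x: "x \<le> Suc 0" "set \<sigma> = {x}" using bdry_1 s n1 by blast
    obtain \<theta> where t: "\<theta> \<in> simplex 0" "\<sigma> = [x] \<odot> \<theta>" using constant_word[OF x(2)] .
    have xb: "[x] \<in> bdry n" using s x unfolding bdry_def n1 by (auto simp: simplex_iff)
    have xs: "[x] \<in> simplex n" using xb bdry_sub by blast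
    have t': "\<theta> \<in> simplex (dm [x])" using t(1) by simp
    have d: "dm [x] = 0" by simp
    have fx: "faces gm n (bdry n) a [x] = gm n [x] \<cdot> a" unfolding faces_def using xb by simp
    have gx: "gm n [x] \<in> hom (Gb n) (Gb 0)" using gm(1)[OF simplex_thick[OF xs]] unfolding d .
    have zx: "Gm n [x] \<in> hom (Zo n) (Zo 0)" using Gm(1)[OF xs] unfolding d .
    have "q 0 \<cdot> (gm n [x] \<cdot> a) = Gm n [x] \<cdot> (q n \<cdot> a)"
      using f_face[OF xs a] unfolding d .
    also have "\<dots> = q 0 \<cdot> c [x]" using e[OF xb] eq unfolding d cz by simp
    finally have "gm n [x] \<cdot> a = c [x]"
      using q0_mono[OF cmp_hom[OF gx a]] ConP_hom[OF c xb] unfolding d by blast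
    then show "faces gm n (bdry n) a \<sigma> = c \<sigma>"
      using ConP_face[OF f xb t'] ConP_face[OF c xb t'] fx unfolding t(2) by simp
  qed
  then have "bdry_map n a = x" unfolding bdry_map_def cz using eq cz by simp
  then show "\<exists>!y. y \<in> El (HomP (Gb n)) U \<and> y = a \<and> bdry_map n y = x"
    using a by (intro ex1I[of _ a]) (simp_all add: HomP_def)
qed

lemma bdry_map_cov: "cov Cov (HomP (Gb n)) (BdryP n) (bdry_map n)"
  using bdry_map_cov_ge2[of n] bdry_map_cov_le1[of n] by (cases "2 \<le> n") auto

text \<open>The definition of a \<open>k\<close>-category gives a cover for some limit over the
  thick 1-simplex and for vertex 0. The isomorphism of limits carries it to \<open>p\<close>, the
  flip \<open>[1, 0]\<close> to vertex 1, and \<open>X 0\<close> is replaced by the isomorphic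
  \<open>Gb 0\<close>.\<close>

lemma vertex_cov:
  assumes j: "j \<le> Suc 0"
  shows "gm (Suc 0) [j] \<in> Cov"
proof -
  have e0: "[0] \<in> thick 0" unfolding thick_def by simp
  have jt: "[x] \<in> thick (Suc 0)" if "x \<le> Suc 0" for x :: nat using that unfolding thick_def by auto
  have p0: "p 0 [0] \<in> hom (Gb 0) (X 0)" using p_hom[OF e0] by simp
  have ph: "p (Suc 0) [x] \<in> hom (Gb (Suc 0)) (X 0)" if "x \<le> Suc 0" for x using p_hom[OF jt[OF that]] by simp
  obtain L p' where L: "is_limit C (map_diag X Xm (thick (Suc 0))) L p'" "p' [0] \<in> Cov"
    using rk unfolding regular_k_category_def k_category_def by auto
  note r = limit_reps[OF sset_thick L(1)]
  have L0: "restrict p' (thick (Suc 0)) \<in> El (ConP X Xm (thick (Suc 0))) L" using r unfolding reps_def by blast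
  obtain u where u: "u \<in> hom L (Gb (Suc 0))" "\<And>w. w \<in> thick (Suc 0) \<Longrightarrow> p (Suc 0) w \<cdot> u = restrict p' (thick (Suc 0)) w"
    using p_ex[OF L0] by blast
  obtain v where v: "v \<in> hom (Gb (Suc 0)) L"
    "ac (ConP X Xm (thick (Suc 0))) (restrict p' (thick (Suc 0))) v = restrict (p (Suc 0)) (thick (Suc 0))"
    using r p_ConP unfolding reps_def by blast
  have pv: "p' w \<cdot> v = p (Suc 0) w" if "w \<in> thick (Suc 0)" for w
    using fun_cong[OF v(2), of w] that unfolding ConP_ac by simp
  have p'h: "p' w \<in> hom L (X (dm w))" if "w \<in> thick (Suc 0)" for w using ConP_hom[OF L0 that] that by simp
  have "u \<cdot> v = Idm C (Gb (Suc 0))"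
  proof (rule p_inj[OF cmp_hom[OF u(1) v(1)] id_hom[OF Gb_ob]])
    fix w assume w: "w \<in> thick (Suc 0)"
    show "p (Suc 0) w \<cdot> (u \<cdot> v) = p (Suc 0) w \<cdot> Idm C (Gb (Suc 0))"
      using assoc[OF p_hom[OF w] u(1) v(1)] u(2)[OF w] pv[OF w] id_right[OF p_hom[OF w]] w by simp
  qed
  moreover have "v \<cdot> u = Idm C L"
  proof -
    have Lo: "L \<in> Ob C" using hom_obs[OF u(1)] by blast
    have "ac (ConP X Xm (thick (Suc 0))) (restrict p' (thick (Suc 0))) (v \<cdot> u) = restrict p' (thick (Suc 0))"
      unfolding ConP_ac
      by (rule restrict_ext) (use assoc[OF p'h v(1) u(1)] pv u(2) in simp)
    moreover have "ac (ConP X Xm (thick (Suc 0))) (restrict p' (thick (Suc 0))) (Idm C L) = restrict p' (thick (Suc 0))"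
      by (rule psh_id[OF psh_ConP[OF so sset_thick] L0])
    moreover have "\<exists>!v. v \<in> hom L L \<and> ac (ConP X Xm (thick (Suc 0))) (restrict p' (thick (Suc 0))) v = restrict p' (thick (Suc 0))"
      using r L0 unfolding reps_def by blast
    ultimately show ?thesis using cmp_hom[OF v(1) u(1)] id_hom[OF Lo] by blast
  qed
  ultimately have "v \<in> Cov" using mor_class_iso[OF covM] isoI[OF v(1) u(1)] by blast
  then have "p' [0] \<cdot> v \<in> Cov" using mor_class_comp[OF covM _ L(2) v(1) p'h[OF jt]] by simp
  then have c0: "p (Suc 0) [0] \<in> Cov" using pv[OF jt, of 0] by simp
  have fl: "[1, 0] \<in> thick (Suc 0)" unfolding thick_def by simp
  define s where "s = gm (Suc 0) [1, 0]"
  have s: "s \<in> hom (Gb (Suc 0)) (Gb (Suc 0))" "\<And>w. w \<in> thick (Suc 0) \<Longrightarrow> p (Suc 0) w \<cdot> s = p (Suc 0) ([1, 0] \<odot> w)"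
    using gm[OF fl] unfolding s_def by auto
  have ss: "s \<cdot> s = Idm C (Gb (Suc 0))"
  proof -
    have "s \<cdot> s = gm (Suc 0) ([1, 0] \<odot> [1, 0])" using gm_cmp[OF fl, of "[1, 0]"] fl unfolding s_def by simp
    also have "[1, 0] \<odot> [1, 0] = e (Suc 0)" by simp
    finally show ?thesis using so_id[OF so_Gb, of "Suc 0"] by simp
  qed
  then have "s \<in> Cov" using mor_class_iso[OF covM isoI[OF s(1) s(1)]] by blast
  then have "p (Suc 0) [0] \<cdot> s \<in> Cov" using mor_class_comp[OF covM _ c0 s(1) ph] by simp
  then have c1: "p (Suc 0) [1] \<in> Cov" using s(2)[OF jt, of 0] by simp
  have pj: "p (Suc 0) [j] \<in> Cov" using c0 c1 j by (cases j) auto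
  \<comment> \<open>The degeneracies of \<open>X 0\<close> form a cone on the thick 0-simplex, which
    equals the standard one; the induced arrow \<open>t\<close> is the inverse of
    \<open>p 0 [0]\<close>.\<close>
  have "(\<lambda>w\<in>thick 0. Xm 0 w) \<in> El (ConP X Xm (thick 0)) (X 0)"
  proof -
    have "thick 0 = simplex 0"
    proof -
      have "w \<in> simplex 0" if w: "w \<in> thick 0" for w
      proof -
        have "set w = {0}" using w unfolding thick_def by (cases w) auto
        then obtain \<theta> where "\<theta> \<in> simplex 0" "w = [0] \<odot> \<theta>" by (rule constant_word)
        moreover have "[0] \<in> simplex 0" unfolding simplex_iff by simp
        ultimately show ?thesis using sub_simplex[of "[0]" 0 \<theta>] by simp
      qed
      then show ?thesis using simplex_thick by blast
    qed
    moreover have i0: "Idm C (X 0) \<in> hom (X 0) (X 0)" using so_ob[OF so] by blast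
    moreover have "faces Xm 0 (simplex 0) (Idm C (X 0)) = (\<lambda>w\<in>simplex 0. Xm 0 w)"
      unfolding faces_def by (rule restrict_ext) (rule id_right[OF so_hom[OF so]])
    ultimately show ?thesis using faces_ConP[OF so order_refl sset_simplex i0] by simp
  qed
  then obtain t where t: "t \<in> hom (X 0) (Gb 0)" "\<And>w. w \<in> thick 0 \<Longrightarrow> p 0 w \<cdot> t = (\<lambda>w\<in>thick 0. Xm 0 w) w"
    by (rule p_ex) (rule that)
  have pt: "p 0 [0] \<cdot> t = Idm C (X 0)" using t(2)[OF e0] e0 so_id[OF so, of 0] by simp
  have "t \<cdot> p 0 [0] = Idm C (Gb 0)"
    by (rule p0_mono[OF cmp_hom[OF t(1) p0] id_hom[OF Gb_ob]])
      (simp add: assoc[OF p0 t(1) p0, symmetric] pt id_left[OF p0] id_right[OF p0])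
  note tp = this
  have tC: "t \<in> Cov" using mor_class_iso[OF covM isoI[OF t(1) p0 pt tp]] .
  have g: "gm (Suc 0) [j] \<in> hom (Gb (Suc 0)) (Gb 0)" "p 0 [0] \<cdot> gm (Suc 0) [j] = p (Suc 0) [j]"
    using gm(1)[OF jt[OF j]] gm(2)[OF jt[OF j], of "[0]"] e0 by auto
  have "gm (Suc 0) [j] = t \<cdot> p (Suc 0) [j]"
    using assoc[OF t(1) p0 g(1)] tp g(2) id_left[OF g(1)] by simp
  then show ?thesis using mor_class_comp[OF covM pj tC ph[OF j] t(1)] by simp
qed

lemma Gb_horn_cov:
  assumes n: "0 < n" and j: "j \<le> n"
  shows "cov Cov (HomP (Gb n)) (ConP Gb gm (horn n j)) (faces gm n (horn n j))"
proof (cases "2 \<le> n")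
  case True
  have "cov Cov (ConP X Xm (thick n)) (ConP X Xm (thick_horn n j)) (\<lambda>c. restrict c (thick_horn n j))"
    by (rule thick_horn_expansion(1)[OF so covM _ _ True j, of k]) (rule horn_cov horn_iso; assumption)+
  then show ?thesis using thicken_cov[OF sset_horn horn_sub] unfolding thickT_horn by blast
next
  case False
  then have n1: "n = Suc 0" using n by simp
  have j1: "j \<le> Suc 0" using j n1 by simp
  \<comment> \<open>The horn is one vertex attached to the empty complex, so cones on it are arrows
    to \<open>Gb 0\<close>, and the horn map becomes composition with
    \<open>gm (Suc 0) [j]\<close>.\<close>
  have at: "attach [j] 0 {} {} (horn (Suc 0) j)"
    using attach_bdry[OF sset_empty, of "[j]" 0] unfolding horn_1[OF j1] bdry_0 by simp
  note af = attach_facts[OF at]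
  have jh: "[j] \<in> horn (Suc 0) j" by (rule af(4))
  have js: "[j] \<in> simplex (Suc 0)" using jh horn_sub by blast
  have gh: "gm (Suc 0) [j] \<in> hom (Gb (Suc 0)) (Gb 0)" using gm(1)[OF simplex_thick[OF js]] by simp
  note a = arrow_cov[OF vertex_cov[OF j1] gh]
  have E: "c \<in> El (ConP Gb gm {}) U \<longleftrightarrow> U \<in> Ob C \<and> c = (\<lambda>_. undefined)" for c U
    unfolding ConP_def is_cone_map_diag by auto
  have re: "restrict c {} = (\<lambda>_. undefined)" for c :: "nat list \<Rightarrow> 'm" by (auto simp: restrict_def)
  have nb: "ntr (ConP Gb gm (horn (Suc 0) j)) (HomP (Gb 0)) (\<lambda>c. c [j])"
    by (rule ntrI) (use ConP_hom[OF _ jh] jh in \<open>auto simp: HomP_def ConP_ac\<close>)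
  have glue: "\<exists>!x. x \<in> El (ConP Gb gm (horn (Suc 0) j)) U \<and> x [j] = b" if b: "b \<in> hom U (Gb 0)" for b U
  proof -
    have "(\<lambda>_. undefined) \<in> El (ConP Gb gm {}) U" unfolding E using hom_obs[OF b] by simp
    from attach_glue[OF so_Gb at b this] show ?thesis unfolding re by simp
  qed
  have bb: "bijn (ConP Gb gm (horn (Suc 0) j)) (HomP (Gb 0)) (\<lambda>c. c [j])"
  proof (rule bijnI[OF nb])
    show "\<exists>x. x \<in> El (ConP Gb gm (horn (Suc 0) j)) U \<and> x [j] = b" if "b \<in> El (HomP (Gb 0)) U" for U b
      using glue[of b U] that unfolding HomP_def fst_conv by blast
    show "x = y" if x: "x \<in> El (ConP Gb gm (horn (Suc 0) j)) U" and y: "y \<in> El (ConP Gb gm (horn (Suc 0) j)) U"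
      and xy: "x [j] = y [j]" for U x y
    proof -
      have "y [j] \<in> hom U (Gb 0)" using ConP_hom[OF y jh] by simp
      from glue[OF this] show ?thesis using x y xy by blast
    qed
  qed
  have ida: "ntr (HomP (Gb (Suc 0))) (HomP (Gb (Suc 0))) (\<lambda>y. y)" by (rule ntrI) auto
  have idb: "bijn (HomP (Gb (Suc 0))) (HomP (Gb (Suc 0))) (\<lambda>y. y)" by (rule bijnI[OF ida]) auto
  show ?thesis unfolding n1
  proof (rule cov_bijn_transfer[OF a[THEN conjunct2] psh_HomP psh_HomP psh_HomP psh_ConP[OF so_Gb sset_horn]
      ntr_faces[OF so_Gb horn_sub sset_horn] ida nb idb bb])
    show "gm (Suc 0) [j] \<cdot> y = faces gm (Suc 0) (horn (Suc 0) j) y [j]" for y unfolding faces_def using jh by simp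
  qed
qed

lemma Gb_horn_bijn:
  assumes n: "k < n" and j: "j \<le> n"
  shows "bijn (HomP (Gb n)) (ConP Gb gm (horn n j)) (faces gm n (horn n j))"
proof -
  \<comment> \<open>Positivity of \<open>k\<close> enters here: it excludes \<open>n = 1\<close>,
    where the horn map is only known to be a cover.\<close>
  have n2: "2 \<le> n" using k n by simp
  have "bijn (ConP X Xm (thick n)) (ConP X Xm (thick_horn n j)) (\<lambda>c. restrict c (thick_horn n j))"
    by (rule thick_horn_expansion(2)[OF so covM _ _ n2 j n]) (rule horn_cov horn_iso; assumption)+
  then show ?thesis using thicken_faces_bijn[OF sset_horn horn_sub] unfolding thickT_horn by blast
qed

lemma core_groupoid: "k_groupoid C Cov Zo Gm k"
  unfolding k_groupoid_def
proof (intro conjI allI impI; (elim conjE)?)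
  show "simplicial_object C Zo Gm" by (rule so_Gm)
  fix n j :: nat
  show "restr_prop C (\<lambda>u. u \<in> Cov) Zo Gm n (horn n j)" if "0 < n" "j \<le> n"
    by (rule groupoid_horn_cov[OF bdry_map_cov coim(1) sset_horn horn_sub Gb_horn_cov[OF that]])
  show "restr_prop C (iso C) Zo Gm n (horn n j)" if kn: "k < n" and jn: "j \<le> n"
  proof -
    have "0 < n" using kn by simp
    then show ?thesis
      by (rule groupoid_horn_iso[OF bdry_map_cov coim(1) sset_horn horn_sub Gb_horn_cov[OF _ jn] Gb_horn_bijn[OF kn jn]])
  qed
qed

end

text \<open>The equations with \<open>q\<close> determine \<open>Gm\<close> on monotone lists, since
  every \<open>q n\<close> is a cover and hence epic.\<close>

theorem theorem7p5:
  fixes C :: "('o,'m) cat" and Cov Reg :: "'m set"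
    and X :: "nat \<Rightarrow> 'o" and Xm :: "nat \<Rightarrow> nat list \<Rightarrow> 'm" and k :: nat
    and Gb :: "nat \<Rightarrow> 'o" and p :: "nat \<Rightarrow> nat list \<Rightarrow> 'm"
    and q i :: "nat \<Rightarrow> 'm"
  assumes "regular_descent_cat C Cov Reg"
    and "0 < k"
    and "regular_k_category C Cov Reg X Xm k"
    and "\<And>n. is_limit C (map_diag X Xm (thick n)) (Gb n) (p n)"
    and "\<And>n. p n [0..<Suc n] \<in> Reg"
    and "\<And>n. is_coimage C (p n [0..<Suc n]) (q n) (i n)"
  shows "\<exists>Gm. simplicial_object C (\<lambda>n. Cod C (q n)) Gm \<and>
           (\<forall>n \<theta>. mono_list n \<theta> \<longrightarrow>
              Cmp C (i (length \<theta> - 1)) (Gm n \<theta>) = Cmp C (Xm n \<theta>) (i n) \<and>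
              Cmp C (Gm n \<theta>) (q n) = Cmp C (q (length \<theta> - 1)) (thick_map C Gb p n \<theta>)) \<and>
           k_groupoid C Cov (\<lambda>n. Cod C (q n)) Gm k \<and>
           hypercover C Cov Gb (thick_map C Gb p) (\<lambda>n. Cod C (q n)) Gm q"
proof -
  have c: "category C" "has_finite_limits C"
    using assms(1) unfolding regular_descent_cat_def subcanonical_def descent_cat_def by auto
  have so: "simplicial_object C X Xm"
    using assms(3) unfolding regular_k_category_def k_category_def by blast
  interpret core_ctx C Cov Reg X Xm Gb p k q i
    by unfold_locales (use c so assms in auto)
  show ?thesis
  proof (intro exI conjI allI impI)
    show "simplicial_object C (\<lambda>n. Cod C (q n)) Gm" by (rule so_Gm)
    show "k_groupoid C Cov (\<lambda>n. Cod C (q n)) Gm k" by (rule core_groupoid)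
    show "hypercover C Cov Gb (thick_map C Gb p) (\<lambda>n. Cod C (q n)) Gm q" by (rule bdry_map_hypercover[OF bdry_map_cov])
    fix n \<theta> assume "mono_list n \<theta>"
    then have t: "\<theta> \<in> simplex n" unfolding mono_list_simplex .
    show "Cmp C (i (length \<theta> - 1)) (Gm n \<theta>) = Cmp C (Xm n \<theta>) (i n)" by (rule i_Gm[OF t])
    show "Cmp C (Gm n \<theta>) (q n) = Cmp C (q (length \<theta> - 1)) (thick_map C Gb p n \<theta>)" by (rule Gm(2)[OF t])
  qed
qed

end
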